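(* Let $f:\mathbb{P}^2\to\mathbb{P}^2$ be a holomorphic map of degree at least $2$. Let $\Omega$ be an invariant Fatou component of $f$ and assume that all orbits in $\Omega$ converge to a Riemann surface $\Sigma\subset\Omega$, i.e. $\Omega$ has an attracting Riemann surface $\Sigma$. Then $\Omega$ is Kobayashi complete.
   Context: $\mathbb{P}^2$ is complex projective space of dimension 2; a holomorphic self-map of degree $d$ is one given in homogeneous coordinates by homogeneous polynomials of degree $d$ whose only common zero is the origin. Fatou components: the Fatou set of $f$ is the set of points having a neighborhood on which the family of iterates $\{f^n\}$ is normal (since $\mathbb{P}^2$ is compact: every sequence of iterates has a subsequence converging uniformly on compact sets); its connected components are the Fatou components. A Fatou component $\Omega$ is invariant if $f(\Omega)=\Omega$. Attracting Riemann surface: an invariant Fatou component $\Omega$ has an attracting Riemann surface $\Sigma$ if $\Sigma$ is a one-dimensional closed complex submanifold of $\Omega$, $f(\Sigma)=\Sigma$, $f^n(K)\to\Sigma$ for every compact $K\subset\Omega$ (i.e. $\sup_{z\in K}\operatorname{dist}(f^n(z),\Sigma)\to 0$ for a distance inducing the topology of $\mathbb{P}^2$), $\Sigma$ is biholomorphic to a disc, a punctured disc or an annulus, and $f|_\Sigma$ is conjugate, via this biholomorphism, to an irrational rotation. Kobayashi completeness: $d_K$ denotes the Kobayashi pseudodistance of a connected complex manifold. The manifold is Kobayashi hyperbolic if $d_K$ is a distance, and a hyperbolic manifold is Kobayashi complete if every sequence that is Cauchy for $d_K$ converges to a point of the manifold. (By a theorem of Ueda, every Fatou component of a holomorphic self-map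 of $\mathbb{P}^2$ of degree at least 2 is Kobayashi hyperbolic.) *)

theory Defs
  imports "HOL-Analysis.Analysis"
begin

section \<open>The complex projective plane\<close>

definition proj_rel :: "complex^3 \<Rightarrow> complex^3 \<Rightarrow> bool" where
  "proj_rel z w \<longleftrightarrow> z \<noteq> 0 \<and> w \<noteq> 0 \<and> (\<exists>c. c \<noteq> 0 \<and> w = c *s z)"

lemma proj_rel_sym: "proj_rel z w \<Longrightarrow> proj_rel w z"
proof -
  assume a: "proj_rel z w"
  then obtain c where c: "c \<noteq> 0" "w = c *s z" by (auto simp: proj_rel_def)
  then have "z = inverse c *s w" by simp
  moreover have "inverse c \<noteq> 0" using c by simp
  ultimately show ?thesis using a unfolding proj_rel_def by blast
qed

lemma proj_rel_trans: "proj_rel z w \<Longrightarrow> proj_rel w v \<Longrightarrow> proj_rel z v"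
  unfolding proj_rel_def by (metis no_zero_divisors vector_smult_assoc)

quotient_type cp2 = "complex^3" / partial: proj_rel morphisms rep_cp2 proj
proof (rule part_equivpI)
  have "(axis 1 1 :: complex^3) \<noteq> 0" by (simp add: axis_eq_0_iff)
  then show "\<exists>x. proj_rel x x"
    by (auto simp: proj_rel_def intro!: exI[of _ "1::complex"] exI[of _ "axis 1 1"])
next
  show "symp proj_rel" by (rule sympI) (rule proj_rel_sym)
next
  show "transp proj_rel" by (rule transpI) (rule proj_rel_trans)
qed

text \<open>The distance is the Hilbert-Schmidt distance between the orthogonal projections
  \<open>z z\<^sup>* / |z|\<^sup>2\<close> onto complex lines; \<open>open_cp2_iff\<close> below shows that it induces the
  quotient topology. Since the projective plane is compact, uniform convergence does not depend
  on the choice of such a distance.\<close>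

definition line_projection :: "complex^3 \<Rightarrow> complex^3^3" where
  "line_projection z = (\<chi> i j. z $ i * cnj (z $ j) / of_real ((norm z)\<^sup>2))"

lemma norm_smult: "norm (c *s z) = cmod c * norm z" for z :: "complex^'n::finite"
  unfolding norm_vec_def by (simp add: norm_mult L2_set_right_distrib)

lemma line_projection_cong: "proj_rel z w \<Longrightarrow> line_projection z = line_projection w"
proof -
  assume "proj_rel z w"
  then obtain c where c: "c \<noteq> 0" "w = c *s z" by (auto simp: proj_rel_def)
  have n: "norm w = cmod c * norm z"
    unfolding c(2) by (rule norm_smult)
  have "(of_real ((norm w)\<^sup>2) :: complex) = c * cnj c * of_real ((norm z)\<^sup>2)"
    unfolding n by (simp add: power_mult_distrib complex_norm_square [symmetric])
  then have "w $ i * cnj (w $ j) / of_real ((norm w)\<^sup>2) = z $ i * cnj (z $ j) / of_real ((norm z)\<^sup>2)"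
    for i j
    using c by simp
  then show ?thesis by (simp add: line_projection_def)
qed

lemma line_projection_inj:
  assumes "z \<noteq> 0" "w \<noteq> 0" "line_projection z = line_projection w"
  shows "proj_rel z w"
proof -
  obtain j where j: "w $ j \<noteq> 0"
    using assms(2) by (metis vec_eq_iff zero_index)
  define c where "c = (cnj (z $ j) * of_real ((norm w)\<^sup>2)) / (of_real ((norm z)\<^sup>2) * cnj (w $ j))"
  have eq: "z $ i * cnj (z $ j) / of_real ((norm z)\<^sup>2) = w $ i * cnj (w $ j) / of_real ((norm w)\<^sup>2)" for i
    using assms(3) by (simp add: line_projection_def vec_eq_iff)
  have "w $ i = c * z $ i" for i
    using eq[of i] j assms(1,2) unfolding c_def by (simp add: field_simps)
  then have w: "w = c *s z" by (simp add: vec_eq_iff)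
  with assms(2) have "c \<noteq> 0" by auto
  with w assms show ?thesis by (auto simp: proj_rel_def)
qed

instantiation cp2 :: metric_space
begin

lift_definition dist_cp2 :: "cp2 \<Rightarrow> cp2 \<Rightarrow> real"
  is "\<lambda>z w. dist (line_projection z) (line_projection w)"
  using line_projection_cong by metis

definition uniformity_cp2 :: "(cp2 \<times> cp2) filter" where
  "uniformity_cp2 = (INF e\<in>{0<..}. principal {(x, y). dist x y < e})"

definition open_cp2 :: "cp2 set \<Rightarrow> bool" where
  "open_cp2 U = (\<forall>x\<in>U. eventually (\<lambda>(x', y). x' = x \<longrightarrow> y \<in> U) uniformity)"

instance
proof
  fix x y z :: cp2
  show "dist x y = 0 \<longleftrightarrow> x = y"
    by transfer (metis dist_eq_0_iff line_projection_cong line_projection_inj proj_rel_def)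
  show "dist x y \<le> dist x z + dist y z"
    by transfer (rule dist_triangle2)
qed (simp_all add: uniformity_cp2_def open_cp2_def)

end

lemma proj_rel_refl: "z \<noteq> 0 \<Longrightarrow> proj_rel z z"
  by (auto simp: proj_rel_def intro!: exI[of _ "1::complex"])

lemma proj_surj: "\<exists>z. z \<noteq> 0 \<and> p = proj z"
  by (metis Quotient3_abs_rep Quotient3_cp2 Quotient3_rep_reflp proj_rel_def)

lemma proj_eq_iff: "z \<noteq> 0 \<Longrightarrow> w \<noteq> 0 \<Longrightarrow> proj z = proj w \<longleftrightarrow> (\<exists>c. c \<noteq> 0 \<and> w = c *s z)"
  using Quotient3_rel[OF Quotient3_cp2, of z w] proj_rel_refl[of z] proj_rel_refl[of w]
  by (auto simp: proj_rel_def)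

lemma rep_cp2_ratio:
  assumes "z $ i \<noteq> 0"
  shows "rep_cp2 (proj z) $ j / rep_cp2 (proj z) $ i = z $ j / z $ i"
proof -
  have "z \<noteq> 0" using assms by auto
  then have "proj_rel (rep_cp2 (proj z)) z"
    using rep_abs_rsp_left[OF Quotient3_cp2] proj_rel_refl by blast
  then obtain c where "c \<noteq> 0" "z = c *s rep_cp2 (proj z)" by (auto simp: proj_rel_def)
  then show ?thesis
    by (metis mult_divide_mult_cancel_left vector_smult_component)
qed

lemma dist_proj:
  "z \<noteq> 0 \<Longrightarrow> w \<noteq> 0 \<Longrightarrow> dist (proj z) (proj w) = dist (line_projection z) (line_projection w)"
  by (intro dist_cp2.abs_eq proj_rel_refl)

lemma continuous_on_proj: "continuous_on (- {0}) proj"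
proof -
  have "continuous_on (- {0}) line_projection"
    unfolding line_projection_def by (intro continuous_intros) auto
  then show ?thesis
    unfolding continuous_on_iff by (simp add: dist_proj)
qed

lemma open_cp2_iff: "open U \<longleftrightarrow> open {z. z \<noteq> 0 \<and> proj z \<in> U}"
proof
  assume "open U"
  then have "open (- {0} \<inter> proj -` U)"
    using continuous_on_proj by (intro continuous_open_preimage) auto
  moreover have "- {0} \<inter> proj -` U = {z. z \<noteq> 0 \<and> proj z \<in> U}" by auto
  ultimately show "open {z. z \<noteq> 0 \<and> proj z \<in> U}" by simp
next
  assume o: "open {z. z \<noteq> 0 \<and> proj z \<in> U}"
  let ?K = "sphere 0 1 - {z. z \<noteq> 0 \<and> proj z \<in> U}"
  have "compact (proj ` ?K)"
    using o by (intro compact_continuous_image continuous_on_subset[OF continuous_on_proj]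
        compact_diff compact_sphere) auto
  moreover have "proj ` ?K = - U"
  proof
    show "- U \<subseteq> proj ` ?K"
    proof
      fix p assume p: "p \<in> - U"
      obtain z where z: "z \<noteq> 0" "p = proj z" using proj_surj by blast
      define w where "w = of_real (inverse (norm z)) *s z"
      have "norm w = 1"
        using z by (simp add: w_def norm_smult norm_inverse)
      moreover from this have "proj z = proj w"
        using z by (subst proj_eq_iff) (auto simp: w_def)
      ultimately show "p \<in> proj ` ?K" using p z by (auto intro!: image_eqI[of _ _ w])
    qed
  qed auto
  ultimately have "compact (- U)" by simp
  then have "closed (- U)" by (rule compact_imp_closed)
  then show "open U" by (simp add: open_closed)
qed

section \<open>Complex manifolds\<close>

text \<open>A complex manifold of dimension \<open>CARD('n)\<close> is given by an atlas; its underlying set is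
  the union of the chart domains, with the subspace topology of the ambient type.\<close>

type_synonym ('a, 'n) atlas = "('a set \<times> ('a \<Rightarrow> complex^'n)) set"

definition carrier_of :: "('a, 'n::finite) atlas \<Rightarrow> 'a set" where
  "carrier_of A = (\<Union>(U, \<phi>)\<in>A. U)"

text \<open>Intended for open \<open>S\<close>.\<close>

definition holomorphic_vec :: "(complex^'n::finite \<Rightarrow> complex^'m::finite) \<Rightarrow> (complex^'n) set \<Rightarrow> bool" where
  "holomorphic_vec g S \<longleftrightarrow>
    (\<forall>x\<in>S. \<exists>L. (g has_derivative L) (at x) \<and> (\<forall>c v. L (c *s v) = c *s L v))"

definition holomorphic_map ::
  "('a::topological_space, 'n::finite) atlas \<Rightarrow> ('b::topological_space, 'm::finite) atlas \<Rightarrow> ('a \<Rightarrow> 'b) \<Rightarrow> bool" where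
  "holomorphic_map A B f \<longleftrightarrow>
    f ` carrier_of A \<subseteq> carrier_of B \<and> continuous_on (carrier_of A) f \<and>
    (\<forall>(U, \<phi>)\<in>A. \<forall>(V, \<psi>)\<in>B.
       holomorphic_vec (\<psi> \<circ> f \<circ> inv_into U \<phi>) (\<phi> ` (U \<inter> f -` V)))"

definition biholomorphic_map ::
  "('a::topological_space, 'n::finite) atlas \<Rightarrow> ('b::topological_space, 'm::finite) atlas \<Rightarrow> ('a \<Rightarrow> 'b) \<Rightarrow> bool" where
  "biholomorphic_map A B f \<longleftrightarrow>
    bij_betw f (carrier_of A) (carrier_of B) \<and> holomorphic_map A B f \<and>
    holomorphic_map B A (inv_into (carrier_of A) f)"

text \<open>The charts of the maximal atlas.\<close>

definition holomorphic_chart ::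
  "('a::topological_space, 'n::finite) atlas \<Rightarrow> 'a set \<Rightarrow> ('a \<Rightarrow> complex^'n) \<Rightarrow> bool" where
  "holomorphic_chart A U \<phi> \<longleftrightarrow>
    openin (top_of_set (carrier_of A)) U \<and> open (\<phi> ` U) \<and>
    homeomorphism U (\<phi> ` U) \<phi> (inv_into U \<phi>) \<and>
    (\<forall>(V, \<psi>)\<in>A. holomorphic_vec (\<psi> \<circ> inv_into U \<phi>) (\<phi> ` (U \<inter> V)) \<and>
                 holomorphic_vec (\<phi> \<circ> inv_into V \<psi>) (\<psi> ` (U \<inter> V)))"

definition restrict_atlas :: "('a, 'n::finite) atlas \<Rightarrow> 'a set \<Rightarrow> ('a, 'n) atlas" where
  "restrict_atlas A S = (\<lambda>(U, \<phi>). (U \<inter> S, \<phi>)) ` A"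

definition planar_atlas :: "complex set \<Rightarrow> (complex, 1) atlas" where
  "planar_atlas D = {(D, vec)}"

text \<open>One-dimensional submanifolds of complex surfaces: an adapted chart maps the submanifold
  to the first coordinate axis, and its first coordinate is a chart of the submanifold.\<close>

definition adapted_chart ::
  "('a::topological_space, 2) atlas \<Rightarrow> 'a set \<Rightarrow> 'a set \<Rightarrow> ('a \<Rightarrow> complex^2) \<Rightarrow> bool" where
  "adapted_chart A S U \<phi> \<longleftrightarrow>
    holomorphic_chart A U \<phi> \<and> \<phi> ` (U \<inter> S) = {w \<in> \<phi> ` U. w $ 2 = 0}"

definition closed_complex_curve :: "('a::topological_space, 2) atlas \<Rightarrow> 'a set \<Rightarrow> bool" where
  "closed_complex_curve A S \<longleftrightarrow>
    closedin (top_of_set (carrier_of A)) S \<and>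
    (\<forall>p\<in>S. \<exists>U \<phi>. p \<in> U \<and> adapted_chart A S U \<phi>)"

definition curve_atlas :: "('a::topological_space, 2) atlas \<Rightarrow> 'a set \<Rightarrow> ('a, 1) atlas" where
  "curve_atlas A S = {(U \<inter> S, \<lambda>p. vec (\<phi> p $ 1)) | U \<phi>. adapted_chart A S U \<phi>}"

text \<open>The three affine charts. They do not depend on the choice of representative, by
  \<open>rep_cp2_ratio\<close>.\<close>

definition cp2_atlas :: "(cp2, 2) atlas" where
  "cp2_atlas =
    {(proj ` {z. z $ 1 \<noteq> 0}, \<lambda>p. let z = rep_cp2 p in vector [z $ 2 / z $ 1, z $ 3 / z $ 1]),
     (proj ` {z. z $ 2 \<noteq> 0}, \<lambda>p. let z = rep_cp2 p in vector [z $ 1 / z $ 2, z $ 3 / z $ 2]),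
     (proj ` {z. z $ 3 \<noteq> 0}, \<lambda>p. let z = rep_cp2 p in vector [z $ 1 / z $ 3, z $ 2 / z $ 3])}"

abbreviation cp2_domain :: "cp2 set \<Rightarrow> (cp2, 2) atlas" where
  "cp2_domain \<Omega> \<equiv> restrict_atlas cp2_atlas \<Omega>"

lemma carrier_cp2_domain: "carrier_of (cp2_domain \<Omega>) = \<Omega>"
proof -
  have "\<exists>z. p = proj z \<and> (z $ 1 \<noteq> 0 \<or> z $ 2 \<noteq> 0 \<or> z $ 3 \<noteq> 0)" for p
    using proj_surj[of p] by (auto simp: vec_eq_iff forall_3)
  then show ?thesis
    unfolding carrier_of_def restrict_atlas_def cp2_atlas_def by auto blast
qed

section \<open>Kobayashi pseudodistance\<close>

text \<open>The Poincare distance of curvature \<open>-1\<close>.\<close>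

definition poincare_dist :: "complex \<Rightarrow> complex \<Rightarrow> real" where
  "poincare_dist a b = 2 * artanh (cmod ((a - b) / (1 - cnj a * b)))"

definition disc_chain_lengths ::
  "('a::topological_space, 'n::finite) atlas \<Rightarrow> 'a \<Rightarrow> 'a \<Rightarrow> real set" where
  "disc_chain_lengths A p q =
    {(\<Sum>i<k. poincare_dist (a i) (b i)) | (k::nat) (a::nat \<Rightarrow> complex) b g.
       k \<ge> 1 \<and>
       (\<forall>i<k. a i \<in> ball 0 1 \<and> b i \<in> ball 0 1 \<and>
              holomorphic_map (planar_atlas (ball 0 1)) A (g i)) \<and>
       g 0 (a 0) = p \<and> g (k - 1) (b (k - 1)) = q \<and>
       (\<forall>i. Suc i < k \<longrightarrow> g i (b i) = g (Suc i) (a (Suc i)))}"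

text \<open>Intended for connected manifolds, where the infimum is over a nonempty set. The value
  outside the manifold is irrelevant, but \<^locale>\<open>Metric_space\<close> wants a function that is
  nonnegative and symmetric on the whole type.\<close>

definition kobayashi_dist :: "('a::topological_space, 'n::finite) atlas \<Rightarrow> 'a \<Rightarrow> 'a \<Rightarrow> real" where
  "kobayashi_dist A p q =
    (if p \<in> carrier_of A \<and> q \<in> carrier_of A then Inf (disc_chain_lengths A p q) else 0)"

definition kobayashi_hyperbolic :: "('a::topological_space, 'n::finite) atlas \<Rightarrow> bool" where
  "kobayashi_hyperbolic A \<longleftrightarrow> Metric_space (carrier_of A) (kobayashi_dist A)"

definition kobayashi_complete :: "('a::topological_space, 'n::finite) atlas \<Rightarrow> bool" where
  "kobayashi_complete A \<longleftrightarrow>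
    kobayashi_hyperbolic A \<and> Metric_space.mcomplete (carrier_of A) (kobayashi_dist A)"

section \<open>Dynamics on the projective plane\<close>

definition homogeneous_polynomial :: "nat \<Rightarrow> (complex^3 \<Rightarrow> complex) \<Rightarrow> bool" where
  "homogeneous_polynomial d P \<longleftrightarrow>
    (\<exists>a :: nat \<Rightarrow> nat \<Rightarrow> complex. \<forall>z.
       P z = (\<Sum>j\<le>d. \<Sum>k\<le>d - j. a j k * z $ 1 ^ j * z $ 2 ^ k * z $ 3 ^ (d - j - k)))"

definition holomorphic_self_map :: "nat \<Rightarrow> (cp2 \<Rightarrow> cp2) \<Rightarrow> bool" where
  "holomorphic_self_map d f \<longleftrightarrow>
    (\<exists>F :: complex^3 \<Rightarrow> complex^3.
       (\<forall>i. homogeneous_polynomial d (\<lambda>z. F z $ i)) \<and>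
       (\<forall>z. F z = 0 \<longleftrightarrow> z = 0) \<and>
       (\<forall>z. z \<noteq> 0 \<longrightarrow> f (proj z) = proj (F z)))"

definition iterates_normal_on :: "(cp2 \<Rightarrow> cp2) \<Rightarrow> cp2 set \<Rightarrow> bool" where
  "iterates_normal_on f U \<longleftrightarrow>
    (\<forall>\<nu> :: nat \<Rightarrow> nat. \<exists>r g. strict_mono r \<and>
       (\<forall>K. compact K \<and> K \<subseteq> U \<longrightarrow> uniform_limit K (\<lambda>k. f ^^ \<nu> (r k)) g sequentially))"

definition fatou_set :: "(cp2 \<Rightarrow> cp2) \<Rightarrow> cp2 set" where
  "fatou_set f = {p. \<exists>U. open U \<and> p \<in> U \<and> iterates_normal_on f U}"

definition invariant_fatou_component :: "(cp2 \<Rightarrow> cp2) \<Rightarrow> cp2 set \<Rightarrow> bool" where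
  "invariant_fatou_component f \<Omega> \<longleftrightarrow> \<Omega> \<in> components (fatou_set f) \<and> f ` \<Omega> = \<Omega>"

text \<open>The disc, the punctured disc and the annuli, up to biholomorphism; the rotations below
  are those about 0.\<close>

definition rotation_domain :: "complex set \<Rightarrow> bool" where
  "rotation_domain D \<longleftrightarrow>
    D = ball 0 1 \<or> D = ball 0 1 - {0} \<or>
    (\<exists>r R. 0 < r \<and> r < R \<and> D = {\<zeta>. r < cmod \<zeta> \<and> cmod \<zeta> < R})"

definition attracting_riemann_surface :: "(cp2 \<Rightarrow> cp2) \<Rightarrow> cp2 set \<Rightarrow> cp2 set \<Rightarrow> bool" where
  "attracting_riemann_surface f \<Omega> \<Sigma> \<longleftrightarrow>
    \<Sigma> \<subseteq> \<Omega> \<and> closed_complex_curve (cp2_domain \<Omega>) \<Sigma> \<and> f ` \<Sigma> = \<Sigma> \<and>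
    (\<forall>K. compact K \<and> K \<noteq> {} \<and> K \<subseteq> \<Omega> \<longrightarrow>
       (\<lambda>n. SUP z\<in>K. infdist ((f ^^ n) z) \<Sigma>) \<longlonglongrightarrow> 0) \<and>
    (\<exists>D \<psi> \<theta>. rotation_domain D \<and>
       biholomorphic_map (curve_atlas (cp2_domain \<Omega>) \<Sigma>) (planar_atlas D) \<psi> \<and>
       \<theta> \<notin> \<rat> \<and> (\<forall>p\<in>\<Sigma>. \<psi> (f p) = cis (2 * pi * \<theta>) * \<psi> p))"

end

theory Submission
 imports Defs "HOL-Complex_Analysis.Great_Picard" "HOL-Complex_Analysis.Riemann_Mapping"
begin

text \<open>
The point is that every orbit in \<open>\<Omega>\<close> stays in a compact part of \<open>\<Omega>\<close>. The set of points with this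
property is open; to see that it is closed in \<open>\<Omega>\<close>, take a disc in \<open>\<Omega>\<close> around a limit point of it. The
Green function of a homogeneous lift of \<open>f\<close> is harmonic along discs in the Fatou set, so the disc
and its iterates have holomorphic lifts of controlled size, and limit discs exist. The Jacobian of
the iterates tends to zero uniformly where orbits are trapped; almost periodicity of the dynamics
and Harnack's inequality for zero-free majorants propagate this decay to the whole disc. Hence a
limit disc has a tube around it in which the iterates stay close together, so it lies in the Fatou
set and does not meet the boundary of \<open>\<Omega>\<close>. All limit points of an orbit in \<open>\<Omega>\<close> therefore lie on
one level set of the modulus of the rotation coordinate of \<open>\<Sigma>\<close>. This level satisfies a Harnack
inequality along discs, which keeps the levels in a Kobayashi-bounded set away from the ends of
\<open>\<Sigma>\<close>, and this forces Cauchy sequences to converge in \<open>\<Omega>\<close>.\<close>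

text \<open>Limit discs may a priori leave \<open>\<Omega>\<close>, where no normality is at hand.
  Compactness is therefore taken from lifts in the zero level of the Green function: their iterates
  stay in a fixed shell around the origin, and two such lifts of one disc differ by a unimodular
  constant, so facts about the trapped inner disc spread to the whole disc. On trapped sets the
  Jacobian decays because two transverse directions are both pressed into the tangent line of the
  curve. The decay must be uniform over all late starting times. The three circles argument serves
  one starting time, with constants depending on it. Almost periodicity leaves finitely many
  starting times at the price of an additive error in each factor, harmful near critical points;
  this is what the majorants repair. If the Jacobian degenerates along the orbit, it vanishes on the
  entire curve and every late factor is small by itself. The tube exists only where the limit disc
  is immersed; isolated exceptional points are surrounded by circles and filled in by a homotopy and
  the maximum principle.\<close>

lemma choice2:
 assumes "\<forall>x. \<exists>y z. Q x y z"
 shows "\<exists>g h. \<forall>x. Q x (g x) (h x)"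
 using assms by metis

section \<open>Vector-valued holomorphic functions\<close>

definition hol_vec :: "(complex => complex^'n::finite) => complex set => bool" where
 "hol_vec L A \<longleftrightarrow> (\<forall>i. (\<lambda>z. L z $ i) holomorphic_on A)"

definition vderiv :: "(complex => complex^'n::finite) => complex => complex^'n" where
 "vderiv L z = (\<chi> i. deriv (\<lambda>w. L w $ i) z)"

lemma vderiv_nth [simp]: "vderiv L z $ i = deriv (\<lambda>w. L w $ i) z"
 by (simp add: vderiv_def)

lemma hol_vecD: "hol_vec L A ==> (\<lambda>z. L z $ i) holomorphic_on A"
 by (simp add: hol_vec_def)

lemma hol_vec_subset: "hol_vec L A ==> B \<subseteq> A ==> hol_vec L B"
 unfolding hol_vec_def using holomorphic_on_subset by blast

lemma hol_vec_continuous: "hol_vec L A ==> continuous_on A L"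
proof -
 assume "hol_vec L A"
 then have "continuous_on A (\<lambda>z. \<chi> i. L z $ i)"
  by (intro continuous_on_vec_lambda holomorphic_on_imp_continuous_on hol_vecD)
 then show ?thesis by simp
qed

lemma hol_vec_scale:
 assumes "q holomorphic_on A" "hol_vec L A"
 shows "hol_vec (\<lambda>z. q z *s L z) A"
 using assms unfolding hol_vec_def by (auto intro!: holomorphic_intros)

lemma hol_vec_add: "hol_vec L A ==> hol_vec M A ==> hol_vec (\<lambda>z. L z + M z) A"
 unfolding hol_vec_def by (auto intro!: holomorphic_intros)

lemma hol_vec_const: "hol_vec (\<lambda>z. v) A"
 unfolding hol_vec_def by auto

lemma hol_vec_id_scale: "hol_vec (\<lambda>z. z *s v) A"
 unfolding hol_vec_def by (auto intro!: holomorphic_intros)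

lemma hol_vec_compose:
 "hol_vec L B ==> g holomorphic_on A ==> g ` A \<subseteq> B ==> hol_vec (\<lambda>z. L (g z)) A"
 unfolding hol_vec_def using holomorphic_on_compose_gen[of g A "\<lambda>z. L z $ i" B for i] by (simp add: o_def)

lemma norm_vec_le_sum: "norm (x :: complex^'n::finite) <= (\<Sum>i\<in>UNIV. cmod (x $ i))"
 unfolding norm_vec_def by (rule L2_set_le_sum) auto

lemma norm_vec_le:
 assumes "\<And>i. cmod ((x :: complex^'n::finite) $ i) <= B"
 shows "norm x <= real CARD('n) * B"
proof -
 have "(\<Sum>i\<in>UNIV. cmod (x $ i)) <= (\<Sum>i\<in>(UNIV::'n set). B)"
  using assms by (intro sum_mono) auto
 then show ?thesis using norm_vec_le_sum[of x] by simp
qed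

lemma has_derivative_hol_vec:
 assumes "hol_vec L A" "open A" "z \<in> A"
 shows "(L has_derivative (\<lambda>h. h *s vderiv L z)) (at z)"
proof -
 have 1: "((\<lambda>w. L w $ i) has_derivative (\<lambda>h. h * vderiv L z $ i)) (at z)" for i
  using holomorphic_derivI[OF hol_vecD[OF assms(1)] assms(2,3)]
  by (simp add: has_field_derivative_def mult_commute_abs)
 have 2: "((\<lambda>w. L w \<bullet> axis i b) has_derivative (\<lambda>h. (h *s vderiv L z) \<bullet> axis i b)) (at z)" for i b
  using has_derivative_inner_left[OF 1[of i], of b] by (simp add: inner_axis)
 show ?thesis
  by (rule iffD2[OF has_derivative_componentwise_within])
   (auto simp: Basis_vec_def 2 simp del: vector_smult_component)
qed

lemma vderiv_unique:
 assumes "(L has_derivative (\<lambda>h. h *s v)) (at z)"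
 shows "vderiv L z = v"
proof -
 have "((\<lambda>w. L w $ i) has_field_derivative v $ i) (at z)" for i
  using bounded_linear.has_derivative[OF bounded_linear_vec_nth assms, of i]
  by (simp add: has_field_derivative_def mult_commute_abs)
 then show ?thesis by (simp add: vec_eq_iff DERIV_imp_deriv)
qed

lemma norm_vderiv_le:
 fixes L :: "complex => complex^'n::finite"
 assumes "hol_vec L (ball a r)" "0 < r" "\<And>z. z \<in> ball a r ==> norm (L z) <= B"
 shows "norm (vderiv L a) <= real CARD('n) * (B / r)"
proof (rule norm_vec_le)
 fix i
 \<comment> \<open>Cauchy's inequality needs the closed ball, so it is used for
   \<open>s < r\<close>; the bound \<open>B / r\<close> follows by letting \<open>s\<close> tend to
   \<open>r\<close> from the left.\<close>
 have "cmod (deriv (\<lambda>w. L w $ i) a) <= B / s" if s: "0 < s" "s < r" for s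
 proof -
  have "cmod ((deriv ^^ 1) (\<lambda>w. L w $ i) a) <= fact 1 * B / s ^ 1"
  proof (rule Cauchy_inequality)
   show "(\<lambda>w. L w $ i) holomorphic_on ball a s"
    using hol_vecD[OF assms(1), of i] s by (auto intro: holomorphic_on_subset)
   show "continuous_on (cball a s) (\<lambda>w. L w $ i)"
    using s by (intro holomorphic_on_imp_continuous_on
      holomorphic_on_subset[OF hol_vecD[OF assms(1)]]) auto
   show "cmod (L x $ i) <= B" if "cmod (a - x) = s" for x
    using order_trans[OF Finite_Cartesian_Product.norm_nth_le[of "L x" i] assms(3)[of x]] that s
    by (simp add: dist_norm)
  qed (use s in auto)
  then show ?thesis by simp
 qed
 then have "eventually (\<lambda>s. cmod (deriv (\<lambda>w. L w $ i) a) <= B / s) (at_left r)"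
  using \<open>0 < r\<close> eventually_at_left by blast
 moreover have "((\<lambda>s. B / s) \<longlongrightarrow> B / r) (at_left r)"
  using \<open>0 < r\<close> by (intro tendsto_intros) auto
 ultimately show "cmod (vderiv L a $ i) <= B / r"
  using tendsto_lowerbound[of "\<lambda>s. B / s" "B / r" "at_left r"] by simp
qed

text \<open>Each point of the half disc is the centre of a disc of radius \<open>r / 2\<close> in
  the domain. Cauchy's estimate there bounds the derivative, and the half disc is convex.\<close>

lemma hol_vec_lipschitz:
 fixes L :: "complex => complex^'n::finite"
 assumes "hol_vec L (ball a r)" "0 < r" "\<And>z. z \<in> ball a r ==> norm (L z) <= B"
  and "x \<in> cball a (r/2)" "y \<in> cball a (r/2)"
 shows "norm (L x - L y) <= real CARD('n) * (2 * B / r) * cmod (x - y)"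
proof -
 have 1: "norm (vderiv L z) <= real CARD('n) * (2 * B / r)" if z: "z \<in> cball a (r/2)" for z
 proof -
  have sub: "ball z (r/2) \<subseteq> ball a r"
  proof
   fix w assume "w \<in> ball z (r/2)"
   then show "w \<in> ball a r" using z dist_triangle[of a w z] by auto
  qed
  have "norm (vderiv L z) <= real CARD('n) * (B / (r/2))"
   by (rule norm_vderiv_le) (use sub assms hol_vec_subset[OF assms(1) sub] in auto)
  then show ?thesis by (simp add: mult.commute)
 qed
 show ?thesis
 proof (rule differentiable_bound[where S = "cball a (r/2)" and f' = "\<lambda>z h. h *s vderiv L z"])
  show "convex (cball a (r/2))" by simp
  fix z assume z: "z \<in> cball a (r/2)"
  have "z \<in> ball a r" using z \<open>0 < r\<close> by auto
  then show "(L has_derivative (\<lambda>h. h *s vderiv L z)) (at z within cball a (r/2))"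
   using has_derivative_hol_vec[OF assms(1) open_ball] has_derivative_at_withinI by blast
  show "onorm (\<lambda>h. h *s vderiv L z) <= real CARD('n) * (2 * B / r)"
  proof (rule onorm_le)
   fix h
   show "norm (h *s vderiv L z) <= real CARD('n) * (2 * B / r) * norm h"
    using mult_left_mono[OF 1[OF z], of "norm h"] by (simp add: norm_smult mult.commute)
  qed
 qed (use assms in auto)
qed

text \<open>Linear in the first slot, so a holomorphic curve paired with a fixed second vector gives
  a scalar holomorphic function. Its modulus, relative to the norms, is the cosine of the angle
  between two complex lines.\<close>

definition herm :: "complex^'n::finite => complex^'n => complex" where
 "herm x y = (\<Sum>i\<in>UNIV. x $ i * cnj (y $ i))"

lemma herm_self: "herm x x = of_real ((norm x)\<^sup>2)"
 by (simp add: herm_def norm_vec_def L2_set_def sum_nonneg complex_norm_square[symmetric] del: of_real_power)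

lemma inner_eq_Re_herm: "x \<bullet> y = Re (herm x y)"
 by (simp add: herm_def inner_vec_def inner_complex_def)

lemma herm_scale_left: "herm (c *s x) y = c * herm x y"
 by (simp add: herm_def sum_distrib_left mult.assoc)

lemma herm_scale_right: "herm x (c *s y) = cnj c * herm x y"
 by (simp add: herm_def sum_distrib_left mult_ac)

text \<open>Rotating \<open>x\<close> by the phase \<open>u\<close> makes the pairing real, which
  reduces the claim to the real Cauchy-Schwarz inequality.\<close>

lemma norm_herm_le: "cmod (herm x y) <= norm x * norm y"
proof (cases "herm x y = 0")
 case False
 define u where "u = cnj (herm x y) / of_real (cmod (herm x y))"
 have u: "cmod u = 1" using False by (simp add: u_def norm_divide)
 have "u * herm x y = of_real (cmod (herm x y))"
  unfolding u_def using False complex_norm_square[of "herm x y"]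
  by (simp add: power2_eq_square mult.commute divide_eq_eq)
 then have "cmod (herm x y) = Re (herm (u *s x) y)"
  by (simp add: herm_scale_left)
 also have "\<dots> = (u *s x) \<bullet> y" by (simp add: inner_eq_Re_herm)
 also have "\<dots> <= norm (u *s x) * norm y" by (rule norm_cauchy_schwarz)
 finally show ?thesis by (simp add: norm_smult u)
qed simp

lemma continuous_on_herm [continuous_intros]:
 "continuous_on A f ==> continuous_on A g ==> continuous_on A (\<lambda>x. herm (f x) (g x))"
 unfolding herm_def by (intro continuous_intros)

lemma holomorphic_herm: "hol_vec L A ==> (\<lambda>z. herm (L z) b) holomorphic_on A"
 unfolding herm_def hol_vec_def by (auto intro!: holomorphic_intros)

text \<open>The scalar maximum principle is applied to the pairing of \<open>L\<close> with the
  fixed vector \<open>L z\<close>, whose value at \<open>z\<close> is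
  \<open>(norm (L z))\<^sup>2\<close>.\<close>

lemma hol_vec_max_modulus:
 fixes L :: "complex => complex^'n::finite"
 assumes "hol_vec L (ball a r)" "continuous_on (cball a r) L"
  and B: "\<And>z. z \<in> sphere a r ==> norm (L z) <= B" and z: "z \<in> cball a r"
 shows "norm (L z) <= B"
proof (cases "L z = 0 \<or> r <= 0")
 case True
 then show ?thesis
 proof
  assume "L z = 0"
  have "r >= 0" using z using zero_le_dist[of a z] by (simp del: zero_le_dist)
  then obtain w where "w \<in> sphere a r" by (metis mem_sphere vector_choose_dist)
  then have "0 <= B" using B norm_ge_zero order_trans by blast
  then show ?thesis using \<open>L z = 0\<close> by simp
 next
  assume "r <= 0"
  then show ?thesis using z B[of z]
   by (metis antisym dist_le_zero_iff mem_cball mem_sphere order_trans zero_le_dist)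
 qed
next
 case False
 then have r: "r > 0" by simp
 have "cmod (herm (L z) (L z)) <= B * norm (L z)"
 proof (rule maximum_modulus_frontier[where S = "cball a r" and f = "\<lambda>w. herm (L w) (L z)"])
  show "(\<lambda>w. herm (L w) (L z)) holomorphic_on interior (cball a r)"
   using assms(1) by (simp add: holomorphic_herm)
  show "continuous_on (closure (cball a r)) (\<lambda>w. herm (L w) (L z))"
   using assms(2) by (auto intro!: continuous_intros)
  fix w assume "w \<in> frontier (cball a r)"
  then have "norm (L w) <= B" using B r by (simp add: frontier_cball)
  then show "cmod (herm (L w) (L z)) <= B * norm (L z)"
   using norm_herm_le[of "L w" "L z"] by (meson mult_right_mono norm_ge_zero order_trans)
 qed (use z in auto)
 then have "norm (L z) * norm (L z) <= B * norm (L z)"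
  by (simp add: herm_self power2_eq_square norm_mult)
 then show ?thesis using False by simp
qed

lemma uniform_limit_subseq:
 assumes "uniform_limit K X S sequentially" "strict_mono (r :: nat => nat)"
 shows "uniform_limit K (\<lambda>n. X (r n)) S sequentially"
 using filterlim_compose[OF assms(1) filterlim_subseq[OF assms(2)]] .

text \<open>Induction over the set of coordinates: the scalar Montel theorem handles one more
  coordinate and refines the subsequence found so far.\<close>

lemma Montel_vec:
 fixes X :: "nat => complex => complex^'n::finite"
 assumes "open A" "\<And>n. hol_vec (X n) A" "\<And>n z. z \<in> A ==> norm (X n z) <= B"
 obtains S r where "hol_vec S A" "strict_mono (r :: nat => nat)"
  "\<And>K. compact K ==> K \<subseteq> A ==> uniform_limit K (X \<circ> r) S sequentially"
proof -
 have "\<exists>r S. strict_mono (r :: nat => nat) \<and> (\<forall>i\<in>I. S i holomorphic_on A \<and>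
   (\<forall>K. compact K \<and> K \<subseteq> A --> uniform_limit K (\<lambda>n z. X (r n) z $ i) (S i) sequentially))"
  if "finite I" for I :: "'n set"
  using that
 proof induction
  case empty
  show ?case by (intro exI[of _ id]) (simp add: strict_mono_def)
 next
  case (insert i I)
  from insert.IH obtain r S where r: "strict_mono (r :: nat => nat)"
   and S: "\<forall>i\<in>I. S i holomorphic_on A \<and>
   (\<forall>K. compact K \<and> K \<subseteq> A --> uniform_limit K (\<lambda>n z. X (r n) z $ i) (S i) sequentially)"
   by (elim exE conjE)
  have rS: "strict_mono r" "\<And>i. i \<in> I ==> S i holomorphic_on A"
   "\<And>i K. i \<in> I ==> compact K ==> K \<subseteq> A ==> uniform_limit K (\<lambda>n z. X (r n) z $ i) (S i) sequentially"
   using r S by simp_all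
  have 1: "h holomorphic_on A" if "h \<in> range (\<lambda>n z. X (r n) z $ i)" for h
   using that assms(2) by (auto simp: hol_vec_def)
  have 2: "\<exists>B. \<forall>h\<in>range (\<lambda>n z. X (r n) z $ i). \<forall>z\<in>K. cmod (h z) <= B"
   if "compact K" "K \<subseteq> A" for K
  proof -
   have "cmod (X (r n) z $ i) <= B" if "z \<in> K" for n z
    using Finite_Cartesian_Product.norm_nth_le[of "X (r n) z" i] assms(3)[of z "r n"] that \<open>K \<subseteq> A\<close>
    by fastforce
   then show ?thesis by blast
  qed
  obtain g r' where g: "g holomorphic_on A" "strict_mono (r' :: nat => nat)"
   "\<And>K. compact K ==> K \<subseteq> A ==> uniform_limit K ((\<lambda>n z. X (r n) z $ i) \<circ> r') g sequentially"
  proof (rule Montel[OF assms(1) 1 2 subset_refl])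
   fix g and r' :: "nat => nat"
   assume a: "g holomorphic_on A" "strict_mono r'"
    "\<And>K. compact K ==> K \<subseteq> A ==> uniform_limit K ((\<lambda>n z. X (r n) z $ i) \<circ> r') g sequentially"
   show thesis by (rule that[OF a])
  qed assumption+
  show ?case
  proof (intro exI[of _ "r \<circ> r'"] exI[of _ "S(i := g)"] conjI ballI allI impI)
   show "strict_mono (r \<circ> r')" using rS(1) g(2) by (rule strict_mono_o)
   fix j assume j: "j \<in> insert i I"
   show "(S(i := g)) j holomorphic_on A" using j g(1) rS(2) by auto
   fix K assume K: "compact K \<and> K \<subseteq> A"
   show "uniform_limit K (\<lambda>n z. X ((r \<circ> r') n) z $ j) ((S(i := g)) j) sequentially"
   proof (cases "j = i")
    case True
    then show ?thesis using g(3)[of K] K by (simp add: o_def)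
   next
    case False
    then have "uniform_limit K (\<lambda>n z. X (r n) z $ j) (S j) sequentially"
     using rS(3) K j by auto
    then have "uniform_limit K (\<lambda>n z. X (r (r' n)) z $ j) (S j) sequentially"
     by (rule uniform_limit_subseq[OF _ g(2)])
    then show ?thesis using False by simp
   qed
  qed
 qed
 from this[OF finite, of UNIV] obtain r S where r: "strict_mono (r :: nat => nat)"
   and S: "\<forall>i\<in>UNIV. S i holomorphic_on A \<and>
   (\<forall>K. compact K \<and> K \<subseteq> A --> uniform_limit K (\<lambda>n z. X (r n) z $ i) (S i) sequentially)"
  by (elim exE conjE)
 have rS: "\<And>i. S i holomorphic_on A"
   "\<And>i K. compact K ==> K \<subseteq> A ==> uniform_limit K (\<lambda>n z. X (r n) z $ i) (S i) sequentially"
  using S by simp_all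
 show ?thesis
 proof (rule that[of "\<lambda>z. \<chi> i. S i z" r])
  show "hol_vec (\<lambda>z. \<chi> i. S i z) A" by (simp add: hol_vec_def rS)
  fix K assume K: "compact K" "K \<subseteq> A"
  show "uniform_limit K (X \<circ> r) (\<lambda>z. \<chi> i. S i z) sequentially"
   unfolding uniform_limit_iff
  proof (intro allI impI)
   fix e :: real assume e: "e > 0"
   have "\<forall>\<^sub>F n in sequentially. \<forall>i. \<forall>z\<in>K. dist (X (r n) z $ i) (S i z) < e / (2 * real CARD('n))"
    using rS(2)[OF K] e by (intro eventually_all_finite) (auto simp: uniform_limit_iff)
   then show "\<forall>\<^sub>F n in sequentially. \<forall>z\<in>K. dist ((X \<circ> r) n z) (\<chi> i. S i z) < e"
   proof eventually_elim
    case (elim n)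
    show ?case
    proof
     fix z assume "z \<in> K"
     then have "norm (X (r n) z - (\<chi> i. S i z)) <= real CARD('n) * (e / (2 * real CARD('n)))"
      using elim by (intro norm_vec_le) (auto simp: dist_norm intro: less_imp_le)
     then show "dist ((X \<circ> r) n z) (\<chi> i. S i z) < e" using e by (simp add: dist_norm)
    qed
   qed
  qed
 qed (rule r)
qed

lemma uniform_limit_seq_tendsto:
 assumes "uniform_limit K X S sequentially" "continuous_on K S"
  and "\<And>n. t n \<in> K" "t0 \<in> K" "t \<longlonglongrightarrow> t0"
 shows "(\<lambda>n. X n (t n)) \<longlonglongrightarrow> (S t0 :: 'b::metric_space)"
proof -
 have 1: "(\<lambda>n. S (t n)) \<longlonglongrightarrow> S t0"
  using assms(2-5) continuous_on_tendsto_compose[of K S t t0 sequentially] by simp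
 have "(\<lambda>n. dist (X n (t n)) (S (t n))) \<longlonglongrightarrow> 0"
 proof (rule LIMSEQ_I)
  fix e :: real assume "e > 0"
  then have "\<forall>\<^sub>F n in sequentially. \<forall>x\<in>K. dist (X n x) (S x) < e"
   using assms(1) by (simp add: uniform_limit_iff)
  then obtain N where "\<forall>n\<ge>N. \<forall>x\<in>K. dist (X n x) (S x) < e"
   by (auto simp: eventually_sequentially)
  then show "\<exists>N. \<forall>n\<ge>N. norm (dist (X n (t n)) (S (t n)) - 0) < e"
   using assms(3) by auto
 qed
 moreover have "(\<lambda>n. dist (S (t n)) (S t0)) \<longlonglongrightarrow> 0"
  using 1 by (simp add: tendsto_dist_iff[symmetric])
 ultimately have "(\<lambda>n. dist (X n (t n)) (S (t n)) + dist (S (t n)) (S t0)) \<longlonglongrightarrow> 0 + 0"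
  by (rule tendsto_add)
 then have 2: "(\<lambda>n. dist (X n (t n)) (S (t n)) + dist (S (t n)) (S t0)) \<longlonglongrightarrow> 0" by simp
 have "\<forall>\<^sub>F n in sequentially. norm (dist (X n (t n)) (S t0)) <= dist (X n (t n)) (S (t n)) + dist (S (t n)) (S t0)"
  by (intro always_eventually allI) (simp add: dist_triangle)
 from Lim_null_comparison[OF this 2] have "(\<lambda>n. dist (X n (t n)) (S t0)) \<longlonglongrightarrow> 0" .
 then show ?thesis by (simp add: tendsto_dist_iff[symmetric])
qed

lemma vderiv_diff:
 assumes "hol_vec L A" "hol_vec M A" "open A" "z \<in> A"
 shows "vderiv (\<lambda>w. L w - M w) z = vderiv L z - vderiv M z"
proof (rule vderiv_unique)
 show "((\<lambda>w. L w - M w) has_derivative (\<lambda>h. h *s (vderiv L z - vderiv M z))) (at z)"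
  using has_derivative_diff[OF has_derivative_hol_vec[OF assms(1,3,4)] has_derivative_hol_vec[OF assms(2,3,4)]]
  by (simp add: vector_ssub_ldistrib)
qed

lemma hol_vec_diff: "hol_vec L A ==> hol_vec M A ==> hol_vec (\<lambda>z. L z - M z) A"
 unfolding hol_vec_def by (auto intro!: holomorphic_intros)

lemma continuous_on_vderiv:
 assumes "hol_vec L A" "open A"
 shows "continuous_on A (vderiv L)"
proof -
 have "continuous_on A (\<lambda>z. \<chi> i. deriv (\<lambda>w. L w $ i) z)"
  by (intro continuous_on_vec_lambda holomorphic_on_imp_continuous_on holomorphic_deriv hol_vecD assms)
 then show ?thesis by (simp add: vderiv_def[abs_def])
qed

text \<open>Locally uniform convergence passes to derivatives by Cauchy's estimate. The points may
  move with \<open>n\<close>, as happens when bad points are extracted in contradiction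
  arguments.\<close>

lemma vderiv_tendsto:
 fixes X :: "nat => complex => complex^'n::finite"
 assumes A: "open A" and X: "\<And>n. hol_vec (X n) A"
  and lim: "\<And>K. compact K ==> K \<subseteq> A ==> uniform_limit K X S sequentially"
  and S: "hol_vec S A" and t: "t \<longlonglongrightarrow> t0" "t0 \<in> A"
 shows "(\<lambda>n. vderiv (X n) (t n)) \<longlonglongrightarrow> vderiv S t0"
proof -
 obtain e where e: "e > 0" "cball t0 e \<subseteq> A"
  using A t(2) open_contains_cball by blast
 have "eventually (\<lambda>n. t n \<in> ball t0 (e/2)) sequentially"
  using t(1) e(1) by (intro topological_tendstoD) auto
 then have ev: "eventually (\<lambda>n. dist t0 (t n) < e / 2) sequentially" by simp
 have tA: "t n \<in> A" "ball (t n) (e/2) \<subseteq> cball t0 e" if "dist t0 (t n) < e / 2" for n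
 proof -
  show sub: "ball (t n) (e/2) \<subseteq> cball t0 e"
  proof
   fix w assume "w \<in> ball (t n) (e/2)"
   then show "w \<in> cball t0 e" using that dist_triangle[of t0 w "t n"] by auto
  qed
  have "t n \<in> ball (t n) (e/2)" using e(1) by simp
  then show "t n \<in> A" using sub e(2) by blast
 qed
 have "(\<lambda>n. vderiv (X n) (t n) - vderiv S (t n)) \<longlonglongrightarrow> 0"
 proof (rule tendstoI)
  fix c :: real assume c: "c > 0"
  \<comment> \<open>With this bound on the difference, Cauchy's estimate on discs of radius
    \<open>e / 2\<close> yields \<open>c / 2\<close>.\<close>
  define b where "b = c * e / (4 * real CARD('n))"
  have b: "b > 0" using c e(1) by (simp add: b_def)
  have "\<forall>\<^sub>F n in sequentially. \<forall>z\<in>cball t0 e. dist (X n z) (S z) < b"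
   using lim[OF compact_cball e(2)] b by (simp add: uniform_limit_iff)
  then show "\<forall>\<^sub>F n in sequentially. dist (vderiv (X n) (t n) - vderiv S (t n)) 0 < c"
   using ev
  proof eventually_elim
   case (elim n)
   note tn = tA[OF elim(2)]
   have "norm (vderiv (\<lambda>z. X n z - S z) (t n)) <= real CARD('n) * (b / (e/2))"
   proof (rule norm_vderiv_le)
    show "hol_vec (\<lambda>z. X n z - S z) (ball (t n) (e/2))"
     using hol_vec_diff[OF X S] tn(2) e(2) hol_vec_subset by blast
    show "norm (X n z - S z) <= b" if "z \<in> ball (t n) (e/2)" for z
    proof -
     have "z \<in> cball t0 e" using tn(2) that by blast
     then have "dist (X n z) (S z) < b" using elim(1) by blast
     then show ?thesis by (simp add: dist_norm)
    qed
   qed (use e in auto)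
   also have "\<dots> < c" using c e(1) by (simp add: b_def)
   finally show ?case by (simp add: vderiv_diff[OF X S A tn(1)])
  qed
 qed
 moreover have "(\<lambda>n. vderiv S (t n)) \<longlonglongrightarrow> vderiv S t0"
  by (rule continuous_on_tendsto_compose[OF continuous_on_vderiv[OF S A] t eventually_mono[OF ev tA(1)]])
 ultimately have "(\<lambda>n. vderiv (X n) (t n) - vderiv S (t n) + vderiv S (t n)) \<longlonglongrightarrow> 0 + vderiv S t0"
  by (rule tendsto_add)
 then show ?thesis by simp
qed

section \<open>The metric of the projective plane\<close>

lemma norm_diff_sq_herm: "(norm (x - y))\<^sup>2 = (norm x)\<^sup>2 - 2 * Re (herm x y) + (norm y)\<^sup>2"
 by (simp add: power2_norm_eq_inner inner_diff inner_commute inner_eq_Re_herm[symmetric])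

text \<open>The real inner product of two rank one projections is the squared cosine of the angle
  between their lines, and each projection has norm 1.\<close>

lemma dist_proj_sq:
 assumes "x ~= 0" "y ~= 0"
 shows "(dist (proj x) (proj y))\<^sup>2 = 2 - 2 * (cmod (herm x y))\<^sup>2 / ((norm x)\<^sup>2 * (norm y)\<^sup>2)"
proof -
 let ?m = "\<lambda>z::complex^3. (norm z)\<^sup>2"
 have 1: "line_projection x \<bullet> line_projection y = (cmod (herm x y))\<^sup>2 / (?m x * ?m y)" for x y
 proof -
  have "complex_of_real (line_projection x \<bullet> line_projection y) =
    of_real (Re (\<Sum>i\<in>UNIV. \<Sum>j\<in>UNIV. line_projection x $ i $ j * cnj (line_projection y $ i $ j)))"
   by (simp add: inner_vec_def inner_complex_def)
  also have "(\<Sum>i\<in>UNIV. \<Sum>j\<in>UNIV. line_projection x $ i $ j * cnj (line_projection y $ i $ j)) =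
    (\<Sum>i\<in>UNIV. \<Sum>j\<in>UNIV. (x $ i * cnj (y $ i)) * (cnj (x $ j) * y $ j)) / of_real (?m x * ?m y)"
   by (simp add: line_projection_def sum_divide_distrib mult_ac)
  also have "(\<Sum>i\<in>UNIV. \<Sum>j\<in>UNIV. (x $ i * cnj (y $ i)) * (cnj (x $ j) * y $ j)) = herm x y * cnj (herm x y)"
   by (simp add: herm_def sum_product)
  also have "\<dots> = of_real ((cmod (herm x y))\<^sup>2)" by (rule complex_norm_square[symmetric])
  finally have "complex_of_real (line_projection x \<bullet> line_projection y) = of_real ((cmod (herm x y))\<^sup>2 / (?m x * ?m y))"
   by (metis Re_complex_of_real of_real_divide)
  then show ?thesis by (simp only: of_real_eq_iff)
 qed
 have 2: "line_projection x \<bullet> line_projection x = 1" if "x ~= 0" for x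
  using that by (simp add: 1 herm_self norm_power norm_mult power2_eq_square)
 have "(dist (proj x) (proj y))\<^sup>2 = (norm (line_projection x - line_projection y))\<^sup>2"
  using assms by (simp add: dist_proj dist_norm)
 also have "\<dots> = 1 - 2 * (line_projection x \<bullet> line_projection y) + 1"
  by (simp add: power2_norm_eq_inner inner_diff inner_commute 2 assms)
 finally show ?thesis by (simp add: 1)
qed

text \<open>The Gram determinant of \<open>x\<close> and \<open>y\<close> is
  \<open>(norm y)\<^sup>2\<close> times the squared distance of \<open>x\<close> from the complex
  line of \<open>y\<close>, hence at most \<open>(norm (x - y))\<^sup>2 * (norm y)\<^sup>2\<close>;
  the first identity exhibits the difference as a square.\<close>

lemma dist_proj_le:
 assumes "x ~= 0" "y ~= 0"
 shows "dist (proj x) (proj y) <= 2 * norm (x - y) / norm x"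
proof -
 let ?h = "herm x y"
 have "(norm (x - y))\<^sup>2 * (norm y)\<^sup>2 - ((norm x)\<^sup>2 * (norm y)\<^sup>2 - (cmod ?h)\<^sup>2)
   = (cmod (of_real ((norm y)\<^sup>2) - ?h))\<^sup>2"
  unfolding norm_diff_sq_herm cmod_power2 minus_complex.sel Re_complex_of_real Im_complex_of_real
  by (simp add: algebra_simps power2_eq_square)
 then have "(norm x)\<^sup>2 * (norm y)\<^sup>2 - (cmod ?h)\<^sup>2 <= (norm (x - y))\<^sup>2 * (norm y)\<^sup>2"
  by (smt (verit) zero_le_power2)
 then have "(dist (proj x) (proj y))\<^sup>2 <= 2 * (norm (x - y))\<^sup>2 / (norm x)\<^sup>2"
  using assms by (simp add: dist_proj_sq divide_simps)
 also have "\<dots> <= (2 * norm (x - y) / norm x)\<^sup>2"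
  by (simp add: power_divide power_mult_distrib divide_right_mono)
 finally show ?thesis by (rule power2_le_imp_le) simp
qed

lemma unit_lift:
 obtains x where "norm x = 1" "p = proj x"
proof -
 obtain z where z: "z ~= 0" "p = proj z" using proj_surj by blast
 define w where "w = of_real (inverse (norm z)) *s z"
 have w: "norm w = 1" using z by (simp add: w_def norm_smult norm_inverse)
 moreover have "proj z = proj w"
  using z w by (subst proj_eq_iff) (auto simp: w_def)
 ultimately show ?thesis using that z by metis
qed

lemma proj_smult: "c ~= 0 ==> x ~= 0 ==> proj (c *s x) = proj x"
 using proj_eq_iff[of x "c *s x"] by auto

text \<open>The phase of the lift makes its pairing with \<open>x\<close> a real \<open>c\<close> in
  the unit interval. Then \<open>2 - 2 * c <= 2 - 2 * c\<^sup>2\<close> compares the two distances.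
  This supplies short affine discs between nearby points.\<close>

lemma aligned_lift:
 assumes "norm x = 1"
 obtains y where "norm y = 1" "q = proj y" "norm (x - y) <= dist (proj x) q"
proof -
 obtain y where y: "norm y = 1" "q = proj y" by (rule unit_lift)
 define c where "c = cmod (herm x y)"
 define u where "u = (if c = 0 then 1 else herm x y / of_real c)"
 have u: "cmod u = 1" by (simp add: u_def c_def norm_divide)
 define w where "w = u *s y"
 have "cnj u * herm x y = of_real c"
  using complex_norm_square[of "herm x y"]
  by (simp add: u_def c_def power2_eq_square mult.commute divide_eq_eq)
 then have hw: "herm x w = of_real c" by (simp add: w_def herm_scale_right)
 have w: "norm w = 1" by (simp add: w_def norm_smult u y)
 have q: "q = proj w" unfolding w_def using y u by (subst proj_smult) auto
 have c: "0 <= c" "c <= 1" using norm_herm_le[of x y] assms y by (auto simp: c_def)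
 have "x ~= 0" "w ~= 0" using assms w by auto
 then have "(dist (proj x) q)\<^sup>2 = 2 - 2 * c\<^sup>2"
  using dist_proj_sq[of x w] by (simp add: q assms w hw c)
 moreover have "(norm (x - w))\<^sup>2 = 2 - 2 * c" by (simp add: norm_diff_sq_herm assms w hw)
 moreover have "c\<^sup>2 <= c" using c by (simp add: power2_eq_square mult_left_le)
 ultimately have "(norm (x - w))\<^sup>2 <= (dist (proj x) q)\<^sup>2" by simp
 then have "norm (x - w) <= dist (proj x) q" by (rule power2_le_imp_le) simp
 then show ?thesis using that w q by blast
qed

lemma dist_cp2_le_2: "dist (p::cp2) q <= 2"
proof -
 obtain x where x: "norm x = 1" "p = proj x" by (rule unit_lift)
 obtain y where y: "norm y = 1" "q = proj y" by (rule unit_lift)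
 have "x ~= 0" "y ~= 0" using x y by auto
 then have "(dist p q)\<^sup>2 = 2 - 2 * (cmod (herm x y))\<^sup>2"
  using dist_proj_sq[of x y] by (simp add: x y)
 moreover have "(cmod (herm x y))\<^sup>2 >= 0" by simp
 ultimately have "(dist p q)\<^sup>2 <= 4" by linarith
 then have "(dist p q)\<^sup>2 <= 2\<^sup>2" by simp
 then show ?thesis by (rule power2_le_imp_le) simp
qed

text \<open>At distance at most 1 the squared cosine is at least \<open>1 / 2\<close>, so the lines
  are far from orthogonal. This is the source of zero-free pairings, whose roots can be
  taken.\<close>

lemma herm_ge_of_dist:
 assumes "x ~= 0" "y ~= 0" "dist (proj x) (proj y) <= 1"
 shows "cmod (herm x y) >= norm x * norm y / 2"
proof -
 have "(dist (proj x) (proj y))\<^sup>2 <= 1" using assms(3) by (simp add: power_le_one)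
 then have "(cmod (herm x y))\<^sup>2 >= (norm x * norm y)\<^sup>2 / 2"
  using assms(1,2) dist_proj_sq[OF assms(1,2)] by (simp add: power_mult_distrib field_simps)
 moreover have "(norm x * norm y)\<^sup>2 / 2 >= (norm x * norm y / 2)\<^sup>2" by (simp add: power_divide)
 ultimately have "(norm x * norm y / 2)\<^sup>2 <= (cmod (herm x y))\<^sup>2" by linarith
 then show ?thesis by (rule power2_le_imp_le) simp
qed

lemma compact_cp2: "compact (UNIV :: cp2 set)"
proof -
 have "compact (proj ` sphere 0 1)"
  by (intro compact_continuous_image continuous_on_subset[OF continuous_on_proj]) auto
 moreover have "proj ` sphere 0 1 = UNIV"
 proof -
  have "p \<in> proj ` sphere 0 1" for p by (rule unit_lift[of p]) auto
  then show ?thesis by auto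
 qed
 ultimately show ?thesis by simp
qed

lemma cp2_convergent_subseq:
 fixes p :: "nat => cp2"
 obtains r l where "strict_mono (r :: nat => nat)" "(\<lambda>n. p (r n)) \<longlonglongrightarrow> l"
proof -
 have "\<exists>l r. strict_mono (r :: nat => nat) \<and> (p \<circ> r) \<longlonglongrightarrow> l"
  using compact_cp2 unfolding compact_def by auto
 then show ?thesis using that by (auto simp: o_def)
qed

lemma closed_imp_compact_cp2: "closed (K :: cp2 set) ==> compact K"
 using compact_Int_closed[OF compact_cp2] by simp

section \<open>Polynomial maps\<close>

text \<open>Bilinear, in contrast to \<open>herm\<close>: through it a gradient acts complex
  linearly on vectors.\<close>

definition cdot :: "complex^'n::finite => complex^'n => complex" where
 "cdot x y = (\<Sum>i\<in>UNIV. x $ i * y $ i)"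

lemma cdot_simps:
 "cdot 0 v = 0" "cdot (axis i 1) v = v $ i" "cdot (a + b) v = cdot a v + cdot b v"
 "cdot (c *s a) v = c * cdot a v" "cdot a (v + w) = cdot a v + cdot a w" "cdot a (c *s v) = c * cdot a v"
proof -
 show "cdot (axis i 1) v = v $ i"
  unfolding cdot_def axis_def by (simp add: if_distrib[where f = "\<lambda>x. x * _"] cong: if_cong)
qed (simp_all add: cdot_def sum.distrib distrib_left distrib_right sum_distrib_left mult_ac)

text \<open>Polynomials carried along with their formal gradients, so that differentiability,
  holomorphy along discs and polynomiality of the derivative are all proved by rule
  induction.\<close>

inductive poly_grad :: "(complex^3 => complex) => (complex^3 => complex^3) => bool" where
 const: "poly_grad (\<lambda>z. c) (\<lambda>z. 0)"
| coord: "poly_grad (\<lambda>z. z $ i) (\<lambda>z. axis i 1)"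
| add: "poly_grad P g ==> poly_grad Q h ==> poly_grad (\<lambda>z. P z + Q z) (\<lambda>z. g z + h z)"
| mult: "poly_grad P g ==> poly_grad Q h ==>
  poly_grad (\<lambda>z. P z * Q z) (\<lambda>z. Q z *s g z + P z *s h z)"

lemma poly_grad_has_derivative:
 "poly_grad P g ==> (P has_derivative cdot (g y)) (at y)"
proof (induction rule: poly_grad.induct)
 case (const c)
 then show ?case by (simp add: cdot_simps(1)[abs_def])
next
 case (coord i)
 have "cdot (axis i 1) = (\<lambda>v. v $ i)" by (auto simp: cdot_simps)
 then show ?case by (simp add: bounded_linear.has_derivative[OF bounded_linear_vec_nth has_derivative_ident])
next
 case (add P g Q h)
 have "cdot (g y + h y) = (\<lambda>v. cdot (g y) v + cdot (h y) v)" by (auto simp: cdot_simps)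
 then show ?case using has_derivative_add[OF add.IH] by simp
next
 case (mult P g Q h)
 have "cdot (Q y *s g y + P y *s h y) = (\<lambda>v. P y * cdot (h y) v + cdot (g y) v * Q y)"
  by (auto simp: cdot_simps)
 then show ?case using has_derivative_mult[OF mult.IH] by simp
qed

lemma poly_grad_holomorphic: "poly_grad P g ==> hol_vec L A ==> (\<lambda>z. P (L z)) holomorphic_on A"
 by (induction rule: poly_grad.induct) (auto simp: hol_vec_def intro!: holomorphic_intros)

definition poly_fun :: "(complex^3 => complex) => bool" where
 "poly_fun P \<longleftrightarrow> (\<exists>g. poly_grad P g)"

lemma poly_fun_const: "poly_fun (\<lambda>z. c)"
 unfolding poly_fun_def by (rule exI) (rule poly_grad.const)

lemma poly_fun_coord: "poly_fun (\<lambda>z. z $ i)"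
 unfolding poly_fun_def by (rule exI) (rule poly_grad.coord)

lemma poly_fun_add: "poly_fun P ==> poly_fun Q ==> poly_fun (\<lambda>z. P z + Q z)"
 unfolding poly_fun_def by (elim exE, rule exI, rule poly_grad.add)

lemma poly_fun_mult: "poly_fun P ==> poly_fun Q ==> poly_fun (\<lambda>z. P z * Q z)"
 unfolding poly_fun_def by (elim exE, rule exI, rule poly_grad.mult)

lemma poly_fun_diff: "poly_fun P ==> poly_fun Q ==> poly_fun (\<lambda>z. P z - Q z)"
proof -
 assume "poly_fun P" "poly_fun Q"
 then have "poly_fun (\<lambda>z. P z + (-1) * Q z)"
  by (intro poly_fun_add poly_fun_mult poly_fun_const)
 then show ?thesis by simp
qed

lemma poly_fun_power: "poly_fun P ==> poly_fun (\<lambda>z. P z ^ n)"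
 by (induction n) (simp_all add: poly_fun_const poly_fun_mult)

lemma poly_fun_sum: "finite I ==> (\<And>i. i \<in> I ==> poly_fun (P i)) ==> poly_fun (\<lambda>z. \<Sum>i\<in>I. P i z)"
 by (induction rule: finite_induct) (simp_all add: poly_fun_const poly_fun_add)

lemma poly_grad_comp_poly_fun:
 "poly_grad P g ==> (\<And>i. poly_fun (\<lambda>z. H z $ i)) ==> poly_fun (\<lambda>z. P (H z))"
 by (induction rule: poly_grad.induct) (simp_all add: poly_fun_const poly_fun_add poly_fun_mult)

lemma poly_grad_nth_poly_fun: "poly_grad P g ==> poly_fun (\<lambda>z. g z $ k)"
proof (induction rule: poly_grad.induct)
 case (mult P g Q h)
 then have "poly_fun P" "poly_fun Q" by (auto simp: poly_fun_def)
 then show ?case using mult.IH by (simp add: poly_fun_add poly_fun_mult)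
qed (simp_all add: poly_fun_const poly_fun_add)

lemma poly_fun_holomorphic: "poly_fun P ==> hol_vec L A ==> (\<lambda>z. P (L z)) holomorphic_on A"
 unfolding poly_fun_def by (elim exE) (rule poly_grad_holomorphic)

lemma poly_fun_continuous: "poly_fun P ==> continuous_on A P"
 unfolding poly_fun_def
 by (elim exE, rule continuous_at_imp_continuous_on)
  (intro ballI has_derivative_continuous, erule poly_grad_has_derivative)

definition polymap :: "(complex^3 => complex^3) => bool" where
 "polymap H \<longleftrightarrow> (\<forall>i. poly_fun (\<lambda>z. H z $ i))"

definition cderiv :: "(complex^3 => complex^3) => complex^3 => complex^3 => complex^3" where
 "cderiv H y v = frechet_derivative H (at y) v"

lemma polymap_grad:
 assumes "polymap H"
 obtains g where "\<And>i. poly_grad (\<lambda>z. H z $ i) (g i)" "\<And>y v i. cderiv H y v $ i = cdot (g i y) v"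
  "\<And>y. (H has_derivative (\<lambda>v. \<chi> i. cdot (g i y) v)) (at y)"
proof -
 have "\<forall>i. \<exists>g. poly_grad (\<lambda>z. H z $ i) g" using assms by (simp add: polymap_def poly_fun_def)
 from choice[OF this] obtain g where "\<forall>i. poly_grad (\<lambda>z. H z $ i) (g i)" by (rule exE)
 then have g: "\<And>i. poly_grad (\<lambda>z. H z $ i) (g i)" by simp
 have 2: "((\<lambda>w. H w \<bullet> axis i b) has_derivative (\<lambda>v. (\<chi> i. cdot (g i y) v) \<bullet> axis i b)) (at y)" for i b y
  using has_derivative_inner_left[OF poly_grad_has_derivative[OF g[of i], of y], of b] by (simp add: inner_axis)
 have 3: "(H has_derivative (\<lambda>v. \<chi> i. cdot (g i y) v)) (at y)" for y
  by (rule iffD2[OF has_derivative_componentwise_within]) (auto simp: Basis_vec_def 2)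
 then have "(\<lambda>v. \<chi> i. cdot (g i y) v) = frechet_derivative H (at y)" for y
  by (rule frechet_derivative_at)
 then have "cderiv H y v $ i = cdot (g i y) v" for y v i
  unfolding cderiv_def by (simp flip: \<open>\<And>y. _ = frechet_derivative H (at y)\<close>)
 then show ?thesis by (rule that[OF g _ 3])
qed

lemma polymap_has_derivative: "polymap H ==> (H has_derivative cderiv H y) (at y)"
proof (erule polymap_grad)
 fix g assume "(H has_derivative (\<lambda>v. \<chi> i. cdot (g i y) v)) (at y)" for y
 moreover from this have "(\<lambda>v. \<chi> i. cdot (g i y) v) = cderiv H y"
  unfolding cderiv_def by (rule frechet_derivative_at)
 ultimately show ?thesis by metis
qed

lemma cderiv_add: "polymap H ==> cderiv H y (v + w) = cderiv H y v + cderiv H y w"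
 by (erule polymap_grad[of H]) (simp add: vec_eq_iff cdot_simps)

lemma cderiv_smult: "polymap H ==> cderiv H y (c *s v) = c *s cderiv H y v"
 by (erule polymap_grad[of H]) (simp add: vec_eq_iff cdot_simps)

lemma polymap_comp:
 assumes "polymap H" "polymap H'"
 shows "polymap (\<lambda>z. H (H' z))"
 unfolding polymap_def
proof
 fix i
 obtain g where "poly_grad (\<lambda>z. H z $ i) g" using assms(1) by (auto simp: polymap_def poly_fun_def)
 then show "poly_fun (\<lambda>z. H (H' z) $ i)"
  using poly_grad_comp_poly_fun[of "\<lambda>z. H z $ i" g H'] assms(2) by (simp add: polymap_def)
qed

lemma cderiv_comp:
 assumes "polymap H" "polymap H'"
 shows "cderiv (\<lambda>z. H (H' z)) y v = cderiv H (H' y) (cderiv H' y v)"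
proof -
 have "((H \<circ> H') has_derivative (cderiv H (H' y) \<circ> cderiv H' y)) (at y)"
  using diff_chain_at polymap_has_derivative[OF assms(1)] polymap_has_derivative[OF assms(2)] by blast
 then have "cderiv H (H' y) \<circ> cderiv H' y = frechet_derivative (H \<circ> H') (at y)"
  by (rule frechet_derivative_at)
 then show ?thesis by (simp add: cderiv_def o_def) metis
qed

lemma hol_vec_polymap: "polymap H ==> hol_vec L A ==> hol_vec (\<lambda>z. H (L z)) A"
 unfolding hol_vec_def[of "\<lambda>z. H (L z)"] polymap_def
 using poly_fun_holomorphic[of "\<lambda>z. H z $ i" L A for i] by blast

lemma polymap_continuous: "polymap H ==> continuous_on A H"
 by (rule continuous_at_imp_continuous_on)
  (intro ballI has_derivative_continuous, erule polymap_has_derivative)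

lemma vderiv_polymap:
 assumes "polymap H" "hol_vec L A" "open A" "z \<in> A"
 shows "vderiv (\<lambda>z. H (L z)) z = cderiv H (L z) (vderiv L z)"
proof (rule vderiv_unique)
 have "((H \<circ> L) has_derivative (cderiv H (L z) \<circ> (\<lambda>h. h *s vderiv L z))) (at z)"
  using diff_chain_at[OF has_derivative_hol_vec[OF assms(2-4)] polymap_has_derivative[OF assms(1)]] .
 then show "((\<lambda>z. H (L z)) has_derivative (\<lambda>h. h *s cderiv H (L z) (vderiv L z))) (at z)"
  by (simp add: o_def cderiv_smult assms(1))
qed

section \<open>Determinants of three vectors\<close>

definition det3 :: "complex^3 => complex^3 => complex^3 => complex" where
 "det3 a b c = a $ 1 * (b $ 2 * c $ 3 - b $ 3 * c $ 2) - a $ 2 * (b $ 1 * c $ 3 - b $ 3 * c $ 1)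
   + a $ 3 * (b $ 1 * c $ 2 - b $ 2 * c $ 1)"

lemma det3_eq_det: "det3 a b c = det (vector [a, b, c])"
 by (simp add: det3_def det_3 algebra_simps)

lemma det3_linear_map:
 assumes add: "\<And>v w. A (v + w) = A v + A w" and smult: "\<And>c v. A (c *s v) = c *s A v"
 shows "det3 (A a) (A b) (A c) = det3 (A (axis 1 1)) (A (axis 2 1)) (A (axis 3 1)) * det3 a b c"
proof -
 have 1: "A v = v $ 1 *s A (axis 1 1) + v $ 2 *s A (axis 2 1) + v $ 3 *s A (axis 3 1)" for v
 proof -
  have "v = v $ 1 *s axis 1 1 + v $ 2 *s axis 2 1 + v $ 3 *s axis 3 1"
   by (simp add: vec_eq_iff forall_3 axis_def)
  then show ?thesis using add smult by metis
 qed
 have "(vector [A a, A b, A c] :: complex^3^3) = vector [a, b, c] ** vector [A (axis 1 1), A (axis 2 1), A (axis 3 1)]"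
  unfolding vec_eq_iff forall_3 matrix_matrix_mult_def
  by (simp add: sum_3 1[of a] 1[of b] 1[of c])
 then show ?thesis by (simp add: det3_eq_det det_mul mult.commute)
qed

lemma det3_simps:
 "det3 (u *s a) b c = u * det3 a b c" "det3 a (u *s b) c = u * det3 a b c" "det3 a b (u *s c) = u * det3 a b c"
 "det3 (a + a') b c = det3 a b c + det3 a' b c" "det3 a (b + b') c = det3 a b c + det3 a b' c"
 "det3 a b (c + c') = det3 a b c + det3 a b c'"
 "det3 a (b - b') c = det3 a b c - det3 a b' c" "det3 a b (c - c') = det3 a b c - det3 a b c'"
 "det3 a a c = 0" "det3 a b a = 0" "det3 a b b = 0"
 by (simp_all add: det3_def algebra_simps)

lemma norm_det3_le: "cmod (det3 a b c) <= 6 * norm a * norm b * norm c"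
proof -
 have n: "cmod (x $ i) <= norm x" for x :: "complex^3" and i by (rule Finite_Cartesian_Product.norm_nth_le)
 have p: "cmod (b $ i * c $ j - b $ k * c $ l) <= 2 * (norm b * norm c)" for i j k l
 proof -
  have "cmod (b $ i * c $ j) <= norm b * norm c" "cmod (b $ k * c $ l) <= norm b * norm c"
   unfolding norm_mult by (intro mult_mono n; simp)+
  then show ?thesis using norm_triangle_ineq4[of "b $ i * c $ j" "b $ k * c $ l"] by linarith
 qed
 have q: "cmod (a $ m * (b $ i * c $ j - b $ k * c $ l)) <= norm a * (2 * (norm b * norm c))" for m i j k l
  unfolding norm_mult[of "a $ m"] by (intro mult_mono n p) auto
 have "cmod (det3 a b c) <= norm a * (2 * (norm b * norm c)) + norm a * (2 * (norm b * norm c)) + norm a * (2 * (norm b * norm c))"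
  unfolding det3_def by (intro norm_triangle_mono order_trans[OF norm_triangle_ineq4] add_mono q)
 then show ?thesis by simp
qed

lemma continuous_on_det3 [continuous_intros]:
 "continuous_on A f ==> continuous_on A g ==> continuous_on A h ==> continuous_on A (\<lambda>x. det3 (f x) (g x) (h x))"
 unfolding det3_def by (intro continuous_intros)

lemma homogeneous_polynomial_poly_fun: "homogeneous_polynomial d P ==> poly_fun P"
proof -
 assume "homogeneous_polynomial d P"
 then obtain a where "P = (\<lambda>z. \<Sum>j\<le>d. \<Sum>k\<le>d - j. a j k * z $ 1 ^ j * z $ 2 ^ k * z $ 3 ^ (d - j - k))"
  by (auto simp: homogeneous_polynomial_def)
 then show ?thesis
  by (simp add: poly_fun_sum poly_fun_mult poly_fun_power poly_fun_const poly_fun_coord)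
qed

lemma homogeneous_polynomial_smult:
 assumes "homogeneous_polynomial d P"
 shows "P (c *s z) = c ^ d * P z"
proof -
 obtain a where a: "\<And>z. P z = (\<Sum>j\<le>d. \<Sum>k\<le>d - j. a j k * z $ 1 ^ j * z $ 2 ^ k * z $ 3 ^ (d - j - k))"
  using assms by (auto simp: homogeneous_polynomial_def)
 have "c ^ j * c ^ k * c ^ (d - j - k) = c ^ d" if "j <= d" "k <= d - j" for j k
  using that by (simp add: power_add[symmetric])
 then have "a j k * (c * x) ^ j * (c * y) ^ k * (c * w) ^ (d - j - k)
   = c ^ d * (a j k * x ^ j * y ^ k * w ^ (d - j - k))" if "j <= d" "k <= d - j" for j k x y w
  using that by (simp add: power_mult_distrib) (metis (no_types, lifting) mult.assoc mult.left_commute)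
 then show ?thesis
  unfolding a sum_distrib_left by (intro sum.cong refl) simp
qed

section \<open>Lifted dynamics and the Green function\<close>

locale lifted_map =
 fixes f :: "cp2 => cp2" and d :: nat and F :: "complex^3 => complex^3"
 assumes d: "d >= 2" and hom: "\<And>i. homogeneous_polynomial d (\<lambda>z. F z $ i)"
  and F_zero: "\<And>z. F z = 0 \<longleftrightarrow> z = 0" and f_proj: "\<And>z. z ~= 0 ==> f (proj z) = proj (F z)"
begin

lemma polymap_F: "polymap F"
 using hom homogeneous_polynomial_poly_fun by (auto simp: polymap_def)

lemma polymap_iter: "polymap (F ^^ n)"
proof (induction n)
 case 0
 show ?case by (simp add: polymap_def poly_fun_coord)
next
 case (Suc n)
 then show ?case using polymap_comp[OF polymap_F Suc] by (simp add: o_def)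
qed

lemma F_smult: "F (c *s z) = c ^ d *s F z"
 using homogeneous_polynomial_smult[OF hom] by (simp add: vec_eq_iff)

lemma iter_smult: "(F ^^ n) (c *s z) = c ^ (d ^ n) *s (F ^^ n) z"
 by (induction n) (simp_all add: F_smult power_mult[symmetric] mult.commute)

lemma iter_zero: "(F ^^ n) z = 0 \<longleftrightarrow> z = 0"
 by (induction n) (auto simp: F_zero)

lemma f_iter_proj: "z ~= 0 ==> (f ^^ n) (proj z) = proj ((F ^^ n) z)"
 by (induction n) (auto simp: f_proj iter_zero)

text \<open>Euler's relation, obtained by differentiating \<open>F (z *s y) = z ^ d *s F y\<close>
  at \<open>z = 1\<close>.\<close>

lemma cderiv_euler: "cderiv F y y = of_nat d *s F y"
proof -
 have "vderiv (\<lambda>z. F (z *s y)) 1 = cderiv F (1 *s y) (vderiv (\<lambda>z. z *s y) 1)"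
  by (rule vderiv_polymap[OF polymap_F hol_vec_id_scale open_UNIV]) simp
 also have "vderiv (\<lambda>z. z *s y) 1 = y" by (simp add: vec_eq_iff)
 finally have "cderiv F y y = vderiv (\<lambda>z. z ^ d *s F y) 1" by (simp add: F_smult)
 also have "\<dots> = of_nat d *s F y"
  unfolding vec_eq_iff by (auto intro!: DERIV_imp_deriv derivative_eq_intros)
 finally show ?thesis .
qed

lemma cderiv_smult_point:
 assumes "c ~= 0"
 shows "cderiv F (c *s y) v = c ^ (d - 1) *s cderiv F y v"
proof -
 have v: "vderiv (\<lambda>z. y + z *s v) 0 = v" for y v :: "complex^3"
  unfolding vec_eq_iff by (auto intro!: DERIV_imp_deriv derivative_eq_intros)
 have L: "hol_vec (\<lambda>z. y + z *s v) UNIV" for y v :: "complex^3"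
  by (intro hol_vec_add hol_vec_const hol_vec_id_scale)
 have "vderiv (\<lambda>z. F (c *s y + z *s (c *s v))) 0 = cderiv F (c *s y + 0 *s (c *s v)) (c *s v)"
  using vderiv_polymap[OF polymap_F L open_UNIV, of 0 "c *s y" "c *s v"] unfolding v by simp
 moreover have "(\<lambda>z. F (c *s y + z *s (c *s v))) = (\<lambda>z. c ^ d *s F (y + z *s v))"
 proof
  fix z
  have "c *s y + z *s (c *s v) = c *s (y + z *s v)" by (simp add: vec_eq_iff algebra_simps)
  then show "F (c *s y + z *s (c *s v)) = c ^ d *s F (y + z *s v)" by (simp only: F_smult)
 qed
 moreover have "vderiv (\<lambda>z. c ^ d *s F (y + z *s v)) 0 = c ^ d *s vderiv (\<lambda>z. F (y + z *s v)) 0"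
  using hol_vec_polymap[OF polymap_F L, of y v]
  by (auto simp: vec_eq_iff hol_vec_def intro!: deriv_cmult holomorphic_on_imp_differentiable_at[of _ UNIV])
 moreover have "vderiv (\<lambda>z. F (y + z *s v)) 0 = cderiv F y v"
  using vderiv_polymap[OF polymap_F L open_UNIV, of 0 y v] by (simp add: v)
 ultimately have "c *s cderiv F (c *s y) v = c ^ d *s cderiv F y v"
  by (simp add: cderiv_smult polymap_F)
 moreover have "c ^ d = c * c ^ (d - 1)" using d by (simp add: power_eq_if)
 ultimately have "c *s cderiv F (c *s y) v = c *s (c ^ (d - 1) *s cderiv F y v)" by simp
 then show ?thesis using assms unfolding vector_mul_lcancel by blast
qed

text \<open>Division by \<open>d\<close> cancels the factor of Euler's relation: in
  \<open>det3_cderiv\<close> the radial vector is sent to \<open>F y\<close> itself and not to its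
  multiple by \<open>d\<close>. Thus \<open>jac\<close> measures the area distortion of
  \<open>f\<close>, up to the norms of the lifts.\<close>

definition jac :: "complex^3 => complex" where
 "jac y = det3 (cderiv F y (axis 1 1)) (cderiv F y (axis 2 1)) (cderiv F y (axis 3 1)) / of_nat d"

lemma poly_fun_jac: "poly_fun jac"
proof -
 obtain g where g: "\<And>i. poly_grad (\<lambda>z. F z $ i) (g i)" "\<And>y v i. cderiv F y v $ i = cdot (g i y) v"
  by (rule polymap_grad[OF polymap_F]) blast
 have "poly_fun (\<lambda>y. cderiv F y (axis k 1) $ i)" for i k
  using poly_grad_nth_poly_fun[OF g(1)[of i], of k]
  by (simp add: g(2) cdot_def axis_def if_distrib[where f = "\<lambda>x. _ * x"] cong: if_cong)
 then have "poly_fun (\<lambda>y. inverse (of_nat d) * det3 (cderiv F y (axis 1 1)) (cderiv F y (axis 2 1)) (cderiv F y (axis 3 1)))"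
  unfolding det3_def by (intro poly_fun_add poly_fun_diff poly_fun_mult poly_fun_const)
 moreover have "jac = (\<lambda>y. inverse (of_nat d) * det3 (cderiv F y (axis 1 1)) (cderiv F y (axis 2 1)) (cderiv F y (axis 3 1)))"
  by (auto simp: jac_def field_simps)
 ultimately show ?thesis by simp
qed

lemma jac_smult: "c ~= 0 ==> jac (c *s y) = c ^ (3 * (d - 1)) * jac y"
 by (simp add: jac_def cderiv_smult_point det3_simps power_mult[symmetric] power_add[symmetric] mult_ac power3_eq_cube
   numeral_3_eq_3)

lemma det3_cderiv: "det3 (F y) (cderiv F y a) (cderiv F y b) = jac y * det3 y a b"
proof -
 have "of_nat d * det3 (F y) (cderiv F y a) (cderiv F y b) = det3 (cderiv F y y) (cderiv F y a) (cderiv F y b)"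
  by (simp add: cderiv_euler det3_simps)
 also have "\<dots> = of_nat d * (jac y * det3 y a b)"
  using det3_linear_map[of "cderiv F y" y a b] d
  by (simp add: cderiv_add cderiv_smult polymap_F jac_def)
 finally show ?thesis using d by simp
qed

text \<open>An orbit product instead of a determinant of \<open>F ^^ n\<close>: it can be cut at any
  time by \<open>jac_iter_add\<close>, and \<open>det3_cderiv_iter\<close> recovers the geometric
  meaning.\<close>

definition jac_iter :: "nat => complex^3 => complex" where
 "jac_iter n x = (\<Prod>j<n. jac ((F ^^ j) x))"

lemma jac_iter_add: "jac_iter (m + n) x = jac_iter m x * jac_iter n ((F ^^ m) x)"
proof -
 have "jac_iter (m + n) x = (\<Prod>j<m. jac ((F ^^ j) x)) * (\<Prod>j<n. jac ((F ^^ (m + j)) x))"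
  unfolding jac_iter_def by (induction n) (simp_all add: mult.assoc)
 moreover have "(F ^^ (m + j)) x = (F ^^ j) ((F ^^ m) x)" for j
  by (simp add: funpow_add add.commute[of m])
 ultimately show ?thesis by (simp add: jac_iter_def)
qed

lemma det3_cderiv_iter:
 "det3 ((F ^^ n) y) (cderiv (F ^^ n) y a) (cderiv (F ^^ n) y b) = jac_iter n y * det3 y a b"
proof (induction n)
 case 0
 have e: "(\<lambda>x. x) = frechet_derivative (\<lambda>x :: complex^3. x) (at y)"
  by (rule frechet_derivative_at) (rule has_derivative_ident)
 have "cderiv (\<lambda>a. a) y v = v" for v unfolding cderiv_def e[symmetric] by (rule refl)
 then show ?case by (simp add: jac_iter_def id_def)
next
 case (Suc n)
 then show ?case using cderiv_comp[OF polymap_F polymap_iter, of n y]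
  by (simp add: det3_cderiv jac_iter_def o_def mult_ac)
qed

lemma cderiv_iter_euler: "cderiv (F ^^ n) y y = of_nat (d ^ n) *s (F ^^ n) y"
proof -
 have "vderiv (\<lambda>z. (F ^^ n) (z *s y)) 1 = cderiv (F ^^ n) (1 *s y) (vderiv (\<lambda>z. z *s y) 1)"
  by (rule vderiv_polymap[OF polymap_iter hol_vec_id_scale open_UNIV]) simp
 also have "vderiv (\<lambda>z. z *s y) 1 = y" by (simp add: vec_eq_iff)
 finally have "cderiv (F ^^ n) y y = vderiv (\<lambda>z. z ^ (d ^ n) *s (F ^^ n) y) 1" by (simp add: iter_smult)
 also have "\<dots> = of_nat (d ^ n) *s (F ^^ n) y"
  unfolding vec_eq_iff by (auto intro!: DERIV_imp_deriv derivative_eq_intros)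
 finally show ?thesis .
qed

section \<open>The Green function of the homogeneous lift\<close>

definition log_defect :: "complex^3 => real" where
 "log_defect x = ln (norm (F x)) - real d * ln (norm x)"

text \<open>The limit of \<open>ln (norm ((F ^^ n) x)) / real d ^ n\<close>, telescoped. The terms
  involve only \<open>log_defect\<close>, which is homogeneous of degree 0 and hence bounded, so the
  series converges uniformly off the origin.\<close>

definition green :: "complex^3 => real" where
 "green x = ln (norm x) + (\<Sum>n. log_defect ((F ^^ n) x) / real d ^ Suc n)"

lemma log_defect_smult: "c ~= 0 ==> x ~= 0 ==> log_defect (c *s x) = log_defect x"
 by (simp add: log_defect_def F_smult norm_smult norm_power ln_mult ln_realpow F_zero algebra_simps)

lemma continuous_on_log_defect: "continuous_on (- {0}) log_defect"
 unfolding log_defect_def[abs_def]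
 by (intro continuous_intros polymap_continuous polymap_F) (auto simp: F_zero)

lemma log_defect_bounded: "\<exists>B\<ge>0. \<forall>x. x ~= 0 --> \<bar>log_defect x\<bar> <= B"
proof -
 have "compact (log_defect ` sphere 0 1)"
  by (intro compact_continuous_image continuous_on_subset[OF continuous_on_log_defect]) auto
 then obtain B where B: "\<And>x. norm x = 1 ==> \<bar>log_defect x\<bar> <= B"
  using compact_imp_bounded by (force simp: bounded_iff)
 have "\<bar>log_defect x\<bar> <= max B 0" if "x ~= 0" for x
 proof -
  have "log_defect x = log_defect (of_real (inverse (norm x)) *s x)"
   using that by (subst log_defect_smult) auto
  moreover have "norm (of_real (inverse (norm x)) *s x) = 1"
   using that by (simp add: norm_smult norm_inverse)
  ultimately show ?thesis using B by (metis max.coboundedI1)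
 qed
 then show ?thesis by (intro exI[of _ "max B 0"]) auto
qed

definition green_bd :: real where
 "green_bd = (SOME B. B >= 0 \<and> (\<forall>x. x ~= 0 --> \<bar>log_defect x\<bar> <= B))"

lemma green_bd: "green_bd >= 0" "x ~= 0 ==> \<bar>log_defect x\<bar> <= green_bd"
 using someI_ex[OF log_defect_bounded] unfolding green_bd_def by blast+

lemma green_term_bound: "x ~= 0 ==> norm (log_defect ((F ^^ n) x) / real d ^ Suc n) <= green_bd * (1/2) ^ Suc n"
proof -
 assume "x ~= 0"
 then have "\<bar>log_defect ((F ^^ n) x)\<bar> <= green_bd" by (intro green_bd) (simp add: iter_zero)
 moreover have "(2::real) ^ Suc n <= real d ^ Suc n" using d by (intro power_mono) auto
 ultimately have "\<bar>log_defect ((F ^^ n) x)\<bar> / real d ^ Suc n <= green_bd / 2 ^ Suc n"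
  using green_bd(1) by (intro frac_le) auto
 then show ?thesis by (simp add: power_one_over)
qed

lemma summable_green_bd: "summable (\<lambda>n. green_bd * (1/2::real) ^ Suc n)"
 by (intro summable_mult) (simp add: summable_geometric)

lemma suminf_green_bd: "(\<Sum>n. green_bd * (1/2::real) ^ Suc n) = green_bd"
proof -
 have "(\<lambda>n. green_bd * (1/2::real) ^ Suc n) sums (green_bd * 1)"
  using power_half_series by (rule sums_mult)
 then show ?thesis by (simp add: sums_unique[symmetric])
qed

lemma summable_green: "x ~= 0 ==> summable (\<lambda>n. log_defect ((F ^^ n) x) / real d ^ Suc n)"
 by (rule summable_comparison_test'[OF summable_green_bd green_term_bound])

text \<open>Since \<open>d >= 2\<close>, the terms are dominated by
  \<open>green_bd / 2 ^ Suc n\<close>, and these bounds sum to exactly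
  \<open>green_bd\<close>.\<close>

lemma green_near_ln: "x ~= 0 ==> \<bar>green x - ln (norm x)\<bar> <= green_bd"
proof -
 assume x: "x ~= 0"
 have s: "summable (\<lambda>n. norm (log_defect ((F ^^ n) x) / real d ^ Suc n))"
  by (rule summable_norm_comparison_test[OF _ summable_green_bd]) (intro exI allI impI green_term_bound[OF x])
 have "norm (\<Sum>n. log_defect ((F ^^ n) x) / real d ^ Suc n) <= (\<Sum>n. norm (log_defect ((F ^^ n) x) / real d ^ Suc n))"
  using s by (rule summable_norm)
 also have "\<dots> <= green_bd"
  using suminf_le[OF green_term_bound[OF x] s summable_green_bd] suminf_green_bd by simp
 finally show ?thesis by (simp add: green_def)
qed

lemma green_F: "x ~= 0 ==> green (F x) = real d * green x"
proof -
 assume x: "x ~= 0"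
 let ?a = "\<lambda>n. log_defect ((F ^^ n) x) / real d ^ Suc n"
 have "(\<Sum>n. ?a (Suc n)) = (\<Sum>n. ?a n) - ?a 0"
  using suminf_split_head[OF summable_green[OF x]] .
 moreover have "real d * ?a (Suc n) = log_defect ((F ^^ n) (F x)) / real d ^ Suc n" for n
  using d by (simp add: funpow_swap1)
 moreover have "summable (\<lambda>n. ?a (Suc n))"
  using summable_ignore_initial_segment[OF summable_green[OF x], of 1] unfolding Suc_eq_plus1 .
 ultimately have "(\<Sum>n. log_defect ((F ^^ n) (F x)) / real d ^ Suc n) = real d * ((\<Sum>n. ?a n) - ?a 0)"
  using suminf_mult[of "\<lambda>n. ?a (Suc n)" "real d"] by simp
 also have "\<dots> = real d * (\<Sum>n. ?a n) - log_defect x" using d by (simp add: algebra_simps)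
 finally show ?thesis by (simp add: green_def log_defect_def algebra_simps)
qed

lemma green_iter: "x ~= 0 ==> green ((F ^^ n) x) = real d ^ n * green x"
 by (induction n) (simp_all add: green_F iter_zero)

lemma green_smult: "c ~= 0 ==> x ~= 0 ==> green (c *s x) = green x + ln (cmod c)"
 by (simp add: green_def iter_smult log_defect_smult iter_zero norm_smult ln_mult)

lemma continuous_on_green: "continuous_on (- {0}) green"
proof -
 have "uniform_limit (- {0}) (\<lambda>n x. \<Sum>i<n. log_defect ((F ^^ i) x) / real d ^ Suc i)
   (\<lambda>x. \<Sum>i. log_defect ((F ^^ i) x) / real d ^ Suc i) sequentially"
  by (rule Weierstrass_m_test[OF green_term_bound summable_green_bd]) simp
 moreover have "continuous_on (- {0}) (\<lambda>x. log_defect ((F ^^ i) x))" for i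
  by (rule continuous_on_compose2[OF continuous_on_log_defect polymap_continuous[OF polymap_iter]])
   (auto simp: iter_zero)
 then have "\<forall>\<^sub>F n in sequentially. continuous_on (- {0}) (\<lambda>x. \<Sum>i<n. log_defect ((F ^^ i) x) / real d ^ Suc i)"
  using d by (intro always_eventually allI continuous_intros) auto
 ultimately have "continuous_on (- {0}) (\<lambda>x. \<Sum>i. log_defect ((F ^^ i) x) / real d ^ Suc i)"
  by (intro uniform_limit_theorem[OF _ _ trivial_limit_sequentially])
 then show ?thesis
  unfolding green_def[abs_def] by (intro continuous_intros) auto
qed

text \<open>The error does not grow with \<open>n\<close>. In particular an orbit starting on the
  zero level of \<open>green\<close> stays in one shell around the origin forever.\<close>

lemma ln_norm_iter: "x ~= 0 ==> \<bar>ln (norm ((F ^^ n) x)) - real d ^ n * green x\<bar> <= green_bd"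
 using green_near_ln[of "(F ^^ n) x"] by (simp add: green_iter iter_zero abs_minus_commute)

end

section \<open>The Fatou set and the Green function\<close>

context lifted_map
begin

text \<open>By \<open>norm_iter_bounds\<close> all iterates of such a lift have norms between
  \<open>1 / nbd\<close> and \<open>nbd\<close>. Montel's theorem then applies to them, and limits
  do not vanish, wherever the projected discs go.\<close>

definition nlift :: "(complex => complex^3) => complex set => bool" where
 "nlift L A \<longleftrightarrow> hol_vec L A \<and> (\<forall>z\<in>A. L z ~= 0 \<and> green (L z) = 0)"

text \<open>Harmonicity of \<open>green\<close> along discs, phrased through a holomorphic function
  of modulus \<open>exp (green (L z))\<close>: dividing \<open>L\<close> by that function normalizes
  the lift.\<close>

definition green_harmonic_on :: "cp2 set => bool" where
 "green_harmonic_on U \<longleftrightarrow> (\<forall>L a r. r > 0 \<and> hol_vec L (ball a r) \<and> (\<forall>z\<in>ball a r. L z ~= 0 \<and> proj (L z) \<in> U) -->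
   (\<exists>q. q holomorphic_on ball a r \<and> (\<forall>z\<in>ball a r. cmod (q z) = exp (green (L z)))))"

definition nbd :: real where "nbd = exp green_bd"

lemma nbd_ge_1: "nbd >= 1"
 using green_bd(1) by (simp add: nbd_def)

lemma norm_iter_bounds:
 assumes "x ~= 0" "green x = 0"
 shows "norm ((F ^^ n) x) <= nbd" "norm ((F ^^ n) x) >= 1 / nbd"
proof -
 have "\<bar>ln (norm ((F ^^ n) x))\<bar> <= green_bd" "norm ((F ^^ n) x) > 0"
  using ln_norm_iter[OF assms(1), of n] assms by (auto simp: iter_zero)
 then have "exp (ln (norm ((F ^^ n) x))) <= exp green_bd" "exp (ln (norm ((F ^^ n) x))) >= exp (- green_bd)"
  unfolding exp_le_cancel_iff by auto
 then have "norm ((F ^^ n) x) <= exp green_bd" "norm ((F ^^ n) x) >= exp (- green_bd)"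
  using \<open>norm ((F ^^ n) x) > 0\<close> by (simp_all only: exp_ln)
 then show "norm ((F ^^ n) x) <= nbd" "norm ((F ^^ n) x) >= 1 / nbd"
  by (simp_all add: nbd_def exp_minus divide_inverse)
qed

lemma nlift_iter: "nlift L A ==> nlift (\<lambda>z. (F ^^ n) (L z)) A"
 unfolding nlift_def using hol_vec_polymap[OF polymap_iter] by (simp add: green_iter iter_zero)

lemma nlift_subset: "nlift L A ==> B \<subseteq> A ==> nlift L B"
 unfolding nlift_def using hol_vec_subset by blast

lemma nlift_normalize:
 assumes "hol_vec L A" "\<And>z. z \<in> A ==> L z ~= 0" "q holomorphic_on A"
  "\<And>z. z \<in> A ==> cmod (q z) = exp (green (L z))"
 shows "nlift (\<lambda>z. inverse (q z) *s L z) A" "z \<in> A ==> proj (inverse (q z) *s L z) = proj (L z)"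
proof -
 have q: "q z ~= 0" if "z \<in> A" for z using assms(4)[OF that] by auto
 have g: "green (inverse (q z) *s L z) = 0" if "z \<in> A" for z
  using that q[OF that] assms(2,4) by (subst green_smult) (auto simp: norm_inverse ln_inverse)
 have "hol_vec (\<lambda>z. inverse (q z) *s L z) A"
  using assms(1,3) q by (intro hol_vec_scale holomorphic_on_inverse) auto
 then show "nlift (\<lambda>z. inverse (q z) *s L z) A"
  using assms(2) q g by (simp add: nlift_def)
 show "z \<in> A ==> proj (inverse (q z) *s L z) = proj (L z)"
  using assms(2) q by (intro proj_smult) auto
qed

text \<open>The functions \<open>herm (F^n \<circ> L) b\<close> have no zeros on the disc, so their roots of order \<open>d^n\<close>
 exist; their moduli converge to \<open>exp (green \<circ> L)\<close>.\<close>

lemma green_root: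
 assumes r: "r > 0" and L: "hol_vec L (ball a r)" "\<And>z. z \<in> ball a r ==> L z ~= 0"
  and m: "filterlim m at_top sequentially"
  and b: "\<And>k. b k ~= 0" "\<And>k z. z \<in> ball a r ==>
   cmod (herm ((F ^^ m k) (L z)) (b k)) >= norm ((F ^^ m k) (L z)) * norm (b k) / 2"
 shows "\<exists>q. q holomorphic_on ball a r \<and> (\<forall>z\<in>ball a r. cmod (q z) = exp (green (L z)))"
proof -
 define h where "h = (\<lambda>k z. herm ((F ^^ m k) (L z)) (b k) / of_real (norm (b k)))"
 \<comment> \<open>\<open>ln 2\<close> pays for the factor \<open>1 / 2\<close> in the lower bound
   on the pairing. The error \<open>D\<close> disappears after division by
   \<open>d ^ m k\<close>.\<close>
 define D where "D = green_bd + ln 2"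
 have D: "D >= 0" using green_bd(1) by (simp add: D_def)
 have hb: "h k z ~= 0" "\<bar>ln (cmod (h k z)) - real d ^ m k * green (L z)\<bar> <= D" if z: "z \<in> ball a r" for k z
 proof -
  let ?y = "(F ^^ m k) (L z)"
  have y: "norm ?y > 0" using L(2)[OF z] by (simp add: iter_zero)
  have bk: "norm (b k) > 0" using b(1) by simp
  have eq: "cmod (h k z) = cmod (herm ?y (b k)) / norm (b k)" by (simp add: h_def norm_divide)
  have lo: "cmod (h k z) >= norm ?y / 2" using b(2)[OF z, of k] bk by (simp add: eq field_simps)
  have hi: "cmod (h k z) <= norm ?y" using norm_herm_le[of ?y "b k"] bk by (simp add: eq field_simps)
  show "h k z ~= 0" using lo y by auto
  then have "ln (cmod (h k z)) <= ln (norm ?y)" "ln (norm ?y / 2) <= ln (cmod (h k z))"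
   using lo hi y by (auto simp del: ln_div)
  moreover have "ln (norm ?y / 2) = ln (norm ?y) - ln 2" using y by (simp add: ln_div)
  moreover have "\<bar>ln (norm ?y) - real d ^ m k * green (L z)\<bar> <= green_bd" by (rule ln_norm_iter[OF L(2)[OF z]])
  moreover have "ln 2 >= (0::real)" by simp
  ultimately show "\<bar>ln (cmod (h k z)) - real d ^ m k * green (L z)\<bar> <= D" unfolding D_def by linarith
 qed
 have hh: "h k holomorphic_on ball a r" for k
  unfolding h_def using holomorphic_herm[OF hol_vec_polymap[OF polymap_iter L(1)]]
  by (intro holomorphic_intros) (use b(1) in auto)
 have "\<exists>g. g holomorphic_on ball a r \<and> (\<forall>z\<in>ball a r. exp (g z) = h k z)" for k
 proof -
  obtain g where "g holomorphic_on ball a r" "\<And>z. z \<in> ball a r ==> h k z = exp (g z)"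
   by (rule contractible_imp_holomorphic_log[OF hh[of k] convex_imp_contractible[OF convex_ball] hb(1)[of _ k]]) auto
  then show ?thesis by auto
 qed
 then have "\<forall>k. \<exists>g. g holomorphic_on ball a r \<and> (\<forall>z\<in>ball a r. exp (g z) = h k z)" by simp
 from choice[OF this] obtain g where "\<forall>k. g k holomorphic_on ball a r \<and> (\<forall>z\<in>ball a r. exp (g k z) = h k z)"
  by (rule exE)
 then have g: "\<And>k. g k holomorphic_on ball a r" "\<And>k z. z \<in> ball a r ==> exp (g k z) = h k z" by auto
 define Q where "Q = (\<lambda>k z. exp (g k z / of_nat (d ^ m k)))"
 have dm: "real d ^ m k >= 1" for k using d by simp
 have Qn: "\<bar>ln (cmod (Q k z)) - green (L z)\<bar> <= D / real d ^ m k" if z: "z \<in> ball a r" for k z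
 proof -
  have "cmod (h k z) = exp (Re (g k z))" using g(2)[OF z, of k] by (metis norm_exp_eq_Re)
  then have "ln (cmod (h k z)) = Re (g k z)" by simp
  moreover have "ln (cmod (Q k z)) = Re (g k z) / real d ^ m k"
   by (simp add: Q_def Re_divide_of_nat flip: of_nat_power)
  moreover have "real d ^ m k ~= 0" using d by simp
  ultimately have "ln (cmod (Q k z)) - green (L z) = (ln (cmod (h k z)) - real d ^ m k * green (L z)) / real d ^ m k"
   by (simp add: diff_divide_distrib)
  then have "\<bar>ln (cmod (Q k z)) - green (L z)\<bar> = \<bar>ln (cmod (h k z)) - real d ^ m k * green (L z)\<bar> / real d ^ m k"
   using dm[of k] by simp
  then show ?thesis using hb(2)[OF z, of k] dm[of k] by (simp add: divide_right_mono)
 qed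
 have Q0: "Q k z ~= 0" for k z by (simp add: Q_def)
 have cont: "continuous_on (ball a r) (\<lambda>z. green (L z))"
  by (rule continuous_on_compose2[OF continuous_on_green hol_vec_continuous[OF L(1)]]) (use L(2) in auto)
 have 1: "h' holomorphic_on ball a r" if "h' \<in> range Q" for h'
 proof -
  from that obtain k where "h' = (\<lambda>z. exp (g k z / of_nat (d ^ m k)))" unfolding Q_def by blast
  then show ?thesis using d by (simp add: holomorphic_on_exp' holomorphic_on_divide g(1))
 qed
 have 2: "\<exists>B. \<forall>h\<in>range Q. \<forall>z\<in>K. cmod (h z) <= B" if K: "compact K" "K \<subseteq> ball a r" for K
 proof -
  have "compact ((\<lambda>z. green (L z)) ` K)"
   using K cont by (intro compact_continuous_image continuous_on_subset[OF cont]) auto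
  then obtain M where M: "\<And>z. z \<in> K ==> \<bar>green (L z)\<bar> <= M"
   using compact_imp_bounded by (force simp: bounded_iff)
  have "cmod (Q k z) <= exp (M + D)" if "z \<in> K" for k z
  proof -
   have "D / real d ^ m k <= D" using mult_left_mono[OF dm[of k] D] d by (simp add: divide_le_eq)
   moreover have "z \<in> ball a r" using that K(2) by blast
   ultimately have "ln (cmod (Q k z)) <= M + D" using Qn[of z k] M[OF that] by linarith
   then have "exp (ln (cmod (Q k z))) <= exp (M + D)" by simp
   then show ?thesis using Q0[of k z] by simp
  qed
  then show ?thesis by auto
 qed
 obtain q s where q: "q holomorphic_on ball a r" "strict_mono (s :: nat => nat)"
  "\<And>z. z \<in> ball a r ==> (\<lambda>n. Q (s n) z) \<longlonglongrightarrow> q z"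
 proof (rule Montel[OF open_ball 1 2 subset_refl])
  fix q s assume a: "q holomorphic_on ball a r" "strict_mono (s :: nat => nat)"
   "\<And>z. z \<in> ball a r ==> (\<lambda>n. Q (s n) z) \<longlonglongrightarrow> q z"
  show thesis by (rule that[OF a])
 qed assumption+
 have "cmod (q z) = exp (green (L z))" if z: "z \<in> ball a r" for z
 proof -
  have "filterlim (\<lambda>n. m (s n)) at_top sequentially"
   using m filterlim_subseq[OF q(2)] by (rule filterlim_compose)
  then have "filterlim (\<lambda>n. real d ^ m (s n)) at_infinity sequentially"
   by (rule filterlim_compose[OF filterlim_realpow_sequentially_gt1, rotated]) (use d in simp)
  then have "(\<lambda>n. D / real d ^ m (s n)) \<longlonglongrightarrow> 0"
   by (rule tendsto_divide_0[OF tendsto_const])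
  moreover have "\<forall>\<^sub>F n in sequentially. norm (ln (cmod (Q (s n) z)) - green (L z)) <= D / real d ^ m (s n)"
   by (intro always_eventually allI) (use Qn[OF z] in simp)
  ultimately have "(\<lambda>n. ln (cmod (Q (s n) z)) - green (L z)) \<longlonglongrightarrow> 0"
   by (rule Lim_null_comparison[rotated])
  then have "(\<lambda>n. ln (cmod (Q (s n) z))) \<longlonglongrightarrow> green (L z)" by (rule LIM_zero_cancel)
  then have "(\<lambda>n. exp (ln (cmod (Q (s n) z)))) \<longlonglongrightarrow> exp (green (L z))" by (rule tendsto_exp)
  then have "(\<lambda>n. cmod (Q (s n) z)) \<longlonglongrightarrow> exp (green (L z))" using Q0 by simp
  moreover have "(\<lambda>n. cmod (Q (s n) z)) \<longlonglongrightarrow> cmod (q z)" using q(3)[OF z] by (rule tendsto_norm)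
  ultimately show ?thesis by (rule LIMSEQ_unique[rotated])
 qed
 then show ?thesis using q(1) by blast
qed

lemma nlift_norm_lipschitz:
 assumes "nlift L (ball a r)" "r > 0" "x \<in> cball a (r/2)" "y \<in> cball a (r/2)"
 shows "norm ((F ^^ n) (L x) - (F ^^ n) (L y)) <= 6 * nbd / r * cmod (x - y)"
proof -
 have "norm ((F ^^ n) (L x) - (F ^^ n) (L y)) <= real CARD(3) * (2 * nbd / r) * cmod (x - y)"
  by (rule hol_vec_lipschitz[where a = a])
   (use assms nlift_iter[OF assms(1), of n] norm_iter_bounds(1) in \<open>auto simp: nlift_def\<close>)
 then show ?thesis by simp
qed

text \<open>Uniform in \<open>n\<close>: Cauchy's estimate for iterates bounded by
  \<open>nbd\<close> gives \<open>6 * nbd / r\<close>, and projecting vectors of norm at least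
  \<open>1 / nbd\<close> costs another \<open>2 * nbd\<close>.\<close>

lemma nlift_dist:
 assumes "nlift L (ball a r)" "r > 0" "x \<in> cball a (r/2)" "y \<in> cball a (r/2)"
 shows "dist ((f ^^ n) (proj (L x))) ((f ^^ n) (proj (L y))) <= 12 * nbd\<^sup>2 / r * cmod (x - y)"
proof -
 have xy: "x \<in> ball a r" "y \<in> ball a r" using assms by auto
 then have nz: "L x ~= 0" "L y ~= 0" "green (L x) = 0" using assms(1) by (auto simp: nlift_def)
 let ?X = "(F ^^ n) (L x)" and ?Y = "(F ^^ n) (L y)"
 have "dist ((f ^^ n) (proj (L x))) ((f ^^ n) (proj (L y))) = dist (proj ?X) (proj ?Y)"
  using nz by (simp add: f_iter_proj)
 also have "\<dots> <= 2 * norm (?X - ?Y) / norm ?X"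
  using nz by (intro dist_proj_le) (auto simp: iter_zero)
 also have "\<dots> <= 2 * norm (?X - ?Y) / (1 / nbd)"
  using norm_iter_bounds(2)[OF nz(1,3), of n] nbd_ge_1 nz by (intro divide_left_mono) (auto simp: iter_zero)
 also have "\<dots> = 2 * nbd * norm (?X - ?Y)" using nbd_ge_1 by simp
 also have "\<dots> <= 2 * nbd * (6 * nbd / r * cmod (x - y))"
  using nlift_norm_lipschitz[OF assms, of n] nbd_ge_1 by (intro mult_left_mono) auto
 finally show ?thesis by (simp add: power2_eq_square)
qed

section \<open>Fatou set, harmonicity of the Green function and equicontinuity\<close>

lemma isCont_f: "isCont f p"
 unfolding continuous_at_eps_delta
proof (intro allI impI)
 fix e :: real assume e: "e > 0"
 obtain x where x: "norm x = 1" "p = proj x" by (rule unit_lift)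
 then have x0: "x ~= 0" by auto
 have "continuous_on UNIV F" by (rule polymap_continuous[OF polymap_F])
 then have "isCont F x" by (simp add: continuous_on_eq_continuous_at)
 moreover have "e * norm (F x) / 2 > 0" using e x0 by (simp add: F_zero)
 ultimately obtain a where a: "a > 0" "\<And>y. dist y x < a ==> dist (F y) (F x) < e * norm (F x) / 2"
  unfolding continuous_at_eps_delta by metis
 show "\<exists>a>0. \<forall>q. dist q p < a --> dist (f q) (f p) < e"
 proof (intro exI[of _ a] conjI allI impI)
  fix q assume q: "dist q p < a"
  obtain y where y: "norm y = 1" "q = proj y" "norm (x - y) <= dist (proj x) q"
   by (rule aligned_lift[OF x(1)])
  then have y0: "y ~= 0" by auto
  have "norm (F x - F y) < e * norm (F x) / 2"
   using a(2)[of y] y(3) q x(2) by (simp add: dist_norm norm_minus_commute dist_commute)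
  then have "2 * norm (F x - F y) / norm (F x) < e" using x0 by (simp add: F_zero field_simps)
  then have "dist (proj (F x)) (proj (F y)) < e"
   using dist_proj_le[of "F x" "F y"] x0 y0 by (simp add: F_zero)
  then show "dist (f q) (f p) < e" using x y x0 y0 by (simp add: f_proj dist_commute)
 qed (rule a(1))
qed

lemma continuous_on_f_iter: "continuous_on A (f ^^ n)"
proof (rule continuous_at_imp_continuous_on, rule ballI)
 show "isCont (f ^^ n) p" for p
  by (induction n) (auto intro: continuous_at_compose[of _ _ f, unfolded o_def] isCont_f simp: o_def)
qed

text \<open>A subsequence of the iterates converges near \<open>p\<close> to a continuous limit.
  Close to \<open>p\<close> these iterates stay within distance 1 of the single point
  \<open>g p\<close>, so pairing with a lift \<open>b\<close> of it has no zeros and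
  \<open>green_root\<close> applies.\<close>

lemma fatou_green_harmonic:
 assumes "p \<in> fatou_set f"
 shows "\<exists>h>0. green_harmonic_on (ball p h)"
proof -
 obtain U where U: "open U" "p \<in> U" "iterates_normal_on f U" using assms by (auto simp: fatou_set_def)
 obtain r g where r: "strict_mono (r :: nat => nat)"
  and lim: "\<And>K. compact K ==> K \<subseteq> U ==> uniform_limit K (\<lambda>k. f ^^ r k) g sequentially"
  using U(3)[unfolded iterates_normal_on_def, rule_format, of id] by auto
 obtain e where e: "e > 0" "cball p e \<subseteq> U" using U open_contains_cball by blast
 have ul: "uniform_limit (cball p e) (\<lambda>k. f ^^ r k) g sequentially"
  using e(2) by (intro lim closed_imp_compact_cp2) auto
 have "\<forall>\<^sub>F n in sequentially. continuous_on (cball p e) (f ^^ r n)"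
  by (intro always_eventually allI continuous_on_f_iter)
 then have cont: "continuous_on (cball p e) g"
  using ul by (rule uniform_limit_theorem) simp
 have "\<exists>c>0. \<forall>x'\<in>cball p e. dist x' p < c --> dist (g x') (g p) < 1/2"
  using cont[unfolded continuous_on_iff, rule_format, of p "1/2"] e(1) by simp
 then obtain c where c: "c > 0" "\<And>x. x \<in> cball p e ==> dist x p < c ==> dist (g x) (g p) < 1/2"
  by blast
 have "\<forall>\<^sub>F n in sequentially. \<forall>x\<in>cball p e. dist ((f ^^ r n) x) (g x) < 1/2"
  by (rule uniform_limitD[OF ul]) simp
 then obtain N where N: "\<And>n x. n >= N ==> x \<in> cball p e ==> dist ((f ^^ r n) x) (g x) < 1/2"
  unfolding eventually_sequentially by blast
 obtain b where b: "norm b = 1" "g p = proj b" by (rule unit_lift)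
 have b0: "b ~= 0" using b by auto
 show ?thesis
 proof (intro exI[of _ "min e c"] conjI)
  show "min e c > 0" using e c by simp
  show "green_harmonic_on (ball p (min e c))"
   unfolding green_harmonic_on_def
  proof (intro allI impI, elim conjE)
   fix L a s assume s: "(s::real) > 0" and L: "hol_vec L (ball a s)"
    and Lp: "\<forall>z\<in>ball a s. L z ~= 0 \<and> proj (L z) \<in> ball p (min e c)"
   show "\<exists>q. q holomorphic_on ball a s \<and> (\<forall>z\<in>ball a s. cmod (q z) = exp (green (L z)))"
   proof (rule green_root[OF s L _ _ b0])
    show "L z ~= 0" if "z \<in> ball a s" for z using Lp that by auto
    show "filterlim (\<lambda>k. r (k + N)) at_top sequentially"
     using filterlim_subseq[OF r] filterlim_add_const_nat_at_top by (rule filterlim_compose)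
    fix k z assume z: "z \<in> ball a s"
    let ?x = "proj (L z)" and ?y = "(F ^^ r (k + N)) (L z)"
    have x: "?x \<in> cball p e" "dist ?x p < c" "L z ~= 0" using bspec[OF Lp z] by (auto simp: dist_commute)
    have "dist ((f ^^ r (k + N)) ?x) (g p) <= 1"
     using N[of "k + N" ?x] c(2)[OF x(1,2)] x(1) dist_triangle[of "(f ^^ r (k + N)) ?x" "g p" "g ?x"] by simp
    then have "dist (proj ?y) (proj b) <= 1" using x(3) by (simp add: f_iter_proj b)
    then show "cmod (herm ?y b) >= norm ?y * norm b / 2"
     using b0 x(3) by (intro herm_ge_of_dist) (auto simp: iter_zero)
   qed
  qed
 qed
qed

lemma green_harmonic_nlift:
 assumes "green_harmonic_on U" "r > 0" "hol_vec L (ball a r)" "\<And>z. z \<in> ball a r ==> L z ~= 0"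
  "\<And>z. z \<in> ball a r ==> proj (L z) \<in> U"
 obtains q where "q holomorphic_on ball a r" "\<And>z. z \<in> ball a r ==> cmod (q z) = exp (green (L z))"
  "nlift (\<lambda>z. inverse (q z) *s L z) (ball a r)"
  "\<And>z. z \<in> ball a r ==> proj (inverse (q z) *s L z) = proj (L z)"
proof -
 obtain q where q: "q holomorphic_on ball a r" "\<And>z. z \<in> ball a r ==> cmod (q z) = exp (green (L z))"
  using assms unfolding green_harmonic_on_def by metis
 show ?thesis
  by (rule that[OF q nlift_normalize[OF assms(3,4) q]])
qed

lemma proj_ball_subset:
 assumes "norm x0 = 1" "e > 0"
 obtains r where "r > 0" "\<And>x. x \<in> ball x0 r ==> x ~= 0 \<and> proj x \<in> ball (proj x0) e"
proof (rule that[of "min 1 (e/2)"])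
 fix x assume x: "x \<in> ball x0 (min 1 (e/2))"
 then have "x ~= 0" using assms(1) by (auto simp: dist_norm)
 moreover have "x0 ~= 0" using assms(1) by auto
 ultimately have "dist (proj x0) (proj x) < e"
  using dist_proj_le[of x0 x] x assms(1) by (simp add: dist_norm)
 then show "x ~= 0 \<and> proj x \<in> ball (proj x0) e" using \<open>x ~= 0\<close> by simp
qed (use assms in auto)

text \<open>A quantitative form of normality: \<open>fatou_lipschitz\<close> and
  \<open>lipschitz_fatou\<close> show that the points with such a neighborhood are exactly those of
  the Fatou set.\<close>

definition equi_lipschitz_on :: "cp2 set => real => bool" where
 "equi_lipschitz_on U C \<longleftrightarrow> (\<forall>x\<in>U. \<forall>y\<in>U. \<forall>n. dist ((f ^^ n) x) ((f ^^ n) y) <= C * dist x y)"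

text \<open>The two points are joined by an affine disc with parameters 0 and 1. The closer they
  are, the larger the radius on which this disc can be normalized, and \<open>nlift_dist\<close> is
  inversely proportional to that radius.\<close>

lemma green_harmonic_lipschitz:
 assumes "green_harmonic_on (ball p a)" "a > 0"
 shows "\<exists>e>0. \<exists>C. equi_lipschitz_on (ball p e) C"
proof -
 obtain x0 where x0: "norm x0 = 1" "p = proj x0" by (rule unit_lift)
 obtain r where r: "r > 0" "\<And>x. x \<in> ball x0 r ==> x ~= 0 \<and> proj x \<in> ball (proj x0) a"
  by (rule proj_ball_subset[OF x0(1) assms(2)]) (rule that)
 have "equi_lipschitz_on (ball p (r/8)) (24 * nbd\<^sup>2 / r)"
   unfolding equi_lipschitz_on_def
  proof (intro ballI allI)
   fix q1 q2 n assume q: "q1 \<in> ball p (r/8)" "q2 \<in> ball p (r/8)"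
   obtain x1 where x1: "norm x1 = 1" "q1 = proj x1" "norm (x0 - x1) <= dist (proj x0) q1"
    by (rule aligned_lift[OF x0(1)])
   obtain x2 where x2: "norm x2 = 1" "q2 = proj x2" "norm (x1 - x2) <= dist (proj x1) q2"
    by (rule aligned_lift[OF x1(1)])
   show "dist ((f ^^ n) q1) ((f ^^ n) q2) <= 24 * nbd\<^sup>2 / r * dist q1 q2"
   proof (cases "x1 = x2")
    case True
    then show ?thesis using x1 x2 r(1) by simp
   next
    case False
    \<comment> \<open>Here \<open>z *s (x2 - x1)\<close> has norm at most \<open>r / 2\<close> for
      \<open>z\<close> in the ball of radius \<open>R\<close>, so the disc stays in
      \<open>ball x0 r\<close>. The later bound \<open>R >= 2\<close> puts 0 and 1 in its half
      disc.\<close>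
    define R where "R = r / (2 * norm (x2 - x1))"
    define L where "L = (\<lambda>z. x1 + z *s (x2 - x1))"
    have n0: "norm (x2 - x1) > 0" using False by simp
    have R: "R > 0" using r(1) n0 by (simp add: R_def)
    have d12: "norm (x2 - x1) <= dist q1 q2" using x2(3) x1(2) by (simp add: norm_minus_commute)
    have "dist q1 q2 < r / 4" using q dist_triangle[of q1 q2 p] by (simp add: dist_commute)
    then have "R >= 2" using d12 n0 r(1) by (simp add: R_def field_simps)
    have Lb: "L z \<in> ball x0 r" if "z \<in> ball 0 R" for z
    proof -
     have "cmod z * norm (x2 - x1) <= r / 2"
      using that n0 by (simp add: R_def field_simps less_imp_le)
     then have "norm (z *s (x2 - x1)) <= r / 2" by (simp only: norm_smult)
     moreover have "norm (x0 - L z) <= norm (x0 - x1) + norm (z *s (x2 - x1))"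
      unfolding L_def by (metis add_diff_eq diff_diff_add norm_triangle_ineq4)
     moreover have "norm (x0 - x1) < r / 8" using x1(3) q(1) x0(2) by simp
     ultimately have "norm (x0 - L z) < r" using r(1) by linarith
     then show ?thesis by (simp add: dist_norm)
    qed
    have hL: "hol_vec L (ball 0 R)" unfolding L_def by (intro hol_vec_add hol_vec_const hol_vec_id_scale)
    have Lz: "L z ~= 0" "proj (L z) \<in> ball p a" if "z \<in> ball 0 R" for z
     using r(2)[OF Lb[OF that]] x0(2) by auto
    obtain u where u: "nlift (\<lambda>z. inverse (u z) *s L z) (ball 0 R)"
     "\<And>z. z \<in> ball 0 R ==> proj (inverse (u z) *s L z) = proj (L z)"
     by (rule green_harmonic_nlift[OF assms(1) R hL Lz]) (assumption, assumption, rule that)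
    have "proj (L 0) = q1" "proj (L 1) = q2" by (simp_all add: L_def x1 x2)
    then have "dist ((f ^^ n) q1) ((f ^^ n) q2) <= 12 * nbd\<^sup>2 / R * cmod (0 - 1)"
     using nlift_dist[OF u(1) R, of 0 1 n] u(2)[of 0] u(2)[of 1] \<open>R >= 2\<close> by simp
    also have "\<dots> = 24 * nbd\<^sup>2 / r * norm (x2 - x1)" by (simp add: R_def)
    also have "\<dots> <= 24 * nbd\<^sup>2 / r * dist q1 q2" using d12 r(1) by (intro mult_left_mono) auto
    finally show ?thesis .
   qed
  qed
 moreover have "r/8 > 0" using r(1) by simp
 ultimately show ?thesis by blast
qed

text \<open>Arzela-Ascoli, made applicable on both sides: the domain is replaced by a compact set
  \<open>S\<close> of unit lifts, and values are embedded isometrically as projection matrices by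
  \<open>emb\<close>. The range of \<open>emb\<close> is closed, so limits come from points of the
  plane.\<close>

lemma lipschitz_fatou:
 assumes "a > 0" "equi_lipschitz_on (ball p a) C"
 shows "p \<in> fatou_set f"
proof -
 define C' where "C' = max C 1"
 have Lip: "dist ((f ^^ n) x) ((f ^^ n) y) <= C' * dist x y" if "x \<in> ball p a" "y \<in> ball p a" for x y n
  using assms(2) that unfolding equi_lipschitz_on_def C'_def
  by (meson max.cobounded1 mult_right_mono order_trans zero_le_dist)
 define lft where "lft = (\<lambda>q. SOME x. norm x = 1 \<and> q = proj x)"
 have lft: "norm (lft q) = 1" "proj (lft q) = q" for q
  using someI_ex[of "\<lambda>x. norm x = 1 \<and> q = proj x"] unit_lift[of q] unfolding lft_def by metis+
 then have lft0: "lft q ~= 0" for q using norm_zero zero_neq_one by metis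
 define emb where "emb = (\<lambda>q. line_projection (lft q))"
 have emb: "dist (emb q) (emb q') = dist q q'" for q q'
  unfolding emb_def using dist_proj[OF lft0 lft0, of q q'] by (simp add: lft)
 have "compact (range emb)"
  by (intro compact_continuous_image compact_cp2) (auto simp: continuous_on_iff emb)
 then have clo: "closed (range emb)" by (rule compact_imp_closed)
 define S where "S = {x \<in> sphere 0 1. proj x \<in> cball p (a/2)}"
 have "closed (- {0} \<inter> sphere 0 1 \<inter> proj -` cball p (a/2))"
 proof -
  have "sphere (0::complex^3) 1 \<subseteq> - {0}" by auto
  then have "continuous_on (sphere (0::complex^3) 1) proj" using continuous_on_proj continuous_on_subset by blast
  then have "closed (sphere (0::complex^3) 1 \<inter> proj -` cball p (a/2))"
   by (intro continuous_closed_preimage) auto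
  moreover have "- {0} \<inter> sphere 0 1 \<inter> proj -` cball p (a/2) = sphere 0 1 \<inter> proj -` cball p (a/2)" by auto
  ultimately show ?thesis by simp
 qed
 moreover have "S = sphere 0 1 \<inter> (- {0} \<inter> sphere 0 1 \<inter> proj -` cball p (a/2))" by (auto simp: S_def)
 ultimately have S: "compact S" by (metis compact_Int_closed compact_sphere)
 have Sb: "proj x \<in> ball p a" "norm x = 1" "x ~= 0" if "x \<in> S" for x using that assms(1) by (auto simp: S_def)
 have "iterates_normal_on f (ball p (a/2))"
  unfolding iterates_normal_on_def
 proof
  fix v :: "nat => nat"
  define \<F> where "\<F> = (\<lambda>n x. emb ((f ^^ v n) (proj x)))"
  have bd: "norm (\<F> n x) <= norm (emb p) + 2" for n x
   using norm_triangle_sub[of "\<F> n x" "emb p"] emb[of "(f ^^ v n) (proj x)" p] dist_cp2_le_2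
   unfolding \<F>_def dist_norm by (metis add_left_mono dist_norm order_trans)
  have eq: "\<exists>e'>0. \<forall>n y. y \<in> S \<and> norm (x - y) < e' --> norm (\<F> n x - \<F> n y) < e"
   if "x \<in> S" "e > 0" for x e
  proof (intro exI[of _ "e / (2 * C')"] conjI allI impI)
   show "e / (2 * C') > 0" using that by (simp add: C'_def)
   fix n y assume y: "y \<in> S \<and> norm (x - y) < e / (2 * C')"
   have "norm (\<F> n x - \<F> n y) = dist ((f ^^ v n) (proj x)) ((f ^^ v n) (proj y))"
    by (simp add: \<F>_def emb flip: dist_norm)
   also have "\<dots> <= C' * dist (proj x) (proj y)" using Lip Sb(1) that y by auto
   also have "\<dots> <= C' * (2 * norm (x - y))"
    using dist_proj_le[of x y] Sb[of x] Sb[of y] that y by (intro mult_left_mono) (auto simp: C'_def)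
   also have "\<dots> < e" using y by (simp add: C'_def field_simps)
   finally show "norm (\<F> n x - \<F> n y) < e" .
  qed
  obtain g k where gk: "continuous_on S g" "strict_mono (k :: nat => nat)"
   "\<And>e. 0 < e ==> \<exists>N. \<forall>n x. n >= N \<and> x \<in> S --> norm (\<F> (k n) x - g x) < e"
   using Arzela_Ascoli[OF S bd eq] by metis
  define g' where "g' = (\<lambda>q. inv emb (g (lft q)))"
  have g': "emb (g' q) = g (lft q)" if "lft q \<in> S" for q
  proof -
   have "(\<lambda>n. \<F> (k n) (lft q)) \<longlonglongrightarrow> g (lft q)"
    using gk(3) that by (intro LIMSEQ_I) blast
   then have "g (lft q) \<in> range emb"
    using clo by (rule Lim_in_closed_set[rotated 3]) (auto simp: \<F>_def)
   then show ?thesis unfolding g'_def by (rule f_inv_into_f)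
  qed
  show "\<exists>r g. strict_mono r \<and> (\<forall>K. compact K \<and> K \<subseteq> ball p (a/2) -->
    uniform_limit K (\<lambda>k. f ^^ v (r k)) g sequentially)"
  proof (intro exI[of _ k] exI[of _ g'] conjI allI impI gk(2))
   fix K assume K: "compact K \<and> K \<subseteq> ball p (a/2)"
   show "uniform_limit K (\<lambda>n. f ^^ v (k n)) g' sequentially"
    unfolding uniform_limit_iff
   proof (intro allI impI)
    fix e :: real assume "e > 0"
    then obtain N where N: "\<And>n x. n >= N ==> x \<in> S ==> norm (\<F> (k n) x - g x) < e" using gk(3) by blast
    have "dist ((f ^^ v (k n)) q) (g' q) < e" if "n >= N" "q \<in> K" for n q
    proof -
     have q: "lft q \<in> S" using that K lft by (force simp: S_def)
     have "dist ((f ^^ v (k n)) q) (g' q) = norm (\<F> (k n) (lft q) - g (lft q))"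
      by (simp add: \<F>_def lft flip: emb g'[OF q] dist_norm)
     then show ?thesis using N[OF that(1) q] by simp
    qed
    then show "\<forall>\<^sub>F n in sequentially. \<forall>x\<in>K. dist ((f ^^ v (k n)) x) (g' x) < e"
     unfolding eventually_sequentially by blast
   qed
  qed
 qed
 then show ?thesis unfolding fatou_set_def using assms(1) by (auto intro!: exI[of _ "ball p (a/2)"])
qed

lemma fatou_lipschitz:
 assumes "p \<in> fatou_set f"
 obtains e C where "e > 0" "equi_lipschitz_on (ball p e) C"
 using fatou_green_harmonic[OF assms] green_harmonic_lipschitz by metis

text \<open>Closeness along one sequence of times suffices. It makes the pairing with
  \<open>(F ^^ m k) x0\<close> zero-free, hence \<open>green\<close> harmonic along discs, and this
  controls all iterates.\<close>

lemma fatou_of_close_orbits: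
 assumes "b > 0" "filterlim m at_top sequentially"
  and close: "\<And>q k. q \<in> ball p b ==> dist ((f ^^ m k) q) ((f ^^ m k) p) <= 1"
 shows "p \<in> fatou_set f"
proof -
 obtain x0 where x0: "norm x0 = 1" "p = proj x0" by (rule unit_lift)
 then have x00: "x0 ~= 0" by auto
 have "green_harmonic_on (ball p b)"
  unfolding green_harmonic_on_def
 proof (intro allI impI, elim conjE)
  fix L a s assume s: "(s::real) > 0" and L: "hol_vec L (ball a s)"
   and Lp: "\<forall>z\<in>ball a s. L z ~= 0 \<and> proj (L z) \<in> ball p b"
  show "\<exists>q. q holomorphic_on ball a s \<and> (\<forall>z\<in>ball a s. cmod (q z) = exp (green (L z)))"
  proof (rule green_root[OF s L _ assms(2), of "\<lambda>k. (F ^^ m k) x0"])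
   fix k z assume z: "z \<in> ball a s"
   then have "dist (proj ((F ^^ m k) (L z))) (proj ((F ^^ m k) x0)) <= 1"
    using close[of "proj (L z)" k] Lp x0(2) x00 by (simp add: f_iter_proj)
   then show "norm ((F ^^ m k) (L z)) * norm ((F ^^ m k) x0) / 2 <= cmod (herm ((F ^^ m k) (L z)) ((F ^^ m k) x0))"
    using Lp z x00 by (intro herm_ge_of_dist) (auto simp: iter_zero)
  qed (use Lp x00 in \<open>auto simp: iter_zero\<close>)
 qed
 then obtain e C where "e > 0" "equi_lipschitz_on (ball p e) C"
  using green_harmonic_lipschitz[OF _ assms(1)] by metis
 then show ?thesis by (rule lipschitz_fatou)
qed

end

section \<open>Charts of the projective plane\<close>

definition affine_dom :: "3 => cp2 set" where
 "affine_dom l = proj ` {z. z $ l ~= 0}"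

definition affine_chart :: "3 => 3 => 3 => cp2 => complex^2" where
 "affine_chart l i j p = vector [rep_cp2 p $ i / rep_cp2 p $ l, rep_cp2 p $ j / rep_cp2 p $ l]"

definition affine_lift :: "3 => 3 => 3 => complex^2 => complex^3" where
 "affine_lift l i j w = (\<chi> k. if k = l then 1 else if k = i then w $ 1 else w $ 2)"

definition distinct3 :: "3 => 3 => 3 => bool" where
 "distinct3 l i j \<longleftrightarrow> l ~= i \<and> l ~= j \<and> i ~= j"

lemma cp2_atlasD:
 assumes "(U, a) \<in> cp2_atlas"
 obtains l i j where "distinct3 l i j" "U = affine_dom l" "a = affine_chart l i j"
proof -
 have "affine_chart l i j = (\<lambda>p. let z = rep_cp2 p in vector [z $ i / z $ l, z $ j / z $ l])" for l i j
  by (simp add: affine_chart_def fun_eq_iff Let_def)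
 then have "(U, a) = (affine_dom 1, affine_chart 1 2 3) \<or> (U, a) = (affine_dom 2, affine_chart 2 1 3)
   \<or> (U, a) = (affine_dom 3, affine_chart 3 1 2)"
  using assms unfolding cp2_atlas_def affine_dom_def by simp
 then show ?thesis
 proof (elim disjE)
  assume "(U, a) = (affine_dom 1, affine_chart 1 2 3)"
  then show ?thesis by (intro that[of 1 2 3]) (auto simp: distinct3_def)
 next
  assume "(U, a) = (affine_dom 2, affine_chart 2 1 3)"
  then show ?thesis by (intro that[of 2 1 3]) (auto simp: distinct3_def)
 next
  assume "(U, a) = (affine_dom 3, affine_chart 3 1 2)"
  then show ?thesis by (intro that[of 3 1 2]) (auto simp: distinct3_def)
 qed
qed

lemma affine_dom_iff: "z ~= 0 ==> proj z \<in> affine_dom l \<longleftrightarrow> z $ l ~= 0"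
proof
 assume z: "z ~= 0" and "proj z \<in> affine_dom l"
 then obtain w where w: "w $ l ~= 0" "proj z = proj w" by (auto simp: affine_dom_def)
 then have "w ~= 0" by auto
 then obtain c where "c ~= 0" "w = c *s z" using w(2) z proj_eq_iff by blast
 then show "z $ l ~= 0" using w(1) by auto
qed (auto simp: affine_dom_def)

lemma open_affine_dom: "open (affine_dom l)"
proof -
 have "{z. z ~= 0 \<and> proj z \<in> affine_dom l} = {z. z $ l ~= 0}"
 proof (rule Collect_cong)
  show "z ~= 0 \<and> proj z \<in> affine_dom l \<longleftrightarrow> z $ l ~= 0" for z
   by (cases "z = 0") (simp_all add: affine_dom_iff)
 qed
 moreover have "open {z :: complex^3. z $ l ~= 0}" by (intro open_Collect_neq continuous_intros)
 ultimately show ?thesis by (simp add: open_cp2_iff)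
qed

lemma affine_chart_proj: "z $ l ~= 0 ==> affine_chart l i j (proj z) = vector [z $ i / z $ l, z $ j / z $ l]"
 by (simp add: affine_chart_def rep_cp2_ratio)

lemma affine_lift_nonzero: "affine_lift l i j w ~= 0" "affine_lift l i j w $ l = 1"
proof -
 show "affine_lift l i j w $ l = 1" by (simp add: affine_lift_def)
 then show "affine_lift l i j w ~= 0" by (metis zero_index zero_neq_one)
qed

lemma affine_lift_chart:
 assumes "distinct3 l i j" "z $ l ~= 0"
 shows "affine_lift l i j (affine_chart l i j (proj z)) = inverse (z $ l) *s z"
proof -
 have "k = l \<or> k = i \<or> k = j" for k
  using assms(1) exhaust_3[of k] exhaust_3[of l] exhaust_3[of i] exhaust_3[of j]
  by (auto simp: distinct3_def)
 then show ?thesis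
  using assms by (auto simp: vec_eq_iff affine_lift_def affine_chart_proj distinct3_def divide_inverse mult.commute)
qed

lemma proj_affine_lift_chart:
 assumes "distinct3 l i j" "p \<in> affine_dom l"
 shows "proj (affine_lift l i j (affine_chart l i j p)) = p"
proof -
 obtain z where z: "z $ l ~= 0" "p = proj z" using assms(2) by (auto simp: affine_dom_def)
 then have "z ~= 0" by auto
 then show ?thesis using z by (simp add: affine_lift_chart[OF assms(1)] proj_smult)
qed

lemma inj_on_affine_chart: "distinct3 l i j ==> inj_on (affine_chart l i j) (affine_dom l)"
 by (rule inj_on_inverseI[of _ "\<lambda>w. proj (affine_lift l i j w)"]) (rule proj_affine_lift_chart)

lemma inv_into_affine_chart:
 assumes "distinct3 l i j" "p \<in> affine_dom l \<inter> S"
 shows "inv_into (affine_dom l \<inter> S) (affine_chart l i j) (affine_chart l i j p) = p"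
 using inj_on_affine_chart[OF assms(1)] assms(2)
 by (intro inv_into_f_f) (auto intro: inj_on_subset)

lemma hol_vec_affine_chart:
 assumes "hol_vec L A" "\<And>z. z \<in> A ==> L z $ l ~= 0"
 shows "hol_vec (\<lambda>z. affine_chart l i j (proj (L z))) A"
 unfolding hol_vec_def
proof
 fix k :: 2
 have "(\<lambda>z. L z $ m / L z $ l) holomorphic_on A" for m
  using assms by (intro holomorphic_on_divide hol_vecD) auto
 moreover have "k = 1 \<or> k = 2" by (rule exhaust_2)
 ultimately have "(\<lambda>z. (vector [L z $ i / L z $ l, L z $ j / L z $ l] :: complex^2) $ k) holomorphic_on A"
  by (elim disjE) simp_all
 then show "(\<lambda>z. affine_chart l i j (proj (L z)) $ k) holomorphic_on A"
  by (rule holomorphic_transform) (simp add: affine_chart_proj assms(2))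
qed

lemma hol_vec_affine_lift:
 assumes "hol_vec w A"
 shows "hol_vec (\<lambda>z. affine_lift l i j (w z)) A"
 unfolding hol_vec_def affine_lift_def
proof
 fix k
 show "(\<lambda>z. (\<chi> k. if k = l then 1 else if k = i then w z $ 1 else w z $ 2) $ k) holomorphic_on A"
  by (cases "k = l"; cases "k = i") (simp_all add: hol_vecD[OF assms])
qed

lemma hol_vecI:
 fixes L :: "complex => complex^'n::finite"
 assumes "\<And>z. z \<in> A ==> \<exists>w. (L has_derivative (\<lambda>h. h *s w)) (at z)"
 shows "hol_vec L A"
 unfolding hol_vec_def holomorphic_on_def
proof (intro allI ballI)
 fix i z assume "z \<in> A"
 then obtain w where "(L has_derivative (\<lambda>h. h *s w)) (at z)" using assms by blast
 then have "((\<lambda>z. L z $ i) has_derivative (\<lambda>h. (h *s w) $ i)) (at z)"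
  by (rule bounded_linear.has_derivative[OF bounded_linear_vec_nth])
 then have "((\<lambda>z. L z $ i) has_field_derivative w $ i) (at z)"
  by (simp add: has_field_derivative_def mult_commute_abs)
 then show "(\<lambda>z. L z $ i) field_differentiable at z within A"
  by (meson field_differentiable_def field_differentiable_at_within)
qed

text \<open>Holomorphy by local nonvanishing lifts, the form in which the dynamics acts. The two
  lemmas relating it to \<open>holomorphic_map\<close> show that it agrees with holomorphy in charts
  on open sets.\<close>

definition hol_disc :: "complex set => (complex => cp2) => bool" where
 "hol_disc A g \<longleftrightarrow> (\<forall>\<zeta>\<in>A. \<exists>r>0. \<exists>L. ball \<zeta> r \<subseteq> A \<and> hol_vec L (ball \<zeta> r) \<and>
   (\<forall>z\<in>ball \<zeta> r. L z ~= 0 \<and> g z = proj (L z)))"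

lemma hol_disc_lift:
 assumes "open A" "hol_vec L A" "\<And>z. z \<in> A ==> L z ~= 0"
 shows "hol_disc A (\<lambda>z. proj (L z))"
 unfolding hol_disc_def
proof
 fix a assume "a \<in> A"
 then obtain s where s: "s > 0" "ball a s \<subseteq> A" using assms(1) open_contains_ball by blast
 then show "\<exists>r>0. \<exists>M. ball a r \<subseteq> A \<and> hol_vec M (ball a r) \<and> (\<forall>z\<in>ball a r. M z ~= 0 \<and> proj (L z) = proj (M z))"
  using assms hol_vec_subset[OF assms(2) s(2)] by (intro exI[of _ s] conjI exI[of _ L]) auto
qed

lemma hol_disc_continuous:
 assumes "hol_disc A g"
 shows "continuous_on A g"
proof (rule continuous_at_imp_continuous_on, rule ballI)
 fix a assume "a \<in> A"
 then obtain r L where L: "r > 0" "hol_vec L (ball a r)" "\<forall>z\<in>ball a r. L z ~= 0 \<and> g z = proj (L z)"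
  using assms unfolding hol_disc_def by blast
 have "continuous_on (ball a r) (\<lambda>z. proj (L z))"
  by (rule continuous_on_compose2[OF continuous_on_proj hol_vec_continuous[OF L(2)]]) (use L(3) in auto)
 then have "continuous_on (ball a r) g"
  by (rule continuous_on_eq) (use L(3) in auto)
 then show "isCont g a" using L(1) by (simp add: continuous_on_eq_continuous_at)
qed

lemma vec_1_smult: "vec (c::complex) = c *s (vec 1 :: complex^1)"
 by (simp add: vec_eq_iff)

lemma vec_nth_1: "vec ((w::complex^1) $ 1) = w"
 by (simp add: vec_eq_iff forall_1)

lemma bounded_linear_vec_1: "bounded_linear (vec :: complex => complex^1)"
 by (rule bounded_linear_intro[where K = 1]) (auto simp: vec_eq_iff norm_vec_def L2_set_def)

lemma inj_vec_1: "inj_on (vec :: complex => complex^1) A"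
 by (auto simp: inj_on_def vec_eq_iff)

lemma restrict_cp2_atlasD:
 assumes "(V, a) \<in> cp2_domain \<Omega>"
 obtains l i j where "distinct3 l i j" "V = affine_dom l \<inter> \<Omega>" "a = affine_chart l i j"
proof -
 obtain U where "(U, a) \<in> cp2_atlas" "V = U \<inter> \<Omega>" using assms by (auto simp: restrict_atlas_def)
 then show ?thesis using cp2_atlasD[of U a] that by metis
qed

lemma cp2_domain_chart_at:
 assumes "p \<in> \<Omega>"
 obtains l i j where "distinct3 l i j" "p \<in> affine_dom l" "(affine_dom l \<inter> \<Omega>, affine_chart l i j) \<in> cp2_domain \<Omega>"
proof -
 have "p \<in> carrier_of (cp2_domain \<Omega>)" using assms by (simp add: carrier_cp2_domain)
 then obtain V a where V: "(V, a) \<in> cp2_domain \<Omega>" "p \<in> V" unfolding carrier_of_def by auto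
 show ?thesis
  by (rule restrict_cp2_atlasD[OF V(1)]) (use V that in auto)
qed

lemma holomorphic_map_imp_hol_disc:
 assumes A: "open A" and hol: "holomorphic_map (planar_atlas A) (cp2_domain \<Omega>) g"
 shows "hol_disc A g" "g ` A \<subseteq> \<Omega>"
proof -
 let ?vec = "vec :: complex => complex^1"
 have car: "carrier_of (planar_atlas A) = A" by (simp add: carrier_of_def planar_atlas_def)
 show sub: "g ` A \<subseteq> \<Omega>" using hol by (simp add: holomorphic_map_def car carrier_cp2_domain)
 have cont: "continuous_on A g" using hol by (simp add: holomorphic_map_def car)
 show "hol_disc A g"
  unfolding hol_disc_def
 proof
  fix b assume b: "b \<in> A"
  then obtain l i j where lij: "distinct3 l i j" "g b \<in> affine_dom l"
   "(affine_dom l \<inter> \<Omega>, affine_chart l i j) \<in> cp2_domain \<Omega>"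
   using cp2_domain_chart_at[of "g b" \<Omega>] sub by blast
  let ?V = "affine_dom l \<inter> \<Omega>" and ?a = "affine_chart l i j"
  have "open (A \<inter> g -` affine_dom l)"
   using cont A open_affine_dom by (rule continuous_open_preimage)
  then obtain r where r: "r > 0" "ball b r \<subseteq> A \<inter> g -` affine_dom l"
   using b lij(2) by (meson IntI open_contains_ball vimageI)
  have "\<forall>(V, \<psi>)\<in>cp2_domain \<Omega>. holomorphic_vec (\<psi> \<circ> g \<circ> inv_into A ?vec) (?vec ` (A \<inter> g -` V))"
   using hol by (simp add: holomorphic_map_def planar_atlas_def)
  then have hv: "holomorphic_vec (?a \<circ> g \<circ> inv_into A ?vec) (?vec ` (A \<inter> g -` ?V))"
   using lij(3) by blast
  have "hol_vec (\<lambda>z. ?a (g z)) (ball b r)"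
  proof (rule hol_vecI)
   fix z assume z: "z \<in> ball b r"
   then have "z \<in> A" "g z \<in> affine_dom l" using r by auto
   then have "z \<in> A \<inter> g -` ?V" using sub by auto
   then obtain D where D: "((?a \<circ> g \<circ> inv_into A ?vec) has_derivative D) (at (?vec z))" "\<And>c v. D (c *s v) = c *s D v"
    using hv unfolding holomorphic_vec_def by blast
   have "((\<lambda>z. (?a \<circ> g \<circ> inv_into A ?vec) (?vec z)) has_derivative (\<lambda>h. D (?vec h))) (at z)"
    by (rule has_derivative_compose[OF bounded_linear_imp_has_derivative[OF bounded_linear_vec_1] D(1)])
   moreover have "(?a \<circ> g \<circ> inv_into A ?vec) (?vec y) = ?a (g y)" if "y \<in> ball b r" for y
   proof -
    have "y \<in> A" using that r by auto
    then show ?thesis by (simp add: inv_into_f_f[OF inj_vec_1])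
   qed
   ultimately have "((\<lambda>z. ?a (g z)) has_derivative (\<lambda>h. D (?vec h))) (at z)"
    by (rule has_derivative_transform_within_open[OF _ open_ball z])
   moreover have "D (?vec h) = h *s D (?vec 1)" for h by (subst vec_1_smult[of h]) (rule D(2))
   ultimately show "\<exists>w. ((\<lambda>z. ?a (g z)) has_derivative (\<lambda>h. h *s w)) (at z)" by auto
  qed
  then have "hol_vec (\<lambda>z. affine_lift l i j (?a (g z))) (ball b r)" by (rule hol_vec_affine_lift)
  moreover have "g z = proj (affine_lift l i j (?a (g z)))" if "z \<in> ball b r" for z
   using proj_affine_lift_chart[OF lij(1), of "g z"] that r by auto
  ultimately show "\<exists>r>0. \<exists>L. ball b r \<subseteq> A \<and> hol_vec L (ball b r) \<and> (\<forall>z\<in>ball b r. L z ~= 0 \<and> g z = proj (L z))"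
   using r affine_lift_nonzero(1)
   by (intro exI[of _ r] conjI exI[of _ "\<lambda>z. affine_lift l i j (?a (g z))"]) auto
 qed
qed

lemma hol_disc_imp_holomorphic_map:
 assumes A: "open A" and g: "hol_disc A g" "g ` A \<subseteq> \<Omega>"
 shows "holomorphic_map (planar_atlas A) (cp2_domain \<Omega>) g"
proof -
 let ?vec = "vec :: complex => complex^1"
 have car: "carrier_of (planar_atlas A) = A" by (simp add: carrier_of_def planar_atlas_def)
 have "holomorphic_vec (a \<circ> g \<circ> inv_into A ?vec) (?vec ` (A \<inter> g -` V))" if V: "(V, a) \<in> cp2_domain \<Omega>" for V a
 proof -
  obtain l i j where lij: "distinct3 l i j" "V = affine_dom l \<inter> \<Omega>" "a = affine_chart l i j"
   by (rule restrict_cp2_atlasD[OF V])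
  show ?thesis
   unfolding holomorphic_vec_def
  proof
   fix x :: "complex^1" assume "x \<in> ?vec ` (A \<inter> g -` V)"
   then obtain z where z: "x = vec z" "z \<in> A" "g z \<in> affine_dom l" using lij by auto
   then obtain r L where L: "r > 0" "ball z r \<subseteq> A" "hol_vec L (ball z r)" "\<forall>y\<in>ball z r. L y ~= 0 \<and> g y = proj (L y)"
    using g(1) unfolding hol_disc_def by blast
   define B where "B = ball z r \<inter> (\<lambda>y. L y $ l) -` (- {0})"
   have B: "open B" unfolding B_def
    by (intro continuous_open_preimage holomorphic_on_imp_continuous_on hol_vecD L(3)) auto
   have zB: "z \<in> B" using z L affine_dom_iff[of "L z" l] by (simp add: B_def)
   have "hol_vec (\<lambda>y. affine_chart l i j (proj (L y))) B"
    by (rule hol_vec_affine_chart[OF hol_vec_subset[OF L(3)]]) (auto simp: B_def)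
   from has_derivative_hol_vec[OF this B zB] obtain u where
    u: "((\<lambda>y. affine_chart l i j (proj (L y))) has_derivative (\<lambda>h. h *s u)) (at z)" by blast
   have "((\<lambda>w. affine_chart l i j (proj (L (w $ 1)))) has_derivative (\<lambda>h. h $ 1 *s u)) (at x)"
    by (rule has_derivative_compose[OF bounded_linear.has_derivative[OF bounded_linear_vec_nth has_derivative_ident]])
     (simp add: u z(1))
   moreover have "open ((\<lambda>w :: complex^1. w $ 1) -` B)"
    by (intro open_vimage B continuous_intros)
   moreover have "x \<in> (\<lambda>w :: complex^1. w $ 1) -` B" using zB z(1) by simp
   moreover have "affine_chart l i j (proj (L (w $ 1))) = (a \<circ> g \<circ> inv_into A ?vec) w"
    if "w \<in> (\<lambda>w :: complex^1. w $ 1) -` B" for w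
   proof -
    have wB: "w $ 1 \<in> B" using that by simp
    then have "w $ 1 \<in> A" using L(2) by (auto simp: B_def)
    then have "inv_into A ?vec w = w $ 1" using inv_into_f_f[OF inj_vec_1, of "w $ 1" A] by (simp add: vec_nth_1)
    then show ?thesis using wB L(4) lij(3) by (simp add: B_def)
   qed
   ultimately have "((a \<circ> g \<circ> inv_into A ?vec) has_derivative (\<lambda>h. h $ 1 *s u)) (at x)"
    by (rule has_derivative_transform_within_open)
   then show "\<exists>D. ((a \<circ> g \<circ> inv_into A ?vec) has_derivative D) (at x) \<and> (\<forall>c v. D (c *s v) = c *s D v)"
    by (intro exI[of _ "\<lambda>h. h $ 1 *s u"]) auto
  qed
 qed
 then show ?thesis
  unfolding holomorphic_map_def car carrier_cp2_domain
  using g hol_disc_continuous[OF g(1)] by (auto simp: planar_atlas_def)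
qed

lemma holomorphic_chart_compose:
 fixes p :: "cp2 => complex^2"
 assumes chart: "holomorphic_chart (cp2_domain \<Omega>) U p" and A: "open A"
  and L: "hol_vec L A" "\<And>z. z \<in> A ==> L z ~= 0 \<and> proj (L z) \<in> U"
 shows "hol_vec (\<lambda>z. p (proj (L z))) A"
proof (rule hol_vecI)
 fix z assume z: "z \<in> A"
 have "U \<subseteq> \<Omega>" using chart unfolding holomorphic_chart_def carrier_cp2_domain by (auto dest: openin_imp_subset)
 then have "proj (L z) \<in> \<Omega>" using L z by auto
 then obtain l i j where lij: "distinct3 l i j" "proj (L z) \<in> affine_dom l"
   "(affine_dom l \<inter> \<Omega>, affine_chart l i j) \<in> cp2_domain \<Omega>"
  by (rule cp2_domain_chart_at)
 let ?V = "affine_dom l \<inter> \<Omega>" and ?a = "affine_chart l i j"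
 define B where "B = A \<inter> (\<lambda>y. L y $ l) -` (- {0})"
 have B: "open B" unfolding B_def
  by (intro continuous_open_preimage holomorphic_on_imp_continuous_on hol_vecD L(1) A) auto
 have zB: "z \<in> B" using z L(2)[OF z] lij(2) affine_dom_iff[of "L z" l] by (simp add: B_def)
 have "hol_vec (\<lambda>y. ?a (proj (L y))) B"
  by (rule hol_vec_affine_chart[OF hol_vec_subset[OF L(1)]]) (auto simp: B_def)
 from has_derivative_hol_vec[OF this B zB] obtain u where
  u: "((\<lambda>y. ?a (proj (L y))) has_derivative (\<lambda>h. h *s u)) (at z)" by blast
 have "holomorphic_vec (p \<circ> inv_into ?V ?a) (?a ` (U \<inter> ?V))"
  using chart lij(3) unfolding holomorphic_chart_def by auto
 moreover have "?a (proj (L z)) \<in> ?a ` (U \<inter> ?V)" using L(2)[OF z] lij(2) \<open>U \<subseteq> \<Omega>\<close> by auto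
 ultimately obtain D where D: "((p \<circ> inv_into ?V ?a) has_derivative D) (at (?a (proj (L z))))"
  "\<And>c v. D (c *s v) = c *s D v"
  unfolding holomorphic_vec_def by blast
 have "((\<lambda>y. (p \<circ> inv_into ?V ?a) (?a (proj (L y)))) has_derivative (\<lambda>h. D (h *s u))) (at z)"
  by (rule has_derivative_compose[OF u D(1)])
 moreover have "(p \<circ> inv_into ?V ?a) (?a (proj (L y))) = p (proj (L y))" if "y \<in> B" for y
 proof -
  have "proj (L y) \<in> ?V" using that L(2)[of y] \<open>U \<subseteq> \<Omega>\<close> affine_dom_iff[of "L y" l] by (auto simp: B_def)
  then show ?thesis using inv_into_affine_chart[OF lij(1)] by simp
 qed
 ultimately have "((\<lambda>y. p (proj (L y))) has_derivative (\<lambda>h. D (h *s u))) (at z)"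
  by (rule has_derivative_transform_within_open[OF _ B zB])
 then show "\<exists>w. ((\<lambda>y. p (proj (L y))) has_derivative (\<lambda>h. h *s w)) (at z)"
  using D(2) by auto
qed

text \<open>The inverse chart is followed by an affine chart and its lift. The latter is affine
  linear, with linear part \<open>E\<close>, so complex linearity of the derivative is inherited
  from the transition map.\<close>

lemma holomorphic_chart_inverse_lift:
 fixes p :: "cp2 => complex^2"
 assumes chart: "holomorphic_chart (cp2_domain \<Omega>) U p" and c: "c \<in> U"
 obtains e L l where "e > 0" "ball (p c) e \<subseteq> p ` U"
  "\<And>w. w \<in> ball (p c) e ==> L w ~= 0 \<and> L w $ l = 1 \<and> proj (L w) = inv_into U p w"
  "\<And>w. w \<in> ball (p c) e ==> \<exists>D. (L has_derivative D) (at w) \<and> (\<forall>a v. D (a *s v) = a *s D v)"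
proof -
 have "U \<subseteq> \<Omega>" using chart unfolding holomorphic_chart_def carrier_cp2_domain by (auto dest: openin_imp_subset)
 then have "c \<in> \<Omega>" using c by auto
 then obtain l i j where lij: "distinct3 l i j" "c \<in> affine_dom l"
   "(affine_dom l \<inter> \<Omega>, affine_chart l i j) \<in> cp2_domain \<Omega>"
  by (rule cp2_domain_chart_at)
 let ?V = "affine_dom l \<inter> \<Omega>" and ?b = "affine_chart l i j"
 have hom: "homeomorphism U (p ` U) p (inv_into U p)" and op: "open (p ` U)"
  and hv: "holomorphic_vec (?b \<circ> inv_into U p) (p ` (U \<inter> ?V))"
  using chart lij(3) unfolding holomorphic_chart_def by auto
 have "open (p ` U \<inter> inv_into U p -` affine_dom l)"
  using hom op open_affine_dom unfolding homeomorphism_def by (intro continuous_open_preimage) auto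
 moreover have "p c \<in> p ` U \<inter> inv_into U p -` affine_dom l"
  using hom c lij(2) unfolding homeomorphism_def by auto
 ultimately obtain e where e: "e > 0" "ball (p c) e \<subseteq> p ` U \<inter> inv_into U p -` affine_dom l"
  using open_contains_ball by blast
 define L where "L = (\<lambda>w. affine_lift l i j (?b (inv_into U p w)))"
 show ?thesis
 proof (rule that[OF e(1)])
  show "ball (p c) e \<subseteq> p ` U" using e by auto
  fix w assume w: "w \<in> ball (p c) e"
  then have iw: "inv_into U p w \<in> affine_dom l" "w \<in> p ` U" using e(2) by auto
  then have iw: "inv_into U p w \<in> affine_dom l" "inv_into U p w \<in> U" by (simp_all add: inv_into_into)
  show "L w ~= 0 \<and> L w $ l = 1 \<and> proj (L w) = inv_into U p w"
   unfolding L_def using affine_lift_nonzero proj_affine_lift_chart[OF lij(1) iw(1)] by auto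
  have "w \<in> p ` U" using w e(2) by auto
  then have "p (inv_into U p w) = w" by (rule f_inv_into_f)
  then have "w \<in> p ` (U \<inter> ?V)" using iw \<open>U \<subseteq> \<Omega>\<close> by (metis IntI image_eqI subsetD)
  then obtain D where D: "((?b \<circ> inv_into U p) has_derivative D) (at w)" "\<And>a v. D (a *s v) = a *s D v"
   using hv unfolding holomorphic_vec_def by blast
  define E :: "complex^2 => complex^3" where "E = (\<lambda>u. \<chi> k. if k = l then 0 else if k = i then u $ 1 else u $ 2)"
  have E: "bounded_linear E"
  proof (rule bounded_linear_intro[where K = 3])
   show "E (x + y) = E x + E y" for x y by (simp add: E_def vec_eq_iff)
   show "E (r *\<^sub>R x) = r *\<^sub>R E x" for r x by (simp add: E_def vec_eq_iff)
   show "norm (E x) <= norm x * 3" for x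
    using norm_vec_le[of "E x" "norm x"] Finite_Cartesian_Product.norm_nth_le[of x] by (simp add: E_def mult.commute)
  qed
  have eq: "affine_lift l i j u = axis l 1 + E u" for u
   by (auto simp: affine_lift_def E_def vec_eq_iff axis_def)
  have "((\<lambda>w. axis l 1 + E ((?b \<circ> inv_into U p) w)) has_derivative (\<lambda>h. 0 + E (D h))) (at w)"
   by (intro has_derivative_add has_derivative_const bounded_linear.has_derivative[OF E] D(1))
  then have "(L has_derivative (\<lambda>h. E (D h))) (at w)" by (simp add: L_def eq)
  moreover have "E (D (a *s v)) = a *s E (D v)" for a v by (simp add: D(2)) (simp add: E_def vec_eq_iff)
  ultimately show "\<exists>D. (L has_derivative D) (at w) \<and> (\<forall>a v. D (a *s v) = a *s D v)" by blast
 qed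
qed

section \<open>Global normalized lifts of discs\<close>

lemma hol_vec_local:
 assumes "\<And>z. z \<in> A ==> \<exists>r>0. \<exists>M. hol_vec M (ball z r) \<and> (\<forall>y\<in>ball z r. L y = M y)"
 shows "hol_vec L A"
proof (rule hol_vecI)
 fix z assume "z \<in> A"
 then obtain r M where r: "r > 0" "hol_vec M (ball z r)" "\<forall>y\<in>ball z r. L y = M y" using assms by blast
 have z: "z \<in> ball z r" using r(1) by simp
 have "(L has_derivative (\<lambda>h. h *s vderiv M z)) (at z)"
  by (rule has_derivative_transform_within_open[OF has_derivative_hol_vec[OF r(2) open_ball z] open_ball z])
   (use r(3) in simp)
 then show "\<exists>w. (L has_derivative (\<lambda>h. h *s w)) (at z)" by blast
qed

lemma norm_unimodular_constant:
 assumes "u holomorphic_on ball a r" "r > 0" "\<And>z. z \<in> ball a r ==> cmod (u z) = 1" "z \<in> ball a r"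
 shows "u z = u a"
proof -
 have "u constant_on ball a r"
  by (rule maximum_modulus_principle[OF assms(1) open_ball connected_ball open_ball order_refl, of a])
   (use assms in auto)
 then show ?thesis using assms(2,4) unfolding constant_on_def by auto
qed

context lifted_map
begin

text \<open>The quotient of the two lifts is holomorphic near \<open>z0\<close> and unimodular
  because both have \<open>green\<close> equal to 0. It is therefore constant there, and the
  identity theorem carries the equality over \<open>A\<close>.\<close>

lemma nlift_unique:
 assumes A: "open A" "connected A" and L: "nlift L A" and M: "nlift M A"
  and p: "\<And>z. z \<in> A ==> proj (L z) = proj (M z)" and z0: "z0 \<in> A" "L z0 = M z0" and z: "z \<in> A"
 shows "L z = M z"
proof -
 have L0: "L z0 ~= 0" using L z0(1) by (simp add: nlift_def)
 then obtain l where l: "L z0 $ l ~= 0" by (metis vec_eq_iff zero_index)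
 have hL: "hol_vec L A" and hM: "hol_vec M A" using L M by (auto simp: nlift_def)
 have op: "open (A \<inter> (\<lambda>y. L y $ l) -` (- {0}))"
  by (intro continuous_open_preimage holomorphic_on_imp_continuous_on hol_vecD hL A) auto
 have "z0 \<in> A \<inter> (\<lambda>y. L y $ l) -` (- {0})" using z0(1) l by simp
 then obtain r where r: "r > 0" "ball z0 r \<subseteq> A \<inter> (\<lambda>y. L y $ l) -` (- {0})"
  by (rule openE[OF op])
 define u where "u = (\<lambda>z. M z $ l / L z $ l)"
 have Mu: "M y = u y *s L y" "cmod (u y) = 1" if y: "y \<in> ball z0 r" for y
 proof -
  have yA: "y \<in> A" and ly: "L y $ l ~= 0" using y r by auto
  then have nz: "L y ~= 0" "M y ~= 0" "green (L y) = 0" "green (M y) = 0" using L M by (auto simp: nlift_def)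
  then obtain c where c: "c ~= 0" "M y = c *s L y" using p[OF yA] proj_eq_iff[OF nz(1,2)] by blast
  then have uc: "u y = c" using ly by (simp add: u_def)
  have "green (M y) = green (L y) + ln (cmod c)" using c nz by (simp add: green_smult)
  then have "ln (cmod c) = 0" using nz by simp
  then have "cmod c = 1" using c(1) by simp
  then show "M y = u y *s L y" "cmod (u y) = 1" using c uc by auto
 qed
 have "u holomorphic_on ball z0 r"
  unfolding u_def using r hL hM
  by (intro holomorphic_on_divide hol_vecD hol_vec_subset[OF hL] hol_vec_subset[OF hM]) auto
 then have "u y = u z0" if "y \<in> ball z0 r" for y
  using norm_unimodular_constant[OF _ r(1) Mu(2) that] by simp
 moreover have "u z0 = 1" using z0(2) l by (simp add: u_def)
 ultimately have eq: "M y = L y" if "y \<in> ball z0 r" for y using Mu(1)[OF that] that by simp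
 have "L z $ k = M z $ k" for k
 proof (rule analytic_continuation_open[of "ball z0 r" A "\<lambda>z. L z $ k" "\<lambda>z. M z $ k" z])
  show "ball z0 r \<subseteq> A" using r by auto
  show "(\<lambda>z. L z $ k) holomorphic_on A" "(\<lambda>z. M z $ k) holomorphic_on A" using hL hM by (auto intro: hol_vecD)
 qed (use A r z eq in auto)
 then show ?thesis by (simp add: vec_eq_iff)
qed

lemma nlift_smult: "nlift L A ==> cmod u = 1 ==> nlift (\<lambda>z. u *s L z) A"
proof -
 assume L: "nlift L A" and u: "cmod u = 1"
 then have "u ~= 0" by auto
 then show ?thesis using L u hol_vec_scale[of "\<lambda>z. u" A L] by (auto simp: nlift_def green_smult)
qed

lemma nlift_phase:
 assumes "x ~= 0" "y ~= 0" "green x = 0" "green y = 0" "proj x = proj y"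
 obtains u where "cmod u = 1" "y = u *s x"
proof -
 obtain c where c: "c ~= 0" "y = c *s x" using assms(5) proj_eq_iff[OF assms(1,2)] by blast
 then have "ln (cmod c) = 0" using assms by (simp add: green_smult)
 then have "cmod c = 1" using c(1) by simp
 then show ?thesis using that c by blast
qed

lemma local_nlift:
 assumes "hol_disc A g" "open A" "g ` A \<subseteq> fatou_set f" "a \<in> A"
 shows "\<exists>r>0. \<exists>L. ball a r \<subseteq> A \<and> nlift L (ball a r) \<and> (\<forall>z\<in>ball a r. proj (L z) = g z)"
proof -
 obtain e where e: "e > 0" "green_harmonic_on (ball (g a) e)"
  using fatou_green_harmonic[of "g a"] assms by blast
 have "open (A \<inter> g -` ball (g a) e)"
  using hol_disc_continuous[OF assms(1)] assms(2) by (intro continuous_open_preimage) auto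
 moreover have "a \<in> A \<inter> g -` ball (g a) e" using assms(4) e(1) by auto
 ultimately obtain s where s: "s > 0" "ball a s \<subseteq> A \<inter> g -` ball (g a) e"
  using open_contains_ball by blast
 obtain r L where L: "r > 0" "hol_vec L (ball a r)" "\<forall>z\<in>ball a r. L z ~= 0 \<and> g z = proj (L z)"
  using assms(1,4) unfolding hol_disc_def by blast
 define t where "t = min r s"
 have t: "t > 0" "ball a t \<subseteq> ball a r" "ball a t \<subseteq> ball a s" using s L by (auto simp: t_def)
 have Lt: "hol_vec L (ball a t)" by (rule hol_vec_subset[OF L(2) t(2)])
 have L0: "L z ~= 0" "proj (L z) \<in> ball (g a) e" "proj (L z) = g z" if "z \<in> ball a t" for z
 proof -
  have "z \<in> ball a r" "z \<in> ball a s" using that t by auto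
  then have "L z ~= 0" "g z = proj (L z)" "g z \<in> ball (g a) e" using L(3) s(2) by auto
  then show "L z ~= 0" "proj (L z) \<in> ball (g a) e" "proj (L z) = g z" by auto
 qed
 obtain q where q: "nlift (\<lambda>z. inverse (q z) *s L z) (ball a t)"
  "\<And>z. z \<in> ball a t ==> proj (inverse (q z) *s L z) = proj (L z)"
  by (rule green_harmonic_nlift[OF e(2) t(1) Lt L0(1,2)]) (assumption, assumption, rule that)
 have "ball a t \<subseteq> A" using t(3) s(2) by auto
 then show ?thesis using t(1) q L0(3)
  by (intro exI[of _ t] conjI exI[of _ "\<lambda>z. inverse (q z) *s L z"]) auto
qed

text \<open>Normalized lifts are unique up to a unimodular constant, hence local ones can be glued along
 radii.\<close>

lemma nlift_extend:
 assumes e: "e > 0" and b: "b > 0"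
  and loc: "\<And>h. h \<in> ball 0 b ==> \<exists>M. nlift M (ball h e) \<and> (\<forall>z\<in>ball h e. proj (M z) = g z)"
  and L: "nlift L (ball 0 b)" "\<And>z. z \<in> ball 0 b ==> proj (L z) = g z"
 shows "\<exists>N. nlift N (ball 0 (b + e/6)) \<and> (\<forall>z\<in>ball 0 (b + e/6). proj (N z) = g z)"
proof -
 have ex: "\<forall>h\<in>ball 0 b. \<exists>M. nlift M (ball h e) \<and> (\<forall>z\<in>ball h e. proj (M z) = g z) \<and> M h = L h"
 proof
  fix h :: complex assume h: "h \<in> ball 0 b"
  obtain M where M: "nlift M (ball h e)" "\<forall>z\<in>ball h e. proj (M z) = g z" using loc[OF h] by blast
  have "h \<in> ball h e" using e by simp
  then have a: "M h ~= 0" "L h ~= 0" "green (M h) = 0" "green (L h) = 0" "proj (M h) = proj (L h)"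
   using M L h by (auto simp: nlift_def)
  obtain u where u: "cmod u = 1" "L h = u *s M h" by (rule nlift_phase[OF a])
  have "proj (u *s M z) = g z" if "z \<in> ball h e" for z
  proof -
   have "M z ~= 0" "u ~= 0" using M(1) that u(1) by (auto simp: nlift_def)
   then show ?thesis using M(2) that by (simp add: proj_smult)
  qed
  then show "\<exists>M. nlift M (ball h e) \<and> (\<forall>z\<in>ball h e. proj (M z) = g z) \<and> M h = L h"
   using nlift_smult[OF M(1) u(1)] u(2)
   by (intro exI[of _ "\<lambda>z. u *s M z"]) auto
 qed
 from bchoice[OF ex] obtain M where "\<forall>h\<in>ball 0 b. nlift (M h) (ball h e) \<and> (\<forall>z\<in>ball h e. proj (M h z) = g z) \<and> M h h = L h"
  by (rule exE)
 then have M: "nlift (M h) (ball h e)" "\<And>z. z \<in> ball h e ==> proj (M h z) = g z" "M h h = L h"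
  if "h \<in> ball 0 b" for h using that by auto
 have MeqL: "M h z = L z" if h: "h \<in> ball 0 b" and z: "z \<in> ball 0 b" "z \<in> ball h e" for h z
 proof (rule nlift_unique[of "ball h e \<inter> ball 0 b" _ _ h])
  show "connected (ball h e \<inter> ball 0 b)" by (intro convex_connected convex_Int) auto
  show "nlift (M h) (ball h e \<inter> ball 0 b)"
   by (rule nlift_subset[OF M(1)[OF h]]) (rule Int_lower1)
  show "nlift L (ball h e \<inter> ball 0 b)"
   by (rule nlift_subset[OF L(1)]) (rule Int_lower2)
  show "proj (M h y) = proj (L y)" if "y \<in> ball h e \<inter> ball 0 b" for y
   using M(2)[OF h, of y] L(2)[of y] that by simp
 qed (use h z e M(3)[OF h] in auto)
 \<comment> \<open>Scaling by \<open>t\<close> retracts the larger ball into \<open>ball 0 b\<close>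
   and moves each point by less than \<open>e / 6\<close>. The lift at \<open>z\<close> is read from
   the local lift centred at the retracted point.\<close>
 define t where "t = b / (b + e/6)"
 have t: "0 < t" "t < 1" "t * (b + e/6) = b" using e b by (auto simp: t_def)
 define c where "c = (\<lambda>z :: complex. of_real t * z)"
 define B where "B = ball (0::complex) (b + e/6)"
 have c: "c z \<in> ball 0 b" "dist (c z) z < e/6" if "z \<in> B" for z
 proof -
  have z: "cmod z < b + e/6" using that by (simp add: B_def)
  have "t * cmod z < t * (b + e/6)" using z t(1) by (rule mult_strict_left_mono)
  then have "t * cmod z < b" by (simp only: t(3))
  then show "c z \<in> ball 0 b" using t by (simp add: c_def norm_mult)
  have "z - c z = of_real (1 - t) * z" by (simp add: c_def algebra_simps)
  then have "dist (c z) z = (1 - t) * cmod z"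
   using t by (simp add: dist_norm norm_minus_commute[of "c z"] norm_mult del: of_real_diff)
  also have "\<dots> < (1 - t) * (b + e/6)" using z t by simp
  also have "\<dots> = (b + e/6) - t * (b + e/6)" by (simp only: left_diff_distrib mult_1)
  also have "\<dots> = e/6" by (simp add: t(3))
  finally show "dist (c z) z < e/6" .
 qed
 have cc: "dist (c z) (c y) <= dist z y" for z y
 proof -
  have "c z - c y = of_real t * (z - y)" by (simp add: c_def algebra_simps)
  then have "dist (c z) (c y) = t * dist z y" using t by (simp add: dist_norm norm_mult)
  then show ?thesis using t by (simp add: mult_left_le_one_le)
 qed
 define N where "N = (\<lambda>z. M (c z) z)"
 \<comment> \<open>The centre varies with the point, so holomorphy of \<open>N\<close> is not
   immediate. By uniqueness \<open>N\<close> coincides near \<open>z0\<close> with one fixed local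
   lift.\<close>
 have loc_eq: "N z = M (c z0) z" if z0: "z0 \<in> B" and z: "z \<in> B" "dist z0 z < e/6" for z0 z
  unfolding N_def
 proof (rule nlift_unique[of "ball (c z) e \<inter> ball (c z0) e" "M (c z)" "M (c z0)" "c z0" z])
  note a = c[OF z0] c[OF z(1)] cc[of z z0] z(2)
  show "connected (ball (c z) e \<inter> ball (c z0) e)" by (intro convex_connected convex_Int) auto
  show "nlift (M (c z)) (ball (c z) e \<inter> ball (c z0) e)"
   by (rule nlift_subset[OF M(1)[OF a(3)]]) (rule Int_lower1)
  show "nlift (M (c z0)) (ball (c z) e \<inter> ball (c z0) e)"
   by (rule nlift_subset[OF M(1)[OF a(1)]]) (rule Int_lower2)
  show "proj (M (c z) y) = proj (M (c z0) y)" if "y \<in> ball (c z) e \<inter> ball (c z0) e" for y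
   using M(2)[OF a(1), of y] M(2)[OF a(3), of y] that by simp
  have d: "dist (c z) (c z0) < e" using a(5,6) e by (simp add: dist_commute)
  then show "c z0 \<in> ball (c z) e \<inter> ball (c z0) e" using e by simp
  show "M (c z) (c z0) = M (c z0) (c z0)"
   using MeqL[OF a(3,1)] M(3)[OF a(1)] d by simp
  have "dist (c z0) z < e" using dist_triangle[of "c z0" z z0] a e by simp
  then show "z \<in> ball (c z) e \<inter> ball (c z0) e" using a(4) e by simp
 qed auto
 have "hol_vec N B"
 proof (rule hol_vec_local)
  fix z0 assume z0: "z0 \<in> B"
  have "open B" by (simp add: B_def)
  then obtain s where s: "s > 0" "ball z0 s \<subseteq> B" using z0 by (rule openE)
  define s' where "s' = min s (e/6)"
  have s': "s' > 0" "ball z0 s' \<subseteq> B" "s' <= e/6" using s e by (auto simp: s'_def)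
  have "ball z0 s' \<subseteq> ball (c z0) e"
  proof
   fix y assume "y \<in> ball z0 s'"
   then show "y \<in> ball (c z0) e" using c(2)[OF z0] s'(3) dist_triangle[of "c z0" y z0] e by simp
  qed
  then have "hol_vec (M (c z0)) (ball z0 s')" using M(1)[OF c(1)[OF z0]] hol_vec_subset by (auto simp: nlift_def)
  moreover have "N y = M (c z0) y" if "y \<in> ball z0 s'" for y
   using loc_eq[OF z0, of y] that s' by auto
  ultimately show "\<exists>r>0. \<exists>M. hol_vec M (ball z0 r) \<and> (\<forall>y\<in>ball z0 r. N y = M y)"
   using s'(1) by blast
 qed
 moreover have "N z ~= 0 \<and> green (N z) = 0 \<and> proj (N z) = g z" if "z \<in> B" for z
 proof -
  have "z \<in> ball (c z) e" using c(2)[OF that] e by simp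
  then show ?thesis using M(1,2)[OF c(1)[OF that]] by (simp add: N_def nlift_def)
 qed
 ultimately show ?thesis unfolding B_def[symmetric] by (intro exI[of _ N]) (simp add: nlift_def)
qed

text \<open>A Lebesgue number \<open>e\<close> of the cover by local lifts makes every extension
  step gain \<open>e / 6\<close>, so finitely many steps reach radius \<open>a\<close>.\<close>

lemma nlift_ball:
 assumes g: "hol_disc (ball 0 1) g" "g ` ball 0 1 \<subseteq> fatou_set f" and a: "0 < a" "a < 1"
 shows "\<exists>N. nlift N (ball 0 a) \<and> (\<forall>z\<in>ball 0 a. proj (N z) = g z)"
proof -
 define \<G> where "\<G> = {ball b r |b r. \<exists>L. nlift L (ball b r) \<and> (\<forall>z\<in>ball b r. proj (L z) = g z)}"
 have "cball 0 a \<subseteq> \<Union>\<G>"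
 proof
  fix b :: complex assume "b \<in> cball 0 a"
  then have "b \<in> ball 0 1" using a by simp
  from local_nlift[OF g(1) open_ball g(2) this] obtain r L where "r > 0" "nlift L (ball b r)" "\<forall>z\<in>ball b r. proj (L z) = g z"
   by blast
  then have "ball b r \<in> \<G>" "b \<in> ball b r" unfolding \<G>_def by auto
  then show "b \<in> \<Union>\<G>" by blast
 qed
 moreover have "open G" if "G \<in> \<G>" for G using that unfolding \<G>_def by auto
 ultimately obtain e where e: "e > 0" "\<And>x. x \<in> cball 0 a ==> \<exists>G\<in>\<G>. ball x e \<subseteq> G"
  using Heine_Borel_lemma[OF compact_cball] by metis
 have loc: "\<exists>M. nlift M (ball b e) \<and> (\<forall>z\<in>ball b e. proj (M z) = g z)" if "b \<in> cball 0 a" for b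
 proof -
  from e(2)[OF that] obtain G where "G \<in> \<G>" "ball b e \<subseteq> G" by blast
  then obtain L where "nlift L G" "\<forall>z\<in>G. proj (L z) = g z" unfolding \<G>_def by blast
  then show ?thesis using nlift_subset \<open>ball b e \<subseteq> G\<close> by blast
 qed
 have "\<exists>s>0. s >= min a (e * real n / 6) \<and> (\<exists>N. nlift N (ball 0 s) \<and> (\<forall>z\<in>ball 0 s. proj (N z) = g z))" for n
 proof (induction n)
  case 0
  show ?case using loc[of 0] e(1) a by (intro exI[of _ e]) auto
 next
  case (Suc n)
  then obtain s N where s: "s > 0" "s >= min a (e * real n / 6)"
   and N: "nlift N (ball 0 s)" "\<forall>z\<in>ball 0 s. proj (N z) = g z" by blast
  show ?case
  proof (cases "s >= a")
   case True
   then show ?thesis using s N by (intro exI[of _ s]) auto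
  next
   case False
   have "\<exists>M. nlift M (ball b e) \<and> (\<forall>z\<in>ball b e. proj (M z) = g z)" if "b \<in> ball 0 s" for b
    using loc[of b] that False by simp
   from nlift_extend[OF e(1) s(1) this N(1) bspec[OF N(2)]]
   have "\<exists>N. nlift N (ball 0 (s + e/6)) \<and> (\<forall>z\<in>ball 0 (s + e/6). proj (N z) = g z)" by simp
   then show ?thesis using s False e(1)
    by (intro exI[of _ "s + e/6"]) (auto simp: algebra_simps min_def split: if_splits)
  qed
 qed
 moreover obtain n where "real n > 6 * a / e" using reals_Archimedean2 by blast
 then have "e * real n / 6 >= a" using e(1) by (simp add: field_simps)
 ultimately obtain s N where "s >= a" "nlift N (ball 0 s)" "\<forall>z\<in>ball 0 s. proj (N z) = g z"
  by (metis min.absorb1)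
 moreover have "ball (0::complex) a \<subseteq> ball 0 s" using \<open>s >= a\<close> by auto
 ultimately show ?thesis using nlift_subset by (intro exI[of _ N]) auto
qed

text \<open>The constant depends neither on the disc nor on \<open>n\<close>: the normalized lift
  lives on the ball of radius \<open>1 / 2\<close> whatever the disc is, and \<open>24\<close> is
  \<open>12 / (1/2)\<close>.\<close>

lemma hol_disc_iter_dist:
 assumes g: "hol_disc (ball 0 1) g" "g ` ball 0 1 \<subseteq> fatou_set f" and z: "cmod z <= 1/4"
 shows "dist ((f ^^ n) (g 0)) ((f ^^ n) (g z)) <= 24 * nbd\<^sup>2 * cmod z"
proof -
 obtain N where N: "nlift N (ball 0 (1/2))" "\<forall>z\<in>ball 0 (1/2). proj (N z) = g z"
  using nlift_ball[OF g, of "1/2"] by auto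
 have "dist ((f ^^ n) (proj (N 0))) ((f ^^ n) (proj (N z))) <= 12 * nbd\<^sup>2 / (1/2) * cmod (0 - z)"
  by (rule nlift_dist[OF N(1)]) (use z in auto)
 then show ?thesis using N(2) z by simp
qed

end

section \<open>The Kobayashi distance\<close>

definition pseudo_hyp :: "complex => complex => real" where
 "pseudo_hyp a b = cmod ((a - b) / (1 - cnj a * b))"

lemma poincare_dist_eq: "poincare_dist a b = 2 * artanh (pseudo_hyp a b)"
 by (simp add: poincare_dist_def pseudo_hyp_def)

lemma pseudo_hyp_sym: "pseudo_hyp a b = pseudo_hyp b a"
proof -
 have "cmod (1 - cnj a * b) = cmod (cnj (1 - cnj a * b))" by (simp only: complex_mod_cnj)
 then show ?thesis by (simp add: pseudo_hyp_def norm_divide norm_minus_commute mult.commute)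
qed

lemma pseudo_hyp_Moebius: "pseudo_hyp a b = cmod (Moebius_function 0 a b)"
 by (simp add: pseudo_hyp_def Moebius_function_simple norm_divide norm_minus_commute)

lemma pseudo_hyp_lt_1: "a \<in> ball 0 1 ==> b \<in> ball 0 1 ==> pseudo_hyp a b < 1"
 by (simp add: pseudo_hyp_Moebius Moebius_function_norm_lt_1)

lemma pseudo_hyp_nonneg: "pseudo_hyp a b >= 0"
 by (simp add: pseudo_hyp_def)

lemma artanh_bounds:
 assumes "0 <= m" "m < (1::real)"
 shows "m <= 2 * artanh m" "2 * artanh m <= 2 * m / (1 - m)"
proof -
 have "ln (1 - m) <= - m" using ln_le_minus_one[of "1 - m"] assms by simp
 moreover have "ln (1 + m) >= 0" using assms by simp
 moreover have "2 * artanh m = ln (1 + m) - ln (1 - m)" using assms by (simp add: artanh_def ln_div)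
 ultimately show "m <= 2 * artanh m" by linarith
 have "2 * artanh m = ln ((1 + m) / (1 - m))" by (simp add: artanh_def)
 also have "\<dots> <= (1 + m) / (1 - m) - 1" using assms by (intro ln_le_minus_one) auto
 also have "\<dots> = 2 * m / (1 - m)" using assms by (simp add: field_simps)
 finally show "2 * artanh m <= 2 * m / (1 - m)" .
qed

lemma poincare_dist_nonneg: "a \<in> ball 0 1 ==> b \<in> ball 0 1 ==> poincare_dist a b >= 0"
 using artanh_bounds(1)[of "pseudo_hyp a b"] pseudo_hyp_lt_1[of a b] pseudo_hyp_nonneg[of a b]
 by (simp add: poincare_dist_eq)

lemma poincare_dist_sym: "poincare_dist a b = poincare_dist b a"
 by (simp add: poincare_dist_eq pseudo_hyp_sym)

lemma disc_chain_single:
 assumes "a \<in> ball 0 1" "b \<in> ball 0 1" "holomorphic_map (planar_atlas (ball 0 1)) A g"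
 shows "poincare_dist a b \<in> disc_chain_lengths A (g a) (g b)"
 unfolding disc_chain_lengths_def
 by (rule CollectI, rule exI[of _ "1::nat"], rule exI[of _ "\<lambda>_. a"], rule exI[of _ "\<lambda>_. b"], rule exI[of _ "\<lambda>_. g"])
  (use assms in auto)

lemma disc_chain_sym:
 assumes "x \<in> disc_chain_lengths A p q"
 shows "x \<in> disc_chain_lengths A q p"
proof -
 obtain k a b g where k: "k >= 1" and x: "x = (\<Sum>i<k. poincare_dist (a i) (b i))"
  and h: "\<And>i. i < k ==> a i \<in> ball 0 1 \<and> b i \<in> ball 0 1 \<and> holomorphic_map (planar_atlas (ball 0 1)) A (g i)"
  and pq: "g 0 (a 0) = p" "g (k - 1) (b (k - 1)) = q"
  and link: "\<And>i. Suc i < k ==> g i (b i) = g (Suc i) (a (Suc i))"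
  using assms unfolding disc_chain_lengths_def by blast
 define r where "r = (\<lambda>i. k - Suc i)"
 have "(\<Sum>i<k. poincare_dist (b (r i)) (a (r i))) = x"
  using sum.nat_diff_reindex[of "\<lambda>i. poincare_dist (b i) (a i)" k] by (simp add: x r_def poincare_dist_sym)
 moreover have "b (r i) \<in> ball 0 1 \<and> a (r i) \<in> ball 0 1 \<and> holomorphic_map (planar_atlas (ball 0 1)) A (g (r i))" if "i < k" for i
  using h[of "r i"] that by (simp add: r_def)
 moreover have "g (r i) (a (r i)) = g (r (Suc i)) (b (r (Suc i)))" if "Suc i < k" for i
 proof -
  have "Suc (r (Suc i)) = r i" using that by (simp add: r_def)
  then show ?thesis using link[of "r (Suc i)"] that by (simp add: r_def)
 qed
 moreover have "g (r 0) (b (r 0)) = q" "g (r (k - 1)) (a (r (k - 1))) = p" using pq k by (simp_all add: r_def)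
 ultimately show ?thesis
  unfolding disc_chain_lengths_def using k
  by (intro CollectI exI[of _ k] exI[of _ "\<lambda>i. b (r i)"] exI[of _ "\<lambda>i. a (r i)"] exI[of _ "\<lambda>i. g (r i)"]) auto
qed

lemma disc_chain_trans:
 assumes "x \<in> disc_chain_lengths A p q" "y \<in> disc_chain_lengths A q s"
 shows "x + y \<in> disc_chain_lengths A p s"
proof -
 obtain k a b g where k: "k >= 1" and x: "x = (\<Sum>i<k. poincare_dist (a i) (b i))"
  and h: "\<And>i. i < k ==> a i \<in> ball 0 1 \<and> b i \<in> ball 0 1 \<and> holomorphic_map (planar_atlas (ball 0 1)) A (g i)"
  and pq: "g 0 (a 0) = p" "g (k - 1) (b (k - 1)) = q"
  and link: "\<And>i. Suc i < k ==> g i (b i) = g (Suc i) (a (Suc i))"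
  using assms(1) unfolding disc_chain_lengths_def by blast
 obtain k' a' b' g' where k': "k' >= 1" and y: "y = (\<Sum>i<k'. poincare_dist (a' i) (b' i))"
  and h': "\<And>i. i < k' ==> a' i \<in> ball 0 1 \<and> b' i \<in> ball 0 1 \<and> holomorphic_map (planar_atlas (ball 0 1)) A (g' i)"
  and pq': "g' 0 (a' 0) = q" "g' (k' - 1) (b' (k' - 1)) = s"
  and link': "\<And>i. Suc i < k' ==> g' i (b' i) = g' (Suc i) (a' (Suc i))"
  using assms(2) unfolding disc_chain_lengths_def by blast
 define j where "j = (\<lambda>(u :: nat => complex) u' i. if i < k then u i else u' (i - k))"
 define G where "G = (\<lambda>i. if i < k then g i else g' (i - k))"
 have "(\<Sum>i<k + k'. poincare_dist (j a a' i) (j b b' i)) = x + y"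
 proof -
  have "(\<Sum>i<k + n. poincare_dist (j a a' i) (j b b' i)) = x + (\<Sum>i<n. poincare_dist (a' i) (b' i))" for n
   by (induction n) (simp_all add: x j_def)
  then show ?thesis by (simp add: y)
 qed
 moreover have "j a a' i \<in> ball 0 1 \<and> j b b' i \<in> ball 0 1 \<and> holomorphic_map (planar_atlas (ball 0 1)) A (G i)" if "i < k + k'" for i
  using h[of i] h'[of "i - k"] that by (auto simp: j_def G_def)
 moreover have "G i (j b b' i) = G (Suc i) (j a a' (Suc i))" if i: "Suc i < k + k'" for i
 proof -
  consider "Suc i < k" | "Suc i = k" | "i >= k" by linarith
  then show ?thesis
  proof cases
   case 1 then show ?thesis using link[of i] by (simp add: j_def G_def)
  next
   case 2
   then have "i = k - 1" "i < k" by auto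
   then show ?thesis using pq pq' 2 by (simp add: j_def G_def)
  next
   case 3
   then show ?thesis using link'[of "i - k"] i by (simp add: j_def G_def Suc_diff_le)
  qed
 qed
 moreover have "G 0 (j a a' 0) = p" "G (k + k' - 1) (j b b' (k + k' - 1)) = s"
  using pq pq' k k' by (auto simp: j_def G_def)
 ultimately show ?thesis
  unfolding disc_chain_lengths_def using k
  by (intro CollectI exI[of _ "k + k'"] exI[of _ "j a a'"] exI[of _ "j b b'"] exI[of _ G]) auto
qed

lemma disc_chain_nonneg: "x \<in> disc_chain_lengths A p q ==> x >= 0"
 unfolding disc_chain_lengths_def by (auto intro!: sum_nonneg poincare_dist_nonneg)

text \<open>Any quantity with the triangle inequality that is contracted by every disc is bounded by
  chain lengths. It is used for distances of iterates and for logarithms of level gaps.\<close>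

lemma disc_chain_bound:
 assumes "x \<in> disc_chain_lengths A p q"
  and disc: "\<And>g a b. a \<in> ball 0 1 ==> b \<in> ball 0 1 ==> holomorphic_map (planar_atlas (ball 0 1)) A g ==>
    D (g a) (g b) <= poincare_dist a b"
  and tri: "\<And>p q s. D p s <= D p q + D q (s :: 'a::topological_space)"
 shows "D p q <= x"
proof -
 obtain k a b g where k: "k >= 1" and x: "x = (\<Sum>i<k. poincare_dist (a i) (b i))"
  and h: "\<And>i. i < k ==> a i \<in> ball 0 1 \<and> b i \<in> ball 0 1 \<and> holomorphic_map (planar_atlas (ball 0 1)) A (g i)"
  and pq: "g 0 (a 0) = p" "g (k - 1) (b (k - 1)) = q"
  and link: "\<And>i. Suc i < k ==> g i (b i) = g (Suc i) (a (Suc i))"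
  using assms(1) unfolding disc_chain_lengths_def by blast
 have "n < k ==> D p (g n (b n)) <= (\<Sum>i<Suc n. poincare_dist (a i) (b i))" for n
 proof (induction n)
  case 0
  then show ?case using disc[of "a 0" "b 0" "g 0"] h[of 0] pq by simp
 next
  case (Suc n)
  then have "D p (g n (b n)) <= (\<Sum>i<Suc n. poincare_dist (a i) (b i))" by simp
  moreover have "D (g n (b n)) (g (Suc n) (b (Suc n))) <= poincare_dist (a (Suc n)) (b (Suc n))"
   using disc[of "a (Suc n)" "b (Suc n)" "g (Suc n)"] h[of "Suc n"] Suc.prems link[of n] by simp
  ultimately show ?case using tri[of p "g (Suc n) (b (Suc n))" "g n (b n)"] by simp
 qed
 from this[of "k - 1"] show ?thesis using k pq x by simp
qed

lemma hol_disc_compose: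
 assumes g: "hol_disc A g" and p: "p holomorphic_on B" "p ` B \<subseteq> A" "open B"
 shows "hol_disc B (\<lambda>z. g (p z))"
 unfolding hol_disc_def
proof
 fix a assume a: "a \<in> B"
 then have "p a \<in> A" using p(2) by blast
 then obtain r L where L: "r > 0" "hol_vec L (ball (p a) r)" "\<forall>z\<in>ball (p a) r. L z ~= 0 \<and> g z = proj (L z)"
  using g unfolding hol_disc_def by blast
 have "open (B \<inter> p -` ball (p a) r)"
  using holomorphic_on_imp_continuous_on[OF p(1)] p(3) by (intro continuous_open_preimage) auto
 moreover have "a \<in> B \<inter> p -` ball (p a) r" using a L(1) by simp
 ultimately obtain s where s: "s > 0" "ball a s \<subseteq> B \<inter> p -` ball (p a) r" by (rule openE)
 have "hol_vec (\<lambda>z. L (p z)) (ball a s)"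
  by (rule hol_vec_compose[OF L(2) holomorphic_on_subset[OF p(1)]]) (use s in auto)
 then show "\<exists>r>0. \<exists>L. ball a r \<subseteq> B \<and> hol_vec L (ball a r) \<and> (\<forall>z\<in>ball a r. L z ~= 0 \<and> g (p z) = proj (L z))"
  using s L(3) by (intro exI[of _ s] conjI exI[of _ "\<lambda>z. L (p z)"]) auto
qed

context lifted_map
begin

lemma small_connected_nhd:
 assumes "open S" "p \<in> (S :: cp2 set)"
 obtains e N where "e > 0" "connected N" "N \<subseteq> S" "ball p e \<subseteq> N"
proof -
 obtain x0 where x0: "norm x0 = 1" "p = proj x0" by (rule unit_lift)
 obtain e0 where e0: "e0 > 0" "ball p e0 \<subseteq> S" using assms by (rule openE)
 obtain r where r: "r > 0" "\<And>x. x \<in> ball x0 r ==> x ~= 0 \<and> proj x \<in> ball (proj x0) e0"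
  by (rule proj_ball_subset[OF x0(1) e0(1)]) (rule that)
 have "connected (proj ` ball x0 r)"
  by (intro connected_continuous_image continuous_on_subset[OF continuous_on_proj] connected_ball)
   (use r(2)[of 0] in auto)
 moreover have "proj ` ball x0 r \<subseteq> S" using r(2) e0(2) x0(2) by auto
 moreover have "ball p r \<subseteq> proj ` ball x0 r"
 proof
  fix q assume q: "q \<in> ball p r"
  obtain y where "norm y = 1" "q = proj y" "norm (x0 - y) <= dist (proj x0) q"
   by (rule aligned_lift[OF x0(1)])
  then show "q \<in> proj ` ball x0 r" using q x0(2) by (auto simp: dist_norm intro!: imageI)
 qed
 ultimately show ?thesis using that r(1) by blast
qed

lemma fatou_open: "open (fatou_set f)"
 unfolding fatou_set_def by (subst open_subopen) blast

text \<open>Near \<open>p\<close> the map \<open>f ^^ n\<close> lands so close to the image point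
  that the Lipschitz bound keeps all later iterates within distance 1;
  \<open>fatou_of_close_orbits\<close> concludes with shifted times.\<close>

lemma fatou_iter_preimage:
 assumes "(f ^^ n) p \<in> fatou_set f"
 shows "p \<in> fatou_set f"
proof -
 obtain e C where e: "e > 0" "equi_lipschitz_on (ball ((f ^^ n) p) e) C"
  by (rule fatou_lipschitz[OF assms])
 define e' where "e' = min e (1 / (\<bar>C\<bar> + 1))"
 have e': "e' > 0" using e(1) by (simp add: e'_def)
 have "isCont (f ^^ n) p" using continuous_on_f_iter[of UNIV n] by (simp add: continuous_on_eq_continuous_at)
 then obtain a where a: "a > 0" "\<And>q. dist q p < a ==> dist ((f ^^ n) q) ((f ^^ n) p) < e'"
  unfolding continuous_at_eps_delta using e' by blast
 show ?thesis
 proof (rule fatou_of_close_orbits[OF a(1) filterlim_add_const_nat_at_top[of n]])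
  fix q k assume "q \<in> ball p a"
  then have "dist q p < a" by (simp add: dist_commute)
  then have d: "dist ((f ^^ n) q) ((f ^^ n) p) < e'" by (rule a(2))
  then have "dist ((f ^^ k) ((f ^^ n) q)) ((f ^^ k) ((f ^^ n) p)) <= C * dist ((f ^^ n) q) ((f ^^ n) p)"
   using e unfolding equi_lipschitz_on_def e'_def by (simp add: dist_commute)
  also have "\<dots> <= \<bar>C\<bar> * dist ((f ^^ n) q) ((f ^^ n) p)" by (intro mult_right_mono) auto
  also have "\<dots> <= \<bar>C\<bar> * (1 / (\<bar>C\<bar> + 1))"
   using d unfolding e'_def by (intro mult_left_mono) auto
  also have "\<dots> <= 1" by (simp add: divide_le_eq)
  finally show "dist ((f ^^ (k + n)) q) ((f ^^ (k + n)) p) <= 1" by (simp add: funpow_add)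
 qed
qed

definition kob_const :: real where "kob_const = 24 * nbd\<^sup>2"

lemma kob_const_ge: "kob_const >= 24"
 using nbd_ge_1 one_le_power[of nbd 2] by (simp add: kob_const_def)

text \<open>A Moebius map moves \<open>a\<close> to the centre and \<open>b\<close> to a point of
  modulus \<open>pseudo_hyp a b\<close>. For modulus above \<open>1 / 4\<close> the diameter bound 2
  already suffices, and \<open>artanh_bounds\<close> passes to the Poincare distance.\<close>

lemma holomorphic_disc_iter_dist:
 assumes g: "hol_disc (ball 0 1) g" "g ` ball 0 1 \<subseteq> fatou_set f" and ab: "a \<in> ball 0 1" "b \<in> ball 0 1"
 shows "dist ((f ^^ n) (g a)) ((f ^^ n) (g b)) <= kob_const * poincare_dist a b"
proof -
 define \<mu> where "\<mu> = Moebius_function 0 (- a)"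
 define c where "c = Moebius_function 0 a b"
 have a1: "cmod (- a) < 1" "cmod a < 1" "cmod b < 1" using ab by auto
 have \<mu>: "\<mu> holomorphic_on ball 0 1" unfolding \<mu>_def by (rule Moebius_function_holomorphic[OF a1(1)])
 have ub: "\<mu> ` ball 0 1 \<subseteq> ball 0 1"
  unfolding \<mu>_def using Moebius_function_norm_lt_1[OF a1(1)] by auto
 have u0: "\<mu> 0 = a" by (simp add: \<mu>_def Moebius_function_of_zero)
 have uc: "\<mu> c = b" unfolding \<mu>_def c_def by (rule Moebius_function_compose) (use a1 in auto)
 have m: "cmod c = pseudo_hyp a b" by (simp add: c_def pseudo_hyp_Moebius)
 have h: "hol_disc (ball 0 1) (\<lambda>z. g (\<mu> z))" "(\<lambda>z. g (\<mu> z)) ` ball 0 1 \<subseteq> fatou_set f"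
  using hol_disc_compose[OF g(1) \<mu> ub open_ball] g(2) ub by auto
 have "dist ((f ^^ n) (g a)) ((f ^^ n) (g b)) <= kob_const * cmod c"
 proof (cases "cmod c <= 1/4")
  case True
  then show ?thesis using hol_disc_iter_dist[OF h True, of n] by (simp add: u0 uc kob_const_def)
 next
  case False
  have "dist ((f ^^ n) (g a)) ((f ^^ n) (g b)) <= 2" by (rule dist_cp2_le_2)
  also have "\<dots> <= 24 * cmod c" using False by simp
  also have "\<dots> <= kob_const * cmod c" using kob_const_ge by (intro mult_right_mono) auto
  finally show ?thesis .
 qed
 also have "\<dots> <= kob_const * poincare_dist a b"
  using artanh_bounds(1)[OF pseudo_hyp_nonneg pseudo_hyp_lt_1[OF ab]] kob_const_ge
  by (intro mult_left_mono) (auto simp: m poincare_dist_eq)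
 finally show ?thesis .
qed

end

section \<open>Fatou components and their Kobayashi distance\<close>

locale fatou_component = lifted_map +
 fixes \<Omega> :: "cp2 set"
 assumes comp: "\<Omega> \<in> components (fatou_set f)" and invariant: "f ` \<Omega> = \<Omega>"
begin

lemma comp_facts: "\<Omega> \<subseteq> fatou_set f" "connected \<Omega>" "\<Omega> ~= {}"
 using comp in_components_subset in_components_connected in_components_nonempty by blast+

lemma comp_closure:
 assumes "p \<in> closure \<Omega>" "p \<in> fatou_set f"
 shows "p \<in> \<Omega>"
proof -
 obtain e N where N: "e > 0" "connected N" "N \<subseteq> fatou_set f" "ball p e \<subseteq> N"
  by (rule small_connected_nhd[OF fatou_open assms(2)])
 obtain y where "y \<in> \<Omega>" "dist y p < e" using assms(1) N(1) closure_approachable by blast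
 then have "y \<in> \<Omega> \<inter> ball p e" by (simp add: dist_commute)
 then have "\<Omega> \<inter> N ~= {}" using N(4) by blast
 then have "N \<subseteq> \<Omega>" using components_maximal[OF comp N(2,3)] by blast
 moreover have "p \<in> ball p e" using N(1) by simp
 ultimately show ?thesis using N(4) by blast
qed

lemma comp_open: "open \<Omega>"
 unfolding open_subopen[of \<Omega>]
proof
 fix p assume p: "p \<in> \<Omega>"
 then have "p \<in> fatou_set f" using comp_facts(1) by blast
 then obtain e N where N: "e > 0" "connected N" "N \<subseteq> fatou_set f" "ball p e \<subseteq> N"
  by (rule small_connected_nhd[OF fatou_open])
 have "p \<in> ball p e" using N(1) by simp
 then have "\<Omega> \<inter> N ~= {}" using p N(4) by blast
 then have "N \<subseteq> \<Omega>" using components_maximal[OF comp N(2,3)] by blast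
 then show "\<exists>T. open T \<and> p \<in> T \<and> T \<subseteq> \<Omega>" using N by (intro exI[of _ "ball p e"]) auto
qed

lemma comp_iter: "z \<in> \<Omega> ==> (f ^^ n) z \<in> \<Omega>"
 using invariant by (induction n) auto

lemma chain_dist:
 assumes "x \<in> disc_chain_lengths (cp2_domain \<Omega>) p q"
 shows "dist ((f ^^ n) p) ((f ^^ n) q) <= kob_const * x"
proof -
 have k: "kob_const > 0" using kob_const_ge by simp
 have "dist ((f ^^ n) p) ((f ^^ n) q) / kob_const <= x"
 proof (rule disc_chain_bound[OF assms])
  fix g and a b :: complex assume ab: "a \<in> ball 0 1" "b \<in> ball 0 1"
   and g: "holomorphic_map (planar_atlas (ball 0 1)) (cp2_domain \<Omega>) g"
  have "dist ((f ^^ n) (g a)) ((f ^^ n) (g b)) <= kob_const * poincare_dist a b"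
   using holomorphic_map_imp_hol_disc[OF open_ball g] comp_facts(1)
   by (intro holomorphic_disc_iter_dist ab) auto
  then show "dist ((f ^^ n) (g a)) ((f ^^ n) (g b)) / kob_const <= poincare_dist a b"
   using k by (simp add: field_simps)
 next
  fix p q s
  show "dist ((f ^^ n) p) ((f ^^ n) s) / kob_const <= dist ((f ^^ n) p) ((f ^^ n) q) / kob_const + dist ((f ^^ n) q) ((f ^^ n) s) / kob_const"
   using k dist_triangle[of "(f ^^ n) p" "(f ^^ n) s" "(f ^^ n) q"]
   by (simp add: add_divide_distrib[symmetric] divide_right_mono)
 qed
 then show ?thesis using k by (simp add: field_simps)
qed

lemma short_chain:
 assumes p: "p \<in> \<Omega>" and a: "a > 0"
 shows "\<exists>e>0. \<forall>q\<in>ball p e. q \<in> \<Omega> \<and> (\<exists>x\<in>disc_chain_lengths (cp2_domain \<Omega>) p q. x < a)"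
proof -
 obtain x0 where x0: "norm x0 = 1" "p = proj x0" by (rule unit_lift)
 obtain e0 where e0: "e0 > 0" "ball p e0 \<subseteq> \<Omega>" using comp_open p by (rule openE)
 obtain r where r: "r > 0" "\<And>x. x \<in> ball x0 r ==> x ~= 0 \<and> proj x \<in> ball (proj x0) e0"
  by (rule proj_ball_subset[OF x0(1) e0(1)]) (rule that)
 \<comment> \<open>The disc below has direction vector of norm at most \<open>r\<close> and reaches
   \<open>y\<close> at parameter \<open>m\<close>. The first bound gives \<open>m <= 1/2\<close>, so
   the Poincare length is at most \<open>4 * m\<close>; the second makes this less than
   \<open>a\<close>.\<close>
 define e where "e = r * min (1/2) (a / 5)"
 have e: "e > 0" "e <= r / 2" "e <= r * (a / 5)"
  using r(1) a by (auto simp: e_def intro!: mult_left_mono)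
 show ?thesis
 proof (intro exI[of _ e] conjI ballI)
  fix q assume q: "q \<in> ball p e"
  obtain y where y: "norm y = 1" "q = proj y" "norm (x0 - y) <= dist (proj x0) q"
   by (rule aligned_lift[OF x0(1)])
  have yd: "norm (y - x0) < e" using y(3) q x0(2) by (simp add: norm_minus_commute)
  then have "y \<in> ball x0 r" using e(2) r(1) by (simp add: dist_norm norm_minus_commute)
  then show "q \<in> \<Omega>" using r(2) e0(2) x0(2) y(2) by auto
  define m where "m = norm (y - x0) / r"
  define w where "w = y - x0"
  define v where "v = (if w = 0 then 0 else of_real (r / norm w) *s w)"
  have v: "norm v <= r" using r(1) by (simp add: v_def norm_smult norm_divide)
  have m: "0 <= m" "m <= 1/2" "m < a / 5"
   using yd e r(1) by (auto simp: m_def field_simps)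
  have mv: "of_real m *s v = w" using r(1) by (simp add: v_def m_def flip: w_def)
  define L where "L = (\<lambda>z. x0 + z *s v)"
  have L: "hol_vec L (ball 0 1)" unfolding L_def by (intro hol_vec_add hol_vec_const hol_vec_id_scale)
  have Lb: "L z \<in> ball x0 r" if "z \<in> ball 0 1" for z
  proof -
   have "cmod z * norm v <= cmod z * r" using v by (intro mult_left_mono) auto
   also have "\<dots> < 1 * r" using that r(1) by (intro mult_strict_right_mono) auto
   finally show ?thesis by (simp add: L_def dist_norm norm_smult)
  qed
  have "hol_disc (ball 0 1) (\<lambda>z. proj (L z))" using L Lb r(2) by (intro hol_disc_lift) auto
  moreover have "(\<lambda>z. proj (L z)) ` ball 0 1 \<subseteq> \<Omega>" using Lb r(2) e0(2) x0(2) by auto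
  ultimately have h: "holomorphic_map (planar_atlas (ball 0 1)) (cp2_domain \<Omega>) (\<lambda>z. proj (L z))"
   by (rule hol_disc_imp_holomorphic_map[OF open_ball])
  have "poincare_dist 0 (of_real m) \<in> disc_chain_lengths (cp2_domain \<Omega>) (proj (L 0)) (proj (L (of_real m)))"
   by (rule disc_chain_single[OF _ _ h]) (use m in auto)
  moreover have "L (of_real m) = y" using mv by (simp add: L_def w_def)
  moreover have "L 0 = x0" by (simp add: L_def)
  moreover have "poincare_dist 0 (of_real m) < a"
  proof -
   have "poincare_dist 0 (of_real m) = 2 * artanh m" using m by (simp add: poincare_dist_def)
   also have "\<dots> <= 2 * m / (1 - m)" by (rule artanh_bounds) (use m in auto)
   also have "\<dots> <= 2 * m / (1/2)" using m by (intro divide_left_mono) auto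
   also have "\<dots> < a" using m a by simp
   finally show ?thesis .
  qed
  ultimately show "\<exists>x\<in>disc_chain_lengths (cp2_domain \<Omega>) p q. x < a" using x0(2) y(2) by metis
 qed (rule e(1))
qed

lemma chain_exists:
 assumes "p \<in> \<Omega>" "q \<in> \<Omega>"
 shows "disc_chain_lengths (cp2_domain \<Omega>) p q ~= {}"
proof -
 let ?dcl = "disc_chain_lengths (cp2_domain \<Omega>)"
 define S where "S = {q \<in> \<Omega>. ?dcl p q ~= {}}"
 have "openin (top_of_set \<Omega>) S"
  unfolding openin_contains_ball
 proof (intro conjI ballI)
  fix q assume "q \<in> S"
  then obtain x where q: "q \<in> \<Omega>" "x \<in> ?dcl p q" by (auto simp: S_def)
  obtain a where a: "a > 0" "\<And>s. s \<in> ball q a ==> s \<in> \<Omega> \<and> (\<exists>x\<in>?dcl q s. x < 1)"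
   using short_chain[OF q(1), of 1] by auto
  have "s \<in> S" if "s \<in> ball q a" for s
   using a(2)[OF that] disc_chain_trans[OF q(2)] by (auto simp: S_def)
  then show "\<exists>e>0. ball q e \<inter> \<Omega> \<subseteq> S" using a(1) by blast
 qed (auto simp: S_def)
 moreover have "openin (top_of_set \<Omega>) (\<Omega> - S)"
  unfolding openin_contains_ball
 proof (intro conjI ballI)
  fix q assume "q \<in> \<Omega> - S"
  then have q: "q \<in> \<Omega>" "?dcl p q = {}" by (auto simp: S_def)
  obtain a where a: "a > 0" "\<And>s. s \<in> ball q a ==> s \<in> \<Omega> \<and> (\<exists>x\<in>?dcl q s. x < 1)"
   using short_chain[OF q(1), of 1] by auto
  have "s \<in> \<Omega> - S" if s: "s \<in> ball q a" for s
  proof -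
   obtain x where x: "x \<in> ?dcl q s" using a(2)[OF s] by blast
   have "?dcl p s = {}"
   proof (rule ccontr)
    assume "?dcl p s ~= {}"
    then obtain y where "y \<in> ?dcl p s" by blast
    from disc_chain_trans[OF this disc_chain_sym[OF x]] show False using q(2) by blast
   qed
   then show ?thesis using a(2)[OF s] by (auto simp: S_def)
  qed
  then show "\<exists>e>0. ball q e \<inter> \<Omega> \<subseteq> \<Omega> - S" using a(1) by blast
 qed auto
 then have "closedin (top_of_set \<Omega>) S"
  unfolding closedin_def by (auto simp: S_def)
 ultimately have "S = {} \<or> S = \<Omega>"
  using comp_facts(2) unfolding connected_clopen by blast
 moreover have "p \<in> S"
 proof -
  obtain a where a: "a > 0" "\<And>s. s \<in> ball p a ==> s \<in> \<Omega> \<and> (\<exists>x\<in>?dcl p s. x < 1)"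
   using short_chain[OF assms(1), of 1] by auto
  have "p \<in> ball p a" using a(1) by simp
  from a(2)[OF this] show ?thesis by (auto simp: S_def)
 qed
 ultimately show ?thesis using assms(2) by (auto simp: S_def)
qed

abbreviation kob :: "cp2 => cp2 => real" where
 "kob \<equiv> kobayashi_dist (cp2_domain \<Omega>)"

lemma kob_eq: "p \<in> \<Omega> ==> q \<in> \<Omega> ==> kob p q = Inf (disc_chain_lengths (cp2_domain \<Omega>) p q)"
 by (simp add: kobayashi_dist_def carrier_cp2_domain)

lemma chain_bdd: "bdd_below (disc_chain_lengths (cp2_domain \<Omega>) p q)"
 by (rule bdd_belowI[of _ 0]) (rule disc_chain_nonneg)

lemma kob_le: "p \<in> \<Omega> ==> q \<in> \<Omega> ==> x \<in> disc_chain_lengths (cp2_domain \<Omega>) p q ==> kob p q <= x"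
 by (simp add: kob_eq cInf_lower chain_bdd)

lemma kob_less_chain:
 assumes "p \<in> \<Omega>" "q \<in> \<Omega>" "kob p q < e"
 obtains x where "x \<in> disc_chain_lengths (cp2_domain \<Omega>) p q" "x < e"
 using cInf_lessD[OF chain_exists[OF assms(1,2)], of e] assms kob_eq by auto

lemma kob_dist:
 assumes "p \<in> \<Omega>" "q \<in> \<Omega>"
 shows "dist ((f ^^ n) p) ((f ^^ n) q) <= kob_const * kob p q"
proof -
 have k: "kob_const > 0" using kob_const_ge by simp
 have "dist ((f ^^ n) p) ((f ^^ n) q) / kob_const <= kob p q"
  unfolding kob_eq[OF assms]
 proof (rule cInf_greatest[OF chain_exists[OF assms]])
  fix x assume "x \<in> disc_chain_lengths (cp2_domain \<Omega>) p q"
  from chain_dist[OF this, of n] show "dist ((f ^^ n) p) ((f ^^ n) q) / kob_const <= x"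
   using k by (simp add: field_simps)
 qed
 then show ?thesis using k by (simp add: field_simps)
qed

lemma kob_tendsto:
 assumes "p \<in> \<Omega>" "a > 0"
 shows "\<exists>e>0. \<forall>q\<in>ball p e. q \<in> \<Omega> \<and> kob p q < a"
proof -
 obtain e where e: "e > 0" "\<And>q. q \<in> ball p e ==> q \<in> \<Omega> \<and> (\<exists>x\<in>disc_chain_lengths (cp2_domain \<Omega>) p q. x < a)"
  using short_chain[OF assms] by blast
 have "q \<in> \<Omega> \<and> kob p q < a" if "q \<in> ball p e" for q
 proof -
  from e(2)[OF that] obtain x where x: "q \<in> \<Omega>" "x \<in> disc_chain_lengths (cp2_domain \<Omega>) p q" "x < a" by blast
  then show ?thesis using kob_le[OF assms(1) x(1,2)] by simp
 qed
 then show ?thesis using e(1) by blast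
qed

lemma kob_sym: "kob p q = kob q p"
proof -
 have "disc_chain_lengths (cp2_domain \<Omega>) p q = disc_chain_lengths (cp2_domain \<Omega>) q p"
  using disc_chain_sym by blast
 then show ?thesis by (auto simp: kobayashi_dist_def)
qed

text \<open>Separation of points is \<open>kob_dist\<close> at time 0; hyperbolicity thus comes out
  of the same estimate for lifted discs.\<close>

lemma kobayashi_hyperbolic_comp: "Metric_space \<Omega> kob"
proof
 fix p q
 show "0 <= kob p q"
 proof (cases "p \<in> \<Omega> \<and> q \<in> \<Omega>")
  case True
  then have "0 <= Inf (disc_chain_lengths (cp2_domain \<Omega>) p q)"
   by (intro cInf_greatest[OF chain_exists]) (auto intro: disc_chain_nonneg)
  then show ?thesis using True by (simp add: kob_eq)
 qed (auto simp: kobayashi_dist_def carrier_cp2_domain)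
 show "kob p q = kob q p" by (rule kob_sym)
next
 fix p q assume pq: "p \<in> \<Omega>" "q \<in> \<Omega>"
 show "kob p q = 0 \<longleftrightarrow> p = q"
 proof
  assume "kob p q = 0"
  then show "p = q" using kob_dist[OF pq, of 0] by simp
 next
  assume "p = q"
  show "kob p q = 0"
  proof (rule antisym)
   show "kob p q <= 0"
   proof (rule field_le_epsilon)
    fix e :: real assume "e > 0"
    then obtain a where "a > 0" "\<forall>q\<in>ball p a. q \<in> \<Omega> \<and> kob p q < e" using kob_tendsto[OF pq(1)] by blast
    then show "kob p q <= 0 + e" using \<open>p = q\<close> by (auto intro: less_imp_le)
   qed
   show "0 <= kob p q" unfolding kob_eq[OF pq]
    by (rule cInf_greatest[OF chain_exists[OF pq]]) (rule disc_chain_nonneg)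
  qed
 qed
next
 fix p q s assume pqs: "p \<in> \<Omega>" "q \<in> \<Omega>" "s \<in> \<Omega>"
 show "kob p s <= kob p q + kob q s"
 proof (rule field_le_epsilon)
  fix e :: real assume "e > 0"
  then have e: "kob p q < kob p q + e / 2" "kob q s < kob q s + e / 2" by auto
  obtain x where x: "x \<in> disc_chain_lengths (cp2_domain \<Omega>) p q" "x < kob p q + e/2"
   by (rule kob_less_chain[OF pqs(1,2) e(1)])
  obtain y where y: "y \<in> disc_chain_lengths (cp2_domain \<Omega>) q s" "y < kob q s + e/2"
   by (rule kob_less_chain[OF pqs(2,3) e(2)])
  have "kob p s <= x + y" by (rule kob_le[OF pqs(1,3) disc_chain_trans[OF x(1) y(1)]])
  then show "kob p s <= kob p q + kob q s + e" using x y by linarith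
 qed
qed

text \<open>A Cauchy sequence with a convergent subsequence converges, and by
  \<open>kob_tendsto\<close> convergence in the plane to a point of \<open>\<Omega>\<close> implies
  convergence for \<open>kob\<close>. Only a limit point inside \<open>\<Omega>\<close> has to be
  found.\<close>

lemma kobayashi_complete_compI:
 assumes "\<And>s. range s \<subseteq> \<Omega> ==> (\<And>a. a > 0 ==> \<exists>N. \<forall>m n. m >= N --> n >= N --> kob (s m) (s n) < a) ==>
  \<exists>p\<in>\<Omega>. \<exists>r. strict_mono (r :: nat => nat) \<and> (\<lambda>n. s (r n)) \<longlonglongrightarrow> p"
 shows "kobayashi_complete (cp2_domain \<Omega>)"
proof -
 interpret M: Metric_space \<Omega> kob by (rule kobayashi_hyperbolic_comp)
 have "M.mcomplete"
  unfolding M.mcomplete_def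
 proof (intro allI impI)
  fix s assume s: "M.MCauchy s"
  then obtain p r where p: "p \<in> \<Omega>" "strict_mono (r :: nat => nat)" "(\<lambda>n. s (r n)) \<longlonglongrightarrow> p"
   using assms[of s] unfolding M.MCauchy_def by blast
  have "limitin M.mtopology (s \<circ> r) p sequentially"
   unfolding M.limit_metric_sequentially
  proof (intro conjI allI impI p(1))
   fix a :: real assume "a > 0"
   then obtain e where e: "e > 0" "\<forall>q\<in>ball p e. q \<in> \<Omega> \<and> kob p q < a" using kob_tendsto[OF p(1)] by blast
   obtain N where N: "\<forall>n\<ge>N. dist (s (r n)) p < e" using p(3) e(1) unfolding lim_sequentially by blast
   have "(s \<circ> r) n \<in> \<Omega> \<and> kob ((s \<circ> r) n) p < a" if "n >= N" for n
   proof -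
    have "s (r n) \<in> ball p e" using N that by (simp add: dist_commute)
    then show ?thesis using e(2) by (simp add: kob_sym[of _ p])
   qed
   then show "\<exists>N. \<forall>n\<ge>N. (s \<circ> r) n \<in> \<Omega> \<and> kob ((s \<circ> r) n) p < a" by blast
  qed
  from M.MCauchy_convergent_subsequence[OF s p(2) this]
  show "\<exists>x. limitin M.mtopology s x sequentially" by blast
 qed
 then show ?thesis
  unfolding kobayashi_complete_def kobayashi_hyperbolic_def carrier_cp2_domain
  using M.Metric_space_axioms by simp
qed

end

section \<open>Decay of the Jacobian near the attracting curve\<close>

lemma norm_deriv_le:
 assumes "h holomorphic_on ball a r" "0 < r" "\<And>z. z \<in> ball a r ==> cmod (h z) <= B"
 shows "cmod (deriv h a) <= B / r"
proof -
 have n: "norm (vec c :: complex^1) = cmod c" for c by (simp add: norm_vec_def L2_set_def)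
 have "norm (vderiv (\<lambda>z. vec (h z) :: complex^1) a) <= real CARD(1) * (B / r)"
  by (rule norm_vderiv_le) (use assms n in \<open>auto simp: hol_vec_def\<close>)
 moreover have "vderiv (\<lambda>z. vec (h z) :: complex^1) a = vec (deriv h a)" by (simp add: vec_eq_iff)
 ultimately show ?thesis by (simp add: n)
qed

lemma vderiv_scale:
 assumes "u holomorphic_on A" "hol_vec L A" "open A" "z \<in> A"
 shows "vderiv (\<lambda>w. u w *s L w) z = deriv u z *s L z + u z *s vderiv L z"
proof -
 have "deriv (\<lambda>w. u w * L w $ i) z = deriv u z * L z $ i + u z * deriv (\<lambda>w. L w $ i) z" for i
  using assms holomorphic_on_imp_differentiable_at[OF assms(1,3,4)]
   holomorphic_on_imp_differentiable_at[OF hol_vecD[OF assms(2)] assms(3,4)]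
  by (simp add: deriv_mult mult.commute)
 then show ?thesis by (simp add: vec_eq_iff)
qed

text \<open>Take the two axes complementary to a coordinate of \<open>x\<close> of modulus at least
  \<open>norm x / 3\<close>; the determinant is that coordinate up to sign.\<close>

lemma large_det3_axis:
 fixes x :: "complex^3"
 obtains i j where "cmod (det3 x (axis i 1) (axis j 1)) >= norm x / 3"
proof -
 have "norm x <= cmod (x $ 1) + cmod (x $ 2) + cmod (x $ 3)"
  using norm_vec_le_sum[of x] by (simp add: sum_3)
 then consider "cmod (x $ 1) >= norm x / 3" | "cmod (x $ 2) >= norm x / 3" | "cmod (x $ 3) >= norm x / 3" by linarith
 then show ?thesis
 proof cases
  case 1 then show ?thesis by (intro that[of 2 3]) (simp add: det3_def axis_def)
 next
  case 2 then show ?thesis by (intro that[of 1 3]) (simp add: det3_def axis_def)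
 next
  case 3 then show ?thesis by (intro that[of 1 2]) (simp add: det3_def axis_def)
 qed
qed

context lifted_map
begin

definition normalized :: "complex^3 => bool" where
 "normalized x \<longleftrightarrow> x ~= 0 \<and> green x = 0"

lemma normalized_iter: "normalized x ==> normalized ((F ^^ n) x)"
 by (simp add: normalized_def iter_zero green_iter)

lemma normalized_bounds: "normalized x ==> norm x <= nbd" "normalized x ==> norm x >= 1 / nbd"
 using norm_iter_bounds[of x 0] by (auto simp: normalized_def)

lemma nlift_normalized: "nlift L A ==> z \<in> A ==> normalized (L z)"
 by (simp add: nlift_def normalized_def)

lemma normalized_closed:
 assumes "\<And>n. normalized (X n)" "X \<longlonglongrightarrow> x"
 shows "normalized x"
proof -
 have "norm x >= 1 / nbd"
  using tendsto_norm[OF assms(2)] normalized_bounds(2)[OF assms(1)] by (intro tendsto_lowerbound) auto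
 then have x0: "x ~= 0" using nbd_ge_1 by auto
 have "(\<lambda>n. green (X n)) \<longlonglongrightarrow> green x"
  using continuous_on_tendsto_compose[OF continuous_on_green assms(2)] assms(1) x0 by (simp add: normalized_def)
 moreover have "(\<lambda>n. green (X n)) = (\<lambda>n. 0)" using assms(1) by (simp add: normalized_def)
 ultimately have "green x = 0" using LIMSEQ_unique tendsto_const by metis
 then show ?thesis using x0 by (simp add: normalized_def)
qed

lemma normalized_subseq:
 assumes "\<And>n. normalized (X n)"
 obtains r x where "strict_mono (r :: nat => nat)" "(\<lambda>n. X (r n)) \<longlonglongrightarrow> x" "normalized x"
proof -
 have "compact (cball (0::complex^3) nbd)" by simp
 moreover have "\<forall>n. X n \<in> cball 0 nbd" using normalized_bounds(1)[OF assms] by simp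
 ultimately obtain x r where r: "strict_mono (r :: nat => nat)" "(X \<circ> r) \<longlonglongrightarrow> x"
  unfolding compact_def by blast
 then have lim: "(\<lambda>n. X (r n)) \<longlonglongrightarrow> x" by (simp add: o_def)
 moreover have "normalized x" by (rule normalized_closed[OF _ lim]) (rule assms)
 ultimately show ?thesis using that r(1) by blast
qed

lemma tendsto_proj: "X \<longlonglongrightarrow> x ==> x ~= 0 ==> (\<And>n. X n ~= 0) ==> (\<lambda>n. proj (X n)) \<longlonglongrightarrow> proj x"
 by (rule continuous_on_tendsto_compose[OF continuous_on_proj]) (auto intro: always_eventually)

text \<open>Normalized vectors have norm at least \<open>1 / nbd\<close>. A shift by less than this
  radius along an axis therefore keeps them nonzero and moves the line by less than
  \<open>e / 2\<close>.\<close>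

definition probe_radius :: "real => real" where
 "probe_radius e = min e 1 / (4 * nbd)"

text \<open>A normalized disc through \<open>x\<close> in a coordinate direction. Normalizing
  changes the derivative by a multiple of \<open>x\<close>, which does not affect determinants
  containing \<open>x\<close>, as \<open>probe_det3\<close> exploits.\<close>

lemma probe:
 assumes e: "e > 0" "green_harmonic_on (ball p e)" and x: "normalized x" "proj x \<in> ball p (e/2)"
 obtains T b where "nlift T (ball 0 (probe_radius e))" "T 0 = x" "vderiv T 0 = axis i 1 + b *s x"
  "\<And>a. a \<in> ball 0 (probe_radius e) ==> proj (T a) \<in> ball p e"
proof -
 let ?r = "probe_radius e"
 have r: "?r > 0" using e nbd_ge_1 by (simp add: probe_radius_def)
 have x0: "x ~= 0" using x(1) by (simp add: normalized_def)
 define L where "L = (\<lambda>a. x + a *s axis i 1)"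
 have L: "hol_vec L (ball 0 ?r)" unfolding L_def by (intro hol_vec_add hol_vec_const hol_vec_id_scale)
 have Lb: "L a ~= 0" "proj (L a) \<in> ball p e" if "a \<in> ball 0 ?r" for a
 proof -
  have z: "cmod a * (4 * nbd) < min e 1"
   using that nbd_ge_1 by (simp add: probe_radius_def less_divide_eq)
  have n: "norm (x - L a) = cmod a" by (simp add: L_def norm_smult norm_axis_1)
  have nx: "norm x >= 1 / nbd" by (rule normalized_bounds(2)[OF x(1)])
  then have nx': "norm x * nbd >= 1" using nbd_ge_1 by (simp add: field_simps)
  have "cmod a * nbd < 1" using z nbd_ge_1 zero_le_mult_iff[of "cmod a" nbd] by linarith
  then have "cmod a * nbd < norm x * nbd" using nx' by linarith
  then have "cmod a < norm x" using nbd_ge_1 by simp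
  then show L0: "L a ~= 0" using n by auto
  have "dist (proj x) (proj (L a)) <= 2 * cmod a / norm x" using dist_proj_le[OF x0 L0] n by simp
  also have "\<dots> <= 2 * cmod a / (1 / nbd)" using nx nbd_ge_1 x0 by (intro divide_left_mono) auto
  also have "\<dots> < e / 2" using z nbd_ge_1 by (simp add: mult_ac)
  finally have "dist p (proj (L a)) < e" using x(2) dist_triangle[of p "proj (L a)" "proj x"] by simp
  then show "proj (L a) \<in> ball p e" by simp
 qed
 obtain q where q: "q holomorphic_on ball 0 ?r" "\<And>z. z \<in> ball 0 ?r ==> cmod (q z) = exp (green (L z))"
  "nlift (\<lambda>z. inverse (q z) *s L z) (ball 0 ?r)"
  "\<And>z. z \<in> ball 0 ?r ==> proj (inverse (q z) *s L z) = proj (L z)"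
  by (rule green_harmonic_nlift[OF e(2) r L Lb]) (assumption, assumption, rule that)
 have in0: "0 \<in> ball 0 ?r" using r by simp
 have "cmod (q 0) = 1" using q(2)[OF in0] x(1) by (simp add: L_def normalized_def)
 then have q0: "q 0 ~= 0" by auto
 have qz: "q z ~= 0" if "z \<in> ball 0 ?r" for z using q(2)[OF that] by auto
 define u where "u = (\<lambda>z. q 0 * inverse (q z))"
 have u: "u holomorphic_on ball 0 ?r" "u 0 = 1"
  unfolding u_def using q(1) qz q0 by (auto intro!: holomorphic_intros)
 define T where "T = (\<lambda>z. u z *s L z)"
 have Teq: "T = (\<lambda>z. q 0 *s (inverse (q z) *s L z))" by (simp add: T_def u_def)
 show ?thesis
 proof (rule that)
  show "nlift T (ball 0 ?r)" unfolding Teq by (rule nlift_smult[OF q(3)]) fact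
  show "T 0 = x" by (simp add: T_def u(2) L_def)
  have "vderiv L 0 = axis i 1"
   unfolding L_def vec_eq_iff by (auto intro!: DERIV_imp_deriv derivative_eq_intros)
  then have "vderiv T 0 = deriv u 0 *s x + axis i 1"
   unfolding T_def using vderiv_scale[OF u(1) L open_ball in0] by (simp add: u(2)) (simp add: L_def)
  then show "vderiv T 0 = axis i 1 + deriv u 0 *s x" by (simp add: add.commute)
  show "proj (T a) \<in> ball p e" if "a \<in> ball 0 ?r" for a
  proof -
   have "u a ~= 0" using qz[OF that] q0 by (simp add: u_def)
   then have "proj (T a) = proj (L a)" unfolding T_def using Lb(1)[OF that] by (rule proj_smult)
   then show ?thesis using Lb(2)[OF that] by simp
  qed
 qed
qed

lemma probe_ex:
 assumes "e > 0" "green_harmonic_on (ball p e)" "normalized x" "proj x \<in> ball p (e/2)"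
 shows "\<exists>T b. nlift T (ball 0 (probe_radius e)) \<and> T 0 = x \<and> vderiv T 0 = axis i 1 + b *s x \<and>
  (\<forall>z\<in>ball 0 (probe_radius e). proj (T z) \<in> ball p e)"
proof (rule probe[OF assms, of i])
 fix T b
 assume "nlift T (ball 0 (probe_radius e))" "T 0 = x" "vderiv T 0 = axis i 1 + b *s x"
  "\<And>z. z \<in> ball 0 (probe_radius e) ==> proj (T z) \<in> ball p e"
 then show ?thesis by (intro exI conjI ballI)
qed

lemma probe_det3:
 assumes "nlift T1 (ball 0 r)" "nlift T2 (ball 0 r)" "r > 0" "T1 0 = x" "T2 0 = x"
  "vderiv T1 0 = axis i 1 + b1 *s x" "vderiv T2 0 = axis j 1 + b2 *s x"
 shows "det3 ((F ^^ n) x) (vderiv (\<lambda>z. (F ^^ n) (T1 z)) 0) (vderiv (\<lambda>z. (F ^^ n) (T2 z)) 0)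
  = jac_iter n x * det3 x (axis i 1) (axis j 1)"
proof -
 have h: "hol_vec T1 (ball 0 r)" "hol_vec T2 (ball 0 r)" using assms by (auto simp: nlift_def)
 have "vderiv (\<lambda>z. (F ^^ n) (T1 z)) 0 = cderiv (F ^^ n) x (axis i 1 + b1 *s x)"
  using vderiv_polymap[OF polymap_iter h(1) open_ball, of 0 n] assms by simp
 moreover have "vderiv (\<lambda>z. (F ^^ n) (T2 z)) 0 = cderiv (F ^^ n) x (axis j 1 + b2 *s x)"
  using vderiv_polymap[OF polymap_iter h(2) open_ball, of 0 n] assms by simp
 ultimately show ?thesis by (simp add: det3_cderiv_iter det3_simps)
qed

text \<open>The images of two transverse probes are bounded by \<open>nbd\<close>, so Cauchy's
  estimate bounds the determinant of their derivatives. By \<open>probe_det3\<close> it equals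
  \<open>jac_iter n x\<close> times a quantity bounded below.\<close>

lemma jac_iter_bounded:
 assumes "p \<in> fatou_set f"
 obtains e C where "e > 0" "\<And>x n. normalized x ==> proj x \<in> ball p e ==> cmod (jac_iter n x) <= C"
proof -
 obtain e where e: "e > 0" "green_harmonic_on (ball p e)" using fatou_green_harmonic[OF assms] by blast
 define r where "r = probe_radius e"
 have r: "r > 0" using e nbd_ge_1 by (simp add: r_def probe_radius_def)
 define C where "C = 18 * nbd * nbd * (3 * (nbd / r)) * (3 * (nbd / r))"
 show ?thesis
 proof (rule that[of "e/2" C])
  fix x n assume x: "normalized x" "proj x \<in> ball p (e/2)"
  obtain i j where ij: "cmod (det3 x (axis i 1) (axis j 1)) >= norm x / 3" by (rule large_det3_axis)
  obtain T1 b1 where T1: "nlift T1 (ball 0 r)" "T1 0 = x" "vderiv T1 0 = axis i 1 + b1 *s x"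
   using probe_ex[OF e x, of i] unfolding r_def by blast
  obtain T2 b2 where T2: "nlift T2 (ball 0 r)" "T2 0 = x" "vderiv T2 0 = axis j 1 + b2 *s x"
   using probe_ex[OF e x, of j] unfolding r_def by blast
  have bd: "norm (vderiv (\<lambda>z. (F ^^ n) (T z)) 0) <= 3 * (nbd / r)" if T: "nlift T (ball 0 r)" for T
   using norm_vderiv_le[of "\<lambda>z. (F ^^ n) (T z)" 0 r nbd] nlift_iter[OF T, of n] r
    normalized_bounds(1)[OF nlift_normalized[OF nlift_iter[OF T, of n]]]
   by (simp add: nlift_def)
  have "cmod (jac_iter n x) * (1 / nbd / 3) <= cmod (jac_iter n x) * cmod (det3 x (axis i 1) (axis j 1))"
   using ij normalized_bounds(2)[OF x(1)] by (intro mult_left_mono) auto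
  also have "\<dots> = cmod (det3 ((F ^^ n) x) (vderiv (\<lambda>z. (F ^^ n) (T1 z)) 0) (vderiv (\<lambda>z. (F ^^ n) (T2 z)) 0))"
   using probe_det3[OF T1(1) T2(1) r T1(2) T2(2) T1(3) T2(3), of n] by (simp add: norm_mult)
  also have "\<dots> <= 6 * norm ((F ^^ n) x) * norm (vderiv (\<lambda>z. (F ^^ n) (T1 z)) 0) * norm (vderiv (\<lambda>z. (F ^^ n) (T2 z)) 0)"
   by (rule norm_det3_le)
  also have "\<dots> <= 6 * nbd * (3 * (nbd / r)) * (3 * (nbd / r))"
   using bd[OF T1(1)] bd[OF T2(1)] normalized_bounds(1)[OF normalized_iter[OF x(1)]] nbd_ge_1 r
   by (intro mult_mono) auto
  finally have "cmod (jac_iter n x) * (1 / nbd / 3) * (3 * nbd) <= 6 * nbd * (3 * (nbd / r)) * (3 * (nbd / r)) * (3 * nbd)"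
   using nbd_ge_1 by (intro mult_right_mono) auto
  then show "cmod (jac_iter n x) <= C" using nbd_ge_1 by (simp add: C_def mult_ac)
 qed (use e in simp)
qed

end

locale attracting_curve = fatou_component +
 fixes \<Sigma> :: "cp2 set"
 assumes \<Sigma>_sub: "\<Sigma> \<subseteq> \<Omega>" and \<Sigma>_ne: "\<Sigma> ~= {}" and \<Sigma>_curve: "closed_complex_curve (cp2_domain \<Omega>) \<Sigma>"
  and attract: "\<And>K. compact K ==> K ~= {} ==> K \<subseteq> \<Omega> ==> (\<lambda>n. SUP z\<in>K. infdist ((f ^^ n) z) \<Sigma>) \<longlonglongrightarrow> 0"
begin

lemma \<Sigma>_closed: "c \<in> \<Omega> ==> c \<in> closure \<Sigma> ==> c \<in> \<Sigma>"
 using \<Sigma>_curve \<Sigma>_sub unfolding closed_complex_curve_def carrier_cp2_domain closedin_limpt closure_def by blast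

text \<open>Attraction forces the limit to have distance 0 from \<open>\<Sigma>\<close>. As
  \<open>\<Sigma>\<close> is closed only relative to \<open>\<Omega>\<close>, it must be known
  beforehand that the limit lies in \<open>\<Omega>\<close>.\<close>

lemma attract_limit:
 assumes K: "compact K" "K \<subseteq> \<Omega>" and z: "\<And>k. z k \<in> K" and n: "filterlim n at_top sequentially"
  and lim: "(\<lambda>k. (f ^^ n k) (z k)) \<longlonglongrightarrow> c" and c: "c \<in> \<Omega>"
 shows "c \<in> \<Sigma>"
proof (rule \<Sigma>_closed[OF c])
 obtain a where a: "a \<in> \<Sigma>" using \<Sigma>_ne by blast
 have K0: "K ~= {}" using z by blast
 have bdd: "bdd_above ((\<lambda>z. infdist ((f ^^ m) z) \<Sigma>) ` K)" for m
  by (intro bdd_aboveI2[of _ _ 2]) (rule order_trans[OF infdist_le[OF a] dist_cp2_le_2])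
 have le: "infdist ((f ^^ n k) (z k)) \<Sigma> <= (SUP z\<in>K. infdist ((f ^^ n k) z) \<Sigma>)" for k
  by (rule cSUP_upper[OF z bdd])
 have "(\<lambda>k. SUP z\<in>K. infdist ((f ^^ n k) z) \<Sigma>) \<longlonglongrightarrow> 0"
  using filterlim_compose[OF attract[OF K(1) K0 K(2)] n] .
 then have "(\<lambda>k. infdist ((f ^^ n k) (z k)) \<Sigma>) \<longlonglongrightarrow> 0"
  by (rule Lim_null_comparison[rotated]) (intro always_eventually allI, simp add: le infdist_nonneg)
 moreover have "(\<lambda>k. infdist ((f ^^ n k) (z k)) \<Sigma>) \<longlonglongrightarrow> infdist c \<Sigma>"
  by (rule tendsto_infdist[OF lim])
 ultimately have "infdist c \<Sigma> = 0" by (rule LIMSEQ_unique[rotated])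
 then show "c \<in> closure \<Sigma>" using \<Sigma>_ne by (simp add: in_closure_iff_infdist_zero)
qed

end

section \<open>Zero-free majorants and Harnack's inequality\<close>

lemma blaschke_identity:
 fixes s :: real
 shows "(cmod (of_real (s\<^sup>2) - cnj c * z))\<^sup>2 - s\<^sup>2 * (cmod (z - c))\<^sup>2 = (s\<^sup>2 - (cmod c)\<^sup>2) * (s\<^sup>2 - (cmod z)\<^sup>2)"
 unfolding cmod_power2 by (simp add: power2_eq_square algebra_simps)

lemma blaschke_factor:
 assumes s: "s > 0" and c: "cmod c < s"
 shows "cmod z < s ==> of_real (s\<^sup>2) - cnj c * z ~= 0"
  "cmod z = s ==> cmod ((of_real (s\<^sup>2) - cnj c * z) / of_real s) = cmod (z - c)"
  "cmod z <= s ==> cmod (z - c) <= cmod ((of_real (s\<^sup>2) - cnj c * z) / of_real s)"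
proof -
 have c2: "(cmod c)\<^sup>2 < s\<^sup>2" using c by (intro power_strict_mono) auto
 show "of_real (s\<^sup>2) - cnj c * z ~= 0" if "cmod z < s"
 proof
  assume 0: "of_real (s\<^sup>2) - cnj c * z = 0"
  have "(cmod z)\<^sup>2 < s\<^sup>2" using that by (intro power_strict_mono) auto
  then have "(s\<^sup>2 - (cmod c)\<^sup>2) * (s\<^sup>2 - (cmod z)\<^sup>2) > 0" using c2 by simp
  moreover have "s\<^sup>2 * (cmod (z - c))\<^sup>2 >= 0" by simp
  moreover have "- (s\<^sup>2 * (cmod (z - c))\<^sup>2) = (s\<^sup>2 - (cmod c)\<^sup>2) * (s\<^sup>2 - (cmod z)\<^sup>2)"
   using blaschke_identity[of s c z] unfolding 0 by simp
  ultimately show False by linarith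
 qed
 have eq: "cmod ((of_real (s\<^sup>2) - cnj c * z) / of_real s) = cmod (of_real (s\<^sup>2) - cnj c * z) / s"
  using s by (simp add: norm_divide)
 show "cmod ((of_real (s\<^sup>2) - cnj c * z) / of_real s) = cmod (z - c)" if "cmod z = s"
 proof -
  have "(cmod (of_real (s\<^sup>2) - cnj c * z))\<^sup>2 = (s * cmod (z - c))\<^sup>2"
   using blaschke_identity[of s c z] that by (simp add: power_mult_distrib)
  then have "cmod (of_real (s\<^sup>2) - cnj c * z) = s * cmod (z - c)"
   by (rule power2_eq_imp_eq) (use s in auto)
  then show ?thesis unfolding eq using s by simp
 qed
 show "cmod (z - c) <= cmod ((of_real (s\<^sup>2) - cnj c * z) / of_real s)" if "cmod z <= s"
 proof -
  have "(cmod z)\<^sup>2 <= s\<^sup>2" using that by (intro power_mono) auto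
  then have "(s\<^sup>2 - (cmod c)\<^sup>2) * (s\<^sup>2 - (cmod z)\<^sup>2) >= 0" using c2 by simp
  then have "(s * cmod (z - c))\<^sup>2 <= (cmod (of_real (s\<^sup>2) - cnj c * z))\<^sup>2"
   using blaschke_identity[of s c z] by (simp add: power_mult_distrib)
  then have "s * cmod (z - c) <= cmod (of_real (s\<^sup>2) - cnj c * z)" by (rule power2_le_imp_le) simp
  then show ?thesis unfolding eq using s by (simp add: field_simps)
 qed
qed

lemma holomorphic_remove_zero:
 assumes q: "q holomorphic_on ball a R" "c \<in> ball a R" "q c = 0" "\<not> q constant_on ball a R"
 obtains g n where "g holomorphic_on ball a R" "(n::nat) > 0" "\<And>z. z \<in> ball a R ==> q z = (z - c) ^ n * g z" "g c ~= 0"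
proof (rule holomorphic_factor_zero_nonconstant[OF q(1) open_ball connected_ball q(2-4)])
 fix g0 r n
 assume *: "0 < (n::nat)" "0 < r" "ball c r \<subseteq> ball a R" "g0 holomorphic_on ball c r"
  "\<And>w. w \<in> ball c r ==> q w = (w - c) ^ n * g0 w" "\<And>w. w \<in> ball c r ==> g0 w ~= 0"
 define g where "g = (\<lambda>z. if z = c then g0 c else q z / (z - c) ^ n)"
 have eq: "g z = g0 z" if "z \<in> ball c r" for z using *(5)[OF that] by (simp add: g_def)
 have "g holomorphic_on ball c r" using *(4) by (rule holomorphic_transform) (simp add: eq)
 moreover have "g holomorphic_on (ball a R - {c})"
 proof (rule holomorphic_transform)
  show "(\<lambda>z. q z / (z - c) ^ n) holomorphic_on (ball a R - {c})"
   by (intro holomorphic_intros holomorphic_on_subset[OF q(1)]) auto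
 qed (simp add: g_def)
 ultimately have "g holomorphic_on (ball c r \<union> (ball a R - {c}))" by (rule holomorphic_on_Un) auto
 moreover have "ball c r \<union> (ball a R - {c}) = ball a R" using *(2,3) by auto
 ultimately have 1: "g holomorphic_on ball a R" by simp
 have 2: "q z = (z - c) ^ n * g z" if "z \<in> ball a R" for z
  using q(3) *(1) by (simp add: g_def)
 have "g0 c ~= 0" by (rule *(6)) (use *(2) in simp)
 then have 3: "g c ~= 0" by (simp add: g_def)
 show thesis by (rule that[OF 1 *(1) _ 3]) (rule 2)
qed

text \<open>Induction on the number of zeros in the open disc. Each factor \<open>z - c\<close> is
  traded for the denominator of the corresponding Blaschke factor, which has the same modulus on the
  circle, a larger one inside, and no zeros in the open disc.\<close>

lemma zero_free_majorant:
 assumes "q holomorphic_on ball a R" "0 < s" "s < R" "\<exists>z\<in>ball a R. q z ~= 0"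
 shows "\<exists>u. u holomorphic_on ball a R \<and> (\<forall>z\<in>ball a s. u z ~= 0) \<and>
  (\<forall>z\<in>sphere a s. cmod (u z) = cmod (q z)) \<and> (\<forall>z\<in>cball a s. cmod (q z) <= cmod (u z))"
 using assms
proof (induction "card {z \<in> ball a s. q z = 0}" arbitrary: q rule: less_induct)
 case less
 show ?case
 proof (cases "{z \<in> ball a s. q z = 0} = {}")
  case True
  then show ?thesis using less.prems(1) by (intro exI[of _ q]) auto
 next
  case False
  then obtain c where c: "c \<in> ball a s" "q c = 0" by blast
  have cR: "c \<in> ball a R" using c less.prems(3) by auto
  have nc: "\<not> q constant_on ball a R"
  proof
   assume "q constant_on ball a R"
   then obtain w where "\<forall>x\<in>ball a R. q x = w" unfolding constant_on_def by blast
   then show False using c(2) cR less.prems(4) by metis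
  qed
  obtain g n where g: "g holomorphic_on ball a R" "(n::nat) > 0" "\<And>z. z \<in> ball a R ==> q z = (z - c) ^ n * g z" "g c ~= 0"
   by (rule holomorphic_remove_zero[OF less.prems(1) cR c(2) nc]) (rule that)
  define b where "b = (\<lambda>z. (of_real (s\<^sup>2) - cnj (c - a) * (z - a)) / of_real s)"
  define q1 where "q1 = (\<lambda>z. b z ^ n * g z)"
  have q1h: "q1 holomorphic_on ball a R"
   unfolding q1_def b_def using less.prems(2) by (intro holomorphic_intros g(1)) auto
  have ca: "cmod (c - a) < s" using c(1) by (simp add: dist_norm norm_minus_commute)
  note bl = blaschke_factor[OF less.prems(2) ca]
  have b0: "b z ~= 0" if "z \<in> ball a s" for z
   using bl(1)[of "z - a"] that less.prems(2) by (simp add: b_def dist_norm norm_minus_commute)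
  have bs: "cmod (b z) = cmod (z - c)" if "z \<in> sphere a s" for z
   using bl(2)[of "z - a"] that by (simp add: b_def dist_norm norm_minus_commute)
  have bc: "cmod (z - c) <= cmod (b z)" if "z \<in> cball a s" for z
   using bl(3)[of "z - a"] that by (simp add: b_def dist_norm norm_minus_commute)
  have sub: "cball a s \<subseteq> ball a R" using less.prems(3) by auto
  have q1s: "cmod (q1 z) = cmod (q z)" if "z \<in> sphere a s" for z
  proof -
   have "z \<in> ball a R" using that sub sphere_cball by blast
   then show ?thesis using bs[OF that] by (simp add: q1_def g(3) norm_mult norm_power)
  qed
  have q1c: "cmod (q z) <= cmod (q1 z)" if "z \<in> cball a s" for z
  proof -
   have "z \<in> ball a R" using that sub by blast
   then show ?thesis using bc[OF that]
    by (simp add: q1_def g(3) norm_mult norm_power mult_right_mono power_mono)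
  qed
  have z1: "{z \<in> ball a s. q1 z = 0} = {z \<in> ball a s. q z = 0} - {c}"
  proof -
   have "q1 z = 0 \<longleftrightarrow> q z = 0 \<and> z ~= c" if "z \<in> ball a s" for z
   proof -
    have "z \<in> ball a R" using that less.prems(3) by auto
    then show ?thesis using b0[OF that] g(2,4) by (auto simp: q1_def g(3))
   qed
   then show ?thesis by blast
  qed
  have "finite {z \<in> cball a s. q z = 0}"
   by (rule holomorphic_compact_finite_zeros[OF less.prems(1) open_ball connected_ball compact_cball sub nc])
  then have fin: "finite {z \<in> ball a s. q z = 0}" by (rule rev_finite_subset) auto
  have "c \<in> {z \<in> ball a s. q z = 0}" using c by simp
  then have "card ({z \<in> ball a s. q z = 0} - {c}) < card {z \<in> ball a s. q z = 0}"
   by (rule card_Diff1_less[OF fin])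
  then have "card {z \<in> ball a s. q1 z = 0} < card {z \<in> ball a s. q z = 0}" by (simp only: z1)
  moreover have "q1 c ~= 0" using b0[OF c(1)] g(4) by (simp add: q1_def)
  then have "\<exists>z\<in>ball a R. q1 z ~= 0" using cR by blast
  ultimately obtain u where u: "u holomorphic_on ball a R" "\<forall>z\<in>ball a s. u z ~= 0"
   "\<forall>z\<in>sphere a s. cmod (u z) = cmod (q1 z)" "\<forall>z\<in>cball a s. cmod (q1 z) <= cmod (u z)"
   using less.hyps[OF _ q1h less.prems(2,3)] by blast
  show ?thesis
  proof (intro exI[of _ u] conjI ballI)
   show "cmod (u z) = cmod (q z)" if "z \<in> sphere a s" for z using u(3) q1s that by simp
   show "cmod (q z) <= cmod (u z)" if "z \<in> cball a s" for z using u(4) q1c[OF that] that order_trans by blast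
  qed (use u in auto)
 qed
qed

lemma Re_ge_of_disc:
 assumes "cmod p <= m" "m < 1" "Re A > 0"
 shows "Re ((A + cnj A * p) / (1 - p)) >= Re A * ((1 - m) / (1 + m))"
proof -
 have n: "cmod p < 1" using assms by simp
 then have n1: "cmod (1 - p) > 0" by auto
 have "Re ((A + cnj A * p) / (1 - p)) = Re ((A + cnj A * p) * cnj (1 - p)) / (cmod (1 - p))\<^sup>2"
  by (subst complex_div_cnj) (simp add: Re_divide_of_real flip: of_real_power)
 also have "Re ((A + cnj A * p) * cnj (1 - p)) = Re A * (1 - (cmod p)\<^sup>2)"
  unfolding cmod_power2 by (simp add: power2_eq_square algebra_simps)
 finally have eq: "Re ((A + cnj A * p) / (1 - p)) = Re A * ((1 - (cmod p)\<^sup>2) / (cmod (1 - p))\<^sup>2)" by simp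
 have "(1 - m) / (1 + m) <= (1 - cmod p) / (1 + cmod p)"
 proof -
  have "0 < 1 + m" "0 < 1 + cmod p" using assms(1) norm_ge_zero[of p] by linarith+

  show ?thesis by (rule frac_le) (use assms(1) n \<open>0 < 1 + cmod p\<close> in auto)
 qed
 also have "\<dots> = (1 - (cmod p)\<^sup>2) / (1 + cmod p)\<^sup>2"
 proof -
  have "1 + cmod p ~= 0" using norm_ge_zero[of p] by linarith
  then show ?thesis by (simp add: divide_simps power2_eq_square) (simp add: algebra_simps)
 qed
 also have "\<dots> <= (1 - (cmod p)\<^sup>2) / (cmod (1 - p))\<^sup>2"
 proof (rule divide_left_mono)
  have "cmod (1 - p) <= 1 + cmod p" using norm_triangle_ineq4[of 1 p] by simp
  then show "(cmod (1 - p))\<^sup>2 <= (1 + cmod p)\<^sup>2" using n1 by (intro power_mono) auto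
  show "0 <= 1 - (cmod p)\<^sup>2" using n by (simp add: power_le_one)
  show "0 < (1 + cmod p)\<^sup>2 * (cmod (1 - p))\<^sup>2" using n1 norm_ge_zero[of p] by (intro mult_pos_pos zero_less_power) linarith+
 qed
 finally have "(1 - m) / (1 + m) <= (1 - (cmod p)\<^sup>2) / (cmod (1 - p))\<^sup>2" .
 then show ?thesis unfolding eq using assms(3) by (intro mult_left_mono) auto
qed

text \<open>A Cayley transform sends the half plane to the disc and \<open>c a\<close> to 0; after a
  Moebius change of variable the Schwarz lemma bounds the transform at \<open>b\<close> by
  \<open>pseudo_hyp a b\<close>. \<open>Re_ge_of_disc\<close> translates back.\<close>

lemma harnack_disc:
 assumes c: "c holomorphic_on ball 0 1" "\<And>z. z \<in> ball 0 1 ==> Re (c z) > 0"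
  and ab: "a \<in> ball 0 1" "b \<in> ball 0 1"
 shows "Re (c b) >= Re (c a) * ((1 - pseudo_hyp a b) / (1 + pseudo_hyp a b))"
proof -
 define A where "A = c a"
 have A: "Re A > 0" using c(2)[OF ab(1)] by (simp add: A_def)
 define p where "p = (\<lambda>z. (c z - A) / (c z + cnj A))"
 have ne: "c z + cnj A ~= 0" if "z \<in> ball 0 1" for z
 proof
  assume "c z + cnj A = 0"
  then have "Re (c z + cnj A) = 0" by simp
  then show False using c(2)[OF that] A by simp
 qed
 have plt: "cmod (p z) < 1" if "z \<in> ball 0 1" for z
 proof -
  have "(cmod (c z + cnj A))\<^sup>2 - (cmod (c z - A))\<^sup>2 = 4 * Re (c z) * Re A"
   unfolding cmod_power2 by (simp add: power2_eq_square algebra_simps)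
  moreover have "4 * Re (c z) * Re A > 0" using c(2)[OF that] A by simp
  ultimately have "(cmod (c z - A))\<^sup>2 < (cmod (c z + cnj A))\<^sup>2" by linarith
  then have "cmod (c z - A) < cmod (c z + cnj A)" by (rule power2_less_imp_less) simp
  then show ?thesis using ne[OF that] by (simp add: p_def norm_divide)
 qed
 have a: "cmod a < 1" "cmod (- a) < 1" using ab by auto
 define M where "M = Moebius_function 0 (- a)"
 have Mh: "M holomorphic_on ball 0 1" unfolding M_def by (rule Moebius_function_holomorphic[OF a(2)])
 have Mim: "M z \<in> ball 0 1" if "z \<in> ball 0 1" for z
  using Moebius_function_norm_lt_1[OF a(2)] that by (simp add: M_def)
 have ph: "p holomorphic_on ball 0 1" unfolding p_def using ne by (intro holomorphic_intros c(1)) auto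
 have comp: "(\<lambda>z. p (M z)) holomorphic_on ball 0 1"
 proof -
  have "M ` ball 0 1 \<subseteq> ball 0 1" using Mim by blast
  from holomorphic_on_compose_gen[OF Mh ph this] show ?thesis by (simp add: o_def)
 qed
 have M0: "M 0 = a" by (simp add: M_def Moebius_function_def)
 define w where "w = Moebius_function 0 a b"
 have w: "cmod w < 1" using Moebius_function_norm_lt_1[OF a(1)] ab by (simp add: w_def)
 have Mw: "M w = b" unfolding M_def w_def by (rule Moebius_function_compose) (use ab in auto)
 have "cmod (p (M w)) <= cmod w"
  by (rule Schwarz_Lemma(1)[OF comp]) (use M0 w plt Mim in \<open>auto simp: p_def A_def\<close>)
 then have le: "cmod (p b) <= pseudo_hyp a b" unfolding Mw by (simp add: pseudo_hyp_Moebius w_def)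
 have p1: "p b ~= 1" using plt[OF ab(2)] by auto
 have "c b = (A + cnj A * p b) / (1 - p b)"
 proof -
  have "p b * (c b + cnj A) = c b - A" using ne[OF ab(2)] by (simp add: p_def)
  then have "c b * (1 - p b) = A + cnj A * p b" by (simp add: algebra_simps)
  then show ?thesis using p1 by (simp add: eq_divide_eq)
 qed
 then show ?thesis using Re_ge_of_disc[OF le pseudo_hyp_lt_1[OF ab] A] by (simp add: A_def)
qed

text \<open>A zero-free \<open>u\<close> has a logarithm, so \<open>ln B - ln (cmod (u z))\<close>
  is the real part of a holomorphic function, and it is positive. On the half disc the Harnack
  factor is at least \<open>(1 - 1/2) / (1 + 1/2) = 1/3\<close>.\<close>

lemma zero_free_harnack:
 assumes u: "u holomorphic_on ball a s" "\<And>z. z \<in> ball a s ==> u z ~= 0" "\<And>z. z \<in> ball a s ==> cmod (u z) < B"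
  and s: "s > 0" and z: "cmod (z - a) <= s / 2"
 shows "ln B - ln (cmod (u z)) >= (ln B - ln (cmod (u a))) / 3"
  "ln B - ln (cmod (u z)) <= 3 * (ln B - ln (cmod (u a)))"
proof -
 define v where "v = (\<lambda>w. u (a + of_real s * w))"
 have im: "a + of_real s * w \<in> ball a s" if "w \<in> ball 0 1" for w
  using that s by (simp add: dist_norm norm_mult)
 have "v holomorphic_on ball 0 1"
  unfolding v_def using im
  by (intro holomorphic_on_compose_gen[OF _ u(1), unfolded o_def] holomorphic_intros) auto
 moreover have "contractible (ball (0::complex) 1)" by (intro convex_imp_contractible convex_ball)
 moreover have v0: "v w ~= 0" if "w \<in> ball 0 1" for w using u(2)[OF im[OF that]] by (simp add: v_def)
 ultimately obtain g where g: "g holomorphic_on ball 0 1" "\<And>w. w \<in> ball 0 1 ==> v w = exp (g w)"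
  by (rule contractible_imp_holomorphic_log) (assumption, rule that)
 define b where "b = (\<lambda>w. of_real (ln B) - g w)"
 have Re: "Re (b w) = ln B - ln (cmod (v w))" if "w \<in> ball 0 1" for w
  using g(2)[OF that] by (simp add: b_def)
 have pos: "Re (b w) > 0" if "w \<in> ball 0 1" for w
 proof -
  have "cmod (v w) < B" "cmod (v w) > 0" using u(3)[OF im[OF that]] v0[OF that] by (auto simp: v_def)
  then have "ln (cmod (v w)) < ln B" by (subst ln_less_cancel_iff) linarith+
  then show ?thesis by (simp add: Re[OF that])
 qed
 have bh: "b holomorphic_on ball 0 1" unfolding b_def by (intro holomorphic_intros g(1))
 define w where "w = (z - a) / of_real s"
 have w: "cmod w <= 1/2" using z s by (simp add: w_def norm_divide field_simps)
 then have wb: "w \<in> ball 0 1" by simp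
 have vz: "v w = u z" "v 0 = u a" using s by (simp_all add: v_def w_def)
 have ps: "pseudo_hyp 0 w = cmod w" "pseudo_hyp w 0 = cmod w" by (simp_all add: pseudo_hyp_def)
 have k: "(1 - cmod w) / (1 + cmod w) >= 1/3"     using w norm_ge_zero[of w] by (subst pos_le_divide_eq) (linarith, argo)
 have in0: "0 \<in> ball (0::complex) 1" by simp
 have 1: "Re (b w) >= Re (b 0) * (1/3)"
  using harnack_disc[OF bh pos in0 wb] mult_left_mono[OF k, of "Re (b 0)"] pos[OF in0] unfolding ps by linarith
 have 2: "Re (b 0) >= Re (b w) * (1/3)"
  using harnack_disc[OF bh pos wb in0] mult_left_mono[OF k, of "Re (b w)"] pos[OF wb] unfolding ps by linarith
 show "ln B - ln (cmod (u z)) >= (ln B - ln (cmod (u a))) / 3"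
  using 1 unfolding Re[OF wb] Re[OF in0] vz by linarith
 show "ln B - ln (cmod (u z)) <= 3 * (ln B - ln (cmod (u a)))"
  using 2 unfolding Re[OF wb] Re[OF in0] vz by argo
qed

section \<open>Geometric decay of products along a disc\<close>

lemma power_div_geometric:
 assumes "0 < q" "q < (1::real)" "m > 0"
 obtains b where "0 < b" "b < 1" "\<And>n. q ^ (n div m) <= (1 / q) * b ^ n"
proof (rule that[of "root m q"])
 show b: "0 < root m q" "root m q < 1" using assms by (auto simp: real_root_lt_1_iff)
 fix n
 have "n <= m * (n div m) + m" using assms(3) by (metis add_le_cancel_left less_imp_le_nat mod_less_divisor mult_div_mod_eq)
 then have "(root m q) ^ (m * (n div m) + m) <= (root m q) ^ n" using b by (intro power_decreasing) auto
 moreover have "(root m q) ^ (m * (n div m) + m) = q ^ (n div m) * q"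
  using assms by (simp add: power_add power_mult)
 ultimately have "q ^ (n div m) * q <= (root m q) ^ n" by linarith
 then show "q ^ (n div m) <= (1 / q) * (root m q) ^ n" using assms by (simp add: field_simps)
qed

text \<open>Hadamard's three circles with integer exponents: divide by \<open>z ^ k\<close> with
  \<open>k = n div m\<close> and use the maximum principle on the annulus. The choice of
  \<open>m\<close> makes the decay on the inner circle beat the growth of
  \<open>1 / z ^ k\<close>.\<close>

lemma three_circles_decay:
 fixes P :: "nat => complex => complex"
 assumes hol: "\<And>n. P n holomorphic_on ball 0 R" and r: "0 < c" "c < r" "r < R1" "R1 < R"
  and bd: "\<And>n z. z \<in> cball 0 R1 ==> cmod (P n z) <= C"
  and small: "\<And>n z. z \<in> cball 0 c ==> cmod (P n z) <= C * a ^ n" and a: "0 < a" "a < 1"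
 obtains b D where "0 < b" "b < 1" "\<And>n z. z \<in> cball 0 r ==> cmod (P n z) <= D * b ^ n"
proof -
 have "cmod (P 0 0) <= C" by (rule bd) (use r in simp)
 then have C: "C >= 0" using norm_ge_zero[of "P 0 0"] by linarith
 obtain m where m: "a ^ m < c / R1" using real_arch_pow_inv[of "c / R1" a] r a by auto
 have m0: "m > 0" using m r by (cases m) auto
 define q where "q = r / R1"
 have q: "0 < q" "q < 1" using r by (auto simp: q_def)
 obtain b where b: "0 < b" "b < 1" "\<And>n. q ^ (n div m) <= (1 / q) * b ^ n"
  by (rule power_div_geometric[OF q m0]) (rule that)
 have an: "a ^ n <= (c / R1) ^ (n div m)" for n
 proof -
  have "a ^ n <= a ^ (m * (n div m))" using a by (intro power_decreasing) auto
  also have "\<dots> = (a ^ m) ^ (n div m)" by (simp add: power_mult)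
  also have "\<dots> <= (c / R1) ^ (n div m)" using m a by (intro power_mono) auto
  finally show ?thesis .
 qed
 have main: "cmod (P n z) <= C * q ^ (n div m)" if z: "z \<in> cball 0 r" for n z
 proof (cases "cmod z <= c")
  case True
  have "(c / R1) ^ (n div m) <= q ^ (n div m)" using r by (intro power_mono) (auto simp: q_def divide_right_mono)
  then have "a ^ n <= q ^ (n div m)" using an[of n] by linarith
  then have "C * a ^ n <= C * q ^ (n div m)" using C by (intro mult_left_mono) auto
  then show ?thesis using small[of z n] True by simp
 next
  case False
  define k where "k = n div m"
  define S where "S = ball (0::complex) R1 - cball 0 c"
  have oS: "open S" unfolding S_def by (intro open_Diff) auto
  have zS: "z \<in> S" using False z r by (simp add: S_def)
  have clS: "closure S \<subseteq> {w. c <= cmod w \<and> cmod w <= R1}"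
  proof (rule closure_minimal)
   show "S \<subseteq> {w. c <= cmod w \<and> cmod w <= R1}" by (auto simp: S_def)
   show "closed {w. c <= cmod w \<and> cmod w <= R1}"
    by (intro closed_Collect_conj closed_Collect_le continuous_intros)
  qed
  define h where "h = (\<lambda>w. P n w / w ^ k)"
  have holh: "h holomorphic_on (ball 0 R - {0})"
   unfolding h_def by (intro holomorphic_intros holomorphic_on_subset[OF hol]) auto
  have cl: "closure S \<subseteq> ball 0 R - {0}" using clS r by auto
  have "cmod (h z) <= C / R1 ^ k"
  proof (rule maximum_modulus_frontier[of h S])
   show "h holomorphic_on interior S"
    using cl closure_subset[of S] interior_subset[of S] by (intro holomorphic_on_subset[OF holh]) auto
   show "continuous_on (closure S) h"
    using holomorphic_on_imp_continuous_on[OF holh] cl by (rule continuous_on_subset)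
   show "bounded S" unfolding S_def by (rule bounded_subset[OF bounded_ball[of 0 R1]]) auto
   fix w assume w: "w \<in> frontier S"
   have w1: "c <= cmod w" "cmod w <= R1" using w clS by (auto simp: frontier_def)
   have "w \<notin> S" using w oS by (simp add: frontier_def interior_open)
   then consider "cmod w = c" | "cmod w = R1" using w1 by (auto simp: S_def)
   then show "cmod (h w) <= C / R1 ^ k"
   proof cases
    case 1
    have "cmod (P n w) <= C * a ^ n" using small[of w n] 1 by simp
    also have "\<dots> <= C * (c / R1) ^ k" using an[of n] C unfolding k_def by (intro mult_left_mono) auto
    finally show ?thesis using 1 r by (simp add: h_def norm_divide norm_power power_divide field_simps)
   next
    case 2
    then show ?thesis using bd[of w n] r by (simp add: h_def norm_divide norm_power divide_right_mono)
   qed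
  qed (rule zS)
  then have "cmod (P n z) <= C / R1 ^ k * cmod z ^ k"
  proof -
   have "cmod z ^ k > 0" using False r(1) by (intro zero_less_power) linarith
   moreover have "cmod (h z) = cmod (P n z) / cmod z ^ k" by (simp add: h_def norm_divide norm_power)
   ultimately show ?thesis using \<open>cmod (h z) <= C / R1 ^ k\<close> by (simp only: pos_divide_le_eq)
  qed
  also have "\<dots> <= C / R1 ^ k * r ^ k" using z r C by (intro mult_left_mono power_mono) auto
  finally show ?thesis by (simp add: q_def k_def power_divide)
 qed
 show ?thesis
 proof (rule that[OF b(1,2)])
  fix n z assume "z \<in> cball (0::complex) r"
  then have "cmod (P n z) <= C * q ^ (n div m)" by (rule main)
  also have "\<dots> <= C * ((1 / q) * b ^ n)" using b(3) C by (intro mult_left_mono) auto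
  finally show "cmod (P n z) <= (C * (1 / q)) * b ^ n" by (simp only: mult.assoc)
 qed
qed

text \<open>Replacing each factor by a zero-free majorant turns the additive error of almost
 periodicity into a multiplicative one.\<close>

lemma window_decay:
 fixes q :: "nat => complex => complex"
 assumes hol: "\<And>j. q j holomorphic_on ball t R" and s: "0 < s" "s < R"
  and B: "\<And>j z. z \<in> cball t s ==> cmod (q j z) <= B"
  and dec: "\<And>n z. z \<in> cball t s ==> cmod (\<Prod>j<n. q j z) <= C * b ^ n" and b: "0 < b" "b < 1"
  and ap: "\<And>a. a > 0 ==> \<exists>M. \<forall>m. \<exists>m'\<le>M. \<forall>j. \<forall>z\<in>cball t s. cmod (q (m + j) z) <= cmod (q (m' + j) z) + a"
  and nd: "k > 0" "\<And>j. \<exists>z\<in>cball t (s/2). cmod (q j z) >= k"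
 shows "\<exists>D b'. 0 < b' \<and> b' < 1 \<and> (\<forall>m n. \<forall>z\<in>cball t (s/2). (\<Prod>j<n. cmod (q (m + j) z)) <= D * b' ^ n)"
proof -
 have sub: "cball t s \<subseteq> ball t R" "cball t (s/2) \<subseteq> ball t s" "cball t (s/2) \<subseteq> cball t s" using s by auto
 have "\<forall>j. \<exists>u. u holomorphic_on ball t R \<and> (\<forall>z\<in>ball t s. u z ~= 0) \<and>
  (\<forall>z\<in>sphere t s. cmod (u z) = cmod (q j z)) \<and> (\<forall>z\<in>cball t s. cmod (q j z) <= cmod (u z))"
 proof
  fix j
  obtain z where z: "z \<in> cball t (s/2)" "cmod (q j z) >= k" using nd(2) by blast
  have "z \<in> ball t R" using z(1) sub(1,3) by blast
  then have "\<exists>z\<in>ball t R. q j z ~= 0" using z(2) nd(1) by (intro bexI[of _ z]) auto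
  then show "\<exists>u. u holomorphic_on ball t R \<and> (\<forall>z\<in>ball t s. u z ~= 0) \<and>
   (\<forall>z\<in>sphere t s. cmod (u z) = cmod (q j z)) \<and> (\<forall>z\<in>cball t s. cmod (q j z) <= cmod (u z))"
   by (rule zero_free_majorant[OF hol s])
 qed
 from choice[OF this] obtain u where u: "\<forall>j. u j holomorphic_on ball t R \<and> (\<forall>z\<in>ball t s. u j z ~= 0) \<and>
  (\<forall>z\<in>sphere t s. cmod (u j z) = cmod (q j z)) \<and> (\<forall>z\<in>cball t s. cmod (q j z) <= cmod (u j z))" by (rule exE)
 have uh: "u j holomorphic_on ball t R" and u0: "z \<in> ball t s ==> u j z ~= 0"
  and us: "z \<in> sphere t s ==> cmod (u j z) = cmod (q j z)" and uq: "z \<in> cball t s ==> cmod (q j z) <= cmod (u j z)" for j z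
  using u by blast+
 have mm: "cmod (h z) <= E" if h: "h holomorphic_on ball t R" "\<And>z. z \<in> sphere t s ==> cmod (h z) <= E" and z: "z \<in> cball t s" for h E z
 proof (rule maximum_modulus_frontier[of h "cball t s"])
  show "h holomorphic_on interior (cball t s)" using sub by (intro holomorphic_on_subset[OF h(1)]) auto
  show "continuous_on (closure (cball t s)) h"
   using holomorphic_on_imp_continuous_on[OF h(1)] sub(1) by (simp add: continuous_on_subset)
  show "cmod (h w) <= E" if "w \<in> frontier (cball t s)" for w using that h(2) s by (simp add: frontier_cball)
 qed (use z in auto)
 have "cmod (q 0 t) <= B" by (rule B) (use s in simp)
 then have B0: "B >= 0" using norm_ge_zero[of "q 0 t"] by linarith
 have uB: "cmod (u j z) <= B" if "z \<in> cball t s" for j z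
  by (rule mm[OF uh _ that]) (use us B sphere_cball in auto)
 \<comment> \<open>Harnack needs \<open>ln B' - ln (cmod (u j z))\<close> strictly positive.\<close>
 define B' where "B' = B + 1"
 have uB': "cmod (u j z) < B'" if "z \<in> ball t s" for j z using uB[of z j] that by (simp add: B'_def)
 have B'1: "B' >= 1" using B0 by (simp add: B'_def)
 note hk = zero_free_harnack[OF holomorphic_on_subset[OF uh] u0 uB' s(1)]
 have subR: "ball t s \<subseteq> ball t R" using s by auto
 \<comment> \<open>Going from a point where \<open>q j\<close> has modulus at least \<open>k\<close>
   to the centre and on to any \<open>z\<close> costs a Harnack factor 3 twice, hence 9. The cap at
   1 makes powers of \<open>k1\<close> decrease.\<close>
 define k1 where "k1 = min 1 (exp (ln B' - 9 * (ln B' - ln k)))"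
 have k1: "0 < k1" "k1 <= 1" by (auto simp: k1_def)
 have low: "cmod (u j z) >= k1" if z: "z \<in> cball t (s/2)" for j z
 proof -
  obtain w where w: "w \<in> cball t (s/2)" "cmod (q j w) >= k" using nd(2) by blast
  have "w \<in> cball t s" using w(1) sub(3) by blast
  then have "cmod (u j w) >= k" using uq[of w j] w(2) by linarith
  then have lw: "ln (cmod (u j w)) >= ln k" using nd(1) by (subst ln_le_cancel_iff) linarith+
  have "ln B' - ln (cmod (u j w)) >= (ln B' - ln (cmod (u j t))) / 3"
   by (rule hk(1)[OF subR]) (use w in \<open>auto simp: dist_norm norm_minus_commute\<close>)
  moreover have "ln B' - ln (cmod (u j z)) <= 3 * (ln B' - ln (cmod (u j t)))"
   by (rule hk(2)[OF subR]) (use z in \<open>auto simp: dist_norm norm_minus_commute\<close>)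
  ultimately have "ln (cmod (u j z)) >= ln B' - 9 * (ln B' - ln k)" using lw by argo
  then have "exp (ln B' - 9 * (ln B' - ln k)) <= exp (ln (cmod (u j z)))" by simp
  moreover have "u j z ~= 0" using u0 z sub by blast
  ultimately show ?thesis by (simp add: k1_def)
 qed
 \<comment> \<open>The relative error allowed in each factor: \<open>b * (1 + e)\<close> is the
   midpoint of \<open>b\<close> and 1, so decay survives.\<close>
 define e where "e = (1 - b) / (2 * b)"
 have e: "e > 0" "b * (1 + e) = (1 + b) / 2" using b by (auto simp: e_def field_simps)
 \<comment> \<open>As the majorants are at least \<open>k1\<close> on the half disc, an additive
   error \<open>k1 * e\<close> is at most \<open>e\<close> times the majorant.\<close>
 obtain M where M: "\<forall>m. \<exists>m'\<le>M. \<forall>j. \<forall>z\<in>cball t s. cmod (q (m + j) z) <= cmod (q (m' + j) z) + k1 * e"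
  using ap[of "k1 * e"] k1 e by auto
 have C0: "C >= 0" using dec[of t 0] s by simp
 have Udec: "cmod (\<Prod>j<n. u j z) <= C * b ^ n" if "z \<in> cball t s" for n z
 proof (rule mm[OF _ _ that])
  show "(\<lambda>z. \<Prod>j<n. u j z) holomorphic_on ball t R" by (intro holomorphic_intros uh)
  fix w assume w: "w \<in> sphere t s"
  have "cmod (\<Prod>j<n. u j w) = cmod (\<Prod>j<n. q j w)" unfolding prod_norm[symmetric] using us[OF w] by simp
  also have "\<dots> <= C * b ^ n" by (rule dec) (use w sphere_cball in blast)
  finally show "cmod (\<Prod>j<n. u j w) <= C * b ^ n" .
 qed
 have main: "(\<Prod>j<n. cmod (q (m + j) z)) <= C / k1 ^ M * ((1 + b) / 2) ^ n" if z: "z \<in> cball t (s/2)" for m n z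
 proof -
  obtain m' where m': "m' <= M" "\<forall>j. \<forall>z\<in>cball t s. cmod (q (m + j) z) <= cmod (q (m' + j) z) + k1 * e" using M by blast
  have zs: "z \<in> cball t s" using z sub by blast
  have "cmod (q (m + j) z) <= cmod (u (m' + j) z) * (1 + e)" for j
  proof -
   have "cmod (q (m + j) z) <= cmod (q (m' + j) z) + k1 * e" using m'(2) zs by blast
   also have "\<dots> <= cmod (u (m' + j) z) + cmod (u (m' + j) z) * e"
    using uq[OF zs, of "m' + j"] low[OF z, of "m' + j"] e(1) by (intro add_mono mult_right_mono) auto
   finally show ?thesis by (simp add: distrib_left)
  qed
  then have "(\<Prod>j<n. cmod (q (m + j) z)) <= (\<Prod>j<n. cmod (u (m' + j) z) * (1 + e))" by (intro prod_mono) auto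
  also have "\<dots> = cmod (\<Prod>j<n. u (m' + j) z) * (1 + e) ^ n" by (simp add: prod.distrib prod_norm)
  \<comment> \<open>The decay is known for products starting at 0. The first \<open>m'\<close>
    factors are divided out; each is at least \<open>k1\<close>, and \<open>m' <= M\<close> bounds
    their number.\<close>
  also have "\<dots> <= (C * b ^ n / k1 ^ M) * (1 + e) ^ n"
  proof (rule mult_right_mono)
   have "(\<Prod>j<m'+n. u j z) = (\<Prod>j<m'. u j z) * (\<Prod>j<n. u (m' + j) z)"
    by (induction n) (simp_all add: mult.assoc)
   then have "cmod (\<Prod>j<m'. u j z) * cmod (\<Prod>j<n. u (m' + j) z) <= C * b ^ (m' + n)"
    using Udec[OF zs, of "m' + n"] by (simp add: norm_mult)
   also have "\<dots> <= C * b ^ n" using C0 b by (intro mult_left_mono power_decreasing) auto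
   finally have le: "cmod (\<Prod>j<m'. u j z) * cmod (\<Prod>j<n. u (m' + j) z) <= C * b ^ n" .
   have "k1 ^ M <= k1 ^ m'" using k1 m'(1) by (intro power_decreasing) auto
   also have "\<dots> = (\<Prod>j<m'. k1)" by simp
   also have "\<dots> <= (\<Prod>j<m'. cmod (u j z))" using low[OF z] k1 by (intro prod_mono) auto
   also have "\<dots> = cmod (\<Prod>j<m'. u j z)" by (rule prod_norm)
   finally have "k1 ^ M * cmod (\<Prod>j<n. u (m' + j) z) <= cmod (\<Prod>j<m'. u j z) * cmod (\<Prod>j<n. u (m' + j) z)"
    by (intro mult_right_mono) auto
   then show "cmod (\<Prod>j<n. u (m' + j) z) <= C * b ^ n / k1 ^ M" using le k1 by (simp add: field_simps)
  qed (use e in auto)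
  also have "\<dots> = C / k1 ^ M * (b * (1 + e)) ^ n" by (simp add: power_mult_distrib)
  finally show ?thesis by (simp only: e(2))
 qed
 show ?thesis
  by (rule exI[of _ "C / k1 ^ M"], rule exI[of _ "(1 + b) / 2"]) (use main b in auto)
qed

section \<open>Local parametrizations of the attracting curve\<close>

context lifted_map
begin

lemma nlift_Montel:
 assumes A: "open A" and Y: "\<And>k. nlift (Y k) A"
 obtains S r where "strict_mono (r :: nat => nat)" "nlift S A"
  "\<And>C. compact C ==> C \<subseteq> A ==> uniform_limit C (\<lambda>k. Y (r k)) S sequentially"
proof -
 have h: "hol_vec (Y k) A" for k using Y by (simp add: nlift_def)
 have b: "norm (Y k z) <= nbd" if "z \<in> A" for k z by (rule normalized_bounds(1)[OF nlift_normalized[OF Y that]])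
 obtain S r where S: "hol_vec S A" "strict_mono (r :: nat => nat)"
  "\<And>K. compact K ==> K \<subseteq> A ==> uniform_limit K (Y \<circ> r) S sequentially"
  by (rule Montel_vec[OF A h b]) (assumption, rule that)
 have u: "uniform_limit C (\<lambda>k. Y (r k)) S sequentially" if "compact C" "C \<subseteq> A" for C
  using S(3)[OF that] by (simp add: o_def)
 have "normalized (S z)" if z: "z \<in> A" for z
 proof (rule normalized_closed)
  have "uniform_limit {z} (\<lambda>k. Y (r k)) S sequentially" by (rule u) (use z in auto)
  then show "(\<lambda>k. Y (r k) z) \<longlonglongrightarrow> S z" by (rule tendsto_uniform_limitI) simp
  show "normalized (Y (r k) z)" for k by (rule nlift_normalized[OF Y z])
 qed
 then have "nlift S A" using S(1) by (simp add: nlift_def normalized_def)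
 from S(2) this u show thesis by (rule that)
qed

text \<open>Equality of the projected discs near 0 forces a unimodular ratio there by
  \<open>nlift_unique\<close>, and the identity theorem extends it to the full ball. This is how
  facts from the trapped inner disc reach the whole disc.\<close>

lemma nlift_rigid:
 assumes Y: "nlift Y (ball 0 R)" and Z: "nlift Z (ball 0 R)" and r: "0 < r" "r <= R"
  and eq: "\<And>t. t \<in> ball 0 r ==> proj (Y t) = proj (Z t)"
 shows "\<exists>u. cmod u = 1 \<and> (\<forall>t\<in>ball 0 R. Y t = u *s Z t)"
proof -
 have sub: "ball 0 r \<subseteq> ball (0::complex) R" using r by auto
 have "0 \<in> ball (0::complex) r" using r by simp
 with sub have 0: "0 \<in> ball (0::complex) r" "0 \<in> ball (0::complex) R" by blast+
 have n: "normalized (Y 0)" "normalized (Z 0)" using nlift_normalized[OF Y 0(2)] nlift_normalized[OF Z 0(2)] by auto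
 obtain u where u: "cmod u = 1" "Y 0 = u *s Z 0"
  by (rule nlift_phase[of "Z 0" "Y 0"]) (use n eq[OF 0(1)] in \<open>auto simp: normalized_def\<close>)
 have uZ: "nlift (\<lambda>z. u *s Z z) (ball 0 R)" by (rule nlift_smult[OF Z u(1)])
 have u0: "u ~= 0" using u(1) by auto
 have near: "Y t = u *s Z t" if t: "t \<in> ball 0 r" for t
 proof (rule nlift_unique[OF open_ball connected_ball nlift_subset[OF Y sub] nlift_subset[OF uZ sub] _ 0(1) u(2) t])
  fix z :: complex assume z: "z \<in> ball 0 r"
  then have "Z z ~= 0" using Z sub by (auto simp: nlift_def)
  then show "proj (Y z) = proj (u *s Z z)" using eq[OF z] u0 by (simp add: proj_smult)
 qed
 have "Y t = u *s Z t" if t: "t \<in> ball 0 R" for t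
 proof -
  have "Y t $ i = (u *s Z t) $ i" for i
  proof (rule analytic_continuation_open[OF open_ball open_ball _ connected_ball sub _ _ _ t])
   show "ball 0 r ~= ({} :: complex set)" using r by simp
   show "(\<lambda>z. Y z $ i) holomorphic_on ball 0 R" "(\<lambda>z. (u *s Z z) $ i) holomorphic_on ball 0 R"
    using Y uZ by (auto simp: nlift_def hol_vec_def)
  qed (simp add: near)
  then show ?thesis by (simp add: vec_eq_iff)
 qed
 then show ?thesis using u(1) by blast
qed

lemma jac_zero_proj:
 assumes "x ~= 0" "y ~= 0" "proj x = proj y" "jac x = 0"
 shows "jac y = 0"
proof -
 obtain c where "c ~= 0" "y = c *s x" using proj_eq_iff[OF assms(1,2)] assms(3) by blast
 then show ?thesis using assms(4) by (simp add: jac_smult)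
qed

lemma jac_norm_smult: "cmod u = 1 ==> cmod (jac (u *s x)) = cmod (jac x)"
proof -
 assume u: "cmod u = 1"
 then have "u ~= 0" by auto
 then show ?thesis by (simp add: jac_smult norm_mult norm_power u)
qed

text \<open>If it fails, take radius \<open>1 / Suc N\<close> and constant \<open>N\<close>: a limit
  of the centres lies in \<open>K\<close>, where \<open>fatou_lipschitz\<close> contradicts large
  \<open>N\<close>. The second point \<open>q\<close> may lie outside \<open>K\<close>.\<close>

lemma compact_equi_lipschitz:
 assumes K: "compact K" "K \<subseteq> fatou_set f"
 shows "\<exists>e>0. \<exists>C. \<forall>p\<in>K. \<forall>q. dist p q < e --> (\<forall>n. dist ((f ^^ n) p) ((f ^^ n) q) <= C * dist p q)"
proof (rule ccontr)
 assume neg: "\<not> ?thesis"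
 have "\<exists>p q. p \<in> K \<and> dist p q < 1 / real (Suc N) \<and> (\<exists>n. \<not> dist ((f ^^ n) p) ((f ^^ n) q) <= real N * dist p q)" for N
 proof (rule ccontr)
  assume a: "\<nexists>p q. p \<in> K \<and> dist p q < 1 / real (Suc N) \<and> (\<exists>n. \<not> dist ((f ^^ n) p) ((f ^^ n) q) <= real N * dist p q)"
  have "1 / real (Suc N) > 0" by simp
  with a neg show False by blast
 qed
 then have "\<forall>N. \<exists>p q. p \<in> K \<and> dist p q < 1 / real (Suc N) \<and> (\<exists>n. \<not> dist ((f ^^ n) p) ((f ^^ n) q) <= real N * dist p q)" by (rule allI)
 from choice2[OF this] obtain p q where pq: "\<forall>N. p N \<in> K \<and> dist (p N) (q N) < 1 / real (Suc N) \<and> (\<exists>n. \<not> dist ((f ^^ n) (p N)) ((f ^^ n) (q N)) <= real N * dist (p N) (q N))"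
  by (elim exE)
 obtain r p0 where r: "strict_mono (r :: nat => nat)" "(\<lambda>k. p (r k)) \<longlonglongrightarrow> p0" by (rule cp2_convergent_subseq)
 have "p0 \<in> K" by (rule Lim_in_closed_set[OF compact_imp_closed[OF K(1)] _ sequentially_bot r(2)]) (use pq in simp)
 then have "p0 \<in> fatou_set f" using K(2) by blast
 then obtain e C where e: "e > 0" "equi_lipschitz_on (ball p0 e) C" by (rule fatou_lipschitz)
 have "(\<lambda>k. 1 / real (Suc (r k))) \<longlonglongrightarrow> 0"
  using filterlim_compose[OF LIMSEQ_inverse_real_of_nat filterlim_subseq[OF r(1)]] by (simp add: inverse_eq_divide)
 then have e1: "\<forall>\<^sub>F k in sequentially. dist (1 / real (Suc (r k))) 0 < e / 2" by (rule tendstoD) (use e(1) in simp)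
 have e2: "\<forall>\<^sub>F k in sequentially. dist (p (r k)) p0 < e / 2" using r(2) by (rule tendstoD) (use e(1) in simp)
 have e3: "\<forall>\<^sub>F k in sequentially. k >= nat \<lceil>C\<rceil>" by (rule eventually_ge_at_top)
 have "\<forall>\<^sub>F k in sequentially. False"
  using e1 e2 e3
 proof eventually_elim
  case (elim k)
  have pk: "p (r k) \<in> ball p0 e" using elim(2) e(1) by (simp add: dist_commute)
  have d: "dist (p (r k)) (q (r k)) < 1 / real (Suc (r k))" using pq by blast
  have "dist (p (r k)) (q (r k)) < e / 2" using d elim(1) by simp
  then have qk: "q (r k) \<in> ball p0 e"
   using elim(2) dist_triangle[of p0 "q (r k)" "p (r k)"] by (simp add: dist_commute)
  have "C <= real k" using elim(3) by linarith
  also have "\<dots> <= real (r k)" using seq_suble[OF r(1), of k] by simp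
  finally have "C * dist (p (r k)) (q (r k)) <= real (r k) * dist (p (r k)) (q (r k))" by (rule mult_right_mono) simp
  moreover have "dist ((f ^^ n) (p (r k))) ((f ^^ n) (q (r k))) <= C * dist (p (r k)) (q (r k))" for n
   using e(2) pk qk unfolding equi_lipschitz_on_def by blast
  ultimately have "dist ((f ^^ n) (p (r k))) ((f ^^ n) (q (r k))) <= real (r k) * dist (p (r k)) (q (r k))" for n
   using order_trans by blast
  then show False using pq by blast
 qed
 then show False by simp
qed

lemma jac_iter_bounded_compact:
 assumes K: "compact K" "K \<subseteq> fatou_set f"
 shows "\<exists>C. \<forall>n x. normalized x --> proj x \<in> K --> cmod (jac_iter n x) <= C"
proof (rule ccontr)
 assume "\<not> ?thesis"
 then have "\<forall>N. \<exists>x n. normalized x \<and> proj x \<in> K \<and> \<not> cmod (jac_iter n x) <= real N" by blast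
 from choice[OF this] obtain x where x: "\<forall>N. \<exists>n. normalized (x N) \<and> proj (x N) \<in> K \<and> \<not> cmod (jac_iter n (x N)) <= real N" by (rule exE)
 have xn: "normalized (x N)" for N using x by blast
 obtain r y where r: "strict_mono (r :: nat => nat)" "(\<lambda>k. x (r k)) \<longlonglongrightarrow> y" "normalized y"
  by (rule normalized_subseq[OF xn]) (rule that)
 have lim: "(\<lambda>k. proj (x (r k))) \<longlonglongrightarrow> proj y"
  using r(2,3) xn by (intro tendsto_proj) (auto simp: normalized_def)
 have "proj y \<in> K" by (rule Lim_in_closed_set[OF compact_imp_closed[OF K(1)] _ sequentially_bot lim]) (use x in simp)
 then have "proj y \<in> fatou_set f" using K(2) by blast
 then obtain e C where e: "e > 0" "\<And>x n. normalized x ==> proj x \<in> ball (proj y) e ==> cmod (jac_iter n x) <= C"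
  by (rule jac_iter_bounded) (rule that)
 have e2: "\<forall>\<^sub>F k in sequentially. dist (proj (x (r k))) (proj y) < e" using lim e(1) by (rule tendstoD)
 have e3: "\<forall>\<^sub>F k in sequentially. k >= nat \<lceil>C\<rceil>" by (rule eventually_ge_at_top)
 have "\<forall>\<^sub>F k in sequentially. False"
  using e2 e3
 proof eventually_elim
  case (elim k)
  have b: "cmod (jac_iter n (x (r k))) <= C" for n by (rule e(2)[OF xn]) (use elim(1) in \<open>simp add: dist_commute\<close>)
  have "C <= real (r k)" using elim(2) seq_suble[OF r(1), of k] by linarith
  then have "cmod (jac_iter n (x (r k))) <= real (r k)" for n using b[of n] by linarith
  then show False using x by blast
 qed
 then show False by simp
qed

end

context attracting_curve
begin

text \<open>Here \<open>k\<close> is the first coordinate of an adapted chart and \<open>m\<close> a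
  lift of the inverse chart along the first axis. The last two conclusions export holomorphy of
  \<open>k\<close> along discs and the chart itself, needed to relate other coordinates on
  \<open>\<Sigma>\<close> to it.\<close>

lemma curve_param:
 assumes c: "c \<in> \<Sigma>"
 obtains e r m k where "e > 0" "r > 0" "hol_vec m (ball (k c) r)"
  "\<And>t. t \<in> ball (k c) r ==> m t ~= 0 \<and> proj (m t) \<in> \<Sigma> \<and> k (proj (m t)) = t"
  "\<And>p. p \<in> \<Sigma> ==> p \<in> ball c e ==> k p \<in> ball (k c) r \<and> proj (m (k p)) = p"
  "continuous_on (ball c e) (k :: cp2 => complex)"
  "\<forall>L A. open A --> hol_vec L A --> (\<forall>z\<in>A. L z ~= 0 \<and> proj (L z) \<in> ball c e) -->
   (\<lambda>z. k (proj (L z))) holomorphic_on A"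
  "\<exists>U q. adapted_chart (cp2_domain \<Omega>) \<Sigma> U q \<and> ball c e \<subseteq> U \<and> k = (\<lambda>p. q p $ 1) \<and>
   (\<forall>t\<in>ball (k c) r. proj (m t) \<in> U)"
proof -
 obtain U q where U: "c \<in> U" "adapted_chart (cp2_domain \<Omega>) \<Sigma> U q"
  using \<Sigma>_curve c unfolding closed_complex_curve_def by blast
 then have hc: "holomorphic_chart (cp2_domain \<Omega>) U q" and im: "q ` (U \<inter> \<Sigma>) = {w \<in> q ` U. w $ 2 = 0}"
  by (auto simp: adapted_chart_def)
 have Uo: "open U" "continuous_on U q" and inj: "\<And>p. p \<in> U ==> inv_into U q (q p) = p"
  using hc comp_open unfolding holomorphic_chart_def carrier_cp2_domain homeomorphism_def
  by (auto simp: openin_open_eq)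
 obtain r g l where r: "r > 0" "ball (q c) r \<subseteq> q ` U"
  and g: "\<And>w. w \<in> ball (q c) r ==> g w ~= 0 \<and> g w $ l = 1 \<and> proj (g w) = inv_into U q w"
  and gd: "\<And>w. w \<in> ball (q c) r ==> \<exists>D. (g has_derivative D) (at w) \<and> (\<forall>a v. D (a *s v) = a *s D v)"
  by (rule holomorphic_chart_inverse_lift[OF hc U(1)]) (rule that)
 define k where "k = (\<lambda>p. q p $ 1)"
 define j where "j = (\<lambda>t. t *s axis 1 1 :: complex^2)"
 have jn: "j t $ 1 = t" "j t $ 2 = 0" for t by (simp_all add: j_def axis_def)
 have q2: "q p = j (k p)" if "p \<in> U" "p \<in> \<Sigma>" for p
 proof -
  have "q p $ 2 = 0" using im that by blast
  then show ?thesis by (simp add: vec_eq_iff forall_2 jn k_def)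
 qed
 have dj: "dist (j a) (j b) = dist a b" for a b
 proof -
  have "j a - j b = (a - b) *s axis 1 1" by (simp add: j_def vec_eq_iff algebra_simps)
  then show ?thesis by (simp only: dist_norm norm_smult) (simp add: norm_axis_1)
 qed
 have jb: "j t \<in> ball (q c) r \<longleftrightarrow> t \<in> ball (k c) r" for t
  using q2[OF U(1) c] dj by simp
 define m where "m = (\<lambda>t. g (j t))"
 have pm: "proj (m t) \<in> U" "q (proj (m t)) = j t" "j t \<in> q ` U" if "t \<in> ball (k c) r" for t
 proof -
  have i: "j t \<in> ball (q c) r" using that jb by simp
  then show "j t \<in> q ` U" using r(2) by blast
  then show "proj (m t) \<in> U" "q (proj (m t)) = j t"
   using g[OF i] by (auto simp: m_def inv_into_into f_inv_into_f)
 qed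
 have mS: "proj (m t) \<in> \<Sigma>" if "t \<in> ball (k c) r" for t
 proof -
  have "q (proj (m t)) \<in> q ` (U \<inter> \<Sigma>)" unfolding im using pm[OF that] jn by auto
  then obtain p where p: "q (proj (m t)) = q p" "p \<in> U \<inter> \<Sigma>" by (rule imageE)
  have "proj (m t) = p" using inj[OF pm(1)[OF that]] inj[of p] p by simp
  then show ?thesis using p(2) by simp
 qed
 have "open (U \<inter> q -` ball (q c) r)" using Uo by (intro continuous_open_preimage) auto
 moreover have "c \<in> U \<inter> q -` ball (q c) r" using U(1) r(1) by simp
 ultimately obtain e where e: "e > 0" "ball c e \<subseteq> U \<inter> q -` ball (q c) r" by (rule openE)
 have eU: "ball c e \<subseteq> U" using e(2) by blast
 show ?thesis
 proof (rule that[of e r m k])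
  show "hol_vec m (ball (k c) r)"
  proof (rule hol_vecI)
   fix t assume "t \<in> ball (k c) r"
   then have "j t \<in> ball (q c) r" by (simp only: jb)
   then obtain E where E: "(g has_derivative E) (at (j t))" "\<And>a v. E (a *s v) = a *s E v" using gd by blast
   have "hol_vec j UNIV" unfolding j_def by (rule hol_vec_id_scale)
   note d = has_derivative_hol_vec[OF this open_UNIV UNIV_I, of t]
   have "(m has_derivative (\<lambda>h. E (h *s vderiv j t))) (at t)"
    unfolding m_def by (rule has_derivative_compose[OF d E(1)])
   then show "\<exists>w. (m has_derivative (\<lambda>h. h *s w)) (at t)" using E(2) by auto
  qed
  show "m t ~= 0 \<and> proj (m t) \<in> \<Sigma> \<and> k (proj (m t)) = t" if "t \<in> ball (k c) r" for t
   using mS[OF that] pm(2)[OF that] g[of "j t"] that jb[of t] jn by (simp add: m_def k_def)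
  show "k p \<in> ball (k c) r \<and> proj (m (k p)) = p" if "p \<in> \<Sigma>" "p \<in> ball c e" for p
  proof -
   have pU: "p \<in> U" "q p \<in> ball (q c) r" using that(2) e(2) by auto
   have ip: "j (k p) = q p" using q2[OF pU(1) that(1)] by simp
   then have "k p \<in> ball (k c) r" using jb[of "k p"] pU(2) by simp
   moreover have "proj (m (k p)) = p" unfolding m_def ip using g[OF pU(2)] inj[OF pU(1)] by simp
   ultimately show ?thesis by blast
  qed
  show "continuous_on (ball c e) k" unfolding k_def by (intro continuous_intros continuous_on_subset[OF Uo(2) eU])
  show "\<forall>L A. open A --> hol_vec L A --> (\<forall>z\<in>A. L z ~= 0 \<and> proj (L z) \<in> ball c e) -->
   (\<lambda>z. k (proj (L z))) holomorphic_on A"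
  proof (intro allI impI)
   fix L A assume a: "open A" "hol_vec L A" "\<forall>z\<in>A. L z ~= 0 \<and> proj (L z) \<in> ball c e"
   have "hol_vec (\<lambda>z. q (proj (L z))) A"
    by (rule holomorphic_chart_compose[OF hc a(1,2)]) (use a(3) eU in blast)
   then show "(\<lambda>z. k (proj (L z))) holomorphic_on A" unfolding k_def by (rule hol_vecD)
  qed
  show "\<exists>U q. adapted_chart (cp2_domain \<Omega>) \<Sigma> U q \<and> ball c e \<subseteq> U \<and> k = (\<lambda>p. q p $ 1) \<and>
   (\<forall>t\<in>ball (k c) r. proj (m t) \<in> U)"
   using U(2) eU pm(1) unfolding k_def by blast
 qed (fact e(1), fact r(1))
qed

text \<open>An identity theorem on \<open>\<Sigma>\<close>: the points near which \<open>jac\<close>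
  vanishes along the curve form a clopen subset. It is nonempty because a nonconstant disc in
  \<open>\<Sigma>\<close> covers a neighborhood of its centre in \<open>\<Sigma>\<close>, by the
  open mapping theorem in the local parameter.\<close>

lemma jac_vanishes_on_curve:
 assumes conn: "connected \<Sigma>" and r: "r > 0" and L: "hol_vec L (ball a r)"
  and L\<Sigma>: "\<And>z. z \<in> ball a r ==> L z ~= 0 \<and> proj (L z) \<in> \<Sigma> \<and> jac (L z) = 0"
  and nc: "\<And>e. e > 0 ==> \<exists>z\<in>ball a e. proj (L z) ~= proj (L a)"
  and x: "x ~= 0" "proj x \<in> \<Sigma>"
 shows "jac x = 0"
proof -
 define Z where "Z = {c\<in>\<Sigma>. \<exists>e>0. \<forall>x. x ~= 0 \<and> proj x \<in> \<Sigma> \<and> proj x \<in> ball c e --> jac x = 0}"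
 have "openin (top_of_set \<Sigma>) Z"
  unfolding openin_euclidean_subtopology_iff
 proof (intro conjI ballI)
  show "Z \<subseteq> \<Sigma>" by (auto simp: Z_def)
  fix c assume "c \<in> Z"
  then obtain e where e: "e > 0" "\<And>x. x ~= 0 ==> proj x \<in> \<Sigma> ==> proj x \<in> ball c e ==> jac x = 0"
   unfolding Z_def by blast
  show "\<exists>e>0. \<forall>x'\<in>\<Sigma>. dist x' c < e --> x' \<in> Z"
  proof (intro exI[of _ "e/2"] conjI ballI impI)
   fix c' assume c': "c' \<in> \<Sigma>" "dist c' c < e / 2"
   have "ball c' (e/2) \<subseteq> ball c e"
   proof
    fix p assume "p \<in> ball c' (e/2)"
    then show "p \<in> ball c e" using c'(2) dist_triangle[of c p c'] by (simp add: dist_commute)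
   qed
   then have "\<forall>x. x ~= 0 \<and> proj x \<in> \<Sigma> \<and> proj x \<in> ball c' (e/2) --> jac x = 0" using e(2) by blast
   then show "c' \<in> Z" unfolding Z_def using c'(1) e(1) half_gt_zero by blast
  qed (use e(1) in simp)
 qed
 moreover have "closedin (top_of_set \<Sigma>) Z"
  unfolding closedin_limpt
 proof (intro conjI allI impI)
  show "Z \<subseteq> \<Sigma>" by (auto simp: Z_def)
  fix c assume c: "c islimpt Z \<and> c \<in> \<Sigma>"
  obtain e h m k where e: "e > 0" "h > 0" "hol_vec m (ball (k c) h)"
   "\<And>b. b \<in> ball (k c) h ==> m b ~= 0 \<and> proj (m b) \<in> \<Sigma> \<and> k (proj (m b)) = b"
   "\<And>p. p \<in> \<Sigma> ==> p \<in> ball c e ==> k p \<in> ball (k c) h \<and> proj (m (k p)) = p"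
   by (rule curve_param[of c]) (use c in blast, rule that)
  obtain c' where c': "c' \<in> Z" "c' \<in> ball c e" using c e(1) unfolding islimpt_approachable by (auto simp: dist_commute)
  then obtain e' where e': "e' > 0" "\<And>x. x ~= 0 ==> proj x \<in> \<Sigma> ==> proj x \<in> ball c' e' ==> jac x = 0" and c'\<Sigma>: "c' \<in> \<Sigma>"
   unfolding Z_def by blast
  define b0 where "b0 = k c'"
  have b0: "b0 \<in> ball (k c) h" "proj (m b0) = c'" using e(5)[OF c'\<Sigma> c'(2)] by (auto simp: b0_def)
  have "continuous_on (ball (k c) h) (\<lambda>b. proj (m b))"
   by (rule continuous_on_compose2[OF continuous_on_proj hol_vec_continuous[OF e(3)]]) (use e(4) in auto)
  then have "open (ball (k c) h \<inter> (\<lambda>b. proj (m b)) -` ball c' e')" by (intro continuous_open_preimage) auto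
  moreover have "b0 \<in> ball (k c) h \<inter> (\<lambda>b. proj (m b)) -` ball c' e'" using b0 e'(1) by simp
  ultimately obtain r' where r': "r' > 0" "ball b0 r' \<subseteq> ball (k c) h \<inter> (\<lambda>b. proj (m b)) -` ball c' e'" by (rule openE)
  have jm: "jac (m b) = 0" if "b \<in> ball (k c) h" for b
  proof (rule analytic_continuation_open[OF open_ball open_ball _ connected_ball _ poly_fun_holomorphic[OF poly_fun_jac e(3)] holomorphic_on_const _ that])
   show "ball b0 r' ~= {}" using r'(1) by simp
   show "ball b0 r' \<subseteq> ball (k c) h" using r'(2) by blast
   fix z assume "z \<in> ball b0 r'"
   then have z: "z \<in> ball (k c) h" "proj (m z) \<in> ball c' e'" using r'(2) by auto
   show "jac (m z) = 0" using e'(2)[of "m z"] e(4)[OF z(1)] z(2) by blast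
  qed
  have "\<forall>x. x ~= 0 \<and> proj x \<in> \<Sigma> \<and> proj x \<in> ball c e --> jac x = 0"
  proof (intro allI impI)
   fix x assume x: "x ~= 0 \<and> proj x \<in> \<Sigma> \<and> proj x \<in> ball c e"
   then have *: "k (proj x) \<in> ball (k c) h" "proj (m (k (proj x))) = proj x" using e(5) by blast+
   show "jac x = 0" by (rule jac_zero_proj[of "m (k (proj x))"]) (use * jm[OF *(1)] e(4)[OF *(1)] x in auto)
  qed
  then show "c \<in> Z" unfolding Z_def using c e(1) by blast
 qed
 moreover have "Z ~= {}"
 proof -
  define c where "c = proj (L a)"
  have in0: "a \<in> ball a r" using r by simp
  have c: "c \<in> \<Sigma>" using L\<Sigma>[OF in0] by (simp add: c_def)
  obtain e h m k where e: "e > 0" "h > 0" "hol_vec m (ball (k c) h)"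
   "\<And>b. b \<in> ball (k c) h ==> m b ~= 0 \<and> proj (m b) \<in> \<Sigma> \<and> k (proj (m b)) = b"
   "\<And>p. p \<in> \<Sigma> ==> p \<in> ball c e ==> k p \<in> ball (k c) h \<and> proj (m (k p)) = p"
   "continuous_on (ball c e) k"
   "\<forall>L A. open A --> hol_vec L A --> (\<forall>z\<in>A. L z ~= 0 \<and> proj (L z) \<in> ball c e) -->
   (\<lambda>z. k (proj (L z))) holomorphic_on A"
   by (rule curve_param[OF c]) (rule that)
  have "continuous_on (ball a r) (\<lambda>z. proj (L z))"
   by (rule continuous_on_compose2[OF continuous_on_proj hol_vec_continuous[OF L]]) (use L\<Sigma> in auto)
  then have "open (ball a r \<inter> (\<lambda>z. proj (L z)) -` ball c e)" by (intro continuous_open_preimage) auto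
  moreover have "a \<in> ball a r \<inter> (\<lambda>z. proj (L z)) -` ball c e" using in0 e(1) by (simp add: c_def)
  ultimately obtain r' where r': "r' > 0" "ball a r' \<subseteq> ball a r \<inter> (\<lambda>z. proj (L z)) -` ball c e" by (rule openE)
  define g where "g = (\<lambda>z. k (proj (L z)))"
  have gh: "g holomorphic_on ball a r'" unfolding g_def
   by (rule e(7)[rule_format, OF open_ball hol_vec_subset[OF L]]) (use r'(2) L\<Sigma> in auto)
  have gp: "proj (L z) \<in> \<Sigma>" "proj (m (g z)) = proj (L z)" "jac (L z) = 0" "L z ~= 0" if "z \<in> ball a r'" for z
  proof -
   have *: "z \<in> ball a r" "proj (L z) \<in> ball c e" using that r'(2) by auto
   then show "proj (L z) \<in> \<Sigma>" "proj (m (g z)) = proj (L z)" "jac (L z) = 0" "L z ~= 0"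
    using L\<Sigma>[OF *(1)] e(5) by (auto simp: g_def)
  qed
  have "\<not> g constant_on ball a r'"
  proof
   assume "g constant_on ball a r'"
   then obtain w where w: "\<And>z. z \<in> ball a r' ==> g z = w" unfolding constant_on_def by blast
   obtain z where z: "z \<in> ball a r'" "proj (L z) ~= proj (L a)" using nc[OF r'(1)] by blast
   have "a \<in> ball a r'" using r'(1) by simp
   then show False using gp(2)[OF z(1)] gp(2)[of a] w[OF z(1)] w[of a] z(2) by simp
  qed
  then have "open (g ` ball a r')" by (intro open_mapping_thm[OF gh open_ball connected_ball open_ball]) auto
  then have "open (ball c e \<inter> k -` (g ` ball a r'))" using e(6) by (intro continuous_open_preimage) auto
  moreover have "c \<in> ball c e \<inter> k -` (g ` ball a r')" using e(1) r'(1) by (auto simp: g_def c_def)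
  ultimately obtain e1 where e1: "e1 > 0" "ball c e1 \<subseteq> ball c e \<inter> k -` (g ` ball a r')" by (rule openE)
  have "\<forall>x. x ~= 0 \<and> proj x \<in> \<Sigma> \<and> proj x \<in> ball c e1 --> jac x = 0"
  proof (intro allI impI)
   fix x assume x: "x ~= 0 \<and> proj x \<in> \<Sigma> \<and> proj x \<in> ball c e1"
   then have 1: "proj x \<in> ball c e" and "k (proj x) \<in> g ` ball a r'" using e1(2) by auto
   then obtain z where z: "z \<in> ball a r'" "k (proj x) = g z" by blast
   have "proj x = proj (L z)" using e(5)[of "proj x"] x 1 z(2) gp(2)[OF z(1)] by simp
   then show "jac x = 0" using jac_zero_proj[of "L z" x] gp[OF z(1)] x by auto
  qed
  then have "c \<in> Z" unfolding Z_def using c e1(1) by blast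
  then show ?thesis by blast
 qed
 ultimately have "Z = \<Sigma>" using conn unfolding connected_clopen by blast
 then obtain e where "e > 0" "\<forall>y. y ~= 0 \<and> proj y \<in> \<Sigma> \<and> proj y \<in> ball (proj x) e --> jac y = 0"
  using x(2) unfolding Z_def by blast
 then show ?thesis using x by auto
qed

lemma det3_field_derivative:
 assumes "hol_vec A S" "hol_vec B S" "open S" "t \<in> S"
 shows "((\<lambda>t. det3 (A t) (B t) W) has_field_derivative det3 (vderiv A t) (B t) W + det3 (A t) (vderiv B t) W) (at t)"
proof -
 have "((\<lambda>t. A t $ i) has_field_derivative vderiv A t $ i) (at t)" "((\<lambda>t. B t $ i) has_field_derivative vderiv B t $ i) (at t)" for i
  using holomorphic_derivI[OF hol_vecD[OF assms(1)] assms(3,4)] holomorphic_derivI[OF hol_vecD[OF assms(2)] assms(3,4)] by auto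
 then show ?thesis unfolding det3_def
  by (auto intro!: derivative_eq_intros simp: algebra_simps simp del: vderiv_nth)
qed

text \<open>Both discs factor through the local parametrization \<open>m\<close>, so modulo the
  radial direction both derivatives are multiples of the one of \<open>m\<close>.\<close>

lemma curve_discs_tangent:
 assumes r: "r > 0" and Y: "hol_vec Y (ball 0 r)" "\<And>t. t \<in> ball 0 r ==> Y t ~= 0 \<and> proj (Y t) \<in> \<Sigma>"
  and Z: "hol_vec Z (ball 0 r)" "\<And>t. t \<in> ball 0 r ==> Z t ~= 0 \<and> proj (Z t) \<in> \<Sigma>" "Z 0 = Y 0"
 shows "det3 (Y 0) (vderiv Y 0) (vderiv Z 0) = 0"
proof -
 define c where "c = proj (Y 0)"
 have c: "c \<in> \<Sigma>" using Y(2)[of 0] r by (simp add: c_def)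
 obtain e i m k where m: "e > 0" "i > 0" "hol_vec m (ball (k c) i)"
  "\<And>j. j \<in> ball (k c) i ==> m j ~= 0 \<and> proj (m j) \<in> \<Sigma> \<and> k (proj (m j)) = j"
  "\<And>p. p \<in> \<Sigma> ==> p \<in> ball c e ==> k p \<in> ball (k c) i \<and> proj (m (k p)) = p"
  "continuous_on (ball c e) (k :: cp2 => complex)"
  "\<forall>L A. open A --> hol_vec L A --> (\<forall>z\<in>A. L z ~= 0 \<and> proj (L z) \<in> ball c e) -->
   (\<lambda>z. k (proj (L z))) holomorphic_on A"
  by (rule curve_param[OF c]) (rule that)
 have tangent: "\<exists>g. \<forall>W. det3 (Y 0) (vderiv Y 0) W = g * det3 (Y 0) (vderiv m (k c)) W"
  if Y: "hol_vec Y (ball 0 r)" "\<And>t. t \<in> ball 0 r ==> Y t ~= 0 \<and> proj (Y t) \<in> \<Sigma>" "proj (Y 0) = c" for Y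
 proof -
  have "continuous_on (ball 0 r) (\<lambda>z. proj (Y z))"
   by (rule continuous_on_compose2[OF continuous_on_proj hol_vec_continuous[OF Y(1)]]) (use Y(2) in auto)
  then have "open (ball 0 r \<inter> (\<lambda>z. proj (Y z)) -` ball c e)" by (intro continuous_open_preimage) auto
  moreover have "0 \<in> ball 0 r \<inter> (\<lambda>z. proj (Y z)) -` ball c e" using r Y(3) m(1) by simp
  ultimately obtain s where s: "s > 0" "ball 0 s \<subseteq> ball 0 r \<inter> (\<lambda>z. proj (Y z)) -` ball c e" by (rule openE)
  have sub: "ball 0 s \<subseteq> ball (0::complex) r" using s by blast
  have 0: "0 \<in> ball (0::complex) s" using s(1) by simp
  define u where "u = (\<lambda>z. k (proj (Y z)))"
  have Ys: "hol_vec Y (ball 0 s)" by (rule hol_vec_subset[OF Y(1) sub])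
  have uh: "u holomorphic_on ball 0 s" unfolding u_def
   by (rule m(7)[rule_format, OF open_ball Ys]) (use s(2) Y(2) in auto)
  have ub: "u z \<in> ball (k c) i" "proj (m (u z)) = proj (Y z)" "Y z ~= 0" if z: "z \<in> ball 0 s" for z
  proof -
   have "z \<in> ball 0 r" "proj (Y z) \<in> ball c e" using z s(2) by auto
   then show "u z \<in> ball (k c) i" "proj (m (u z)) = proj (Y z)" "Y z ~= 0"
    using m(5)[of "proj (Y z)"] Y(2)[of z] by (auto simp: u_def)
  qed
  have u0: "u 0 = k c" by (simp add: u_def Y(3))
  have Mh: "hol_vec (\<lambda>z. m (u z)) (ball 0 s)" by (rule hol_vec_compose[OF m(3) uh]) (use ub(1) in blast)
  have par: "\<exists>b. b ~= 0 \<and> m (u z) = b *s Y z" if z: "z \<in> ball 0 s" for z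
   using proj_eq_iff[of "Y z" "m (u z)"] ub[OF z] m(4)[OF ub(1)[OF z]] by auto
  have "(u has_derivative (\<lambda>h. h * deriv u 0)) (at 0)"
   using holomorphic_derivI[OF uh open_ball 0] by (simp add: has_field_derivative_def mult.commute[of _ "deriv u 0"])
  note d = has_derivative_compose[OF this has_derivative_hol_vec[OF m(3) open_ball ub(1)[OF 0]]]
  have dM: "vderiv (\<lambda>z. m (u z)) 0 = deriv u 0 *s vderiv m (k c)"
   by (rule vderiv_unique) (use d in \<open>simp add: u0\<close>)
  obtain b where b: "b ~= 0" "m (k c) = b *s Y 0" using par[OF 0] by (auto simp: u0)
  have "det3 (Y 0) (vderiv Y 0) W = (deriv u 0 / b) * det3 (Y 0) (vderiv m (k c)) W" for W
  proof -
   \<comment> \<open>\<open>Y z\<close> and \<open>m (u z)\<close> are parallel, so this determinant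
     vanishes identically; differentiating it compares the two derivatives without choosing a
     holomorphic proportionality factor.\<close>
   have "((\<lambda>z. det3 (Y z) (m (u z)) W) has_field_derivative 0) (at 0)"
   proof (rule has_field_derivative_transform_within_open[OF DERIV_const open_ball 0])
    fix z assume "z \<in> ball (0::complex) s"
    from par[OF this] obtain b where "m (u z) = b *s Y z" by blast
    then show "0 = det3 (Y z) (m (u z)) W" by (simp add: det3_simps)
   qed
   from DERIV_unique[OF det3_field_derivative[OF Ys Mh open_ball 0] this]
   have "b * det3 (vderiv Y 0) (Y 0) W + deriv u 0 * det3 (Y 0) (vderiv m (k c)) W = 0"
    by (simp add: dM det3_simps u0 b(2))
   moreover have "det3 (vderiv Y 0) (Y 0) W = - det3 (Y 0) (vderiv Y 0) W" by (simp add: det3_def algebra_simps)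
   ultimately show ?thesis using b(1) by (simp add: field_simps)
  qed
  then show ?thesis by blast
 qed
 obtain g where g: "\<And>W. det3 (Y 0) (vderiv Y 0) W = g * det3 (Y 0) (vderiv m (k c)) W"
  using tangent[OF Y] by (auto simp: c_def)
 obtain g' where g': "\<And>W. det3 (Z 0) (vderiv Z 0) W = g' * det3 (Z 0) (vderiv m (k c)) W"
  using tangent[OF Z(1,2)] by (auto simp: c_def Z(3))
 have swap: "det3 a u v = - det3 a v u" for a u v by (simp add: det3_def algebra_simps)
 show ?thesis unfolding g swap[of _ "vderiv m (k c)"] using g'[of "vderiv m (k c)"] by (simp add: Z(3) det3_simps)
qed

text \<open>Otherwise take probes in two transverse directions at bad points and iterate them by the
  bad times. Their limits are discs in \<open>\<Sigma>\<close> with a common centre, hence tangent,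
  so the limit determinant is 0. Before the limit it is \<open>jac_iter\<close> times a quantity
  bounded below.\<close>

lemma jac_iter_uniformly_small:
 assumes K: "compact K" "K \<subseteq> \<Omega>" and inv: "\<And>z n. z \<in> K ==> (f ^^ n) z \<in> K" and c: "c > 0"
 shows "\<exists>N. \<forall>n\<ge>N. \<forall>x. normalized x --> proj x \<in> K --> cmod (jac_iter n x) < c"
proof (rule ccontr)
 assume "\<not> ?thesis"
 then have "\<forall>N. \<exists>n x. n >= N \<and> normalized x \<and> proj x \<in> K \<and> \<not> cmod (jac_iter n x) < c" by blast
 from choice2[OF this] obtain n X where X: "\<forall>N. n N >= N \<and> normalized (X N) \<and> proj (X N) \<in> K \<and> \<not> cmod (jac_iter (n N) (X N)) < c"
  by (elim exE)
 have Xn: "normalized (X N)" for N using X by blast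
 obtain r x where r: "strict_mono (r :: nat => nat)" "(\<lambda>k. X (r k)) \<longlonglongrightarrow> x" "normalized x"
  by (rule normalized_subseq[OF Xn]) (rule that)
 have pX: "(\<lambda>k. proj (X (r k))) \<longlonglongrightarrow> proj x"
  using r(2,3) Xn by (intro tendsto_proj) (auto simp: normalized_def)
 have xK: "proj x \<in> K" by (rule Lim_in_closed_set[OF compact_imp_closed[OF K(1)] _ sequentially_bot pX]) (use X in simp)
 obtain e where e: "e > 0" "green_harmonic_on (ball (proj x) e)"
  using fatou_green_harmonic[of "proj x"] xK K(2) comp_facts(1) by blast
 obtain e1 where e1: "e1 > 0" "cball (proj x) e1 \<subseteq> \<Omega>" using comp_open xK K(2) open_contains_cball by blast
 define e' where "e' = min e e1"
 have e': "e' > 0" "green_harmonic_on (ball (proj x) e')" "cball (proj x) e' \<subseteq> \<Omega>"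
 proof -
  show "e' > 0" using e e1 by (simp add: e'_def)
  have "ball (proj x) e' \<subseteq> ball (proj x) e" by (rule subset_ball) (simp add: e'_def)
  then show "green_harmonic_on (ball (proj x) e')" using e(2) unfolding green_harmonic_on_def by blast
  have "cball (proj x) e' \<subseteq> cball (proj x) e1" by (rule subset_cball) (simp add: e'_def)
  then show "cball (proj x) e' \<subseteq> \<Omega>" using e1(2) by blast
 qed
 define s where "s = probe_radius e'"
 have s: "s > 0" using e' nbd_ge_1 by (simp add: s_def probe_radius_def)
 have "\<forall>\<^sub>F k in sequentially. dist (proj (X (r k))) (proj x) < e' / 2" by (rule tendstoD[OF pX]) (use e'(1) in simp)
 then obtain k0 where k0: "\<And>k. k >= k0 ==> dist (proj (X (r k))) (proj x) < e' / 2" unfolding eventually_sequentially by blast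
 define q where "q = (\<lambda>k. r (k + k0))"
 have q: "strict_mono q" using r(1) by (simp add: q_def strict_mono_def)
 have xq: "(\<lambda>k. X (q k)) \<longlonglongrightarrow> x" unfolding q_def by (rule LIMSEQ_ignore_initial_segment[OF r(2)])
 have near: "proj (X (q k)) \<in> ball (proj x) (e' / 2)" for k using k0[of "k + k0"] by (simp add: q_def dist_commute)
 obtain i j where ij: "cmod (det3 x (axis i 1) (axis j 1)) >= norm x / 3" by (rule large_det3_axis)
 have P: "\<forall>k. \<exists>T b. nlift T (ball 0 s) \<and> T 0 = X (q k) \<and> vderiv T 0 = axis l 1 + b *s X (q k) \<and>
  (\<forall>g\<in>ball 0 s. proj (T g) \<in> ball (proj x) e')" for l
  unfolding s_def using probe_ex[OF e'(1,2) Xn near] by blast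
 from choice[OF P[of i]] obtain A where A: "\<forall>k. \<exists>b. nlift (A k) (ball 0 s) \<and> A k 0 = X (q k) \<and> vderiv (A k) 0 = axis i 1 + b *s X (q k) \<and>
  (\<forall>g\<in>ball 0 s. proj (A k g) \<in> ball (proj x) e')" by (rule exE)
 from choice[OF P[of j]] obtain B where B: "\<forall>k. \<exists>b. nlift (B k) (ball 0 s) \<and> B k 0 = X (q k) \<and> vderiv (B k) 0 = axis j 1 + b *s X (q k) \<and>
  (\<forall>g\<in>ball 0 s. proj (B k g) \<in> ball (proj x) e')" by (rule exE)
 have nA: "nlift (A k) (ball 0 s)" and nB: "nlift (B k) (ball 0 s)" and AB0: "A k 0 = X (q k)" "B k 0 = X (q k)"
  and pA: "g \<in> ball 0 s ==> proj (A k g) \<in> cball (proj x) e'" and pB: "g \<in> ball 0 s ==> proj (B k g) \<in> cball (proj x) e'" for k g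
  using A B ball_subset_cball by blast+
 define AA where "AA = (\<lambda>k g. (F ^^ n (q k)) (A k g))"
 define BB where "BB = (\<lambda>k g. (F ^^ n (q k)) (B k g))"
 have nAA: "nlift (AA k) (ball 0 s)" and nBB: "nlift (BB k) (ball 0 s)" for k
  unfolding AA_def BB_def by (rule nlift_iter[OF nA], rule nlift_iter[OF nB])
 obtain Y a where Y: "strict_mono (a :: nat => nat)" "nlift Y (ball 0 s)"
  "\<And>C. compact C ==> C \<subseteq> ball 0 s ==> uniform_limit C (\<lambda>k. AA (a k)) Y sequentially"
  by (rule nlift_Montel[OF open_ball nAA]) (rule that)
 obtain Z b where Z: "strict_mono (b :: nat => nat)" "nlift Z (ball 0 s)"
  "\<And>C. compact C ==> C \<subseteq> ball 0 s ==> uniform_limit C (\<lambda>k. BB (a (b k))) Z sequentially"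
  by (rule nlift_Montel[where Y = "\<lambda>k. BB (a k)", OF open_ball nBB]) (rule that)
 have Ya: "uniform_limit C (\<lambda>k. AA (a (b k))) Y sequentially" if "compact C" "C \<subseteq> ball 0 s" for C
  by (rule uniform_limit_subseq[OF Y(3)[OF that] Z(1)])
 define h where "h = (\<lambda>k. q (a (b k)))"
 have "strict_mono (\<lambda>k. a (b k))" using strict_mono_o[OF Y(1) Z(1)] by (simp add: o_def)
 then have h: "strict_mono h" using strict_mono_o[OF q] by (fastforce simp: h_def o_def)
 have nh: "filterlim (\<lambda>k. n (h k)) at_top sequentially"
  by (rule filterlim_at_top_mono[OF filterlim_subseq[OF h]]) (use X in simp)
 have hY: "hol_vec Y (ball 0 s)" "hol_vec Z (ball 0 s)" "\<And>k. hol_vec (AA (a (b k))) (ball 0 s)" "\<And>k. hol_vec (BB (a (b k))) (ball 0 s)"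
  using Y(2) Z(2) nAA nBB by (auto simp: nlift_def)
 have 0: "0 \<in> ball (0::complex) s" using s by simp
 have AB0': "AA (a (b k)) 0 = (F ^^ n (h k)) (X (h k))" "BB (a (b k)) 0 = (F ^^ n (h k)) (X (h k))" for k
  by (simp_all add: AA_def BB_def AB0 h_def)
 have lim: "(\<lambda>k. AA (a (b k)) t) \<longlonglongrightarrow> Y t" "(\<lambda>k. BB (a (b k)) t) \<longlonglongrightarrow> Z t" if "t \<in> ball 0 s" for t
  by (rule tendsto_uniform_limitI[OF Ya[of "{t}"]], use that in auto)
   (rule tendsto_uniform_limitI[OF Z(3)[of "{t}"]], use that in auto)
 have YZ: "Z 0 = Y 0" using LIMSEQ_unique[OF lim(2)[OF 0]] lim(1)[OF 0] by (simp add: AB0')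
 have nz: "L t ~= 0" if "nlift L (ball 0 s)" "t \<in> ball 0 s" for L t using that by (simp add: nlift_def)
 have "proj (Y 0) \<in> K"
 proof (rule Lim_in_closed_set[OF compact_imp_closed[OF K(1)] _ sequentially_bot])
  show "(\<lambda>k. proj (AA (a (b k)) 0)) \<longlonglongrightarrow> proj (Y 0)"
   by (rule tendsto_proj[OF lim(1)[OF 0] nz[OF Y(2) 0]]) (rule nz[OF nAA 0])
  show "\<forall>\<^sub>F k in sequentially. proj (AA (a (b k)) 0) \<in> K"
   using X Xn inv by (intro always_eventually allI) (simp add: AB0' f_iter_proj[symmetric] normalized_def)
 qed
 \<comment> \<open>Invariance of \<open>K\<close> places the centre in \<open>\<Omega>\<close>. Only
   then does a small limit disc stay in \<open>\<Omega>\<close> and \<open>attract_limit\<close> put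
   it into \<open>\<Sigma>\<close>.\<close>
 then have Y0: "proj (Y 0) \<in> \<Omega>" using K(2) by blast
 have small: "\<exists>u>0. \<forall>t\<in>ball 0 u. t \<in> ball 0 s \<and> proj (L t) \<in> \<Sigma>"
  if L: "nlift L (ball 0 s)" "L 0 = Y 0" and D: "\<And>k. nlift (D k) (ball 0 s)" "\<And>k g. g \<in> ball 0 s ==> proj (D k g) \<in> cball (proj x) e'"
   and l: "\<And>t. t \<in> ball 0 s ==> (\<lambda>k. (F ^^ n (h k)) (D k t)) \<longlonglongrightarrow> L t" for L D
 proof -
  have hL: "hol_vec L (ball 0 s)" using L(1) by (simp add: nlift_def)
  have "continuous_on (ball 0 s) (\<lambda>z. proj (L z))"
   by (rule continuous_on_compose2[OF continuous_on_proj hol_vec_continuous[OF hL]]) (use nz[OF L(1)] in auto)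
  then have "open (ball 0 s \<inter> (\<lambda>z. proj (L z)) -` \<Omega>)" using comp_open by (intro continuous_open_preimage) auto
  moreover have "0 \<in> ball 0 s \<inter> (\<lambda>z. proj (L z)) -` \<Omega>" using 0 Y0 L(2) by simp
  ultimately obtain u where u: "u > 0" "ball 0 u \<subseteq> ball 0 s \<inter> (\<lambda>z. proj (L z)) -` \<Omega>" by (rule openE)
  have "proj (L t) \<in> \<Sigma>" if t: "t \<in> ball 0 s" "proj (L t) \<in> \<Omega>" for t
  proof (rule attract_limit[OF closed_imp_compact_cp2[OF closed_cball] e'(3) D(2)[OF t(1)] nh _ t(2)])
   have "(\<lambda>k. proj ((F ^^ n (h k)) (D k t))) \<longlonglongrightarrow> proj (L t)"
    by (rule tendsto_proj[OF l[OF t(1)] nz[OF L(1) t(1)]]) (use nz[OF D(1) t(1)] in \<open>simp add: iter_zero\<close>)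
   then show "(\<lambda>k. (f ^^ n (h k)) (proj (D k t))) \<longlonglongrightarrow> proj (L t)" using nz[OF D(1) t(1)] by (simp add: f_iter_proj)
  qed
  then show ?thesis using u by (intro exI[of _ u] conjI ballI) blast+
 qed
 obtain u1 where u1: "u1 > 0" "\<forall>t\<in>ball 0 u1. t \<in> ball 0 s \<and> proj (Y t) \<in> \<Sigma>"
  using small[OF Y(2) refl nA pA, of "\<lambda>k. a (b k)"] lim(1) by (auto simp: AA_def h_def)
 obtain u2 where u2: "u2 > 0" "\<forall>t\<in>ball 0 u2. t \<in> ball 0 s \<and> proj (Z t) \<in> \<Sigma>"
  using small[OF Z(2) YZ nB pB, of "\<lambda>k. a (b k)"] lim(2) by (auto simp: BB_def h_def)
 define u where "u = min u1 u2"
 have us: "t \<in> ball 0 s" "proj (Y t) \<in> \<Sigma>" "proj (Z t) \<in> \<Sigma>" if "t \<in> ball 0 u" for t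
  using u1(2) u2(2) that by (auto simp: u_def)
 have "det3 (Y 0) (vderiv Y 0) (vderiv Z 0) = 0"
 proof (rule curve_discs_tangent[of u])
  show "u > 0" using u1(1) u2(1) by (simp add: u_def)
  show "hol_vec Y (ball 0 u)" "hol_vec Z (ball 0 u)" using us by (auto intro: hol_vec_subset[OF hY(1)] hol_vec_subset[OF hY(2)])
  show "Y t ~= 0 \<and> proj (Y t) \<in> \<Sigma>" "Z t ~= 0 \<and> proj (Z t) \<in> \<Sigma>" if "t \<in> ball 0 u" for t
   using us[OF that] nz[OF Y(2)] nz[OF Z(2)] by auto
 qed (rule YZ)
 moreover have "(\<lambda>k. vderiv (AA (a (b k))) 0) \<longlonglongrightarrow> vderiv Y 0" "(\<lambda>k. vderiv (BB (a (b k))) 0) \<longlonglongrightarrow> vderiv Z 0"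
  by (rule vderiv_tendsto[OF open_ball hY(3) Ya hY(1) tendsto_const 0], assumption+)
   (rule vderiv_tendsto[OF open_ball hY(4) Z(3) hY(2) tendsto_const 0], assumption+)
 then have "(\<lambda>k. det3 (AA (a (b k)) 0) (vderiv (AA (a (b k))) 0) (vderiv (BB (a (b k))) 0)) \<longlonglongrightarrow> det3 (Y 0) (vderiv Y 0) (vderiv Z 0)"
  using lim(1)[OF 0] unfolding det3_def by (intro tendsto_intros)
 moreover have "det3 (AA (a (b k)) 0) (vderiv (AA (a (b k))) 0) (vderiv (BB (a (b k))) 0)
  = jac_iter (n (h k)) (X (h k)) * det3 (X (h k)) (axis i 1) (axis j 1)" for k
 proof -
  obtain b1 b2 where "vderiv (A (a (b k))) 0 = axis i 1 + b1 *s X (h k)" "vderiv (B (a (b k))) 0 = axis j 1 + b2 *s X (h k)"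
   using A B unfolding h_def by blast
  then show ?thesis unfolding AB0'(1)
   unfolding AA_def BB_def h_def by (intro probe_det3[OF nA nB s AB0]) auto
 qed
 ultimately have 1: "(\<lambda>k. cmod (jac_iter (n (h k)) (X (h k)) * det3 (X (h k)) (axis i 1) (axis j 1))) \<longlonglongrightarrow> 0"
  using tendsto_norm_zero by simp
 have "(\<lambda>k. X (h k)) \<longlonglongrightarrow> x"
  using LIMSEQ_subseq_LIMSEQ[OF xq \<open>strict_mono (\<lambda>k. a (b k))\<close>] by (simp add: o_def h_def)
 then have 2: "(\<lambda>k. c * cmod (det3 (X (h k)) (axis i 1) (axis j 1))) \<longlonglongrightarrow> c * cmod (det3 x (axis i 1) (axis j 1))"
  unfolding det3_def by (intro tendsto_intros)
 have "c * cmod (det3 x (axis i 1) (axis j 1)) <= 0"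
 proof (rule LIMSEQ_le[OF 2 1], intro exI allI impI)
  fix k
  have "cmod (jac_iter (n (h k)) (X (h k))) >= c" using X by (simp add: not_less)
  then show "c * cmod (det3 (X (h k)) (axis i 1) (axis j 1)) <= cmod (jac_iter (n (h k)) (X (h k)) * det3 (X (h k)) (axis i 1) (axis j 1))"
   unfolding norm_mult by (intro mult_right_mono) auto
 qed
 moreover have "norm x > 0" using r(3) by (simp add: normalized_def)
 ultimately show False using ij c by (simp add: mult_le_0_iff)
qed

end

section \<open>Limits of an orbit of discs\<close>

text \<open>The bilinear cross product. For a nonvanishing lift \<open>S\<close>,
  \<open>wedge (S t) (vderiv S t) = 0\<close> says that the projected disc has zero derivative at
  \<open>t\<close>.\<close>

definition wedge :: "complex^3 => complex^3 => complex^3" where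
 "wedge a b = (\<chi> i. det3 (axis i 1) a b)"

lemma wedge_nth: "wedge a b $ 1 = a $ 2 * b $ 3 - a $ 3 * b $ 2"
 "wedge a b $ 2 = - (a $ 1 * b $ 3 - a $ 3 * b $ 1)" "wedge a b $ 3 = a $ 1 * b $ 2 - a $ 2 * b $ 1"
 by (simp_all add: wedge_def det3_def axis_def)

lemma wedge_smult: "wedge (u *s a) b = u *s wedge a b" "wedge a (u *s b) = u *s wedge a b" "wedge a a = 0"
 by (simp_all add: wedge_def det3_simps vec_eq_iff)

lemma wedge_zero_imp_parallel:
 assumes "wedge a b = 0" "a ~= 0"
 obtains c where "b = c *s a"
proof -
 have e: "a $ 2 * b $ 3 = a $ 3 * b $ 2" "a $ 1 * b $ 3 = a $ 3 * b $ 1" "a $ 1 * b $ 2 = a $ 2 * b $ 1"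
  using assms(1) wedge_nth[of a b] by auto
 obtain j where j: "a $ j ~= 0" using assms(2) by (auto simp: vec_eq_iff)
 have "\<forall>i j. b $ i * a $ j = b $ j * a $ i"
 proof -
  have "b $ 1 * a $ 2 = b $ 2 * a $ 1" by (rule trans[OF mult.commute trans[OF e(3)[symmetric] mult.commute]])
  moreover have "b $ 1 * a $ 3 = b $ 3 * a $ 1" by (rule trans[OF mult.commute trans[OF e(2)[symmetric] mult.commute]])
  moreover have "b $ 2 * a $ 3 = b $ 3 * a $ 2" by (rule trans[OF mult.commute trans[OF e(1)[symmetric] mult.commute]])
  ultimately show ?thesis unfolding forall_3 by (intro conjI) (assumption | rule refl | (rule sym, assumption))+
 qed
 then have "b $ i * a $ j = b $ j * a $ i" for i by blast
 then have eq: "b $ i = (b $ j / a $ j) * a $ i" for i using j by (simp add: field_simps)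
 have "b = (b $ j / a $ j) *s a" unfolding vec_eq_iff vector_smult_component using eq by (rule allI)
 then show ?thesis by (rule that)
qed

lemma continuous_on_wedge [continuous_intros]:
 "continuous_on A g ==> continuous_on A h ==> continuous_on A (\<lambda>x. wedge (g x) (h x))"
 unfolding wedge_def by (intro continuous_intros)

lemma tendsto_wedge:
 assumes "a \<longlonglongrightarrow> x" "b \<longlonglongrightarrow> y"
 shows "(\<lambda>n. wedge (a n) (b n)) \<longlonglongrightarrow> wedge x y"
proof -
 have "continuous_on UNIV (\<lambda>p. wedge (fst p) (snd p))" by (intro continuous_intros)
 from continuous_on_tendsto_compose[OF this tendsto_Pair[OF assms]] show ?thesis by simp
qed

lemma vderiv_cong:
 assumes "open A" "z \<in> A" "\<And>w. w \<in> A ==> L w = M w"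
 shows "vderiv L z = vderiv M z"
proof -
 have "deriv (\<lambda>w. L w $ i) z = deriv (\<lambda>w. M w $ i) z" for i
  by (rule deriv_cong_ev) (use assms in \<open>auto simp: eventually_nhds\<close>)
 then show ?thesis by (simp add: vec_eq_iff)
qed

text \<open>The setting for the closedness argument: the orbit of the full disc lies in
  \<open>\<Omega>\<close>, but only the inner disc of radius \<open>\<rho>0\<close> is known to be
  trapped in an invariant compact set.\<close>

locale orbit_disc = attracting_curve +
 fixes T :: "complex => complex^3" and R \<rho>0 :: real and K :: "cp2 set"
 assumes \<Sigma>_conn: "connected \<Sigma>" and T: "nlift T (ball 0 R)"
  and T_\<Omega>: "\<And>t. t \<in> ball 0 R ==> proj (T t) \<in> \<Omega>" and \<rho>0: "0 < \<rho>0" "\<rho>0 < R"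
  and K: "compact K" "K \<subseteq> \<Omega>" "\<And>z. z \<in> K ==> f z \<in> K"
  and T_K: "\<And>t. t \<in> cball 0 \<rho>0 ==> proj (T t) \<in> K"
begin

definition X :: "nat => complex => complex^3" where
 "X m t = (F ^^ m) (T t)"

lemma X_add: "X (m + n) t = (F ^^ n) (X m t)"
 unfolding X_def by (subst add.commute) (simp add: funpow_add)

lemma X_nlift: "nlift (X m) (ball 0 R)"
 unfolding X_def by (rule nlift_iter[OF T])

lemma X_normalized: "t \<in> ball 0 R ==> normalized (X m t)"
 by (rule nlift_normalized[OF X_nlift])

lemma nonzero: "nlift Y A ==> t \<in> A ==> Y t ~= 0"
 by (simp add: nlift_def)

lemma proj_X: "t \<in> ball 0 R ==> proj (X m t) = (f ^^ m) (proj (T t))"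
 unfolding X_def using nonzero[OF T] by (simp add: f_iter_proj)

lemma proj_X_add: "t \<in> ball 0 R ==> proj (X (m + n) t) = (f ^^ n) (proj (X m t))"
 unfolding X_add using nonzero[OF X_nlift] by (simp add: f_iter_proj)

lemma K_iter: "z \<in> K ==> (f ^^ n) z \<in> K"
 by (induction n) (auto intro: K)

lemma in_R: "t \<in> cball 0 \<rho>0 ==> t \<in> ball 0 R"
 using \<rho>0 by simp

lemma X_K: "t \<in> cball 0 \<rho>0 ==> proj (X m t) \<in> K"
 using proj_X[OF in_R] K_iter[OF T_K] by simp

lemma X_\<Omega>: "t \<in> ball 0 R ==> proj (X m t) \<in> \<Omega>"
 using proj_X comp_iter[OF T_\<Omega>] by simp

definition limit_disc :: "(complex => complex^3) => (nat => nat) => bool" where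
 "limit_disc S m \<longleftrightarrow> nlift S (ball 0 R) \<and> filterlim m at_top sequentially \<and>
  (\<forall>C. compact C --> C \<subseteq> ball 0 R --> uniform_limit C (\<lambda>k. X (m k)) S sequentially)"

lemma limit_discD:
 assumes "limit_disc S m"
 shows "nlift S (ball 0 R)" "filterlim m at_top sequentially"
  "compact C ==> C \<subseteq> ball 0 R ==> uniform_limit C (\<lambda>k. X (m k)) S sequentially"
 using assms unfolding limit_disc_def by blast+

lemma limit_disc_exists:
 assumes "filterlim m at_top sequentially"
 obtains S r where "strict_mono (r :: nat => nat)" "limit_disc S (\<lambda>k. m (r k))"
proof -
 obtain S r where S: "strict_mono (r :: nat => nat)" "nlift S (ball 0 R)"
  "\<And>C. compact C ==> C \<subseteq> ball 0 R ==> uniform_limit C (\<lambda>k. X (m (r k))) S sequentially"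
  by (rule nlift_Montel[OF open_ball X_nlift]) (rule that)
 have "filterlim (\<lambda>k. m (r k)) at_top sequentially" by (rule filterlim_compose[OF assms filterlim_subseq[OF S(1)]])
 then have "limit_disc S (\<lambda>k. m (r k))"
  unfolding limit_disc_def
 proof (intro conjI allI impI)
  show "nlift S (ball 0 R)" by (rule S(2))
  fix C :: "complex set" assume "compact C" "C \<subseteq> ball 0 R"
  then show "uniform_limit C (\<lambda>k. X (m (r k))) S sequentially" by (rule S(3))
 qed
 with S(1) show ?thesis by (rule that)
qed

lemma nlift_limit_points:
 assumes Y: "\<And>k. nlift (Y k) (ball 0 R)" and C: "compact C" "C \<subseteq> ball 0 R" and z: "\<And>k. z k \<in> C"
 obtains S r z0 where "strict_mono (r :: nat => nat)" "nlift S (ball 0 R)" "z0 \<in> C" "(\<lambda>k. z (r k)) \<longlonglongrightarrow> z0"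
  "(\<lambda>k. Y (r k) (z (r k))) \<longlonglongrightarrow> S z0" "(\<lambda>k. vderiv (Y (r k)) (z (r k))) \<longlonglongrightarrow> vderiv S z0"
  "\<And>t. t \<in> ball 0 R ==> (\<lambda>k. Y (r k) t) \<longlonglongrightarrow> S t"
  "\<And>C. compact C ==> C \<subseteq> ball 0 R ==> uniform_limit C (\<lambda>k. Y (r k)) S sequentially"
proof -
 obtain S r where S: "strict_mono (r :: nat => nat)" "nlift S (ball 0 R)"
  "\<And>C. compact C ==> C \<subseteq> ball 0 R ==> uniform_limit C (\<lambda>k. Y (r k)) S sequentially"
  by (rule nlift_Montel[OF open_ball Y]) (rule that)
 have "\<forall>k. z (r k) \<in> C" using z by blast
 with C(1) have "\<exists>l\<in>C. \<exists>s::nat => nat. strict_mono s \<and> ((\<lambda>k. z (r k)) \<circ> s) \<longlonglongrightarrow> l"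
  unfolding compact_def by (elim allE[of _ "\<lambda>k. z (r k)"]) simp
 then obtain z0 s where s: "z0 \<in> C" "strict_mono (s :: nat => nat)" "((\<lambda>k. z (r k)) \<circ> s) \<longlonglongrightarrow> z0"
  by blast
 define q where "q = (\<lambda>k. r (s k))"
 have q: "strict_mono q" using strict_mono_o[OF S(1) s(2)] by (simp add: q_def o_def)
 have zl: "(\<lambda>k. z (q k)) \<longlonglongrightarrow> z0" using s(3) by (simp add: o_def q_def)
 have u: "uniform_limit C' (\<lambda>k. Y (q k)) S sequentially" if "compact C'" "C' \<subseteq> ball 0 R" for C'
  unfolding q_def by (rule uniform_limit_subseq[OF S(3)[OF that] s(2)])
 have hS: "hol_vec S (ball 0 R)" and hY: "\<And>k. hol_vec (Y k) (ball 0 R)" using S(2) Y by (auto simp: nlift_def)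
 have 1: "(\<lambda>k. Y (q k) (z (q k))) \<longlonglongrightarrow> S z0"
  by (rule uniform_limit_seq_tendsto[OF u[OF C] _ z s(1) zl])
   (rule continuous_on_subset[OF hol_vec_continuous[OF hS] C(2)])
 have 2: "(\<lambda>k. vderiv (Y (q k)) (z (q k))) \<longlonglongrightarrow> vderiv S z0"
  by (rule vderiv_tendsto[OF open_ball hY u hS zl]) (use s(1) C(2) in auto)
 have 3: "(\<lambda>k. Y (q k) t) \<longlonglongrightarrow> S t" if "t \<in> ball 0 R" for t
  by (rule tendsto_uniform_limitI[OF u[of "{t}"]]) (use that in auto)
 show thesis by (rule that[OF q S(2) s(1) zl 1 2 3 u])
qed

lemma limit_disc_near:
 assumes S: "limit_disc S m" and t: "t \<in> cball 0 \<rho>0"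
 shows "proj (S t) \<in> K" "proj (S t) \<in> \<Sigma>"
proof -
 have tR: "t \<in> ball 0 R" by (rule in_R[OF t])
 have "(\<lambda>k. X (m k) t) \<longlonglongrightarrow> S t"
  by (rule tendsto_uniform_limitI[OF limit_discD(3)[OF S, of "{t}"]]) (use tR in auto)
 then have lim: "(\<lambda>k. proj (X (m k) t)) \<longlonglongrightarrow> proj (S t)"
  by (rule tendsto_proj) (use nonzero[OF X_nlift tR] nonzero[OF limit_discD(1)[OF S] tR] in auto)
 show 1: "proj (S t) \<in> K"
  by (rule Lim_in_closed_set[OF compact_imp_closed[OF K(1)] _ sequentially_bot lim]) (use X_K[OF t] in simp)
 have lim2: "(\<lambda>k. (f ^^ m k) (proj (T t))) \<longlonglongrightarrow> proj (S t)" using lim by (simp only: proj_X[OF tR])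
 show "proj (S t) \<in> \<Sigma>"
  by (rule attract_limit[OF K(1,2) T_K[OF t] limit_discD(2)[OF S] lim2]) (use 1 K(2) in blast)
qed

text \<open>Closeness is required on the trapped inner disc only; \<open>nlift_rigid\<close> turns
  equality of the limits there into equality up to a phase on the whole ball.\<close>

lemma close_discs_limit:
 assumes Y: "nlift Y (ball 0 R)" and Z: "nlift Z (ball 0 R)"
  and lim: "\<And>t. t \<in> ball 0 R ==> (\<lambda>k. Yk k t) \<longlonglongrightarrow> Y t" "\<And>t. t \<in> ball 0 R ==> (\<lambda>k. Zk k t) \<longlonglongrightarrow> Z t"
  and nz: "\<And>k t. t \<in> ball 0 R ==> Yk k t ~= 0" "\<And>k t. t \<in> ball 0 R ==> Zk k t ~= 0"
  and close: "\<And>t. t \<in> cball 0 \<rho>0 ==> (\<lambda>k. dist (proj (Yk k t)) (proj (Zk k t))) \<longlonglongrightarrow> 0"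
 shows "\<exists>u. cmod u = 1 \<and> (\<forall>t\<in>ball 0 R. Y t = u *s Z t)"
proof (rule nlift_rigid[OF Y Z \<rho>0(1)])
 show "\<rho>0 <= R" using \<rho>0(2) by simp
 show "proj (Y t) = proj (Z t)" if t: "t \<in> ball 0 \<rho>0" for t
 proof -
  have tc: "t \<in> cball 0 \<rho>0" using t by simp
  have tR: "t \<in> ball 0 R" by (rule in_R[OF tc])
  have "(\<lambda>k. proj (Yk k t)) \<longlonglongrightarrow> proj (Y t)" "(\<lambda>k. proj (Zk k t)) \<longlonglongrightarrow> proj (Z t)"
   using tendsto_proj[OF lim(1)[OF tR] nonzero[OF Y tR]] tendsto_proj[OF lim(2)[OF tR] nonzero[OF Z tR]] nz tR by blast+
  then have "(\<lambda>k. dist (proj (Yk k t)) (proj (Zk k t))) \<longlonglongrightarrow> dist (proj (Y t)) (proj (Z t))" by (rule tendsto_dist)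
  from LIMSEQ_unique[OF this close[OF tc]] show ?thesis by simp
 qed
qed

lemma K_fatou: "K \<subseteq> fatou_set f"
 using K(2) comp_facts(1) by blast

lemma K_close_iter:
 assumes "\<And>k. p k \<in> K" "(\<lambda>k. dist (p k) (q k)) \<longlonglongrightarrow> 0"
 shows "(\<lambda>k. dist ((f ^^ n k) (p k)) ((f ^^ n k) (q k))) \<longlonglongrightarrow> 0"
proof -
 obtain e C where e: "e > 0" "\<forall>p\<in>K. \<forall>q. dist p q < e --> (\<forall>n. dist ((f ^^ n) p) ((f ^^ n) q) <= C * dist p q)"
  using compact_equi_lipschitz[OF K(1) K_fatou] by blast
 have "\<forall>\<^sub>F k in sequentially. dist (dist (p k) (q k)) 0 < e" using assms(2) e(1) by (rule tendstoD)
 then have "\<forall>\<^sub>F k in sequentially. norm (dist ((f ^^ n k) (p k)) ((f ^^ n k) (q k))) <= C * dist (p k) (q k)"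
 proof eventually_elim
  case (elim k)
  then show ?case using e(2) assms(1)[of k] by simp
 qed
 moreover have "(\<lambda>k. C * dist (p k) (q k)) \<longlonglongrightarrow> 0" using tendsto_mult_left[OF assms(2), of C] by simp
 ultimately show ?thesis by (rule Lim_null_comparison)
qed

lemma jac_holomorphic: "nlift Y A ==> (\<lambda>z. jac (Y z)) holomorphic_on A"
 by (simp add: nlift_def poly_fun_holomorphic[OF poly_fun_jac])

lemma tendsto_jac: "x \<longlonglongrightarrow> y ==> (\<lambda>k. jac (x k)) \<longlonglongrightarrow> jac y"
 by (rule continuous_on_tendsto_compose[OF poly_fun_continuous[OF poly_fun_jac, of UNIV]]) auto

lemma subseq_above:
 fixes r \<mu> :: "nat => nat"
 assumes "strict_mono r"
 shows "r (k + \<mu> k) >= \<mu> k" "k + \<mu> k >= k"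
 using seq_suble[OF assms, of "k + \<mu> k"] by auto

text \<open>If no \<open>M\<close> works, pass to a convergent subsequence of the unmatched starting
  discs. Two late ones are close, and on the trapped inner disc they stay close at all later times.
  Limits of the shifted discs thus agree up to a phase on the whole disc, and
  \<open>cmod (jac _)\<close> does not see the phase.\<close>

lemma jac_almost_periodic:
 assumes C: "compact C" "C \<subseteq> ball 0 R" and e: "e > 0"
 shows "\<exists>M. \<forall>m. \<exists>m'\<le>M. \<forall>j. \<forall>z\<in>C. cmod (jac (X (m0 + (m + j)) z)) <= cmod (jac (X (m0 + (m' + j)) z)) + e"
proof (rule ccontr)
 assume "\<not> ?thesis"
 then have neg: "\<nexists>M. \<forall>m. \<exists>m'\<le>M. \<forall>j. \<forall>z\<in>C. cmod (jac (X (m0 + (m + j)) z)) <= cmod (jac (X (m0 + (m' + j)) z)) + e" .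
 define bad where "bad = (\<lambda>m m'. \<not> (\<forall>j. \<forall>z\<in>C. cmod (jac (X (m0 + (m + j)) z)) <= cmod (jac (X (m0 + (m' + j)) z)) + e))"
 have "\<nexists>M. \<forall>m. \<exists>m'\<le>M. \<not> bad m m'" unfolding bad_def not_not by (rule neg)
 then have ex: "\<forall>M. \<exists>m. \<forall>m'\<le>M. bad m m'" by blast
 have "\<exists>j z. z \<in> C \<and> \<not> cmod (jac (X (m0 + (m + j)) z)) <= cmod (jac (X (m0 + (m' + j)) z)) + e" if "bad m m'" for m m'
  using that unfolding bad_def by blast
 with ex have "\<forall>M. \<exists>m. \<forall>m'\<le>M. \<exists>j z. z \<in> C \<and> \<not> cmod (jac (X (m0 + (m + j)) z)) <= cmod (jac (X (m0 + (m' + j)) z)) + e"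
  by meson
 from choice[OF this] obtain \<mu> where \<mu>: "\<forall>M. \<forall>m'\<le>M. \<exists>j z. z \<in> C \<and> \<not> cmod (jac (X (m0 + (\<mu> M + j)) z)) <= cmod (jac (X (m0 + (m' + j)) z)) + e"
  by (rule exE)
 obtain S r where S: "strict_mono (r :: nat => nat)" "nlift S (ball 0 R)"
  "\<And>C. compact C ==> C \<subseteq> ball 0 R ==> uniform_limit C (\<lambda>k. X (m0 + \<mu> (r k))) S sequentially"
  by (rule nlift_Montel[OF open_ball X_nlift]) (rule that)
 \<comment> \<open>This gives \<open>\<mu> (r k) <= r (l k)\<close>, so \<open>\<mu> (r k)\<close>
   is one of the starting times that fail to match \<open>\<mu> (r (l k))\<close>, while
   \<open>l k\<close> still tends to infinity.\<close>
 define l where "l = (\<lambda>k. k + \<mu> (r k))"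
 have l: "r (l k) >= \<mu> (r k)" "l k >= k" for k unfolding l_def by (rule subseq_above[OF S(1), where \<mu> = "\<lambda>k. \<mu> (r k)"])+
 have "\<forall>k. \<exists>j z. z \<in> C \<and> \<not> cmod (jac (X (m0 + (\<mu> (r (l k)) + j)) z)) <= cmod (jac (X (m0 + (\<mu> (r k) + j)) z)) + e"
  using \<mu> l(1) by blast
 from choice2[OF this] obtain j z where z: "\<forall>k. z k \<in> C \<and> \<not> cmod (jac (X (m0 + (\<mu> (r (l k)) + j k)) (z k))) <= cmod (jac (X (m0 + (\<mu> (r k) + j k)) (z k))) + e"
  by (elim exE)
 have zC: "z k \<in> C" for k using z by blast
 define P where "P = (\<lambda>k. X (m0 + (\<mu> (r (l k)) + j k)))"
 define Q where "Q = (\<lambda>k. X (m0 + (\<mu> (r k) + j k)))"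
 have PQ: "nlift (P k) (ball 0 R)" "nlift (Q k) (ball 0 R)" for k unfolding P_def Q_def by (rule X_nlift)+
 obtain Y s z0 where Y: "strict_mono (s :: nat => nat)" "nlift Y (ball 0 R)" "z0 \<in> C" "(\<lambda>k. z (s k)) \<longlonglongrightarrow> z0"
  "(\<lambda>k. P (s k) (z (s k))) \<longlonglongrightarrow> Y z0" "\<And>t. t \<in> ball 0 R ==> (\<lambda>k. P (s k) t) \<longlonglongrightarrow> Y t"
  by (rule nlift_limit_points[where Y = P and z = z, OF PQ(1) C zC]) (rule that)
 obtain Z s' z1 where Z: "strict_mono (s' :: nat => nat)" "nlift Z (ball 0 R)" "z1 \<in> C" "(\<lambda>k. z (s (s' k))) \<longlonglongrightarrow> z1"
  "(\<lambda>k. Q (s (s' k)) (z (s (s' k)))) \<longlonglongrightarrow> Z z1" "\<And>t. t \<in> ball 0 R ==> (\<lambda>k. Q (s (s' k)) t) \<longlonglongrightarrow> Z t"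
  by (rule nlift_limit_points[where Y = "\<lambda>k. Q (s k)" and z = "\<lambda>k. z (s k)", OF PQ(2) C zC]) (rule that)
 have zz: "z1 = z0" using LIMSEQ_unique[OF Z(4) LIMSEQ_subseq_LIMSEQ[OF Y(4) Z(1), unfolded o_def]] .
 have Yt: "(\<lambda>k. P (s (s' k)) t) \<longlonglongrightarrow> Y t" if "t \<in> ball 0 R" for t
  using LIMSEQ_subseq_LIMSEQ[OF Y(6)[OF that] Z(1)] by (simp add: o_def)
 have "\<exists>u. cmod u = 1 \<and> (\<forall>t\<in>ball 0 R. Y t = u *s Z t)"
 proof (rule close_discs_limit[where Y = Y and Z = Z and Yk = "\<lambda>k. P (s (s' k))" and Zk = "\<lambda>k. Q (s (s' k))", OF Y(2) Z(2) Yt Z(6) nonzero[OF PQ(1)] nonzero[OF PQ(2)]])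
  fix t :: complex assume t: "t \<in> cball 0 \<rho>0"
  have tR: "t \<in> ball 0 R" by (rule in_R[OF t])
  have St: "(\<lambda>k. proj (X (m0 + \<mu> (r k)) t)) \<longlonglongrightarrow> proj (S t)"
   by (rule tendsto_proj[OF tendsto_uniform_limitI[OF S(3)[of "{t}"]]])
    (use tR nonzero[OF X_nlift tR] nonzero[OF S(2) tR] in auto)
  have ll: "filterlim l at_top sequentially"
   by (rule filterlim_at_top_mono[OF filterlim_ident]) (use l(2) in simp)
  have "(\<lambda>k. proj (X (m0 + \<mu> (r (l k))) t)) \<longlonglongrightarrow> proj (S t)" by (rule filterlim_compose[OF St ll])
  from tendsto_dist[OF this St]
  have d: "(\<lambda>k. dist (proj (X (m0 + \<mu> (r (l k))) t)) (proj (X (m0 + \<mu> (r k)) t))) \<longlonglongrightarrow> 0" by simp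
  have "(\<lambda>k. dist ((f ^^ j k) (proj (X (m0 + \<mu> (r (l k))) t))) ((f ^^ j k) (proj (X (m0 + \<mu> (r k)) t)))) \<longlonglongrightarrow> 0"
   by (rule K_close_iter[OF X_K[OF t] d])
  then have "(\<lambda>k. dist (proj (P k t)) (proj (Q k t))) \<longlonglongrightarrow> 0"
   unfolding P_def Q_def by (simp only: add.assoc[symmetric] proj_X_add[OF tR])
  moreover have "filterlim (\<lambda>k. s (s' k)) at_top sequentially"
   using filterlim_compose[OF filterlim_subseq[OF Y(1)] filterlim_subseq[OF Z(1)]] .
  ultimately show "(\<lambda>k. dist (proj (P (s (s' k)) t)) (proj (Q (s (s' k)) t))) \<longlonglongrightarrow> 0"
   by (rule filterlim_compose)
 qed
 then obtain u where u: "cmod u = 1" "\<And>t. t \<in> ball 0 R ==> Y t = u *s Z t" by blast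
 have "(\<lambda>k. P (s (s' k)) (z (s (s' k)))) \<longlonglongrightarrow> Y z0"
  using LIMSEQ_subseq_LIMSEQ[OF Y(5) Z(1)] by (simp add: o_def)
 then have 1: "(\<lambda>k. cmod (jac (P (s (s' k)) (z (s (s' k)))))) \<longlonglongrightarrow> cmod (jac (Y z0))"
  by (intro tendsto_norm tendsto_jac)
 have 2: "(\<lambda>k. cmod (jac (Q (s (s' k)) (z (s (s' k))))) + e) \<longlonglongrightarrow> cmod (jac (Z z0)) + e"
  using Z(5) unfolding zz by (intro tendsto_add tendsto_const tendsto_norm tendsto_jac)
 have "cmod (jac (Z z0)) + e <= cmod (jac (Y z0))"
 proof (rule LIMSEQ_le[OF 2 1], intro exI allI impI)
  fix k show "cmod (jac (Q (s (s' k)) (z (s (s' k))))) + e <= cmod (jac (P (s (s' k)) (z (s (s' k)))))"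
   using z unfolding P_def Q_def by (metis less_imp_le not_le)
 qed
 moreover have "z0 \<in> ball 0 R" using Y(3) C(2) by blast
 then have "cmod (jac (Y z0)) = cmod (jac (Z z0))" using u(2)[of z0] jac_norm_smult[OF u(1)] by simp
 ultimately show False using e by simp
qed

lemma jac_iter_holomorphic: "(\<lambda>z. jac_iter n (X m z)) holomorphic_on ball 0 R"
 unfolding jac_iter_def X_add[symmetric] by (intro holomorphic_intros jac_holomorphic X_nlift)

text \<open>On the inner disc blocks of length \<open>N\<close> have factor at most
  \<open>1 / 2\<close>, which gives geometric decay; on a larger disc there is a bound for fixed
  \<open>m\<close>; the three circles estimate interpolates. Since that bound depends on
  \<open>m\<close>, so do the constants obtained here.\<close>

lemma jac_iter_decay:
 assumes r: "r < R"
 shows "\<exists>b D. 0 < b \<and> b < 1 \<and> (\<forall>n. \<forall>z\<in>cball 0 r. cmod (jac_iter n (X m z)) <= D * b ^ n)"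
proof -
 define r1 where "r1 = (max r \<rho>0 + R) / 2"
 define R1 where "R1 = (r1 + R) / 2"
 have rr: "\<rho>0 < r1" "r < r1" "r1 < R1" "R1 < R" using r \<rho>0 by (auto simp: r1_def R1_def max_def)
 have sub: "cball 0 R1 \<subseteq> ball (0::complex) R" using rr by auto
 have "continuous_on (cball 0 R1) (\<lambda>z. proj (X m z))"
  by (rule continuous_on_compose2[OF continuous_on_proj continuous_on_subset[OF hol_vec_continuous sub]])
   (use X_nlift sub nonzero[OF X_nlift] in \<open>auto simp: nlift_def\<close>)
 then have "compact ((\<lambda>z. proj (X m z)) ` cball 0 R1)" by (intro compact_continuous_image) auto
 moreover have "(\<lambda>z. proj (X m z)) ` cball 0 R1 \<subseteq> fatou_set f" using X_\<Omega> sub comp_facts(1) by blast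
 ultimately obtain C1 where C1: "\<And>n x. normalized x ==> proj x \<in> (\<lambda>z. proj (X m z)) ` cball 0 R1 ==> cmod (jac_iter n x) <= C1"
  using jac_iter_bounded_compact by blast
 obtain C2 where C2: "\<And>n x. normalized x ==> proj x \<in> K ==> cmod (jac_iter n x) <= C2"
  using jac_iter_bounded_compact[OF K(1) K_fatou] by blast
 obtain N0 where N0: "\<forall>n\<ge>N0. \<forall>x. normalized x --> proj x \<in> K --> cmod (jac_iter n x) < 1/2"
  using jac_iter_uniformly_small[OF K(1,2) K_iter, of "1/2"] by auto
 define N where "N = Suc N0"
 have N: "N > 0" "\<And>x. normalized x ==> proj x \<in> K ==> cmod (jac_iter N x) <= 1/2"
  using N0 by (auto simp: N_def intro: less_imp_le)
 have blk: "cmod (jac_iter (i * N) x) <= (1/2) ^ i" if "normalized x" "proj x \<in> K" for i x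
  using that
 proof (induction i arbitrary: x)
  case 0 then show ?case by (simp add: jac_iter_def)
 next
  case (Suc i)
  have "normalized ((F ^^ N) x)" "proj ((F ^^ N) x) \<in> K"
   using normalized_iter[OF Suc.prems(1)] K_iter[OF Suc.prems(2), of N] f_iter_proj[of x N] Suc.prems(1) by (auto simp: normalized_def)
  then have "cmod (jac_iter (i * N) ((F ^^ N) x)) <= (1/2) ^ i" by (rule Suc.IH)
  then have "cmod (jac_iter N x) * cmod (jac_iter (i * N) ((F ^^ N) x)) <= (1/2) * (1/2) ^ i"
   using N(2)[OF Suc.prems] by (intro mult_mono) auto
  then show ?case using jac_iter_add[of N "i * N" x] by (simp add: norm_mult)
 qed
 have "cmod (jac_iter 0 (X m 0)) <= C2" by (rule C2[OF X_normalized[OF in_R] X_K]) (use \<rho>0 in auto)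
 then have C20: "C2 >= 0" using norm_ge_zero[of "jac_iter 0 (X m 0)"] by linarith
 define h :: real where "h = 1/2"
 have h: "0 < h" "h < 1" by (auto simp: h_def)
 obtain b where b: "0 < b" "b < 1" "\<And>n. h ^ (n div N) <= (1 / h) * b ^ n"
  by (rule power_div_geometric[OF h N(1)]) (rule that)
 define C where "C = max C1 (2 * C2)"
 have small: "cmod (jac_iter n (X m z)) <= C * b ^ n" if z: "z \<in> cball 0 \<rho>0" for n z
 proof -
  note x = X_normalized[OF in_R[OF z], of m] X_K[OF z, of m]
  let ?y = "(F ^^ (n div N * N)) (X m z)"
  have y: "normalized ?y" "proj ?y \<in> K"
   using normalized_iter[OF x(1)] K_iter[OF x(2)] f_iter_proj[of "X m z"] x(1) by (auto simp: normalized_def)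
  have "jac_iter n (X m z) = jac_iter (n div N * N) (X m z) * jac_iter (n mod N) ?y"
   using jac_iter_add[of "n div N * N" "n mod N" "X m z"] by simp
  then have "cmod (jac_iter n (X m z)) <= (1/2) ^ (n div N) * C2"
   using blk[OF x] C2[OF y] by (simp add: norm_mult mult_mono)
  also have "\<dots> <= ((1 / h) * b ^ n) * C2" using b(3)[of n] C20 unfolding h_def by (intro mult_right_mono) auto
  also have "\<dots> = 2 * C2 * b ^ n" by (simp add: h_def)
  also have "\<dots> <= C * b ^ n" using b by (intro mult_right_mono) (auto simp: C_def)
  finally show ?thesis .
 qed
 have bd: "cmod (jac_iter n (X m z)) <= C" if z: "z \<in> cball 0 R1" for n z
 proof -
  have "cmod (jac_iter n (X m z)) <= C1" by (rule C1) (use X_normalized sub z in auto)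
  then show ?thesis by (simp add: C_def)
 qed
 obtain b' D where "0 < b'" "b' < 1" "\<And>n z. z \<in> cball 0 r1 ==> cmod (jac_iter n (X m z)) <= D * b' ^ n"
  by (rule three_circles_decay[where P = "\<lambda>n z. jac_iter n (X m z)", OF jac_iter_holomorphic \<rho>0(1) rr(1,3,4) bd small b(1,2)])
   (assumption, assumption, rule that)
 then show ?thesis using rr(2) by (intro exI[of _ b'] exI[of _ D]) auto
qed

text \<open>All limit discs degenerate at the same parameters. Suitable iterates of \<open>S\<close>
  shadow the discs converging to \<open>S'\<close>, and by Euler's relation an iterate keeps a
  derivative that is parallel to the radial direction parallel to it.\<close>

lemma wedge_zeros:
 assumes S: "limit_disc S m" and S': "limit_disc S' m'" and t: "t \<in> ball 0 R" and 0: "wedge (S t) (vderiv S t) = 0"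
 shows "wedge (S' t) (vderiv S' t) = 0"
proof -
 note nS = limit_discD(1)[OF S] and nS' = limit_discD(1)[OF S']
 have "\<forall>k. \<exists>l\<ge>k. m' l >= m k + k"
 proof
  fix k
  have "\<forall>\<^sub>F l in sequentially. m' l >= m k + k" using limit_discD(2)[OF S'] by (simp add: filterlim_at_top)
  then obtain l0 where "\<forall>l\<ge>l0. m' l >= m k + k" unfolding eventually_sequentially by blast
  then show "\<exists>l\<ge>k. m' l >= m k + k" by (intro exI[of _ "max l0 k"]) auto
 qed
 from choice[OF this] obtain l where l: "\<forall>k. l k >= k \<and> m' (l k) >= m k + k" by (rule exE)
 define n where "n = (\<lambda>k. m' (l k) - m k)"
 have mn: "m k + n k = m' (l k)" for k using l by (simp add: n_def) (metis add_leD1 le_add_diff_inverse)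
 define W where "W = (\<lambda>k z. (F ^^ n k) (S z))"
 have nW: "nlift (W k) (ball 0 R)" for k unfolding W_def by (rule nlift_iter[OF nS])
 have c: "compact {t}" "{t} \<subseteq> ball 0 R" "\<And>k::nat. t \<in> {t}" using t by auto
 obtain Y r t0 where Y: "strict_mono (r :: nat => nat)" "nlift Y (ball 0 R)" "t0 \<in> {t}" "(\<lambda>k. t) \<longlonglongrightarrow> t0"
  "(\<lambda>k. W (r k) t) \<longlonglongrightarrow> Y t0" "(\<lambda>k. vderiv (W (r k)) t) \<longlonglongrightarrow> vderiv Y t0"
  "\<And>t. t \<in> ball 0 R ==> (\<lambda>k. W (r k) t) \<longlonglongrightarrow> Y t"
  by (rule nlift_limit_points[where Y = W and z = "\<lambda>k. t" and C = "{t}", OF nW c]) (rule that)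
 obtain a where a: "vderiv S t = a *s S t" using wedge_zero_imp_parallel[OF 0 nonzero[OF nS t]] by blast
 have wW: "wedge (W k t) (vderiv (W k) t) = 0" for k
 proof -
  have "vderiv (W k) t = cderiv (F ^^ n k) (S t) (vderiv S t)"
   unfolding W_def by (rule vderiv_polymap[OF polymap_iter _ open_ball t]) (use nS in \<open>simp add: nlift_def\<close>)
  also have "\<dots> = (a * of_nat (d ^ n k)) *s W k t"
   unfolding a W_def by (simp add: cderiv_smult[OF polymap_iter] cderiv_iter_euler)
  finally show ?thesis by (simp add: wedge_smult)
 qed
 have "(\<lambda>k. wedge (W (r k) t) (vderiv (W (r k)) t)) \<longlonglongrightarrow> wedge (Y t0) (vderiv Y t0)"
  by (rule tendsto_wedge[OF Y(5,6)])
 then have "wedge (Y t0) (vderiv Y t0) = 0" unfolding wW by (simp add: LIMSEQ_const_iff)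
 then have wY: "wedge (Y t) (vderiv Y t) = 0" using Y(3) by simp
 have "\<exists>u. cmod u = 1 \<and> (\<forall>t\<in>ball 0 R. S' t = u *s Y t)"
 proof (rule close_discs_limit[where Y = S' and Z = Y and Yk = "\<lambda>k. X (m' (l (r k)))" and Zk = "\<lambda>k. W (r k)", OF nS' Y(2) _ Y(7) nonzero[OF X_nlift] nonzero[OF nW]])
  have ll: "filterlim (\<lambda>k. l (r k)) at_top sequentially"
   by (rule filterlim_at_top_mono[OF filterlim_subseq[OF Y(1)]]) (use l in simp)
  fix t :: complex assume t: "t \<in> ball 0 R"
  have "(\<lambda>k. X (m' k) t) \<longlonglongrightarrow> S' t"
   by (rule tendsto_uniform_limitI[OF limit_discD(3)[OF S', of "{t}"]]) (use t in auto)
  then show "(\<lambda>k. X (m' (l (r k))) t) \<longlonglongrightarrow> S' t" using ll by (rule filterlim_compose)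
 next
  fix t :: complex assume t: "t \<in> cball 0 \<rho>0"
  have tR: "t \<in> ball 0 R" by (rule in_R[OF t])
  have "(\<lambda>k. X (m k) t) \<longlonglongrightarrow> S t"
   by (rule tendsto_uniform_limitI[OF limit_discD(3)[OF S, of "{t}"]]) (use tR in auto)
  then have "(\<lambda>k. proj (X (m k) t)) \<longlonglongrightarrow> proj (S t)"
   by (rule tendsto_proj) (use nonzero[OF X_nlift tR] nonzero[OF nS tR] in auto)
  from tendsto_dist[OF this tendsto_const[of "proj (S t)"]]
  have "(\<lambda>k. dist (proj (X (m k) t)) (proj (S t))) \<longlonglongrightarrow> 0" by simp
  then have "(\<lambda>k. dist ((f ^^ n k) (proj (X (m k) t))) ((f ^^ n k) (proj (S t)))) \<longlonglongrightarrow> 0"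
   by (rule K_close_iter[OF X_K[OF t]])
  moreover have "(f ^^ n k) (proj (X (m k) t)) = proj (X (m' (l k)) t)" for k
   using proj_X_add[OF tR, of "m k" "n k"] mn[of k] by simp
  moreover have "(f ^^ n k) (proj (S t)) = proj (W k t)" for k
   unfolding W_def using nonzero[OF nS tR] by (simp add: f_iter_proj)
  ultimately have "(\<lambda>k. dist (proj (X (m' (l k)) t)) (proj (W k t))) \<longlonglongrightarrow> 0" by simp
  then show "(\<lambda>k. dist (proj (X (m' (l (r k))) t)) (proj (W (r k) t))) \<longlonglongrightarrow> 0"
   by (rule filterlim_compose[OF _ filterlim_subseq[OF Y(1)]])
 qed
 then obtain u where u: "cmod u = 1" "\<And>t. t \<in> ball 0 R ==> S' t = u *s Y t" by blast
 have "vderiv S' t = vderiv (\<lambda>z. u *s Y z) t" by (rule vderiv_cong[OF open_ball t u(2)])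
 also have "\<dots> = u *s vderiv Y t"
 proof -
  have "vderiv (\<lambda>w. u *s Y w) t = deriv (\<lambda>_. u) t *s Y t + u *s vderiv Y t"
   by (rule vderiv_scale[OF holomorphic_on_const _ open_ball t]) (use Y(2) in \<open>simp add: nlift_def\<close>)
  then show ?thesis by simp
 qed
 finally show ?thesis using wY by (simp add: u(2)[OF t] wedge_smult)
qed

end

lemma hol_vec_wedge:
 assumes "hol_vec S A" "open A"
 shows "hol_vec (\<lambda>z. wedge (S z) (vderiv S z)) A"
proof -
 have h: "(\<lambda>z. S z $ i) holomorphic_on A" "deriv (\<lambda>z. S z $ i) holomorphic_on A" for i
  using hol_vecD[OF assms(1)] holomorphic_deriv[OF hol_vecD[OF assms(1)] assms(2)] by auto
 show ?thesis unfolding hol_vec_def forall_3 wedge_nth vderiv_nth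
  by (intro conjI holomorphic_intros h)
qed

lemma wedge_zero_of_constant:
 assumes S: "hol_vec S (ball a e)" "\<And>z. z \<in> ball a e ==> S z ~= 0 \<and> proj (S z) = proj (S a)" and z: "z \<in> ball a e"
 shows "wedge (S z) (vderiv S z) = 0"
proof -
 have "e > 0" using z by (auto intro: le_less_trans[OF zero_le_dist])
 then have a: "S a ~= 0" using S(2)[of a] by simp
 then obtain l where l: "S a $ l ~= 0" by (auto simp: vec_eq_iff)
 have eq: "S w = (S w $ l / S a $ l) *s S a" if w: "w \<in> ball a e" for w
 proof -
  obtain c where c: "S w = c *s S a" using proj_eq_iff[OF a, of "S w"] S(2)[OF w] by auto
  then have "S w $ l = c * S a $ l" by simp
  then have "c = S w $ l / S a $ l" using l by simp
  with c show ?thesis by simp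
 qed
 have h: "(\<lambda>w. S w $ l / S a $ l) holomorphic_on ball a e" by (intro holomorphic_intros hol_vecD[OF S(1)] l)
 have "vderiv S z = vderiv (\<lambda>w. (S w $ l / S a $ l) *s S a) z" by (rule vderiv_cong[OF open_ball z eq])
 also have "\<dots> = deriv (\<lambda>w. S w $ l / S a $ l) z *s S a + (S z $ l / S a $ l) *s vderiv (\<lambda>w. S a) z"
  by (rule vderiv_scale[OF h hol_vec_const open_ball z])
 also have "vderiv (\<lambda>w. S a) z = 0" by (simp add: vec_eq_iff)
 finally have v: "vderiv S z = deriv (\<lambda>w. S w $ l / S a $ l) z *s S a" by simp
 show ?thesis unfolding v by (subst eq[OF z]) (simp only: wedge_smult vector_smult_rzero)
qed

text \<open>If the derivative is always a multiple of \<open>S\<close>, quotients of coordinates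
  have derivative zero; analytic continuation removes the restriction to points where the
  denominator is nonzero.\<close>

lemma constant_of_wedge_zero:
 assumes S: "hol_vec S (ball a R)" "\<And>z. z \<in> ball a R ==> S z ~= 0"
  and w: "\<And>z. z \<in> ball a R ==> wedge (S z) (vderiv S z) = 0" and z: "z \<in> ball a R"
 shows "proj (S z) = proj (S a)"
proof -
 have R: "R > 0" using z by (auto intro: le_less_trans[OF zero_le_dist])
 then have aR: "a \<in> ball a R" by simp
 obtain l where l: "S a $ l ~= 0" using S(2)[OF aR] by (auto simp: vec_eq_iff)
 have "continuous_on (ball a R) (\<lambda>z. S z $ l)" by (intro continuous_intros hol_vec_continuous S)
 then have "open (ball a R \<inter> (\<lambda>z. S z $ l) -` (- {0}))" by (intro continuous_open_preimage) auto
 moreover have "a \<in> ball a R \<inter> (\<lambda>z. S z $ l) -` (- {0})" using aR l by simp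
 ultimately obtain e where e: "e > 0" "ball a e \<subseteq> ball a R \<inter> (\<lambda>z. S z $ l) -` (- {0})" by (rule openE)
 have eR: "ball a e \<subseteq> ball a R" and el: "S y $ l ~= 0" if "y \<in> ball a e" for y using e(2) that by auto
 have sub: "ball a e \<subseteq> ball a R" using e(2) by blast
 have ratio: "S y $ i / S y $ l = S a $ i / S a $ l" if y: "y \<in> ball a e" for y i
 proof -
  have "((\<lambda>z. S z $ i / S z $ l) has_field_derivative 0) (at x within ball a e)" if x: "x \<in> ball a e" for x
  proof -
   have xR: "x \<in> ball a R" using x sub by blast
   obtain c where c: "vderiv S x = c *s S x" by (rule wedge_zero_imp_parallel[OF w[OF xR] S(2)[OF xR]])
   have d: "((\<lambda>z. S z $ k) has_field_derivative c * S x $ k) (at x)" for k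
   proof -
    have "((\<lambda>z. S z $ k) has_field_derivative deriv (\<lambda>z. S z $ k) x) (at x)"
     by (rule holomorphic_derivI[OF hol_vecD[OF S(1)] open_ball xR])
    moreover have "deriv (\<lambda>z. S z $ k) x = (c *s S x) $ k" by (subst c[symmetric]) simp
    ultimately show ?thesis by simp
   qed
   have "((\<lambda>z. S z $ i / S z $ l) has_field_derivative (c * S x $ i * S x $ l - S x $ i * (c * S x $ l)) / (S x $ l * S x $ l)) (at x)"
    by (rule DERIV_divide[OF d d el[OF x]])
   then show ?thesis by (simp add: has_field_derivative_at_within)
  qed
  then have "\<exists>c. \<forall>x\<in>ball a e. S x $ i / S x $ l = c"
   by (intro has_field_derivative_zero_constant) auto
  then show ?thesis using y e(1) by (metis centre_in_ball)
 qed
 have "S z $ i = (S z $ l / S a $ l) * S a $ i" for i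
 proof (rule analytic_continuation_open[OF open_ball open_ball _ connected_ball sub hol_vecD[OF S(1)] _ _ z])
  show "ball a e ~= {}" using e(1) by simp
  show "(\<lambda>z. (S z $ l / S a $ l) * S a $ i) holomorphic_on ball a R" by (intro holomorphic_intros hol_vecD[OF S(1)] l)
  fix y assume y: "y \<in> ball a e"
  show "S y $ i = S y $ l / S a $ l * S a $ i" using ratio[OF y, of i] el[OF y] l by (simp add: field_simps)
 qed
 then have eq: "S z = (S z $ l / S a $ l) *s S a" unfolding vec_eq_iff vector_smult_component by (rule allI)
 then have "S z $ l / S a $ l ~= 0" using S(2)[OF z] by auto
 then have "proj ((S z $ l / S a $ l) *s S a) = proj (S a)" using S(2)[OF aR] by (rule proj_smult)
 then show ?thesis using eq by simp
qed

lemma wedge_continuation: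
 assumes S: "hol_vec S (ball 0 R)" and e: "0 < e" "e <= R" and w: "\<And>z. z \<in> ball 0 e ==> wedge (S z) (vderiv S z) = 0"
  and z: "z \<in> ball 0 R"
 shows "wedge (S z) (vderiv S z) = 0"
proof -
 have "wedge (S z) (vderiv S z) $ i = 0" for i
 proof (rule analytic_continuation_open[OF open_ball open_ball _ connected_ball _ hol_vecD[OF hol_vec_wedge[OF S open_ball]] holomorphic_on_const _ z])
  show "ball 0 e ~= ({} :: complex set)" "ball 0 e \<subseteq> ball (0::complex) R" using e by auto
 qed (simp add: w)
 then show ?thesis by (simp add: vec_eq_iff)
qed

section \<open>Decay of the Jacobian uniform in the starting time\<close>

context orbit_disc
begin

lemma jac_bounded: "\<exists>B. \<forall>x. normalized x --> cmod (jac x) <= B"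
proof -
 have "compact (jac ` cball 0 nbd)" by (intro compact_continuous_image poly_fun_continuous[OF poly_fun_jac]) auto
 then have "bounded (jac ` cball 0 nbd)" by (rule compact_imp_bounded)
 then obtain B where "\<forall>x\<in>jac ` cball 0 nbd. cmod x <= B" unfolding bounded_iff by blast
 then show ?thesis using normalized_bounds(1) by (intro exI[of _ B]) auto
qed

lemma jac_zero_continuation:
 assumes Y: "nlift Y (ball 0 R)" and e: "e > 0" "ball t e \<subseteq> ball 0 R" and 0: "\<And>z. z \<in> ball t e ==> jac (Y z) = 0"
  and z: "z \<in> ball 0 R"
 shows "jac (Y z) = 0"
 by (rule analytic_continuation_open[OF open_ball open_ball _ connected_ball e(2) jac_holomorphic[OF Y] holomorphic_on_const _ z])
  (use e 0 in auto)

text \<open>Smallness on half discs at arbitrarily late times produces a limit disc on which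
  \<open>jac\<close> vanishes. By \<open>wedge_zeros\<close> it is nonconstant near 0, and there it
  lies in \<open>\<Sigma>\<close>, so \<open>jac\<close> vanishes on all of \<open>\<Sigma>\<close>.
  Hence it vanishes on every limit disc, and late factors are uniformly small.\<close>

lemma nondegenerate_or_small:
 assumes S: "limit_disc S m" and nc: "t1 \<in> ball 0 R" "wedge (S t1) (vderiv S t1) ~= 0"
  and s: "0 < s" "cball t s \<subseteq> ball 0 R"
  and deg: "\<And>b m0. b > 0 ==> \<exists>j\<ge>m0. \<forall>z\<in>cball t (s/2). cmod (jac (X j z)) < b"
 shows "\<exists>N. \<forall>j\<ge>N. \<forall>z\<in>cball t s. cmod (jac (X j z)) < 1/2"
proof (rule ccontr)
 assume neg: "\<not> ?thesis"
 have ex: "\<forall>k. \<exists>j\<ge>k. \<forall>z\<in>cball t (s/2). cmod (jac (X j z)) < 1 / real (Suc k)" by (intro allI deg) simp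
 from choice[OF ex] obtain j where j: "\<forall>k. j k >= k \<and> (\<forall>z\<in>cball t (s/2). cmod (jac (X (j k) z)) < 1 / real (Suc k))" by (rule exE)
 have "filterlim j at_top sequentially" by (rule filterlim_at_top_mono[OF filterlim_ident]) (use j in simp)
 then obtain S' r where r: "strict_mono (r :: nat => nat)" "limit_disc S' (\<lambda>k. j (r k))" by (rule limit_disc_exists)
 note nS' = limit_discD(1)[OF r(2)]
 have hS': "hol_vec S' (ball 0 R)" using nS' by (simp add: nlift_def)
 have half: "cball t (s/2) \<subseteq> ball 0 R" "ball t (s/2) \<subseteq> ball 0 R" using s by auto
 have "jac (S' z) = 0" if z: "z \<in> cball t (s/2)" for z
 proof -
  have zR: "z \<in> ball 0 R" using z half by blast
  have "(\<lambda>k. X (j (r k)) z) \<longlonglongrightarrow> S' z"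
   by (rule tendsto_uniform_limitI[OF limit_discD(3)[OF r(2), of "{z}"]]) (use zR in auto)
  then have 1: "(\<lambda>k. jac (X (j (r k)) z)) \<longlonglongrightarrow> jac (S' z)" by (rule tendsto_jac)
  have 2: "(\<lambda>k. 1 / real (Suc (r k))) \<longlonglongrightarrow> 0"
   using filterlim_compose[OF LIMSEQ_inverse_real_of_nat filterlim_subseq[OF r(1)]] by (simp add: inverse_eq_divide)
  have "(\<lambda>k. jac (X (j (r k)) z)) \<longlonglongrightarrow> 0"
   by (rule Lim_null_comparison[OF _ 2]) (use j z in \<open>intro always_eventually allI less_imp_le; blast\<close>)
  with 1 show ?thesis by (rule LIMSEQ_unique)
 qed
 then have j0: "jac (S' z) = 0" if "z \<in> ball 0 R" for z
  using jac_zero_continuation[OF nS' _ half(2) _ that] s(1) by (simp add: ball_subset_cball[THEN subsetD])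
 have nc': "\<exists>z\<in>ball 0 e. proj (S' z) ~= proj (S' 0)" if e: "e > 0" for e
 proof (rule ccontr)
  assume a: "\<not> ?thesis"
  define e' where "e' = min e R"
  have e': "0 < e'" "e' <= R" "e' <= e" using e \<rho>0 by (auto simp: e'_def)
  have sub: "ball 0 e' \<subseteq> ball (0::complex) R" "ball 0 e' \<subseteq> ball (0::complex) e" using e' by auto
  have "wedge (S' z) (vderiv S' z) = 0" if z: "z \<in> ball 0 e'" for z
  proof (rule wedge_zero_of_constant[OF hol_vec_subset[OF hS' sub(1)] _ z])
   fix w :: complex assume w: "w \<in> ball 0 e'"
   then show "S' w ~= 0 \<and> proj (S' w) = proj (S' 0)" using nonzero[OF nS'] sub a by blast
  qed
  then have "wedge (S' t1) (vderiv S' t1) = 0" by (rule wedge_continuation[OF hS' e'(1,2) _ nc(1)])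
  then have "wedge (S t1) (vderiv S t1) = 0" by (rule wedge_zeros[OF r(2) S nc(1)])
  then show False using nc(2) by simp
 qed
 have sub0: "ball 0 \<rho>0 \<subseteq> ball (0::complex) R" using \<rho>0 by auto
 have J: "jac x = 0" if "x ~= 0" "proj x \<in> \<Sigma>" for x
 proof (rule jac_vanishes_on_curve[OF \<Sigma>_conn \<rho>0(1) hol_vec_subset[OF hS' sub0] _ nc' that])
  fix z :: complex assume z: "z \<in> ball 0 \<rho>0"
  then have "z \<in> cball 0 \<rho>0" "z \<in> ball 0 R" using sub0 by auto
  then show "S' z ~= 0 \<and> proj (S' z) \<in> \<Sigma> \<and> jac (S' z) = 0"
   using nonzero[OF nS'] limit_disc_near(2)[OF r(2)] j0 by blast
 qed
 have "\<forall>k. \<exists>i z. i >= k \<and> z \<in> cball t s \<and> \<not> cmod (jac (X i z)) < 1/2" using neg by blast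
 from choice2[OF this] obtain i z where iz: "\<forall>k. i k >= k \<and> z k \<in> cball t s \<and> \<not> cmod (jac (X (i k) (z k))) < 1/2"
  by (elim exE)
 have zc: "z k \<in> cball t s" for k using iz by blast
 obtain S2 q z0 where q: "strict_mono (q :: nat => nat)" "nlift S2 (ball 0 R)" "z0 \<in> cball t s" "(\<lambda>k. z (q k)) \<longlonglongrightarrow> z0"
  "(\<lambda>k. X (i (q k)) (z (q k))) \<longlonglongrightarrow> S2 z0" "(\<lambda>k. vderiv (X (i (q k))) (z (q k))) \<longlonglongrightarrow> vderiv S2 z0"
  "\<And>t. t \<in> ball 0 R ==> (\<lambda>k. X (i (q k)) t) \<longlonglongrightarrow> S2 t"
  "\<And>C. compact C ==> C \<subseteq> ball 0 R ==> uniform_limit C (\<lambda>k. X (i (q k))) S2 sequentially"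
  by (rule nlift_limit_points[where Y = "\<lambda>k. X (i k)" and z = z, OF X_nlift compact_cball s(2) zc]) (rule that)
 have "filterlim (\<lambda>k. i (q k)) at_top sequentially"
  by (rule filterlim_at_top_mono[OF filterlim_subseq[OF q(1)]]) (use iz in simp)
 then have S2: "limit_disc S2 (\<lambda>k. i (q k))" unfolding limit_disc_def using q(2,8) by simp
 have "jac (S2 w) = 0" if w: "w \<in> ball 0 \<rho>0" for w
 proof -
  have "w \<in> cball 0 \<rho>0" "w \<in> ball 0 R" using w sub0 by auto
  then show ?thesis using J nonzero[OF q(2)] limit_disc_near(2)[OF S2] by blast
 qed
 then have "jac (S2 z0) = 0" by (rule jac_zero_continuation[OF q(2) \<rho>0(1) sub0]) (use q(3) s(2) in auto)
 moreover have "cmod (jac (S2 z0)) >= 1/2"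
  by (rule tendsto_lowerbound[OF tendsto_norm[OF tendsto_jac[OF q(5)]]])
   (use iz in \<open>auto simp: not_less intro: always_eventually\<close>)
 ultimately show False by simp
qed

text \<open>Either \<open>jac\<close> keeps a lower bound somewhere on the half disc at all late
  times, so that \<open>window_decay\<close> applies, or it degenerates and every late factor is
  below \<open>1 / 2\<close>. Both give geometric decay with constants independent of
  \<open>m\<close>.\<close>

lemma local_windows:
 assumes S: "limit_disc S m" and nc: "t1 \<in> ball 0 R" "wedge (S t1) (vderiv S t1) ~= 0" and t: "t \<in> ball 0 R"
 shows "\<exists>r>0. \<forall>e>0. \<exists>N. \<forall>n\<ge>N. \<forall>m\<ge>N. \<forall>z\<in>cball t r. cmod (jac_iter n (X m z)) < e"
proof -
 define R' where "R' = R - cmod t"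
 define s where "s = R' / 2"
 have R': "R' > 0" "s > 0" "s < R'" using t by (auto simp: R'_def s_def)
 have rs: "cmod t + s < R" using t by (simp add: R'_def s_def field_simps)
 have b: "ball t R' \<subseteq> ball 0 R"
 proof
  fix z assume "z \<in> ball t R'"
  then show "z \<in> ball 0 R" using norm_triangle_ineq[of t "z - t"] by (simp add: R'_def dist_norm norm_minus_commute)
 qed
 have cb: "cball t s \<subseteq> ball 0 R" using b R' by (auto simp: subset_iff)
 have cr: "cball t s \<subseteq> cball 0 (cmod t + s)"
 proof
  fix z assume "z \<in> cball t s"
  then show "z \<in> cball 0 (cmod t + s)" using norm_triangle_ineq[of t "z - t"] by (simp add: dist_norm norm_minus_commute)
 qed
 have pr: "jac_iter n (X m z) = (\<Prod>j<n. jac (X (m + j) z))" for n m z by (simp add: jac_iter_def X_add)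
 have fin: "\<exists>r>0. \<forall>e>0. \<exists>N. \<forall>n\<ge>N. \<forall>m\<ge>N. \<forall>z\<in>cball t r. cmod (jac_iter n (X m z)) < e"
  if D: "0 < a" "a < 1" "\<And>n m z. z \<in> cball t (s/2) ==> m >= m0 ==> cmod (jac_iter n (X m z)) <= D * a ^ n" for D a m0
 proof (intro exI[of _ "s/2"] conjI allI impI)
  fix e :: real assume e: "e > 0"
  have "(\<lambda>n. D * a ^ n) \<longlonglongrightarrow> D * 0" by (intro tendsto_mult tendsto_const LIMSEQ_realpow_zero) (use D in auto)
  then have "\<forall>\<^sub>F n in sequentially. D * a ^ n < e" using e by (intro order_tendstoD(2)[of _ "D * 0"]) auto
  then obtain N where N: "\<forall>n\<ge>N. D * a ^ n < e" unfolding eventually_sequentially by blast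
  show "\<exists>N. \<forall>n\<ge>N. \<forall>m\<ge>N. \<forall>z\<in>cball t (s/2). cmod (jac_iter n (X m z)) < e"
  proof (intro exI[of _ "max N m0"] allI impI ballI)
   fix n m z assume "max N m0 <= n" "max N m0 <= m" "z \<in> cball t (s/2)"
   then show "cmod (jac_iter n (X m z)) < e" using D(3)[of z m n] N[rule_format, of n] by simp
  qed
 qed (use R' in simp)
 show ?thesis
 proof (cases "\<exists>k m0. k > 0 \<and> (\<forall>j\<ge>m0. \<exists>z\<in>cball t (s/2). cmod (jac (X j z)) >= k)")
  case True
  then obtain k m0 where k: "k > 0" "\<And>j. j >= m0 ==> \<exists>z\<in>cball t (s/2). cmod (jac (X j z)) >= k" by blast
  obtain B where B: "\<And>x. normalized x ==> cmod (jac x) <= B" using jac_bounded by blast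
  obtain a D where a: "0 < a" "a < 1" "\<forall>n. \<forall>z\<in>cball 0 (cmod t + s). cmod (jac_iter n (X m0 z)) <= D * a ^ n"
   using jac_iter_decay[OF rs] by blast
  have "\<exists>D b'. 0 < b' \<and> b' < 1 \<and> (\<forall>m n. \<forall>z\<in>cball t (s/2). (\<Prod>j<n. cmod (jac (X (m0 + (m + j)) z))) <= D * b' ^ n)"
  proof (rule window_decay[where q = "\<lambda>j z. jac (X (m0 + j) z)", OF _ R'(2,3) _ _ a(1,2) _ k(1)])
   show "(\<lambda>z. jac (X (m0 + j) z)) holomorphic_on ball t R'" for j
    by (rule holomorphic_on_subset[OF jac_holomorphic[OF X_nlift] b])
   show "cmod (jac (X (m0 + j) z)) <= B" if "z \<in> cball t s" for j z
    by (rule B[OF X_normalized]) (use that cb in blast)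
   show "cmod (\<Prod>j<n. jac (X (m0 + j) z)) <= D * a ^ n" if "z \<in> cball t s" for n z
    using a(3) cr that unfolding pr by blast
   show "\<exists>M. \<forall>m. \<exists>m'\<le>M. \<forall>j. \<forall>z\<in>cball t s. cmod (jac (X (m0 + (m + j)) z)) <= cmod (jac (X (m0 + (m' + j)) z)) + e"
    if "e > 0" for e by (rule jac_almost_periodic[OF compact_cball cb that])
   show "\<exists>z\<in>cball t (s/2). k <= cmod (jac (X (m0 + j) z))" for j by (rule k(2)) simp
  qed
  then obtain D' a' where D': "0 < a'" "a' < 1" "\<And>m n z. z \<in> cball t (s/2) ==> (\<Prod>j<n. cmod (jac (X (m0 + (m + j)) z))) <= D' * a' ^ n"
   by blast
  show ?thesis
  proof (rule fin[OF D'(1,2)])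
   fix n m z assume z: "z \<in> cball t (s/2)" "m0 <= m"
   show "cmod (jac_iter n (X m z)) <= D' * a' ^ n"
    using D'(3)[OF z(1), where m = "m - m0" and n = n] z(2) unfolding pr prod_norm[symmetric] by (simp add: add.assoc[symmetric])
  qed
 next
  case False
  have "\<exists>N. \<forall>j\<ge>N. \<forall>z\<in>cball t s. cmod (jac (X j z)) < 1/2"
  proof (rule nondegenerate_or_small[OF S nc R'(2) cb])
   fix k :: real and m0 :: nat assume "k > 0"
   then show "\<exists>j\<ge>m0. \<forall>z\<in>cball t (s/2). cmod (jac (X j z)) < k" using False by (meson not_le)
  qed
  then obtain N where N: "\<And>j z. j >= N ==> z \<in> cball t s ==> cmod (jac (X j z)) < 1/2" by blast
  show ?thesis
  proof (rule fin[of "1/2" N 1])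
   fix n m z assume z: "z \<in> cball t (s/2)" "N <= m"
   have "(\<Prod>j<n. cmod (jac (X (m + j) z))) <= (\<Prod>j<n. 1/2)"
   proof (rule prod_mono)
    fix j show "0 <= cmod (jac (X (m + j) z)) \<and> cmod (jac (X (m + j) z)) <= 1/2"
     using N[of "m + j" z] z R'(2) by simp
   qed
   then show "cmod (jac_iter n (X m z)) <= 1 * (1/2) ^ n" unfolding pr prod_norm[symmetric] by simp
  qed auto
 qed
qed

lemma compact_windows:
 assumes S: "limit_disc S m" and nc: "t1 \<in> ball 0 R" "wedge (S t1) (vderiv S t1) ~= 0"
  and C: "compact C" "C \<subseteq> ball 0 R" and e: "e > 0"
 shows "\<exists>N. \<forall>n\<ge>N. \<forall>m\<ge>N. \<forall>z\<in>C. cmod (jac_iter n (X m z)) < e"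
proof (rule ccontr)
 assume "\<not> ?thesis"
 then have ex: "\<forall>N. \<exists>z. z \<in> C \<and> (\<exists>n\<ge>N. \<exists>m\<ge>N. \<not> cmod (jac_iter n (X m z)) < e)" by blast
 from choice[OF ex] obtain z where z: "\<forall>N. z N \<in> C \<and> (\<exists>n\<ge>N. \<exists>m\<ge>N. \<not> cmod (jac_iter n (X m (z N))) < e)" by (rule exE)
 have "\<exists>l\<in>C. \<exists>s::nat => nat. strict_mono s \<and> (z \<circ> s) \<longlonglongrightarrow> l"
  using C(1) z unfolding compact_def by (elim allE[of _ z]) simp
 then obtain l s where s: "l \<in> C" "strict_mono (s :: nat => nat)" "(z \<circ> s) \<longlonglongrightarrow> l" by blast
 have "l \<in> ball 0 R" using s(1) C(2) by blast
 from local_windows[OF S nc this] obtain r where r: "r > 0" "\<forall>e>0. \<exists>N. \<forall>n\<ge>N. \<forall>m\<ge>N. \<forall>z\<in>cball l r. cmod (jac_iter n (X m z)) < e"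
  by blast
 then obtain N where N: "\<forall>n\<ge>N. \<forall>m\<ge>N. \<forall>z\<in>cball l r. cmod (jac_iter n (X m z)) < e" using e by blast
 have "\<forall>\<^sub>F k in sequentially. dist ((z \<circ> s) k) l < r" using s(3) r(1) by (rule tendstoD)
 moreover have "\<forall>\<^sub>F k in sequentially. k >= N" by (rule eventually_ge_at_top)
 ultimately have "\<forall>\<^sub>F k in sequentially. False"
 proof eventually_elim
  case (elim k)
  have "z (s k) \<in> cball l r" using elim(1) by (simp add: dist_commute)
  moreover obtain n m where nm: "n >= s k" "m >= s k" "\<not> cmod (jac_iter n (X m (z (s k)))) < e" using z by blast
  moreover have "n >= N" "m >= N" using nm(1,2) elim(2) seq_suble[OF s(2), of k] by auto
  ultimately show False using N by blast
 qed
 then show False by simp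
qed

text \<open>A failure would give some limit disc degenerate at a point of \<open>C\<close>, and by
  \<open>wedge_zeros\<close> then \<open>S\<close> itself would be degenerate there.\<close>

lemma wedge_lower_bound:
 assumes S: "limit_disc S m" and C: "compact C" "C \<subseteq> ball 0 R"
  and w: "\<And>t. t \<in> C ==> wedge (S t) (vderiv S t) ~= 0"
 shows "\<exists>b>0. \<exists>N. \<forall>m\<ge>N. \<forall>t\<in>C. norm (wedge (X m t) (vderiv (X m) t)) >= b"
proof (rule ccontr)
 assume neg: "\<not> ?thesis"
 have "\<exists>i t. i >= k \<and> t \<in> C \<and> norm (wedge (X i t) (vderiv (X i) t)) < 1 / real (Suc k)" for k
 proof (rule ccontr)
  assume a: "\<not> ?thesis"
  have "\<forall>m\<ge>k. \<forall>t\<in>C. norm (wedge (X m t) (vderiv (X m) t)) >= 1 / real (Suc k)"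
   using a by (meson not_le)
  moreover have "1 / real (Suc k) > 0" by simp
  ultimately show False using neg by blast
 qed
 then have "\<forall>k. \<exists>i t. i >= k \<and> t \<in> C \<and> norm (wedge (X i t) (vderiv (X i) t)) < 1 / real (Suc k)" by (rule allI)
 from choice2[OF this] obtain i t where it: "\<forall>k. i k >= k \<and> t k \<in> C \<and> norm (wedge (X (i k) (t k)) (vderiv (X (i k)) (t k))) < 1 / real (Suc k)"
  by (elim exE)
 have tC: "t k \<in> C" for k using it by blast
 obtain S2 q z0 where q: "strict_mono (q :: nat => nat)" "nlift S2 (ball 0 R)" "z0 \<in> C" "(\<lambda>k. t (q k)) \<longlonglongrightarrow> z0"
  "(\<lambda>k. X (i (q k)) (t (q k))) \<longlonglongrightarrow> S2 z0" "(\<lambda>k. vderiv (X (i (q k))) (t (q k))) \<longlonglongrightarrow> vderiv S2 z0"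
  "\<And>t. t \<in> ball 0 R ==> (\<lambda>k. X (i (q k)) t) \<longlonglongrightarrow> S2 t"
  "\<And>C. compact C ==> C \<subseteq> ball 0 R ==> uniform_limit C (\<lambda>k. X (i (q k))) S2 sequentially"
  by (rule nlift_limit_points[where Y = "\<lambda>k. X (i k)" and z = t, OF X_nlift C tC]) (rule that)
 have "filterlim (\<lambda>k. i (q k)) at_top sequentially"
  by (rule filterlim_at_top_mono[OF filterlim_subseq[OF q(1)]]) (use it in simp)
 then have S2: "limit_disc S2 (\<lambda>k. i (q k))" unfolding limit_disc_def using q(2,8) by simp
 have 1: "(\<lambda>k. wedge (X (i (q k)) (t (q k))) (vderiv (X (i (q k))) (t (q k)))) \<longlonglongrightarrow> wedge (S2 z0) (vderiv S2 z0)"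
  by (rule tendsto_wedge[OF q(5,6)])
 have 2: "(\<lambda>k. 1 / real (Suc (q k))) \<longlonglongrightarrow> 0"
  using filterlim_compose[OF LIMSEQ_inverse_real_of_nat filterlim_subseq[OF q(1)]] by (simp add: inverse_eq_divide)
 have "(\<lambda>k. wedge (X (i (q k)) (t (q k))) (vderiv (X (i (q k))) (t (q k)))) \<longlonglongrightarrow> 0"
  by (rule Lim_null_comparison[OF _ 2]) (use it in \<open>intro always_eventually allI less_imp_le; blast\<close>)
 then have "wedge (S2 z0) (vderiv S2 z0) = 0" using LIMSEQ_unique[OF 1] by simp
 moreover have "z0 \<in> ball 0 R" using q(3) C(2) by blast
 ultimately have "wedge (S z0) (vderiv S z0) = 0" using wedge_zeros[OF S2 S] by blast
 then show False using w q(3) by blast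
qed

end

section \<open>A contracting tube around a limit disc\<close>

text \<open>Cauchy's estimate twice, with radii \<open>r / 2\<close> and \<open>r / 4\<close>,
  bounds the second derivative of each coordinate by \<open>8 * B / r\<^sup>2\<close>.\<close>

lemma hol_vec_taylor:
 fixes L :: "complex => complex^'n::finite"
 assumes L: "hol_vec L (ball t r)" "0 < r" "\<And>z. z \<in> ball t r ==> norm (L z) <= B" and h: "cmod h < r / 4"
 shows "norm (L (t + h) - L t - h *s vderiv L t) <= real CARD('n) * (8 * B / r\<^sup>2 * (cmod h)\<^sup>2)"
proof (rule norm_vec_le)
 fix i
 define l where "l = (\<lambda>z. L z $ i)"
 have lh: "l holomorphic_on ball t r" unfolding l_def by (rule hol_vecD[OF L(1)])
 have lb: "cmod (l z) <= B" if "z \<in> ball t r" for z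
  using L(3)[OF that] Finite_Cartesian_Product.norm_nth_le[of "L z" i] by (simp add: l_def)
 have sub: "ball z e \<subseteq> ball t r" if "z \<in> ball t (r - e)" for z e
 proof
  fix y assume "y \<in> ball z e"
  then show "y \<in> ball t r" using that dist_triangle[of t y z] by simp
 qed
 have d1: "cmod (deriv l z) <= B / (r/2)" if z: "z \<in> ball t (r/2)" for z
 proof -
  have s: "ball z (r/2) \<subseteq> ball t r" by (rule sub) (use z in simp)
  show ?thesis by (rule norm_deriv_le[OF holomorphic_on_subset[OF lh s]]) (use L(2) lb s in auto)
 qed
 have dh: "deriv l holomorphic_on ball t r" by (rule holomorphic_deriv[OF lh open_ball])
 have d2: "cmod (deriv (deriv l) z) <= B / (r/2) / (r/4)" if z: "z \<in> ball t (r/4)" for z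
 proof -
  have s: "ball z (r/4) \<subseteq> ball t (r/2)"
  proof
   fix y assume "y \<in> ball z (r/4)"
   then show "y \<in> ball t (r/2)" using z dist_triangle[of t y z] by simp
  qed
  have s2: "ball t (r/2) \<subseteq> ball t r" using L(2) by auto
  show ?thesis by (rule norm_deriv_le[OF holomorphic_on_subset[OF dh order_trans[OF s s2]]]) (use L(2) d1 s in auto)
 qed
 have sub4: "ball t (r/4) \<subseteq> ball t r" using L(2) by auto
 define f where "f = (\<lambda>k::nat. if k = 0 then l else if k = 1 then deriv l else deriv (deriv l))"
 have "cmod (f 0 (t + h) - (\<Sum>k\<le>1. f k t * (t + h - t) ^ k / fact k)) <= B / (r/2) / (r/4) * cmod (t + h - t) ^ Suc 1 / fact 1"
 proof (rule complex_Taylor[of "ball t (r/4)"])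
  show "convex (ball t (r/4))" by (rule convex_ball)
  show "(f k has_field_derivative f (Suc k) x) (at x within ball t (r/4))" if "x \<in> ball t (r/4)" "k <= 1" for k x
  proof -
   have x: "x \<in> ball t r" using that sub4 by blast
   have "(l has_field_derivative deriv l x) (at x)" "(deriv l has_field_derivative deriv (deriv l) x) (at x)"
    using holomorphic_derivI[OF lh open_ball x] holomorphic_derivI[OF dh open_ball x] by auto
   then show ?thesis using that(2) by (cases k) (auto simp: f_def intro: has_field_derivative_at_within)
  qed
  show "cmod (f (Suc 1) x) <= B / (r/2) / (r/4)" if "x \<in> ball t (r/4)" for x using d2[OF that] by (simp add: f_def)
  show "t \<in> ball t (r/4)" "t + h \<in> ball t (r/4)" using h L(2) by (auto simp: dist_norm)
 qed
 then have "cmod (l (t + h) - (l t + deriv l t * h)) <= B / (r/2) / (r/4) * (cmod h)\<^sup>2"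
  by (simp add: f_def power2_eq_square)
 also have "B / (r/2) / (r/4) = 8 * B / r\<^sup>2" by (simp add: power2_eq_square)
 finally show "cmod ((L (t + h) - L t - h *s vderiv L t) $ i) <= 8 * B / r\<^sup>2 * (cmod h)\<^sup>2"
  by (simp add: l_def algebra_simps)
qed

text \<open>Restriction to the complex line through \<open>y\<close> in direction \<open>v\<close>.
  A parameter disc of radius 8 makes both one-variable constants, \<open>3 / 8\<close> and
  \<open>3 * 8 / 8\<^sup>2\<close>, smaller than 1.\<close>

lemma polymap_taylor:
 assumes H: "polymap H"
 obtains C where "C >= 0" "\<And>y v. norm y <= K ==> norm (cderiv H y v) <= C * norm v"
  "\<And>y v. norm y <= K ==> norm v <= 1 ==> norm (H (y + v) - H y - cderiv H y v) <= C * (norm v)\<^sup>2"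
proof -
 have "compact (H ` cball 0 (K + 8))" by (intro compact_continuous_image polymap_continuous[OF H]) auto
 then have "bounded (H ` cball 0 (K + 8))" by (rule compact_imp_bounded)
 then obtain B where "\<forall>x\<in>H ` cball 0 (K + 8). norm x <= B" unfolding bounded_iff by (rule exE)
 then have B: "norm (H x) <= B" if "norm x <= K + 8" for x using that by simp
 have line: "norm (cderiv H y v) <= \<bar>B\<bar> * norm v \<and>
   (norm v <= 1 --> norm (H (y + v) - H y - cderiv H y v) <= \<bar>B\<bar> * (norm v)\<^sup>2)" if y: "norm y <= K" for y v
 proof (cases "v = 0")
  case True
  have "cderiv H y 0 = 0" using cderiv_smult[OF H, of y 0 0] by simp
  then show ?thesis using True by simp
 next
  case False
  define e where "e = of_real (1 / norm v) *s v"
  have e: "norm e = 1" "of_real (norm v) *s e = v" using False by (simp_all add: e_def norm_smult norm_divide)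
  have line: "hol_vec (\<lambda>t. y + t *s e) A" for A by (intro hol_vec_add hol_vec_const hol_vec_id_scale)
  have h: "hol_vec (\<lambda>t. H (y + t *s e)) (ball 0 8)" by (rule hol_vec_polymap[OF H line])
  have b: "norm (H (y + t *s e)) <= B" if "t \<in> ball 0 8" for t
   by (rule B) (use that y e(1) norm_triangle_ineq[of y "t *s e"] in \<open>simp add: norm_smult\<close>)
  have "vderiv (\<lambda>t. y + t *s e) 0 = e" unfolding vec_eq_iff by (auto intro!: DERIV_imp_deriv derivative_eq_intros)
  then have d: "vderiv (\<lambda>t. H (y + t *s e)) 0 = cderiv H y e"
   using vderiv_polymap[OF H line open_UNIV UNIV_I, of 0] by simp
  have cv: "cderiv H y v = of_real (norm v) *s cderiv H y e" using cderiv_smult[OF H, of y "of_real (norm v)" e] e(2) by simp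
  have "B >= 0" using order_trans[OF norm_ge_zero b[of 0]] by simp
  then have "norm (cderiv H y e) <= \<bar>B\<bar>" using norm_vderiv_le[OF h _ b] d by simp
  then have "norm v * norm (cderiv H y e) <= norm v * \<bar>B\<bar>" by (rule mult_left_mono) simp
  then have "norm (cderiv H y v) <= \<bar>B\<bar> * norm v" unfolding cv norm_smult by (simp add: mult.commute)
  moreover have "norm (H (y + v) - H y - cderiv H y v) <= \<bar>B\<bar> * (norm v)\<^sup>2" if "norm v <= 1"
  proof -
   have "norm (H (y + v) - H y - cderiv H y v) * 8 <= 3 * (B * (norm v)\<^sup>2)"
    using hol_vec_taylor[OF h _ b, of "of_real (norm v)"] that \<open>B >= 0\<close> by (simp add: d e(2) cv)
   moreover have "0 <= B * (norm v)\<^sup>2" using \<open>B >= 0\<close> by simp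
   ultimately show ?thesis using \<open>B >= 0\<close> by linarith
  qed
  ultimately show ?thesis by blast
 qed
 show ?thesis by (rule that[of "\<bar>B\<bar>"]) (use line in auto)
qed

definition cnj_vec :: "complex^3 => complex^3" where
 "cnj_vec w = (\<chi> i. cnj (w $ i))"

lemma norm_cnj_vec: "norm (cnj_vec w) = norm w"
 by (simp add: cnj_vec_def norm_vec_def)

lemma cramer: "det3 A B C *s V = det3 V B C *s A + det3 A V C *s B + det3 A B V *s C"
 unfolding vec_eq_iff forall_3 det3_def by (simp add: algebra_simps)

lemma det3_wedge: "det3 A B V = cdot (wedge A B) V"
 by (simp add: cdot_def sum_3 wedge_nth det3_def algebra_simps)

lemma det3_cnj_wedge: "det3 A B (cnj_vec (wedge A B)) = of_real ((norm (wedge A B))\<^sup>2)"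
proof -
 have "cdot w (cnj_vec w) = herm w w" for w by (simp add: cdot_def herm_def cnj_vec_def)
 then show ?thesis by (simp add: det3_wedge herm_self)
qed

text \<open>Cramer's rule in the frame of radial vector \<open>A\<close>, tangent vector
  \<open>B\<close> and normal vector \<open>cnj_vec (wedge A B)\<close>, whose determinant is
  \<open>(norm (wedge A B))\<^sup>2\<close>. The normal part is controlled by
  \<open>det3 A B V\<close>, the quantity that the Jacobian multiplies.\<close>

lemma normal_decomposition:
 assumes w: "norm (wedge A B) >= k" "k > 0"
 obtains a b g where "V = a *s A + b *s B + g *s cnj_vec (wedge A B)"
  "cmod a <= 6 * norm B / k * norm V" "cmod b <= 6 * norm A / k * norm V"
  "norm (g *s cnj_vec (wedge A B)) <= cmod (det3 A B V) / k"
proof -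
 define W where "W = norm (wedge A B)"
 have W: "W > 0" "W >= k" using w by (auto simp: W_def)
 define N where "N = cnj_vec (wedge A B)"
 have nN: "norm N = W" by (simp add: N_def W_def norm_cnj_vec)
 define D where "D = det3 A B N"
 have D: "D = of_real (W\<^sup>2)" unfolding D_def N_def W_def by (rule det3_cnj_wedge)
 have D0: "D ~= 0" "cmod D = W\<^sup>2" using W by (auto simp: D simp del: of_real_power)
 define a where "a = det3 V B N / D"
 define b where "b = det3 A V N / D"
 define g where "g = det3 A B V / D"
 have eq: "V = a *s A + b *s B + g *s N"
 proof -
  have "D *s V = D *s (a *s A + b *s B + g *s N)"
   unfolding D_def[symmetric] using cramer[of A B N V] D0(1)
   by (simp add: vec.scale_right_distrib a_def b_def g_def D_def[symmetric])
  then show ?thesis using D0(1) by (simp only: vector_mul_lcancel) simp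
 qed
 have frac: "6 * x * y * W / W\<^sup>2 <= 6 * x / k * y" if "x >= 0" "y >= 0" for x y :: real
 proof -
  have "6 * x * y * W / W\<^sup>2 = 6 * x * y / W" using W by (simp add: power2_eq_square)
  also have "\<dots> <= 6 * x * y / k" using W w(2) that by (intro divide_left_mono) auto
  finally show ?thesis by simp
 qed
 have "cmod a <= 6 * norm V * norm B * W / W\<^sup>2"
  using norm_det3_le[of V B N] W by (simp add: a_def norm_divide D0 nN divide_right_mono)
 then have a: "cmod a <= 6 * norm B / k * norm V" using frac[of "norm B" "norm V"] by (simp add: mult_ac)
 have "cmod b <= 6 * norm A * norm V * W / W\<^sup>2"
  using norm_det3_le[of A V N] W by (simp add: b_def norm_divide D0 nN divide_right_mono)
 then have b: "cmod b <= 6 * norm A / k * norm V" using frac[of "norm A" "norm V"] by (simp add: mult_ac)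
 have "norm (g *s N) = cmod (det3 A B V) / W"
  using W by (simp add: norm_smult g_def norm_divide D0 nN power2_eq_square)
 also have "\<dots> <= cmod (det3 A B V) / k" using W w(2) by (intro divide_left_mono) auto
 finally have g: "norm (g *s N) <= cmod (det3 A B V) / k" .
 show thesis by (rule that[of a b g]) (use eq a b g in \<open>simp_all add: N_def\<close>)
qed

lemma proj_pert_dist:
 assumes "x ~= 0" "x + v ~= 0" "norm x >= c" "c > 0"
 shows "dist (proj (x + v)) (proj x) <= 2 * norm v / c"
proof -
 have "dist (proj x) (proj (x + v)) <= 2 * norm (x - (x + v)) / norm x" by (rule dist_proj_le[OF assms(1,2)])
 also have "\<dots> <= 2 * norm v / c" using assms by (simp add: frac_le)
 finally show ?thesis by (simp add: dist_commute)
qed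

context orbit_disc
begin

lemma room:
 assumes C: "compact C" "C \<subseteq> ball (0::complex) R"
 obtains r where "r > 0" "\<And>t. t \<in> C ==> ball t r \<subseteq> ball 0 R"
proof (cases "C = {}")
 case True then show ?thesis using that[of 1] by simp
next
 case False
 obtain t1 where t1: "t1 \<in> C" "\<And>t. t \<in> C ==> cmod t <= cmod t1"
  using continuous_attains_sup[OF C(1) False, of cmod] continuous_on_norm_id by auto
 show ?thesis
 proof (rule that[of "R - cmod t1"])
  show "R - cmod t1 > 0" using t1(1) C(2) by auto
  fix t assume t: "t \<in> C"
  show "ball t (R - cmod t1) \<subseteq> ball 0 R"
  proof
   fix y assume "y \<in> ball t (R - cmod t1)"
   then show "y \<in> ball 0 R" using t1(2)[OF t] norm_triangle_ineq[of t "y - t"] by (simp add: dist_norm norm_minus_commute)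
  qed
 qed
qed

text \<open>The linear image of a perturbation is split along the new disc. The radial part goes
  into the scalar \<open>c\<close>, the tangential part into the parameter shift \<open>h\<close>;
  the normal part is contracted, since \<open>q\<close> makes the Jacobian small. The remaining
  errors are quadratic in \<open>norm V\<close>.\<close>

lemma tube_step:
 assumes S: "limit_disc S \<mu>" and C: "compact C" "C \<subseteq> ball 0 R" "C ~= {}"
  and w: "\<And>t. t \<in> C ==> wedge (S t) (vderiv S t) ~= 0"
 shows "\<exists>q N. \<exists>k>0. \<exists>E\<ge>0. q >= 1 \<and> (\<forall>m\<ge>N. \<forall>t\<in>C. \<forall>V. norm V <= k -->
  (\<exists>c h V'. c ~= 0 \<and> (F ^^ q) (X m t + V) = c *s (X (m + q) (t + h) + V') \<and> norm V' <= norm V / 2 \<and> cmod h <= E * norm V))"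
proof -
 obtain r where r: "r > 0" "\<And>t. t \<in> C ==> ball t r \<subseteq> ball 0 R" by (rule room[OF C(1,2)]) (rule that)
 obtain l N1 where l: "l > 0" "\<forall>m\<ge>N1. \<forall>t\<in>C. norm (wedge (X m t) (vderiv (X m) t)) >= l"
  using wedge_lower_bound[OF S C(1,2) w] by blast
 obtain t1 where t1: "t1 \<in> C" using C(3) by blast
 have hX: "hol_vec (X m) (ball t r)" if "t \<in> C" for m t
 proof -
  have "hol_vec (X m) (ball 0 R)" using X_nlift[of m] by (simp add: nlift_def)
  then show ?thesis by (rule hol_vec_subset[OF _ r(2)[OF that]])
 qed
 have bX: "norm (X m z) <= nbd" if "t \<in> C" "z \<in> ball t r" for m t z
  by (rule normalized_bounds(1)[OF X_normalized]) (use r(2) that in blast)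
 define D1 where "D1 = 3 * (nbd / r)"
 have D1: "D1 >= 0" using r nbd_ge_1 by (simp add: D1_def)
 have dX: "norm (vderiv (X m) t) <= D1" if "t \<in> C" for m t
  using norm_vderiv_le[OF hX[OF that] r(1) bX[OF that]] by (simp add: D1_def)
 define C2 where "C2 = 3 * (8 * nbd / r\<^sup>2)"
 have C20: "C2 >= 0" using nbd_ge_1 by (simp add: C2_def)
 have tay: "norm (X m (t + h) - X m t - h *s vderiv (X m) t) <= C2 * (cmod h)\<^sup>2" if "t \<in> C" "cmod h < r / 4" for m t h
  using hol_vec_taylor[OF hX[OF that(1)] r(1) bX[OF that(1)] that(2), of m] by (simp add: C2_def mult_ac)
 define W where "W = 6 * nbd * D1"
 have W0: "W >= 0" using nbd_ge_1 D1 by (simp add: W_def)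
 \<comment> \<open>\<open>W\<close> bounds the determinant of the incoming vectors per unit of
   \<open>norm V\<close>. The normal part, doubled by dividing by \<open>c\<close>, then takes at
   most \<open>1 / 4\<close> of \<open>norm V\<close>.\<close>
 define j where "j = l / (8 * W + 1)"
 have j: "j > 0" "2 * (j * W / l) <= 1/4"
  using l(1) W0 by (auto simp: j_def divide_simps)
 have t1R: "t1 \<in> ball 0 R" using t1 C(2) by blast
 obtain N2 where N2: "\<forall>n\<ge>N2. \<forall>m\<ge>N2. \<forall>z\<in>C. cmod (jac_iter n (X m z)) < j"
  using compact_windows[OF S t1R w[OF t1] C(1,2) j(1)] by blast
 define q where "q = Suc N2"
 obtain CH where CH: "CH >= 0" "\<And>y v. norm y <= nbd ==> norm (cderiv (F ^^ q) y v) <= CH * norm v"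
  "\<And>y v. norm y <= nbd ==> norm v <= 1 ==> norm ((F ^^ q) (y + v) - (F ^^ q) y - cderiv (F ^^ q) y v) <= CH * (norm v)\<^sup>2"
  by (rule polymap_taylor[OF polymap_iter, where K = nbd and n1 = q]) (rule that)
 define E where "E = 6 * (D1 + nbd) / l * CH"
 have E: "E >= 0" using D1 nbd_ge_1 l(1) CH(1) by (simp add: E_def)
 \<comment> \<open>Collects the quadratic errors: the Taylor remainder of \<open>F ^^ q\<close>,
   doubled by the division by \<open>c\<close>, and that of the disc at shift at most
   \<open>2 * E * norm V\<close>.\<close>
 define G where "G = 2 * CH + 4 * C2 * E\<^sup>2"
 have G: "G >= 0" using CH(1) C20 by (simp add: G_def)
 \<comment> \<open>The constraints ensure, in turn, the Taylor bound for \<open>F ^^ q\<close>,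
   \<open>cmod c >= 1/2\<close>, \<open>cmod h < r / 4\<close>, and quadratic errors of at most a
   quarter of \<open>norm V\<close>.\<close>
 define k where "k = min (min 1 (1 / (2 * E + 1))) (min (r / (16 * E + 16)) (1 / (4 * G + 1)))"
 have k: "k > 0" "k <= 1" "k * (2 * E + 1) <= 1" "k * (16 * E + 16) <= r" "k * (4 * G + 1) <= 1"
 proof -
  have p: "2 * E + 1 > 0" "16 * E + 16 > 0" "4 * G + 1 > 0" using E G by auto
  show "k > 0" using p r(1) by (simp add: k_def)
  show "k <= 1" by (simp add: k_def)
  have "k <= 1 / (2 * E + 1)" "k <= r / (16 * E + 16)" "k <= 1 / (4 * G + 1)" unfolding k_def by linarith+
  then show "k * (2 * E + 1) <= 1" "k * (16 * E + 16) <= r" "k * (4 * G + 1) <= 1"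
   using p by (simp_all only: pos_le_divide_eq)
 qed
 have main: "\<exists>c h V'. c ~= 0 \<and> (F ^^ q) (X m t + V) = c *s (X (m + q) (t + h) + V') \<and> norm V' <= norm V / 2 \<and> cmod h <= (2 * E) * norm V"
  if m: "m >= max N1 N2" and t: "t \<in> C" and V: "norm V <= k" for m t V
 proof -
  define v where "v = norm V"
  have v: "0 <= v" "v <= k" "v <= 1" using V k(2) by (auto simp: v_def)
  have tR: "t \<in> ball 0 R" using t C(2) by blast
  have tr: "t \<in> ball t r" using r(1) by simp
  define Y where "Y = X m t"
  define Y' where "Y' = vderiv (X m) t"
  define Z where "Z = X (m + q) t"
  define Z' where "Z' = vderiv (X (m + q)) t"
  have HY: "(F ^^ q) Y = Z" by (simp add: Y_def Z_def X_add)
  have Yb: "norm Y <= nbd" "norm Z <= nbd" "norm Y' <= D1" "norm Z' <= D1"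
   unfolding Y_def Z_def Y'_def Z'_def using bX[OF t tr] dX[OF t] by auto
  have Z'eq: "Z' = cderiv (F ^^ q) Y Y'"
  proof -
   have "vderiv (\<lambda>z. (F ^^ q) (X m z)) t = cderiv (F ^^ q) (X m t) (vderiv (X m) t)"
    by (rule vderiv_polymap[OF polymap_iter _ open_ball tR]) (use X_nlift in \<open>simp add: nlift_def\<close>)
   then show ?thesis by (simp add: Z'_def X_add[symmetric] Y_def Y'_def)
  qed
  define DV where "DV = cderiv (F ^^ q) Y V"
  have DVb: "norm DV <= CH * v" unfolding DV_def v_def by (rule CH(2)[OF Yb(1)])
  have wl: "norm (wedge Z Z') >= l" unfolding Z_def Z'_def using l(2) m t by simp
  obtain a b g where dec: "DV = a *s Z + b *s Z' + g *s cnj_vec (wedge Z Z')"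
   "cmod a <= 6 * norm Z' / l * norm DV" "cmod b <= 6 * norm Z / l * norm DV"
   "norm (g *s cnj_vec (wedge Z Z')) <= cmod (det3 Z Z' DV) / l"
   by (rule normal_decomposition[OF wl l(1), of DV]) (rule that)
  define n where "n = g *s cnj_vec (wedge Z Z')"
  have "6 * norm Z' / l * norm DV <= 6 * (D1 + nbd) / l * (CH * v)"
   using Yb l(1) D1 nbd_ge_1 DVb by (intro mult_mono divide_right_mono) auto
  then have ab: "cmod a <= E * v" using dec(2) by (simp add: E_def)
  have "6 * norm Z / l * norm DV <= 6 * (D1 + nbd) / l * (CH * v)"
   using Yb l(1) D1 nbd_ge_1 DVb by (intro mult_mono divide_right_mono) auto
  then have bb: "cmod b <= E * v" using dec(3) by (simp add: E_def)
  have Ev: "E * v <= 1/2"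
  proof -
   have "v * (2 * E + 1) <= k * (2 * E + 1)" using v E by (intro mult_right_mono) auto
   then have "v * (2 * E + 1) <= 1" using k(3) by linarith
   then show ?thesis using v by (simp add: algebra_simps)
  qed
  have nb: "norm n <= j * W / l * v"
  proof -
   have "det3 Z Z' DV = jac_iter q Y * det3 Y Y' V"
    using det3_cderiv_iter[of q Y Y' V] by (simp add: HY Z'eq DV_def)
   moreover have "cmod (jac_iter q Y) <= j" using N2 m t by (simp add: Y_def q_def less_imp_le)
   moreover have "cmod (det3 Y Y' V) <= W * v"
   proof -
    have "cmod (det3 Y Y' V) <= 6 * norm Y * norm Y' * norm V" by (rule norm_det3_le)
    also have "\<dots> <= 6 * nbd * D1 * v" unfolding v_def using Yb nbd_ge_1 D1 by (intro mult_mono) auto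
    finally show ?thesis by (simp add: W_def)
   qed
   ultimately have "cmod (det3 Z Z' DV) <= j * (W * v)"
    unfolding norm_mult using j(1) by (simp add: norm_mult mult_mono)
   then have "cmod (det3 Z Z' DV) / l <= j * (W * v) / l" using l(1) by (intro divide_right_mono) auto
   with dec(4) show ?thesis by (simp add: n_def mult_ac)
  qed
  define e where "e = (F ^^ q) (Y + V) - (F ^^ q) Y - DV"
  have eb: "norm e <= CH * v\<^sup>2" unfolding e_def DV_def v_def by (rule CH(3)[OF Yb(1)]) (use v(3) in \<open>simp add: v_def\<close>)
  define c where "c = 1 + a"
  have c: "cmod c >= 1/2" using norm_triangle_ineq2[of 1 "- a"] ab Ev by (simp add: c_def)
  then have c0: "c ~= 0" by auto
  define h where "h = b / c"
  have ic: "cmod (x / c) <= 2 * cmod x" for x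
  proof -
   have "cmod x / cmod c <= cmod x / (1/2)" using c by (intro divide_left_mono) auto
   then show ?thesis by (simp add: norm_divide)
  qed
  have hb: "cmod h <= 2 * E * v" using ic[of b] bb by (simp add: h_def)
  have hr: "cmod h < r / 4"
  proof -
   have "v * (16 * E + 16) <= k * (16 * E + 16)" using v E by (intro mult_right_mono) auto
   then have "8 * (2 * E * v) + 16 * v <= r" using k(4) by (simp add: algebra_simps)
   then have "8 * (2 * E * v) <= r" using v by linarith
   then have "2 * E * v <= r / 8" by linarith
   then show ?thesis using hb r(1) by linarith
  qed
  define i where "i = X (m + q) (t + h) - Z - h *s Z'"
  have ib: "norm i <= C2 * (2 * E * v)\<^sup>2"
  proof -
   have "norm i <= C2 * (cmod h)\<^sup>2" unfolding i_def Z_def Z'_def by (rule tay[OF t hr])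
   also have "\<dots> <= C2 * (2 * E * v)\<^sup>2" using hb C20 by (intro mult_left_mono power_mono) auto
   finally show ?thesis .
  qed
  define V' where "V' = (1 / c) *s (n + e) - i"
  have eq: "(F ^^ q) (Y + V) = c *s (X (m + q) (t + h) + V')"
  proof -
   have "(F ^^ q) (Y + V) = Z + DV + e" by (simp add: e_def HY)
   also have "\<dots> = c *s Z + b *s Z' + (n + e)" unfolding dec(1) n_def[symmetric] c_def by (simp add: vec.scale_left_distrib)
   also have "\<dots> = c *s (Z + h *s Z' + (1 / c) *s (n + e))"
    using c0 by (simp add: vec.scale_right_distrib h_def)
   also have "Z + h *s Z' + (1 / c) *s (n + e) = X (m + q) (t + h) + V'" by (simp add: V'_def i_def)
   finally show ?thesis .
  qed
  have "norm V' <= v / 2"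
  proof -
   have "norm V' <= norm ((1 / c) *s (n + e)) + norm i" unfolding V'_def by (rule norm_triangle_ineq4)
   also have "norm ((1 / c) *s (n + e)) <= 2 * norm (n + e)"
   proof -
    have "cmod (1 / c) * norm (n + e) <= 2 * norm (n + e)" using ic[of 1] by (intro mult_right_mono) auto
    then show ?thesis by (simp only: norm_smult)
   qed
   also have "2 * norm (n + e) <= 2 * (j * W / l * v + CH * v\<^sup>2)"
    by (rule mult_left_mono[OF order_trans[OF norm_triangle_ineq add_mono[OF nb eb]]]) simp
   finally have "norm V' <= 2 * (j * W / l * v + CH * v\<^sup>2) + C2 * (2 * E * v)\<^sup>2" using ib by linarith
   also have "\<dots> = 2 * (j * W / l) * v + (G * v) * v" by (simp add: G_def algebra_simps power2_eq_square)
   also have "\<dots> <= 1/4 * v + 1/4 * v"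
   proof (intro add_mono mult_right_mono)
    have "v * (4 * G + 1) <= k * (4 * G + 1)" using v G by (intro mult_right_mono) auto
    then have "v * (4 * G + 1) <= 1" using k(5) by linarith
    then show "G * v <= 1/4" using v by (simp add: algebra_simps)
   qed (use j v in auto)
   finally show ?thesis by simp
  qed
  then show ?thesis using c0 eq hb unfolding Y_def v_def by blast
 qed
 show ?thesis
 proof (rule exI[of _ q], rule exI[of _ "max N1 N2"], rule exI[of _ k], rule conjI[OF k(1)], rule exI[of _ "2 * E"], intro conjI)
  show "0 <= 2 * E" using E by simp
  show "1 <= q" by (simp add: q_def)
 qed (use main in blast)
qed

text \<open>Perturbations halve at each step, so the parameter shifts sum to at most
  \<open>2 * E * norm V\<close>. For small \<open>V\<close> this is at most \<open>e\<close>, and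
  the shifted parameter never leaves \<open>C\<close>.\<close>

lemma tube_iter:
 assumes S: "limit_disc S \<mu>" and C: "compact C" "C \<subseteq> ball 0 R"
  and w: "\<And>t. t \<in> C ==> wedge (S t) (vderiv S t) ~= 0"
  and C0: "C0 ~= {}" "\<And>t. t \<in> C0 ==> cball t e \<subseteq> C" "e > 0"
 shows "\<exists>q N. \<exists>b>0. \<exists>E\<ge>0. q >= 1 \<and> (\<forall>m\<ge>N. \<forall>t\<in>C0. \<forall>V i. norm V <= b -->
  (\<exists>c h V'. c ~= 0 \<and> (F ^^ (q * i)) (X m t + V) = c *s (X (m + q * i) (t + h) + V') \<and> norm V' <= norm V \<and>
   cmod h <= E * norm V \<and> cmod h <= e))"
proof -
 have Cne: "C ~= {}"
 proof -
  obtain t where t: "t \<in> C0" using C0(1) by blast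
  have "t \<in> cball t e" using C0(3) by simp
  then show ?thesis using C0(2)[OF t] by blast
 qed
 obtain q N b E where st: "b > 0" "E >= 0" "q >= 1" "\<And>m t V. m >= N ==> t \<in> C ==> norm V <= b ==>
  \<exists>c h V'. c ~= 0 \<and> (F ^^ q) (X m t + V) = c *s (X (m + q) (t + h) + V') \<and> norm V' <= norm V / 2 \<and> cmod h <= E * norm V"
  using tube_step[OF S C Cne w] by blast
 define b' where "b' = min b (e / (2 * E + 1))"
 have E1: "2 * E + 1 > 0" using st(2) by simp
 have "b' <= e / (2 * E + 1)" unfolding b'_def by (rule min.cobounded2)
 then have "b' * (2 * E + 1) <= e" by (simp only: pos_le_divide_eq[OF E1])
 moreover have "b' > 0" "b' <= b" using st(1) C0(3) E1 by (auto simp: b'_def)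
 ultimately have b': "b' > 0" "b' <= b" "b' * (2 * E + 1) <= e" by blast+
 have EV: "2 * E * norm V <= e" if V: "norm V <= b'" for V :: "complex^3"
 proof -
  have "norm V * (2 * E + 1) <= b' * (2 * E + 1)" using V E1 by (intro mult_right_mono) auto
  moreover have "norm V * (2 * E + 1) = 2 * E * norm V + norm V" by (simp add: algebra_simps)
  ultimately show ?thesis using b'(3) norm_ge_zero[of V] by linarith
 qed
 have "\<exists>c h V'. c ~= 0 \<and> (F ^^ (q * i)) (X m t + V) = c *s (X (m + q * i) (t + h) + V') \<and> norm V' <= norm V / 2 ^ i \<and>
   cmod h <= 2 * E * norm V * (1 - 1 / 2 ^ i)"
  if m: "m >= N" and t: "t \<in> C0" and V: "norm V <= b'" for m t V i
 proof (induction i)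
  case 0
  show ?case by (rule exI[of _ 1], rule exI[of _ 0], rule exI[of _ V]) simp
 next
  case (Suc i)
  then obtain c h V' where IH: "c ~= 0" "(F ^^ (q * i)) (X m t + V) = c *s (X (m + q * i) (t + h) + V')"
   "norm V' <= norm V / 2 ^ i" "cmod h <= 2 * E * norm V * (1 - 1 / 2 ^ i)" by blast
  have V'V: "norm V' <= norm V"
  proof -
   have "norm V / 2 ^ i <= norm V / 1" by (intro divide_left_mono) auto
   then show ?thesis using IH(3) by simp
  qed
  have "2 * E * norm V * (1 - 1 / 2 ^ i) <= 2 * E * norm V * 1" using st(2) by (intro mult_left_mono) auto
  then have "cmod h <= e" using IH(4) EV[OF V] by linarith
  then have thC: "t + h \<in> C" using C0(2)[OF t] by (auto simp: dist_norm)
  have mN: "m + q * i >= N" using m by simp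
  have "norm V' <= b" using V'V V b'(2) by linarith
  from st(4)[OF mN thC this] obtain c1 h1 V1 where s: "c1 ~= 0" "(F ^^ q) (X (m + q * i) (t + h) + V') = c1 *s (X (m + q * i + q) (t + h + h1) + V1)"
   "norm V1 <= norm V' / 2" "cmod h1 <= E * norm V'" by blast
  show ?case
  \<comment> \<open>The earlier scalar passes through \<open>F ^^ q\<close> by homogeneity of degree
    \<open>d ^ q\<close>; its size is irrelevant after projecting.\<close>
  proof (rule exI[of _ "c ^ (d ^ q) * c1"], rule exI[of _ "h + h1"], rule exI[of _ V1], intro conjI)
   show "c ^ (d ^ q) * c1 ~= 0" using IH(1) s(1) by simp
   have "(F ^^ (q * Suc i)) (X m t + V) = (F ^^ q) ((F ^^ (q * i)) (X m t + V))" by (simp add: funpow_add)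
   also have "\<dots> = c ^ (d ^ q) *s (c1 *s (X (m + q * i + q) (t + h + h1) + V1))" unfolding IH(2) iter_smult s(2) ..
   also have "\<dots> = (c ^ (d ^ q) * c1) *s (X (m + q * Suc i) (t + (h + h1)) + V1)"
    by (simp only: vector_smult_assoc mult_Suc_right add.assoc add.commute[of q])
   finally show "(F ^^ (q * Suc i)) (X m t + V) = (c ^ (d ^ q) * c1) *s (X (m + q * Suc i) (t + (h + h1)) + V1)" .
   show "norm V1 <= norm V / 2 ^ Suc i" using s(3) IH(3) by simp
   have "cmod (h + h1) <= 2 * E * norm V * (1 - 1 / 2 ^ i) + E * (norm V / 2 ^ i)"
    using norm_triangle_ineq[of h h1] IH(4) s(4) mult_left_mono[OF IH(3) st(2)] by linarith
   also have "\<dots> = 2 * E * norm V * (1 - 1 / 2 ^ Suc i)" by (simp add: field_simps)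
   finally show "cmod (h + h1) <= 2 * E * norm V * (1 - 1 / 2 ^ Suc i)" .
  qed
 qed
 note it = this
 have "\<exists>c h V'. c ~= 0 \<and> (F ^^ (q * i)) (X m t + V) = c *s (X (m + q * i) (t + h) + V') \<and> norm V' <= norm V \<and>
   cmod h <= (2 * E) * norm V \<and> cmod h <= e" if a: "m >= N" "t \<in> C0" "norm V <= b'" for m t V i
 proof -
  obtain c h V' where *: "c ~= 0" "(F ^^ (q * i)) (X m t + V) = c *s (X (m + q * i) (t + h) + V')"
   "norm V' <= norm V / 2 ^ i" "cmod h <= 2 * E * norm V * (1 - 1 / 2 ^ i)" using it[OF a] by blast
  have "norm V / 2 ^ i <= norm V / 1" by (intro divide_left_mono) auto
  then have 1: "norm V' <= norm V" using *(3) by simp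
  have "2 * E * norm V * (1 - 1 / 2 ^ i) <= 2 * E * norm V * 1" using st(2) by (intro mult_left_mono) auto
  then have 2: "cmod h <= (2 * E) * norm V" using *(4) by linarith
  have 3: "cmod h <= e" using 2 EV[OF a(3)] by linarith
  show ?thesis using *(1,2) 1 2 3 by blast
 qed
 note fin = this
 show ?thesis
  by (rule exI[of _ q], rule exI[of _ N], rule exI[of _ b'], rule conjI[OF b'(1)], rule exI[of _ "2 * E"])
   (use st(2,3) fin in \<open>intro conjI; blast | simp\<close>)
qed

text \<open>Projection discards the scalar \<open>c\<close>. What remains is the perturbation
  \<open>V'\<close>, never larger than \<open>V\<close>, and the parameter shift, converted into a
  distance by \<open>nlift_dist\<close>.\<close>

lemma tube_dist:
 assumes S: "limit_disc S \<mu>" and C: "compact C" "C \<subseteq> ball 0 R"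
  and w: "\<And>t. t \<in> C ==> wedge (S t) (vderiv S t) ~= 0"
  and C0: "C0 ~= {}" "\<And>t. t \<in> C0 ==> cball t e \<subseteq> C" "e > 0"
 shows "\<exists>q N. \<exists>a>0. \<exists>B\<ge>0. q >= 1 \<and> (\<forall>m\<ge>N. \<forall>t\<in>C0. \<forall>V i. norm V <= a --> X m t + V ~= 0 \<and>
   dist ((f ^^ (q * i)) (proj (X m t + V))) ((f ^^ (q * i)) (proj (X m t))) <= B * norm V)"
proof -
 have C0C: "C0 \<subseteq> C"
 proof
  fix t assume t: "t \<in> C0"
  have "t \<in> cball t e" using C0(3) by simp
  then show "t \<in> C" using C0(2)[OF t] by blast
 qed
 obtain r where r: "r > 0" "\<And>t. t \<in> C ==> ball t r \<subseteq> ball 0 R" by (rule room[OF C]) (rule that)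
 define e' where "e' = min e (r / 4)"
 have e': "e' > 0" "e' <= e" "e' <= r / 4" using C0(3) r(1) by (auto simp: e'_def)
 have C0': "cball t e' \<subseteq> C" if "t \<in> C0" for t
  using C0(2)[OF that] subset_cball[OF e'(2), of t] by blast
 obtain q N a E where it: "a > 0" "E >= 0" "q >= 1" "\<And>m t V i. m >= N ==> t \<in> C0 ==> norm V <= a ==>
  \<exists>c h V'. c ~= 0 \<and> (F ^^ (q * i)) (X m t + V) = c *s (X (m + q * i) (t + h) + V') \<and> norm V' <= norm V \<and>
   cmod h <= E * norm V \<and> cmod h <= e'"
  using tube_iter[OF S C w C0(1) C0' e'(1)] by blast
 define a' where "a' = min a (1 / (2 * nbd))"
 have a': "a' > 0" "a' <= a" "a' <= 1 / (2 * nbd)" using it(1) nbd_ge_1 by (auto simp: a'_def)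
 have small: "1 / (2 * nbd) < 1 / nbd" using nbd_ge_1 by (simp add: frac_less2)
 define B where "B = 2 * nbd + 12 * nbd\<^sup>2 / r * E"
 have B: "B >= 0" using nbd_ge_1 r(1) it(2) by (simp add: B_def)
 have main: "X m t + V ~= 0 \<and> dist ((f ^^ (q * i)) (proj (X m t + V))) ((f ^^ (q * i)) (proj (X m t))) <= B * norm V"
  if m: "m >= N" and t: "t \<in> C0" and V: "norm V <= a'" for m t V i
 proof -
  have tC: "t \<in> C" using t C0C by blast
  have tR: "t \<in> ball 0 R" using tC C(2) by blast
  have nz: "x + v ~= 0" if "normalized x" "norm v <= a'" for x v
  proof
   assume "x + v = 0"
   then have "x = - v" by (simp add: eq_neg_iff_add_eq_0)
   then have "norm x = norm v" by simp
   then show False using normalized_bounds(2)[OF that(1)] that(2) a'(3) small by linarith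
  qed
  have n1: "X m t + V ~= 0" by (rule nz[OF X_normalized[OF tR] V])
  have "norm V <= a" using V a'(2) by linarith
  from it(4)[OF m t this, of i] obtain c h V' where *: "c ~= 0" "(F ^^ (q * i)) (X m t + V) = c *s (X (m + q * i) (t + h) + V')"
   "norm V' <= norm V" "cmod h <= E * norm V" "cmod h <= e'" by blast
  have hr: "cmod h <= r / 4" using *(5) e'(3) by linarith
  have thr: "t + h \<in> ball t r" using hr r(1) by (simp add: dist_norm)
  have thR: "t + h \<in> ball 0 R" using thr r(2)[OF tC] by blast
  have V'b: "norm V' <= a'" using *(3) V by linarith
  have n2: "X (m + q * i) (t + h) + V' ~= 0" by (rule nz[OF X_normalized[OF thR] V'b])
  have p1: "(f ^^ (q * i)) (proj (X m t + V)) = proj (X (m + q * i) (t + h) + V')"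
   using f_iter_proj[OF n1, of "q * i"] proj_smult[OF *(1) n2] by (simp only: *(2))
  have p2: "(f ^^ (q * i)) (proj (X m t)) = proj (X (m + q * i) t)" using proj_X_add[OF tR] by simp
  have d1: "dist (proj (X (m + q * i) (t + h) + V')) (proj (X (m + q * i) (t + h))) <= 2 * norm V' / (1 / nbd)"
   by (rule proj_pert_dist[OF nonzero[OF X_nlift thR] n2 normalized_bounds(2)[OF X_normalized[OF thR]]]) (use nbd_ge_1 in simp)
  have d2: "dist ((f ^^ 0) (proj (X (m + q * i) (t + h)))) ((f ^^ 0) (proj (X (m + q * i) t))) <= 12 * nbd\<^sup>2 / r * cmod (t + h - t)"
   by (rule nlift_dist[OF nlift_subset[OF X_nlift r(2)[OF tC]] r(1)]) (use hr r(1) in \<open>auto simp: dist_norm\<close>)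
  have "dist (proj (X (m + q * i) (t + h) + V')) (proj (X (m + q * i) t)) <= 2 * norm V' / (1 / nbd) + 12 * nbd\<^sup>2 / r * cmod h"
   using d1 d2 dist_triangle[of "proj (X (m + q * i) (t + h) + V')" "proj (X (m + q * i) t)" "proj (X (m + q * i) (t + h))"] by simp
  also have "\<dots> <= 2 * norm V / (1 / nbd) + 12 * nbd\<^sup>2 / r * (E * norm V)"
   using *(3,4) nbd_ge_1 r(1) by (intro add_mono divide_right_mono mult_left_mono) auto
  also have "\<dots> = B * norm V" by (simp add: B_def algebra_simps)
  finally show ?thesis using n1 unfolding p1 p2 by blast
 qed
 show ?thesis
  by (rule exI[of _ q], rule exI[of _ N], rule exI[of _ a'], rule conjI[OF a'(1)], rule exI[of _ B]) (use B it(3) main in blast)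
qed

end

text \<open>Connectedness of the unit interval. The parameters with a zero form a closed set by
  compactness of the disc; those without zeros form a closed set by Hurwitz, as zeros on the
  boundary are excluded.\<close>

lemma zero_free_homotopy:
 fixes l :: "real => complex => complex"
 assumes cont: "continuous_on ({0..1} \<times> cball a r) (\<lambda>(s, t). l s t)" and r: "r > 0"
  and hol: "\<And>s. s \<in> {0..1} ==> l s holomorphic_on ball a r"
  and bdry: "\<And>s t. s \<in> {0..1} ==> t \<in> sphere a r ==> l s t ~= 0"
  and zero: "\<And>t. t \<in> cball a r ==> l 0 t ~= 0" and t: "t \<in> cball a r"
 shows "l 1 t ~= 0"
proof -
 define Z where "Z = {s\<in>{0..1}. \<forall>t\<in>cball a r. l s t ~= 0}"
 have joint: "(\<lambda>n. l (s n) (u n)) \<longlonglongrightarrow> l s0 u0"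
  if "\<And>n. s n \<in> {0..1}" "\<And>n. u n \<in> cball a r" "s \<longlonglongrightarrow> s0" "u \<longlonglongrightarrow> u0" "s0 \<in> {0..1}" "u0 \<in> cball a r" for s u s0 u0
 proof -
  have "(\<lambda>n. (\<lambda>(s, t). l s t) (s n, u n)) \<longlonglongrightarrow> (\<lambda>(s, t). l s t) (s0, u0)"
   by (rule continuous_on_tendsto_compose[OF cont tendsto_Pair[OF that(3,4)]])
    (use that in \<open>auto intro: always_eventually\<close>)
  then show ?thesis by simp
 qed
 have unif: "uniform_limit (cball a r) (\<lambda>n. l (s n)) (l s0) sequentially"
  if s: "\<And>n. s n \<in> {0..1}" "s \<longlonglongrightarrow> s0" "s0 \<in> {0..1}" for s s0
 proof (rule uniform_limitI)
  fix e :: real assume e: "e > 0"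
  have "uniformly_continuous_on ({0..1} \<times> cball a r) (\<lambda>(s, t). l s t)"
   by (rule compact_uniformly_continuous[OF cont]) (intro compact_Times compact_Icc compact_cball)
  then obtain g where g: "g > 0" "\<And>x x'. x \<in> {0..1} \<times> cball a r ==> x' \<in> {0..1} \<times> cball a r ==> dist x' x < g ==>
   dist ((\<lambda>(s, t). l s t) x') ((\<lambda>(s, t). l s t) x) < e"
   using e unfolding uniformly_continuous_on_def by metis
  have "\<forall>\<^sub>F n in sequentially. dist (s n) s0 < g" using s(2) g(1) by (rule tendstoD)
  then show "\<forall>\<^sub>F n in sequentially. \<forall>x\<in>cball a r. dist (l (s n) x) (l s0 x) < e"
  proof eventually_elim
   case (elim n)
   show ?case
   proof
    fix x assume x: "x \<in> cball a r"
    show "dist (l (s n) x) (l s0 x) < e"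
     using g(2)[of "(s0, x)" "(s n, x)"] s(1)[of n] s(3) x elim by (simp add: dist_Pair_Pair)
   qed
  qed
 qed
 have clZ: "closed Z"
  unfolding closed_sequential_limits
 proof (intro allI impI)
  fix s s0 assume s: "(\<forall>n::nat. s n \<in> Z) \<and> s \<longlonglongrightarrow> s0"
  have s0: "s0 \<in> {0..1}"
   by (rule Lim_in_closed_set[of "{0..1}" s sequentially]) (use s in \<open>auto simp: Z_def\<close>)
  have sn: "s n \<in> {0..1}" "\<And>t. t \<in> cball a r ==> l (s n) t ~= 0" for n using s by (auto simp: Z_def)
  have lim: "s \<longlonglongrightarrow> s0" using s by blast
  have "l s0 t ~= 0" if t: "t \<in> cball a r" for t
  proof (cases "t \<in> sphere a r")
   case True then show ?thesis by (rule bdry[OF s0])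
  next
   case False
   then have tb: "t \<in> ball a r" using t by auto
   show ?thesis
   \<comment> \<open>Hurwitz requires a nonconstant limit. A constant limit equals a boundary value
     by continuity and so is nonzero.\<close>
   proof (cases "l s0 constant_on ball a r")
    case True
    then obtain c where c: "\<And>x. x \<in> ball a r ==> l s0 x = c" unfolding constant_on_def by blast
    define b where "b = a + of_real r"
    have b: "b \<in> sphere a r" using r by (simp add: b_def dist_norm)
    have pt: "cmod (a - (a + of_real (r * (1 - 1 / real (Suc n))))) <= r" "cmod (a - (a + of_real (r * (1 - 1 / real (Suc n))))) < r" for n
    proof -
     define x where "x = r * (1 - 1 / real (Suc n))"
     have x: "0 <= x" "x < r"
      unfolding x_def using r by (auto simp: field_simps)
     have "cmod (a - (a + of_real x)) = \<bar>x\<bar>" by simp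
     with x show "cmod (a - (a + of_real (r * (1 - 1 / real (Suc n))))) <= r" "cmod (a - (a + of_real (r * (1 - 1 / real (Suc n))))) < r"
      unfolding x_def[symmetric] by linarith+
    qed
    have "(\<lambda>n. l s0 (a + of_real (r * (1 - 1 / real (Suc n))))) \<longlonglongrightarrow> l s0 (a + of_real (r * (1 - 0)))"
    proof (rule joint[OF s0 _ tendsto_const _ s0])
     show "a + of_real (r * (1 - 1 / real (Suc n))) \<in> cball a r" for n
      using pt(1)[of n] by (simp only: mem_cball dist_norm)
     show "(\<lambda>n. a + complex_of_real (r * (1 - 1 / real (Suc n)))) \<longlonglongrightarrow> a + of_real (r * (1 - 0))"
      using LIMSEQ_inverse_real_of_nat by (intro tendsto_intros) (simp add: inverse_eq_divide)
     show "a + complex_of_real (r * (1 - 0)) \<in> cball a r" using r by (simp add: dist_norm)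
    qed
    moreover have "l s0 (a + of_real (r * (1 - 1 / real (Suc n)))) = c" for n
     by (rule c) (use pt(2)[of n] in \<open>simp only: mem_ball dist_norm\<close>)
    ultimately have "l s0 b = c" by (simp add: b_def LIMSEQ_const_iff)
    then show ?thesis using bdry[OF s0 b] c[OF tb] by simp
   next
    case nc: False
    show ?thesis
    proof (rule Hurwitz_no_zeros[where \<F> = "\<lambda>n. l (s n)", OF open_ball connected_ball hol[OF sn(1)] hol[OF s0] _ nc _ tb])
     show "uniform_limit K (\<lambda>n. l (s n)) (l s0) sequentially" if "compact K" "K \<subseteq> ball a r" for K
      by (rule uniform_limit_on_subset[OF unif[OF sn(1) lim s0]]) (use that in auto)
     show "l (s n) z ~= 0" if "z \<in> ball a r" for n z by (rule sn(2)) (use that in auto)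
    qed
   qed
  qed
  then show "s0 \<in> Z" using s0 by (simp add: Z_def)
 qed
 have clZ': "closed ({0..1} - Z)"
  unfolding closed_sequential_limits
 proof (intro allI impI)
  fix s s0 assume s: "(\<forall>n::nat. s n \<in> {0..1} - Z) \<and> s \<longlonglongrightarrow> s0"
  have s0: "s0 \<in> {0..1}"
   by (rule Lim_in_closed_set[of "{0..1}" s sequentially]) (use s in auto)
  have ex: "\<forall>n. \<exists>t. t \<in> cball a r \<and> l (s n) t = 0" using s unfolding Z_def by blast
  from choice[OF ex] obtain u where u: "\<forall>n. u n \<in> cball a r \<and> l (s n) (u n) = 0" by (rule exE)
  have "\<exists>x\<in>cball a r. \<exists>q::nat => nat. strict_mono q \<and> (u \<circ> q) \<longlonglongrightarrow> x"
   using compact_cball[of a r] u unfolding compact_def by (elim allE[of _ u]) simp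
  then obtain x q where x: "x \<in> cball a r" "strict_mono (q :: nat => nat)" "(\<lambda>n. u (q n)) \<longlonglongrightarrow> x" by (auto simp: o_def)
  have sq: "(\<lambda>n. s (q n)) \<longlonglongrightarrow> s0" using LIMSEQ_subseq_LIMSEQ[of s s0 q] s x(2) by (simp add: o_def)
  have "(\<lambda>n. l (s (q n)) (u (q n))) \<longlonglongrightarrow> l s0 x"
   by (rule joint[OF _ _ sq x(3) s0 x(1)]) (use s u in blast)+
  then have "l s0 x = 0" using u by (simp add: LIMSEQ_const_iff)
  then show "s0 \<in> {0..1} - Z" using s0 x(1) by (auto simp: Z_def)
 qed
 have Z0: "0 \<in> Z" using zero by (simp add: Z_def)
 have "1 \<in> Z"
 proof (rule ccontr)
  assume a: "1 \<notin> Z"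
  have "{0..1} \<subseteq> Z \<union> ({0..1} - Z)" "Z \<inter> ({0..1} - Z) \<inter> {0..1} = {}" "Z \<inter> {0..1} ~= {}" "({0..1} - Z) \<inter> {0..1} ~= {}"
  proof -
   have "1 \<in> ({0..1} - Z) \<inter> {0..1}" using a by simp
   then show "({0..1} - Z) \<inter> {0..1} ~= {}" by blast
  qed (use Z0 in auto)
  then show False using connected_Icc[of 0 "1::real"] clZ clZ' unfolding connected_closed by blast
 qed
 then show ?thesis using t by (simp add: Z_def)
qed

text \<open>A disc whose boundary moves within a small cap does not leave a slightly larger cap: the
 quotient of the disc by its zero-free component is controlled by the maximum principle.\<close>

lemma cap_homotopy:
 fixes P :: "real => complex => complex^3"
 assumes cont: "continuous_on ({0..1} \<times> cball a r) (\<lambda>(s, t). P s t)" and r: "r > 0"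
  and hol: "\<And>s. s \<in> {0..1} ==> hol_vec (P s) (ball a r)"
  and nz: "\<And>s t. s \<in> {0..1} ==> t \<in> sphere a r ==> P s t ~= 0" and b: "b ~= 0" and k: "k > 0"
  and bdry: "\<And>s t. s \<in> {0..1} ==> t \<in> sphere a r ==> cmod (herm (P s t) b) >= k * (norm (P s t) * norm b)"
  and zero: "\<And>t. t \<in> cball a r ==> herm (P 0 t) b ~= 0"
 shows "cmod (herm (P 1 a) b) >= k * (norm (P 1 a) * norm b)"
proof -
 define l where "l = (\<lambda>s t. herm (P s t) b)"
 have lc: "continuous_on ({0..1} \<times> cball a r) (\<lambda>(s, t). l s t)"
  using cont unfolding l_def split_def by (intro continuous_intros)
 have l1: "l 1 t ~= 0" if t: "t \<in> cball a r" for t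
 proof (rule zero_free_homotopy[OF lc r _ _ _ t])
  fix s :: real assume s: "s \<in> {0..1}"
  show "l s holomorphic_on ball a r" unfolding l_def by (rule holomorphic_herm[OF hol[OF s]])
  fix u assume u: "u \<in> sphere a r"
  have "k * (norm (P s u) * norm b) > 0" using nz[OF s u] b k by simp
  then show "l s u ~= 0" using bdry[OF s u] by (auto simp: l_def)
 next
  show "l 0 u ~= 0" if "u \<in> cball a r" for u using zero[OF that] by (simp add: l_def)
 qed
 have one: "(1::real) \<in> {0..1}" by simp
 have c1: "continuous_on (cball a r) (P 1)"
 proof -
  have "continuous_on (cball a r) (\<lambda>t. (\<lambda>(s, t). P s t) (1, t))"
   by (rule continuous_on_compose2[OF cont]) (auto intro: continuous_intros)
  then show ?thesis by simp
 qed
 define M where "M = (\<lambda>t. (1 / l 1 t) *s P 1 t)"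
 have ac: "a \<in> cball a r" using r by simp
 have "norm (M a) <= 1 / (k * norm b)"
 proof (rule hol_vec_max_modulus[OF _ _ _ ac])
  show "hol_vec M (ball a r)" unfolding M_def
  proof (intro hol_vec_scale hol[OF one] holomorphic_intros)
   show "l 1 holomorphic_on ball a r" unfolding l_def by (rule holomorphic_herm[OF hol[OF one]])
   show "l 1 z ~= 0" if "z \<in> ball a r" for z by (rule l1) (use that in auto)
  qed
  have "continuous_on (cball a r) (\<lambda>t. l 1 t)" unfolding l_def by (intro continuous_intros c1)
  then show "continuous_on (cball a r) M" unfolding M_def vec_eq_iff using l1 c1
   by (intro continuous_on_vec_lambda[where f = "\<lambda>i t. (1 / l 1 t) * P 1 t $ i", simplified vector_scalar_mult_def[symmetric]] continuous_intros) (auto simp: vector_scalar_mult_def)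
  fix t assume t: "t \<in> sphere a r"
  have "k * (norm (P 1 t) * norm b) > 0" using nz[OF one t] b k by simp
  moreover have "cmod (l 1 t) >= k * (norm (P 1 t) * norm b)" using bdry[OF one t] by (simp add: l_def)
  ultimately have "norm (P 1 t) / cmod (l 1 t) <= norm (P 1 t) / (k * (norm (P 1 t) * norm b))"
   by (intro divide_left_mono mult_pos_pos) (use k b nz[OF one t] l1[of t] t in auto)
  also have "\<dots> = 1 / (k * norm b)" using nz[OF one t] by simp
  finally show "norm (M t) <= 1 / (k * norm b)" by (simp add: M_def norm_smult norm_divide)
 qed
 then have "norm (P 1 a) / cmod (l 1 a) <= 1 / (k * norm b)" by (simp add: M_def norm_smult norm_divide)
 then have "norm (P 1 a) * (k * norm b) <= cmod (l 1 a)"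
  using l1[OF ac] b k by (simp add: field_simps)
 then show ?thesis by (simp add: l_def mult_ac)
qed

text \<open>Distance \<open>1 / 4\<close> means squared cosine at least \<open>31 / 32\<close>,
  above \<open>(9/10)\<^sup>2\<close>. The cap with cosine at least \<open>9 / 10\<close> is what
  the homotopy preserves, and \<open>dist_le_of_herm\<close> returns from it to distance at most
  1.\<close>

lemma herm_of_dist_le:
 assumes "x ~= 0" "y ~= 0" "dist (proj x) (proj y) <= 1/4"
 shows "cmod (herm x y) >= 9/10 * (norm x * norm y)"
proof -
 define c where "c = cmod (herm x y) / (norm x * norm y)"
 have p: "norm x * norm y > 0" using assms by simp
 have "2 - 2 * c\<^sup>2 = (dist (proj x) (proj y))\<^sup>2"
  unfolding dist_proj_sq[OF assms(1,2)] by (simp add: c_def power_divide power_mult_distrib)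
 also have "\<dots> <= (1/4)\<^sup>2" using assms(3) by (intro power_mono) auto
 finally have "(9/10)\<^sup>2 <= c\<^sup>2" by (simp add: power2_eq_square)
 moreover have "c >= 0" by (simp add: c_def)
 ultimately have "9/10 <= c" by (rule power2_le_imp_le)
 then show ?thesis using p by (simp add: c_def pos_le_divide_eq)
qed

lemma dist_le_of_herm:
 assumes "x ~= 0" "y ~= 0" "cmod (herm x y) >= 9/10 * (norm x * norm y)"
 shows "dist (proj x) (proj y) <= 1"
proof -
 define c where "c = cmod (herm x y) / (norm x * norm y)"
 have p: "norm x * norm y > 0" using assms by simp
 have "c >= 9/10" using assms(3) p by (simp add: c_def pos_le_divide_eq)
 then have "c\<^sup>2 >= (9/10)\<^sup>2" by (intro power_mono) auto
 moreover have "(dist (proj x) (proj y))\<^sup>2 = 2 - 2 * c\<^sup>2"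
  unfolding dist_proj_sq[OF assms(1,2)] by (simp add: c_def power_divide power_mult_distrib)
 ultimately have "(dist (proj x) (proj y))\<^sup>2 <= 1\<^sup>2" by (simp add: power2_eq_square)
 then show ?thesis by (rule power2_le_imp_le) simp
qed

section \<open>Limit discs lie in the Fatou set\<close>

context orbit_disc
begin

text \<open>If \<open>wedge\<close> vanishes identically, the limit disc is one point of
  \<open>K\<close>. Otherwise its zeros are isolated: the tube is used on a circle around
  \<open>t0\<close>, where the disc is immersed, and \<open>cap_homotopy\<close> fills in the
  centre. Closeness along the times \<open>q * i\<close> then suffices.\<close>

lemma limit_disc_fatou:
 assumes S: "limit_disc S \<mu>" and t0: "t0 \<in> ball 0 R"
 shows "proj (S t0) \<in> fatou_set f"
proof (cases "\<exists>t1\<in>ball 0 R. wedge (S t1) (vderiv S t1) ~= 0")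
 case False
 have hS: "hol_vec S (ball 0 R)" using limit_discD(1)[OF S] by (simp add: nlift_def)
 have "proj (S t0) = proj (S 0)"
  by (rule constant_of_wedge_zero[OF hS nonzero[OF limit_discD(1)[OF S]] _ t0]) (use False in blast)+
 moreover have "proj (S 0) \<in> K" by (rule limit_disc_near(1)[OF S]) (use \<rho>0 in simp)
 ultimately show ?thesis using K_fatou by auto
next
 case True
 then obtain t1 where t1: "t1 \<in> ball 0 R" "wedge (S t1) (vderiv S t1) ~= 0" by blast
 note nS = limit_discD(1)[OF S]
 have hS: "hol_vec S (ball 0 R)" using nS by (simp add: nlift_def)
 obtain i where i: "wedge (S t1) (vderiv S t1) $ i ~= 0" using t1(2) by (auto simp: vec_eq_iff)
 define g where "g = (\<lambda>z. wedge (S z) (vderiv S z) $ i)"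
 have gh: "g holomorphic_on ball 0 R" unfolding g_def by (rule hol_vecD[OF hol_vec_wedge[OF hS open_ball]])
 define R0 where "R0 = R - cmod t0"
 have R0: "R0 > 0" "ball t0 R0 \<subseteq> ball 0 R"
 proof -
  show "R0 > 0" using t0 by (simp add: R0_def)
  show "ball t0 R0 \<subseteq> ball 0 R"
  proof
   fix y assume "y \<in> ball t0 R0"
   then show "y \<in> ball 0 R" using norm_triangle_ineq[of t0 "y - t0"] by (simp add: R0_def dist_norm norm_minus_commute)
  qed
 qed
 have "\<exists>r1>0. \<forall>z\<in>ball t0 r1 - {t0}. z \<in> ball 0 R \<and> g z ~= 0"
 proof (cases "g t0 = 0")
  case True
  obtain r1 where "r1 > 0" "ball t0 r1 \<subseteq> ball 0 R" "\<And>z. z \<in> ball t0 r1 - {t0} ==> g z ~= 0"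
   by (rule isolated_zeros[OF gh open_ball connected_ball t0 True t1(1)]) (use i in \<open>simp add: g_def\<close>, rule that)
  then show ?thesis by blast
 next
  case False
  have "open (ball 0 R \<inter> g -` (- {0}))"
   using holomorphic_on_imp_continuous_on[OF gh] by (intro continuous_open_preimage) auto
  moreover have "t0 \<in> ball 0 R \<inter> g -` (- {0})" using False t0 by simp
  ultimately obtain r1 where "r1 > 0" "ball t0 r1 \<subseteq> ball 0 R \<inter> g -` (- {0})" by (rule openE)
  then show ?thesis by (intro exI[of _ r1]) auto
 qed
 then obtain r1 where r1: "r1 > 0" "\<And>z. z \<in> ball t0 r1 ==> z ~= t0 ==> z \<in> ball 0 R \<and> g z ~= 0" by auto
 define L where "L = 12 * nbd\<^sup>2 / R0"
 have L: "L >= 0" using R0(1) by (simp add: L_def)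
 \<comment> \<open>The annulus between \<open>r / 2\<close> and \<open>3 * r / 2\<close> must avoid
   \<open>t0\<close> and the other zeros, the disc must fit into the half disc of radius
   \<open>R0 / 2\<close>, and iterates of \<open>S\<close> must vary by at most \<open>1 / 8\<close>
   over it.\<close>
 define r where "r = min (r1 / 2) (min (R0 / 2) (1 / (8 * (L + 1)))) / 2"
 have r: "r > 0" "2 * r < r1" "2 * r <= R0 / 2" "L * r <= 1/8"
 proof -
  have p: "8 * (L + 1) > 0" using L by simp
  show "r > 0" using r1 R0 p by (simp add: r_def)
  show "2 * r < r1" using r1 by (simp add: r_def min_def)
  show "2 * r <= R0 / 2" by (simp add: r_def)
  have "2 * r <= 1 / (8 * (L + 1))" unfolding r_def by simp
  then have "2 * r * (8 * (L + 1)) <= 1" using p by (simp only: pos_le_divide_eq)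
  then have "16 * (L * r) + 16 * r <= 1" by (simp add: algebra_simps)
  then show "L * r <= 1/8" using \<open>r > 0\<close> by linarith
 qed
 define C where "C = cball t0 (3 * r / 2) - ball t0 (r / 2)"
 have C: "compact C" unfolding C_def by (intro compact_diff) auto
 have CR: "C \<subseteq> ball 0 R" and Cw: "wedge (S t) (vderiv S t) ~= 0" if "t \<in> C" for t
 proof -
  have "z \<in> ball 0 R \<and> g z ~= 0" if "z \<in> C" for z
   by (rule r1(2)) (use that r in \<open>auto simp: C_def\<close>)
  then show "C \<subseteq> ball 0 R" by blast
  have "g t ~= 0" using \<open>\<And>z. z \<in> C ==> z \<in> ball 0 R \<and> g z ~= 0\<close> that by blast
  then show "wedge (S t) (vderiv S t) ~= 0" unfolding g_def by (metis zero_index)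
 qed
 have CR: "C \<subseteq> ball 0 R" using CR by blast
 have C0: "sphere t0 r ~= {}" "\<And>t. t \<in> sphere t0 r ==> cball t (r/2) \<subseteq> C" "r/2 > 0"
 proof -
  show "cball t (r/2) \<subseteq> C" if t: "t \<in> sphere t0 r" for t
  proof
   fix y assume "y \<in> cball t (r/2)"
   then show "y \<in> C" using t dist_triangle[of t0 y t] dist_triangle[of t0 t y] by (auto simp: C_def dist_commute)
  qed
 qed (use r in \<open>auto simp: sphere_eq_empty\<close>)
 obtain q N h B where tube: "h > 0" "B >= 0" "q >= 1" "\<And>m t V i. m >= N ==> t \<in> sphere t0 r ==> norm V <= h ==> X m t + V ~= 0 \<and>
   dist ((f ^^ (q * i)) (proj (X m t + V))) ((f ^^ (q * i)) (proj (X m t))) <= B * norm V"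
  using tube_dist[OF S C CR Cw C0] by blast
 \<comment> \<open>\<open>S t + V\<close> differs from the nearby orbit disc by up to
   \<open>2 * h1\<close>, which must fit in the tube of size \<open>h\<close>. The two tube
   estimates used cost \<open>3 * B * h1\<close>, at most \<open>1 / 8\<close>. The last bound keeps
   \<open>S t + V\<close> nonzero.\<close>
 define h1 where "h1 = min (h / 2) (min (1 / (24 * (B + 1))) (1 / (2 * nbd)))"
 have h1: "h1 > 0" "2 * h1 <= h" "3 * B * h1 <= 1/8" "h1 <= 1 / (2 * nbd)"
 proof -
  have p: "24 * (B + 1) > 0" using tube(2) by simp
  show "h1 > 0" using tube(1) p nbd_ge_1 by (simp add: h1_def)
  show "2 * h1 <= h" by (simp add: h1_def)
  have "h1 <= 1 / (24 * (B + 1))" by (simp add: h1_def)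
  then have "h1 * (24 * (B + 1)) <= 1" using p by (simp only: pos_le_divide_eq)
  then have "24 * (B * h1) + 24 * h1 <= 1" by (simp add: algebra_simps)
  then show "3 * B * h1 <= 1/8" using \<open>h1 > 0\<close> by linarith
  show "h1 <= 1 / (2 * nbd)" by (simp add: h1_def)
 qed
 have sR: "cball t0 r \<subseteq> ball 0 R" "sphere t0 r \<subseteq> cball t0 r"
  using R0(2) r by (auto simp: subset_iff)
 have cR0: "cball t0 r \<subseteq> cball t0 (R0/2)" using r by auto
 have "\<forall>\<^sub>F k in sequentially. \<forall>t\<in>cball t0 r. dist (X (\<mu> k) t) (S t) < h1"
  by (rule uniform_limitD[OF limit_discD(3)[OF S compact_cball sR(1)] h1(1)])
 moreover have "\<forall>\<^sub>F k in sequentially. \<mu> k >= N" using limit_discD(2)[OF S] by (simp add: filterlim_at_top)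
 ultimately have "\<forall>\<^sub>F k in sequentially. (\<forall>t\<in>cball t0 r. dist (X (\<mu> k) t) (S t) < h1) \<and> \<mu> k >= N" by (rule eventually_conj)
 \<comment> \<open>A single late time is enough: the tube around this one orbit disc contains the
   limit disc, and the estimate is transferred to \<open>S\<close>.\<close>
 then obtain k where k: "\<And>t. t \<in> cball t0 r ==> dist (X (\<mu> k) t) (S t) < h1" "\<mu> k >= N"
  using eventually_happens'[OF sequentially_bot] by blast
 define M where "M = \<mu> k"
 have St: "normalized (S t)" if "t \<in> cball t0 r" for t by (rule nlift_normalized[OF nS]) (use that sR in blast)
 have half: "1 / (2 * nbd) < 1 / nbd" using nbd_ge_1 by (simp add: frac_less2)
 have nzS: "S t + V ~= 0" if "t \<in> cball t0 r" "norm V <= h1" for t V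
 proof
  assume "S t + V = 0"
  then have "S t = - V" by (simp add: eq_neg_iff_add_eq_0)
  then have "norm (S t) = norm V" by simp
  then show False using normalized_bounds(2)[OF St[OF that(1)]] that(2) h1(4) half by linarith
 qed
 have circ: "dist ((f ^^ (q * i)) (proj (S t + V))) ((f ^^ (q * i)) (proj (S t0))) <= 1/4"
  if t: "t \<in> sphere t0 r" and V: "norm V <= h1" for t V i
 proof -
  have tc: "t \<in> cball t0 r" using t by auto
  have d: "norm (S t - X M t) <= h1" using k(1)[OF tc] by (simp add: M_def dist_norm norm_minus_commute less_imp_le)
  have "norm (S t - X M t + V) <= 2 * h1" using norm_triangle_ineq[of "S t - X M t" V] d V by linarith
  then have "norm (S t - X M t + V) <= h" "norm (S t - X M t + V) <= 2 * h1" using h1(2) by auto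
  note V1 = this
  have MN: "M >= N" using k(2) by (simp add: M_def)
  have e1: "X M t + (S t - X M t + V) = S t + V" "X M t + (S t - X M t) = S t" by simp_all
  have "dist ((f ^^ (q * i)) (proj (S t + V))) ((f ^^ (q * i)) (proj (X M t))) <= B * norm (S t - X M t + V)"
   using tube(4)[OF MN t V1(1), of i] unfolding e1 by blast
  also have "\<dots> <= B * (2 * h1)" using V1(2) tube(2) by (rule mult_left_mono)
  finally have 1: "dist ((f ^^ (q * i)) (proj (S t + V))) ((f ^^ (q * i)) (proj (X M t))) <= B * (2 * h1)" .
  have "norm (S t - X M t) <= h" using d h1(1,2) by linarith
  then have "dist ((f ^^ (q * i)) (proj (S t))) ((f ^^ (q * i)) (proj (X M t))) <= B * norm (S t - X M t)"
   using tube(4)[OF MN t, of "S t - X M t" i] unfolding e1 by blast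
  also have "\<dots> <= B * h1" using d tube(2) by (rule mult_left_mono)
  finally have 2: "dist ((f ^^ (q * i)) (proj (S t))) ((f ^^ (q * i)) (proj (X M t))) <= B * h1" .
  have "dist ((f ^^ (q * i)) (proj (S t))) ((f ^^ (q * i)) (proj (S t0))) <= 12 * nbd\<^sup>2 / R0 * cmod (t - t0)"
   by (rule nlift_dist[OF nlift_subset[OF nS R0(2)] R0(1)]) (use tc cR0 R0(1) in auto)
  also have "\<dots> = L * r" using t by (simp add: L_def dist_norm norm_minus_commute)
  finally have 3: "dist ((f ^^ (q * i)) (proj (S t))) ((f ^^ (q * i)) (proj (S t0))) <= 1/8" using r(4) by linarith
  have "B * (2 * h1) + B * h1 = 3 * B * h1" by simp
  then show ?thesis using 1 2 3 h1(3)
   dist_triangle[of "(f ^^ (q * i)) (proj (S t + V))" "(f ^^ (q * i)) (proj (S t0))" "(f ^^ (q * i)) (proj (S t))"]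
   dist_triangle2[of "(f ^^ (q * i)) (proj (S t + V))" "(f ^^ (q * i)) (proj (S t))" "(f ^^ (q * i)) (proj (X M t))"] by linarith
 qed
 have t0c: "t0 \<in> cball t0 r" using r(1) by simp
 have fill: "dist ((f ^^ (q * i)) (proj (S t0 + V))) ((f ^^ (q * i)) (proj (S t0))) <= 1" if V: "norm V <= h1" for V i
 proof -
  define b where "b = (F ^^ (q * i)) (S t0)"
  have S0: "S t0 ~= 0" using St[OF t0c] by (simp add: normalized_def)
  have b: "b ~= 0" using S0 by (simp add: b_def iter_zero)
  \<comment> \<open>At \<open>s = 0\<close> the whole disc is near \<open>proj b\<close> by
    \<open>nlift_dist\<close>; for all \<open>s\<close> the boundary circle is near it by
    \<open>circ\<close>. At \<open>s = 1\<close> the centre is the perturbed point.\<close>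
  define P where "P = (\<lambda>s t. (F ^^ (q * i)) (S t + of_real s *s V))"
  have sV: "norm (of_real s *s V) <= h1" if "s \<in> {0..1}" for s :: real
  proof -
   have "\<bar>s\<bar> * norm V <= 1 * norm V" using that by (intro mult_right_mono) auto
   then show ?thesis using V by (simp add: norm_smult)
  qed
  have pP: "P s t ~= 0" "proj (P s t) = (f ^^ (q * i)) (proj (S t + of_real s *s V))" if "s \<in> {0..1}" "t \<in> cball t0 r" for s t
   using nzS[OF that(2) sV[OF that(1)]] by (simp_all add: P_def iter_zero f_iter_proj)
  have pb: "proj b = (f ^^ (q * i)) (proj (S t0))" using S0 by (simp add: b_def f_iter_proj)
  have hSr: "hol_vec S (ball t0 r)" by (rule hol_vec_subset[OF hS]) (use sR in auto)
  have "cmod (herm (P 1 t0) b) >= 9/10 * (norm (P 1 t0) * norm b)"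
  proof (rule cap_homotopy[OF _ r(1) _ _ b])
   have cS: "continuous_on (cball t0 r) S" by (rule continuous_on_subset[OF hol_vec_continuous[OF hS] sR(1)])
   have "continuous_on ({0..1} \<times> cball t0 r) (\<lambda>x. S (snd x) + of_real (fst x) *s V)"
   proof (intro continuous_intros)
    show "continuous_on ({0..1} \<times> cball t0 r) (\<lambda>x. S (snd x))"
     by (rule continuous_on_compose2[OF cS]) (auto intro: continuous_intros)
    have eq: "of_real s *s V = s *\<^sub>R V" for s :: real by (simp add: vec_eq_iff complex_eq_iff)
    show "continuous_on ({0..1} \<times> cball t0 r) (\<lambda>x. of_real (fst x) *s V)"
     unfolding eq by (intro continuous_intros)
   qed
   then have "continuous_on ({0..1} \<times> cball t0 r) (\<lambda>x. (F ^^ (q * i)) (S (snd x) + of_real (fst x) *s V))"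
    by (rule continuous_on_compose2[OF polymap_continuous[OF polymap_iter, of UNIV]]) auto
   then show "continuous_on ({0..1} \<times> cball t0 r) (\<lambda>(s, t). P s t)" by (simp add: P_def split_def)
   show "hol_vec (P s) (ball t0 r)" for s
    unfolding P_def by (rule hol_vec_polymap[OF polymap_iter hol_vec_add[OF hSr hol_vec_const]])
   fix s t assume st: "s \<in> {0..1::real}" "t \<in> sphere t0 r"
   then have tc: "t \<in> cball t0 r" by auto
   show "P s t ~= 0" by (rule pP(1)[OF st(1) tc])
   show "9/10 * (norm (P s t) * norm b) <= cmod (herm (P s t) b)"
    by (rule herm_of_dist_le[OF pP(1)[OF st(1) tc] b]) (use circ[OF st(2) sV[OF st(1)], of i] pP(2)[OF st(1) tc] pb in simp)
  next
   fix t assume t: "t \<in> cball t0 r"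
   have n: "P 0 t ~= 0" by (rule pP(1)[OF _ t]) simp
   have "dist ((f ^^ (q * i)) (proj (S t))) ((f ^^ (q * i)) (proj (S t0))) <= 12 * nbd\<^sup>2 / R0 * cmod (t - t0)"
    by (rule nlift_dist[OF nlift_subset[OF nS R0(2)] R0(1)]) (use t cR0 R0(1) in auto)
   also have "\<dots> <= L * r" unfolding L_def[symmetric] using t L by (intro mult_left_mono) (auto simp: dist_norm norm_minus_commute)
   finally have "dist (proj (P 0 t)) (proj b) <= 1/4"
    using r(4) pP(2)[of 0 t] t by (simp add: pb)
   moreover have "9/10 * (norm (P 0 t) * norm b) > 0" using n b by simp
   ultimately have "cmod (herm (P 0 t) b) > 0" using herm_of_dist_le[OF n b] by linarith
   then show "herm (P 0 t) b ~= 0" by auto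
  qed simp
  then have "dist (proj (P 1 t0)) (proj b) <= 1" by (intro dist_le_of_herm pP(1) b t0c) auto
  then show ?thesis using pP(2)[of 1 t0] t0c by (simp add: pb)
 qed
 show ?thesis
 \<comment> \<open>As \<open>norm (S t0) <= nbd\<close>, a point at distance less than
   \<open>h1 / nbd\<close> has a lift \<open>S t0 + V\<close> with
   \<open>norm V <= h1\<close>.\<close>
 proof (rule fatou_of_close_orbits[where m = "\<lambda>i. q * i" and b = "h1 / nbd"])
  show "h1 / nbd > 0" using h1(1) nbd_ge_1 by simp
  show "filterlim (\<lambda>i. q * i) at_top sequentially"
   by (rule filterlim_at_top_mono[OF filterlim_ident]) (use tube(3) in simp)
  fix p i assume p: "p \<in> ball (proj (S t0)) (h1 / nbd)"
  define s where "s = norm (S t0)"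
  have s: "s > 0" "s <= nbd" using St[OF t0c] normalized_bounds(1)[OF St[OF t0c]] by (auto simp: s_def normalized_def)
  define x where "x = of_real (1 / s) *s S t0"
  have S0: "S t0 ~= 0" using s(1) by (auto simp: s_def)
  have nx: "norm x = 1" using s by (simp add: x_def norm_smult s_def norm_divide)
  have px: "proj x = proj (S t0)" unfolding x_def by (rule proj_smult) (use s S0 in auto)
  obtain y where y: "norm y = 1" "p = proj y" "norm (x - y) <= dist (proj x) p" by (rule aligned_lift[OF nx])
  define V where "V = of_real s *s y - S t0"
  have "V = of_real s *s (y - x)" using s(1) by (simp add: V_def x_def vec_eq_iff field_simps)
  then have "norm V = s * norm (x - y)" using s(1) by (simp only: norm_smult) (simp add: norm_minus_commute)
  also have "\<dots> <= nbd * (h1 / nbd)"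
   using y(3) p s unfolding px by (intro mult_mono) (auto simp: less_imp_le)
  finally have Vb: "norm V <= h1" using nbd_ge_1 by simp
  have "proj (S t0 + V) = proj (of_real s *s y)" by (simp add: V_def)
  also have "\<dots> = p" unfolding y(2) by (rule proj_smult) (use s y(1) in auto)
  finally show "dist ((f ^^ (q * i)) p) ((f ^^ (q * i)) (proj (S t0))) <= 1" using fill[OF Vb, of i] by simp
 qed
qed

theorem orbit_limit_fatou:
 assumes t: "t \<in> ball 0 R" and m: "filterlim m at_top sequentially"
  and lim: "(\<lambda>k. (f ^^ m k) (proj (T t))) \<longlonglongrightarrow> p"
 shows "p \<in> fatou_set f"
proof -
 obtain S r where r: "strict_mono (r :: nat => nat)" "limit_disc S (\<lambda>k. m (r k))" by (rule limit_disc_exists[OF m])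
 have "(\<lambda>k. X (m (r k)) t) \<longlonglongrightarrow> S t"
  by (rule tendsto_uniform_limitI[OF limit_discD(3)[OF r(2), of "{t}"]]) (use t in auto)
 then have "(\<lambda>k. proj (X (m (r k)) t)) \<longlonglongrightarrow> proj (S t)"
  by (rule tendsto_proj) (use nonzero[OF X_nlift t] nonzero[OF limit_discD(1)[OF r(2)] t] in auto)
 then have "(\<lambda>k. (f ^^ m (r k)) (proj (T t))) \<longlonglongrightarrow> proj (S t)" by (simp only: proj_X[OF t])
 moreover have "(\<lambda>k. (f ^^ m (r k)) (proj (T t))) \<longlonglongrightarrow> p" using LIMSEQ_subseq_LIMSEQ[OF lim r(1)] by (simp add: o_def)
 ultimately have "p = proj (S t)" using LIMSEQ_unique by blast
 then show ?thesis using limit_disc_fatou[OF r(2) t] by simp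
qed

end

section \<open>Orbits do not escape to the boundary\<close>

context attracting_curve
begin

definition trapped :: "cp2 => bool" where
 "trapped z \<longleftrightarrow> z \<in> \<Omega> \<and> closure (range (\<lambda>n. (f ^^ n) z)) \<subseteq> \<Omega>"

text \<open>By equicontinuity all orbits from a small ball follow the trapped orbit to within
  \<open>e / 2\<close>. The closure of their union is the compact forward invariant set.\<close>

lemma trapped_nhd:
 assumes z: "trapped z"
 obtains a K where "a > 0" "compact K" "K \<subseteq> \<Omega>" "\<And>w. w \<in> K ==> f w \<in> K" "ball z a \<subseteq> K"
proof -
 define K1 where "K1 = closure (range (\<lambda>n. (f ^^ n) z))"
 have K1: "compact K1" "K1 \<subseteq> \<Omega>" unfolding K1_def
  using z by (auto simp: trapped_def intro: closed_imp_compact_cp2)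
 obtain e where e: "e > 0" "(\<Union>x\<in>K1. cball x e) \<subseteq> \<Omega>"
  by (rule compact_subset_open_imp_cball_epsilon_subset[OF K1(1) comp_open K1(2)]) (rule that)
 have "z \<in> fatou_set f" using z comp_facts(1) by (auto simp: trapped_def)
 then obtain a0 C where C: "a0 > 0" "equi_lipschitz_on (ball z a0) C" by (rule fatou_lipschitz)
 define a where "a = min a0 (e / 2 / (\<bar>C\<bar> + 1))"
 have p: "\<bar>C\<bar> + 1 > 0" by simp
 have "a <= e / 2 / (\<bar>C\<bar> + 1)" unfolding a_def by (rule min.cobounded2)
 then have "a * (\<bar>C\<bar> + 1) <= e / 2" by (simp only: pos_le_divide_eq[OF p])
 moreover have "a > 0" "a <= a0" using C(1) e(1) p by (auto simp: a_def)
 ultimately have a: "a > 0" "a <= a0" "a * (\<bar>C\<bar> + 1) <= e / 2" by blast+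
 have near: "dist ((f ^^ n) z) ((f ^^ n) w) <= e / 2" if w: "w \<in> ball z a" for n w
 proof -
  have "z \<in> ball z a0" "w \<in> ball z a0" using w a(2) C(1) by auto
  then have "dist ((f ^^ n) z) ((f ^^ n) w) <= C * dist z w" using C(2) unfolding equi_lipschitz_on_def by blast
  also have "\<dots> <= (\<bar>C\<bar> + 1) * a" using w by (intro mult_mono) auto
  finally show ?thesis using a(3) by (simp add: mult.commute)
 qed
 define U where "U = (\<Union>w\<in>ball z a. range (\<lambda>n. (f ^^ n) w))"
 define K where "K = closure U"
 show thesis
 proof (rule that[of a K])
  show "a > 0" by (rule a(1))
  show "compact K" unfolding K_def by (rule closed_imp_compact_cp2) simp
  show "K \<subseteq> \<Omega>"
  proof
   fix y assume "y \<in> K"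
   then have "\<forall>e>0. \<exists>u\<in>U. dist u y < e" unfolding K_def closure_approachable .
   note this[rule_format, OF half_gt_zero[OF e(1)]]
   then obtain u where u: "u \<in> U" "dist u y < e / 2" by (rule bexE)
   then obtain w n where w: "w \<in> ball z a" "u = (f ^^ n) w" unfolding U_def by blast
   have "dist ((f ^^ n) z) y <= e"
    using near[OF w(1), of n] u(2) w(2) dist_triangle[of "(f ^^ n) z" y u] by simp
   moreover have "(f ^^ n) z \<in> K1" unfolding K1_def by (rule subsetD[OF closure_subset rangeI])
   ultimately show "y \<in> \<Omega>" using e(2) by (auto simp: subset_iff)
  qed
  show "f w \<in> K" if "w \<in> K" for w
  proof -
   have "f ` U \<subseteq> closure U"
   proof
    fix y assume "y \<in> f ` U"
    then obtain v n where v: "v \<in> ball z a" "y = f ((f ^^ n) v)" unfolding U_def by blast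
    have "y = (f ^^ Suc n) v" using v(2) by simp
    then have "y \<in> U" unfolding U_def using v(1) by blast
    then show "y \<in> closure U" using closure_subset by blast
   qed
   then have "f ` closure U \<subseteq> closure U"
    by (intro image_closure_subset continuous_at_imp_continuous_on ballI isCont_f) auto
   then show ?thesis using that unfolding K_def by blast
  qed
  show "ball z a \<subseteq> K"
  proof
   fix w assume w: "w \<in> ball z a"
   have "w = (f ^^ 0) w" by simp
   then have "w \<in> U" unfolding U_def using w by blast
   then show "w \<in> K" unfolding K_def using closure_subset by blast
  qed
 qed
qed

lemma trapped_of_invariant:
 assumes "compact K" "K \<subseteq> \<Omega>" "\<And>w. w \<in> K ==> f w \<in> K" "w \<in> K"
 shows "trapped w"
proof -
 have "(f ^^ n) w \<in> K" for n by (induction n) (use assms in auto)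
 then have "closure (range (\<lambda>n. (f ^^ n) w)) \<subseteq> K" by (intro closure_minimal compact_imp_closed[OF assms(1)]) auto
 then show ?thesis using assms unfolding trapped_def by blast
qed

lemma open_trapped: "open {z. trapped z}"
 unfolding open_contains_ball
proof
 fix z assume "z \<in> {z. trapped z}"
 then obtain a K where "a > 0" "compact K" "K \<subseteq> \<Omega>" "\<And>w. w \<in> K ==> f w \<in> K" "ball z a \<subseteq> K"
  using trapped_nhd[of z] by (metis mem_Collect_eq)
 then show "\<exists>e>0. ball z e \<subseteq> {z. trapped z}"
  using trapped_of_invariant[of K] by (intro exI[of _ a]) blast
qed

text \<open>A disc through \<open>z0\<close> is also made to pass through a nearby trapped point,
  whose neighborhood supplies the trapped inner disc. Limit points of the orbit of \<open>z0\<close>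
  then lie in the Fatou set and in the closure of \<open>\<Omega>\<close>, hence in
  \<open>\<Omega>\<close>.\<close>

lemma trapped_closed:
 assumes conn: "connected \<Sigma>" and z0: "z0 \<in> \<Omega>" "z0 \<in> closure {z. trapped z}"
 shows "trapped z0"
proof -
 obtain e1 where e1: "e1 > 0" "ball z0 e1 \<subseteq> \<Omega>" using comp_open z0(1) by (rule openE)
 obtain e2 where e2: "e2 > 0" "green_harmonic_on (ball z0 e2)" using fatou_green_harmonic[of z0] z0(1) comp_facts(1) by blast
 define e where "e = min e1 e2"
 have e: "e > 0" "ball z0 e \<subseteq> \<Omega>" "green_harmonic_on (ball z0 e)"
 proof -
  show "e > 0" using e1 e2 by (simp add: e_def)
  show "ball z0 e \<subseteq> \<Omega>"
  proof -
   have "ball z0 e \<subseteq> ball z0 e1" by (rule subset_ball) (simp add: e_def)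
   then show ?thesis using e1(2) by (rule order_trans)
  qed
  have "ball z0 e \<subseteq> ball z0 e2" by (rule subset_ball) (simp add: e_def)
  then show "green_harmonic_on (ball z0 e)" using e2(2) unfolding green_harmonic_on_def by blast
 qed
 obtain x0 where x0: "norm x0 = 1" "z0 = proj x0" by (rule unit_lift)
 obtain b where b: "b > 0" "\<And>x. x \<in> ball x0 b ==> x ~= 0 \<and> proj x \<in> ball (proj x0) e"
  by (rule proj_ball_subset[OF x0(1) e(1)]) (rule that)
 obtain z1 where z1: "trapped z1" "dist z1 z0 < b / 4"
  using z0(2) b(1) unfolding closure_approachable by (metis mem_Collect_eq zero_less_divide_iff zero_less_numeral)
 obtain x1 where x1: "norm x1 = 1" "z1 = proj x1" "norm (x0 - x1) <= dist (proj x0) z1" by (rule aligned_lift[OF x0(1)])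
 \<comment> \<open>Parameter 0 is the trapped point and parameter 1 is \<open>z0\<close>. On radius
   3 one has \<open>cmod (1 - t) <= 4\<close>, which is why \<open>z1\<close> was chosen within
   \<open>b / 4\<close>.\<close>
 define L where "L = (\<lambda>t. x1 + t *s (x0 - x1))"
 have Lh: "hol_vec L A" for A unfolding L_def by (intro hol_vec_add hol_vec_const hol_vec_id_scale)
 have n01: "norm (x0 - x1) < b / 4" using x1(3) z1(2) by (simp add: x0(2) dist_commute)
 have Lb: "L t \<in> ball x0 b" if "t \<in> ball 0 3" for t
 proof -
  have "x0 - L t = (1 - t) *s (x0 - x1)" by (simp add: L_def vec_eq_iff algebra_simps)
  then have "dist x0 (L t) = cmod (1 - t) * norm (x0 - x1)" by (simp only: dist_norm norm_smult)
  also have "\<dots> <= 4 * norm (x0 - x1)"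
   using that norm_triangle_ineq4[of 1 t] by (intro mult_right_mono) auto
  finally show ?thesis using n01 by simp
 qed
 have L0: "L t ~= 0" "proj (L t) \<in> ball z0 e" if "t \<in> ball 0 3" for t using b(2)[OF Lb[OF that]] by (simp_all add: x0(2))
 have three: "(3::real) > 0" by simp
 obtain q where q: "q holomorphic_on ball 0 3" "\<And>z. z \<in> ball 0 3 ==> cmod (q z) = exp (green (L z))"
  "nlift (\<lambda>z. inverse (q z) *s L z) (ball 0 3)"
  "\<And>z. z \<in> ball 0 3 ==> proj (inverse (q z) *s L z) = proj (L z)"
  by (rule green_harmonic_nlift[OF e(3) three Lh L0]) (assumption, assumption, rule that)
 define T where "T = (\<lambda>z. inverse (q z) *s L z)"
 have T: "nlift T (ball 0 3)" "\<And>z. z \<in> ball 0 3 ==> proj (T z) = proj (L z)" using q(3,4) by (simp_all add: T_def)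
 obtain a K where K: "a > 0" "compact K" "K \<subseteq> \<Omega>" "\<And>w. w \<in> K ==> f w \<in> K" "ball z1 a \<subseteq> K"
  by (rule trapped_nhd[OF z1(1)]) (rule that)
 have "continuous_on (ball 0 3) (\<lambda>t. proj (L t))"
  by (rule continuous_on_compose2[OF continuous_on_proj hol_vec_continuous[OF Lh]]) (use L0 in auto)
 then have "open (ball 0 3 \<inter> (\<lambda>t. proj (L t)) -` ball z1 a)" by (intro continuous_open_preimage) auto
 moreover have "0 \<in> ball 0 3 \<inter> (\<lambda>t. proj (L t)) -` ball z1 a" using K(1) by (simp add: L_def x1(2))
 ultimately obtain r where r: "r > 0" "ball 0 r \<subseteq> ball 0 3 \<inter> (\<lambda>t. proj (L t)) -` ball z1 a" by (rule openE)
 define \<rho>0 where "\<rho>0 = min (r / 2) 1"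
 interpret od: orbit_disc f d F \<Omega> \<Sigma> T 3 \<rho>0 K
 proof unfold_locales
  show "connected \<Sigma>" by (rule conn)
  show "nlift T (ball 0 3)" by (rule T(1))
  show "proj (T t) \<in> \<Omega>" if "t \<in> ball 0 3" for t using T(2)[OF that] L0(2)[OF that] e(2) by auto
  show "0 < \<rho>0" "\<rho>0 < 3" using r(1) by (auto simp: \<rho>0_def)
  show "compact K" "K \<subseteq> \<Omega>" by (rule K(2), rule K(3))
  show "f z \<in> K" if "z \<in> K" for z by (rule K(4)[OF that])
  fix t :: complex assume "t \<in> cball 0 \<rho>0"
  then have "t \<in> ball 0 r" using r(1) by (auto simp: \<rho>0_def)
  then have "t \<in> ball 0 3" "proj (L t) \<in> ball z1 a" using r(2) by auto
  then show "proj (T t) \<in> K" using T(2) K(5) by auto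
 qed
 have t1: "(1::complex) \<in> ball 0 3" by simp
 have T1: "proj (T 1) = z0" using T(2)[OF t1] by (simp add: L_def x0(2))
 have "p \<in> \<Omega>" if p: "p \<in> closure (range (\<lambda>n. (f ^^ n) z0))" for p
 proof (cases "p \<in> range (\<lambda>n. (f ^^ n) z0)")
  case True then show ?thesis using comp_iter[OF z0(1)] by auto
 next
  case False
  obtain y where y: "\<And>k::nat. y k \<in> range (\<lambda>n. (f ^^ n) z0)" "y \<longlonglongrightarrow> p" using p unfolding closure_sequential by blast
  have ex: "\<forall>k. \<exists>n. y k = (f ^^ n) z0" using y(1) by blast
  from choice[OF ex] obtain m where m: "\<forall>k. y k = (f ^^ m k) z0" by (rule exE)
  have "y = (\<lambda>k. (f ^^ m k) z0)" using m by (intro ext) blast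
  with y(2) have lim: "(\<lambda>k. (f ^^ m k) z0) \<longlonglongrightarrow> p" by (simp only:)
  \<comment> \<open>A limit point that is not itself on the orbit cannot be approached through
    finitely many times.\<close>
  have mt: "filterlim m at_top sequentially"
   unfolding filterlim_at_top
  proof
   fix N
   define A where "A = (\<lambda>n. (f ^^ n) z0) ` {..<N}"
   have "closed A" unfolding A_def by (intro finite_imp_closed) simp
   moreover have "p \<notin> A" using False by (auto simp: A_def)
   ultimately have "open (- A)" "p \<in> - A" by auto
   with lim have "\<forall>\<^sub>F k in sequentially. (f ^^ m k) z0 \<in> - A" by (rule topological_tendstoD)
   then show "\<forall>\<^sub>F k in sequentially. N <= m k"
    by eventually_elim (auto simp: A_def not_less[symmetric])
  qed
  have "p \<in> fatou_set f" by (rule od.orbit_limit_fatou[OF t1 mt]) (use lim T1 in simp)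
  moreover have "p \<in> closure \<Omega>"
   unfolding closure_sequential using lim comp_iter[OF z0(1)] by (intro exI[of _ "\<lambda>k. (f ^^ m k) z0"]) auto
  ultimately show "p \<in> \<Omega>" using comp_closure by blast
 qed
 then show ?thesis using z0(1) unfolding trapped_def by blast
qed

lemma all_trapped:
 assumes conn: "connected \<Sigma>" and c: "trapped c" and z: "z \<in> \<Omega>"
 shows "trapped z"
proof (rule ccontr)
 assume nt: "\<not> trapped z"
 have o: "open (- closure {z. trapped z})" by (intro open_Compl closed_closure)
 have cov: "\<Omega> \<subseteq> {z. trapped z} \<union> (- closure {z. trapped z})"
 proof
  fix w assume "w \<in> \<Omega>"
  from trapped_closed[OF conn this] show "w \<in> {z. trapped z} \<union> (- closure {z. trapped z})" by (cases "w \<in> closure {z. trapped z}") simp_all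
 qed
 have "{z. trapped z} \<inter> (- closure {z. trapped z}) \<inter> \<Omega> = {}" using closure_subset[of "{z. trapped z}"] by blast
 from connectedD[OF comp_facts(2) open_trapped o this cov]
 have "{z. trapped z} \<inter> \<Omega> = {} \<or> (- closure {z. trapped z}) \<inter> \<Omega> = {}" .
 moreover have "{z. trapped z} \<inter> \<Omega> ~= {}" using c by (auto simp: trapped_def)
 moreover have "z \<in> - closure {z. trapped z}" using trapped_closed[OF conn z] nt by (intro ComplI notI) blast
 then have "(- closure {z. trapped z}) \<inter> \<Omega> ~= {}" using z by blast
 ultimately show False by blast
qed

end

section \<open>The rotation coordinate on the attracting curve\<close>

lemma carrier_curve_atlas:
 assumes "closed_complex_curve (cp2_domain \<Omega>) \<Sigma>"
 shows "carrier_of (curve_atlas (cp2_domain \<Omega>) \<Sigma>) = \<Sigma>"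
proof
 show "carrier_of (curve_atlas (cp2_domain \<Omega>) \<Sigma>) \<subseteq> \<Sigma>" by (auto simp: carrier_of_def curve_atlas_def)
 show "\<Sigma> \<subseteq> carrier_of (curve_atlas (cp2_domain \<Omega>) \<Sigma>)"
 proof
  fix p assume p: "p \<in> \<Sigma>"
  then obtain U a where U: "p \<in> U" "adapted_chart (cp2_domain \<Omega>) \<Sigma> U a"
   using assms unfolding closed_complex_curve_def by blast
  then have "(U \<inter> \<Sigma>, \<lambda>p. vec (a p $ 1)) \<in> curve_atlas (cp2_domain \<Omega>) \<Sigma>" unfolding curve_atlas_def by blast
  then show "p \<in> carrier_of (curve_atlas (cp2_domain \<Omega>) \<Sigma>)" using U(1) p unfolding carrier_of_def by blast
 qed
qed

lemma carrier_planar_atlas: "carrier_of (planar_atlas D) = D"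
 by (simp add: carrier_of_def planar_atlas_def)

lemma rotation_domain_norm:
 assumes "rotation_domain D" "z \<in> D" "cmod w = cmod z"
 shows "w \<in> D"
 using assms unfolding rotation_domain_def by auto

lemma rotation_domain_facts:
 assumes "rotation_domain D"
 shows "D ~= {}" "connected D" "open D"
proof -
 have two: "2 <= DIM(complex)" by simp
 consider "D = ball 0 1" | "D = ball 0 1 - {0}" | r R where "0 < r" "r < R" "D = {z. r < cmod z \<and> cmod z < R}"
  using assms unfolding rotation_domain_def by blast
 then have "D ~= {} \<and> connected D \<and> open D"
 proof cases
  case 1
  then show ?thesis by auto
 next
  case 2
  have "of_real (1/2) \<in> ball (0::complex) 1 - {0}" by simp
  then have "D ~= {}" unfolding 2 by blast
  moreover have "open D" unfolding 2 by (intro open_Diff) auto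
  moreover have "connected D" unfolding 2 by (rule connected_open_delete[OF open_ball connected_ball two])
  ultimately show ?thesis by blast
 next
  case 3
  have "complex_of_real ((r + R) / 2) \<in> D" using 3 by (simp add: norm_divide flip: of_real_add)
  then have "D ~= {}" by blast
  moreover have "open D" unfolding 3(3) by (intro open_Collect_conj open_Collect_less continuous_intros)
  moreover have eq: "D = {z. r < norm (z - 0) \<and> norm (z - 0) < R}" using 3 by simp
  have "connected D" unfolding eq by (rule connected_annulus(1)[OF two])
  ultimately show ?thesis by blast
 qed
 then show "D ~= {}" "connected D" "open D" by blast+
qed

locale rotation_curve = attracting_curve +
 fixes D :: "complex set" and \<psi> :: "cp2 => complex" and \<theta> :: real
 assumes D: "rotation_domain D" and \<psi>: "biholomorphic_map (curve_atlas (cp2_domain \<Omega>) \<Sigma>) (planar_atlas D) \<psi>"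
  and rot: "\<And>p. p \<in> \<Sigma> ==> \<psi> (f p) = cis (2 * pi * \<theta>) * \<psi> p" and f_\<Sigma>: "f ` \<Sigma> = \<Sigma>"
begin

definition \<xi> :: "complex => cp2" where "\<xi> = inv_into \<Sigma> \<psi>"

lemma \<psi>_bij: "bij_betw \<psi> \<Sigma> D"
 using \<psi> unfolding biholomorphic_map_def carrier_curve_atlas[OF \<Sigma>_curve] carrier_planar_atlas by blast

lemma \<psi>_cont: "continuous_on \<Sigma> \<psi>"
 using \<psi> unfolding biholomorphic_map_def holomorphic_map_def carrier_curve_atlas[OF \<Sigma>_curve] by blast

lemma \<xi>_cont: "continuous_on D \<xi>"
 using \<psi> unfolding biholomorphic_map_def holomorphic_map_def carrier_curve_atlas[OF \<Sigma>_curve] carrier_planar_atlas \<xi>_def by blast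

lemma \<psi>_D: "p \<in> \<Sigma> ==> \<psi> p \<in> D"
 using \<psi>_bij by (auto simp: bij_betw_def)

lemma \<xi>_\<psi>: "p \<in> \<Sigma> ==> \<xi> (\<psi> p) = p"
 unfolding \<xi>_def using \<psi>_bij by (auto simp: bij_betw_def inv_into_f_f)

lemma \<xi>_\<Sigma>: "z \<in> D ==> \<xi> z \<in> \<Sigma>" "z \<in> D ==> \<psi> (\<xi> z) = z"
 unfolding \<xi>_def using \<psi>_bij by (auto simp: bij_betw_def inv_into_into f_inv_into_f)

lemma \<Sigma>_eq: "\<Sigma> = \<xi> ` D"
 using \<xi>_\<Sigma>(1) \<psi>_D \<xi>_\<psi> by (force simp: image_iff)

lemma \<Sigma>_connected: "connected \<Sigma>"
proof -
 have "connected (\<xi> ` D)" by (rule connected_continuous_image[OF \<xi>_cont rotation_domain_facts(2)[OF D]])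
 with \<Sigma>_eq show ?thesis by (rule ssubst)
qed

lemma f_in_\<Sigma>: "p \<in> \<Sigma> ==> f p \<in> \<Sigma>"
 using f_\<Sigma> by blast

lemma \<psi>_iter: "p \<in> \<Sigma> ==> (f ^^ n) p \<in> \<Sigma> \<and> cmod (\<psi> ((f ^^ n) p)) = cmod (\<psi> p)"
 by (induction n) (auto simp: f_in_\<Sigma> rot norm_mult)

text \<open>A rotation preserves the modulus, so the image under \<open>\<xi>\<close> of the circle
  through \<open>\<psi> c\<close> is a compact invariant set. This gives the first trapped
  points.\<close>

lemma trapped_\<Sigma>:
 assumes c: "c \<in> \<Sigma>"
 shows "trapped c"
proof (rule trapped_of_invariant)
 have sub: "sphere 0 (cmod (\<psi> c)) \<subseteq> D" using rotation_domain_norm[OF D \<psi>_D[OF c]] by auto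
 show "compact (\<xi> ` sphere 0 (cmod (\<psi> c)))"
  by (rule compact_continuous_image[OF continuous_on_subset[OF \<xi>_cont sub] compact_sphere])
 show "\<xi> ` sphere 0 (cmod (\<psi> c)) \<subseteq> \<Omega>" using \<xi>_\<Sigma>(1) sub \<Sigma>_sub by blast
 show "c \<in> \<xi> ` sphere 0 (cmod (\<psi> c))" using \<xi>_\<psi>[OF c] by (intro image_eqI[of _ _ "\<psi> c"]) auto
 fix w assume "w \<in> \<xi> ` sphere 0 (cmod (\<psi> c))"
 then obtain z where z: "cmod z = cmod (\<psi> c)" "w = \<xi> z" by auto
 then have "z \<in> D" using sub by auto
 then have w: "w \<in> \<Sigma>" "\<psi> w = z" using \<xi>_\<Sigma> z(2) by auto
 show "f w \<in> \<xi> ` sphere 0 (cmod (\<psi> c))"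
  using \<xi>_\<psi>[OF f_in_\<Sigma>[OF w(1)]] rot[OF w(1)] w(2) z(1) by (intro image_eqI[of _ _ "\<psi> (f w)"]) (auto simp: norm_mult)
qed

lemma trapped_\<Omega>: "z \<in> \<Omega> ==> trapped z"
 using all_trapped[OF \<Sigma>_connected] trapped_\<Sigma> \<Sigma>_ne by blast

end

section \<open>Levels of limit points and completeness\<close>

text \<open>A positive radial function measuring the distance to an end of \<open>D\<close> and
  obeying Harnack's inequality along all discs in \<open>D\<close>. Two-sided bounds on such
  functions confine a point to a compact part of \<open>D\<close>.\<close>

definition harnack_gap :: "complex set => (real => real) => bool" where
 "harnack_gap D \<gamma> \<longleftrightarrow> (\<forall>\<zeta>\<in>D. \<gamma> (cmod \<zeta>) > 0) \<and>
  (\<forall>v a b. v holomorphic_on ball 0 1 --> v ` ball 0 1 \<subseteq> D --> a \<in> ball 0 1 --> b \<in> ball 0 1 -->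
   \<gamma> (cmod (v b)) >= \<gamma> (cmod (v a)) * ((1 - pseudo_hyp a b) / (1 + pseudo_hyp a b)))"

lemma harnack_factor_nonneg:
 assumes "a \<in> ball 0 1" "b \<in> ball 0 1"
 shows "(1 - pseudo_hyp a b) / (1 + pseudo_hyp a b) >= 0"
 using pseudo_hyp_lt_1[OF assms] pseudo_hyp_nonneg[of a b] by simp

text \<open>\<open>1 - cmod (v z)\<close> is not harmonic, but with the phase \<open>u\<close>
  adapted to \<open>v b\<close> the positive harmonic function \<open>1 - Re (u * v z)\<close>
  dominates it and agrees with it at \<open>b\<close>.\<close>

lemma harnack_gap_disc:
 assumes "D \<subseteq> ball 0 1"
 shows "harnack_gap D (\<lambda>s. 1 - s)"
 unfolding harnack_gap_def
proof (intro conjI ballI allI impI)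
 show "0 < 1 - cmod g" if "g \<in> D" for g using assms that by auto
 fix v :: "complex => complex" and a b :: complex
 assume v: "v holomorphic_on ball 0 1" "v ` ball 0 1 \<subseteq> D" and ab: "a \<in> ball 0 1" "b \<in> ball (0::complex) 1"
 define u where "u = (if v b = 0 then 1 else cnj (v b) / of_real (cmod (v b)))"
 have u: "cmod u = 1" "Re (u * v b) = cmod (v b)"
 proof -
  show "cmod u = 1" by (simp add: u_def norm_divide)
  have c: "cnj (v b) * v b = of_real (cmod (v b)) * of_real (cmod (v b))"
   using complex_norm_square[of "v b"] by (simp add: power2_eq_square mult.commute)
  have "u * v b = of_real (cmod (v b))"
  proof (cases "v b = 0")
   case False
   have "u * v b = (cnj (v b) * v b) / of_real (cmod (v b))" using False by (simp add: u_def)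
   also have "\<dots> = of_real (cmod (v b))" unfolding c using False by simp
   finally show ?thesis .
  qed simp
  then show "Re (u * v b) = cmod (v b)" by simp
 qed
 have le: "Re (u * v z) <= cmod (v z)" for z using complex_Re_le_cmod[of "u * v z"] u(1) by (simp add: norm_mult)
 define e where "e = (\<lambda>z. 1 - u * v z)"
 have h: "e holomorphic_on ball 0 1" unfolding e_def by (intro holomorphic_intros v(1))
 have pos: "Re (e z) > 0" if "z \<in> ball 0 1" for z
 proof -
  have "cmod (v z) < 1" using v(2) assms that by (auto simp: image_subset_iff subset_iff)
  then show ?thesis using le[of z] by (simp add: e_def)
 qed
 let ?k = "(1 - pseudo_hyp a b) / (1 + pseudo_hyp a b)"
 have "(1 - cmod (v a)) * ?k <= Re (e a) * ?k"
  using le[of a] harnack_factor_nonneg[OF ab] by (intro mult_right_mono) (auto simp: e_def)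
 also have "\<dots> <= Re (e b)" by (rule harnack_disc[OF h pos ab])
 also have "\<dots> = 1 - cmod (v b)" using u(2) by (simp add: e_def)
 finally show "(1 - cmod (v a)) * ?k <= 1 - cmod (v b)" .
qed

text \<open>A disc avoiding 0 has a holomorphic logarithm, which makes the function the real part of
  a holomorphic one. Both signs of \<open>s\<close> are wanted, for the two ends of an
  annulus.\<close>

lemma harnack_gap_log:
 assumes "0 \<notin> D" "\<And>e. e \<in> D ==> A - s * ln (cmod e) > 0"
 shows "harnack_gap D (\<lambda>x. A - s * ln x)"
 unfolding harnack_gap_def
proof (intro conjI ballI allI impI)
 show "0 < A - s * ln (cmod e)" if "e \<in> D" for e by (rule assms(2)[OF that])
 fix v :: "complex => complex" and a b :: complex
 assume v: "v holomorphic_on ball 0 1" "v ` ball 0 1 \<subseteq> D" and ab: "a \<in> ball 0 1" "b \<in> ball (0::complex) 1"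
 have v0: "v z ~= 0" "v z \<in> D" if "z \<in> ball 0 1" for z
 proof -
  show "v z \<in> D" using v(2) that by blast
  then show "v z ~= 0" using assms(1) by auto
 qed
 have "contractible (ball (0::complex) 1)" by (intro convex_imp_contractible convex_ball)
 from contractible_imp_holomorphic_log[OF v(1) this v0(1)]
 obtain g where g: "g holomorphic_on ball 0 1" "\<And>z. z \<in> ball 0 1 ==> v z = exp (g z)" by blast
 define c where "c = (\<lambda>z. of_real A - of_real s * g z)"
 have h: "c holomorphic_on ball 0 1" unfolding c_def by (intro holomorphic_intros g(1))
 have Re: "Re (c z) = A - s * ln (cmod (v z))" if "z \<in> ball 0 1" for z using g(2)[OF that] by (simp add: c_def)
 have pos: "Re (c z) > 0" if "z \<in> ball 0 1" for z using Re[OF that] assms(2)[OF v0(2)[OF that]] by simp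
 show "(A - s * ln (cmod (v a))) * ((1 - pseudo_hyp a b) / (1 + pseudo_hyp a b)) <= A - s * ln (cmod (v b))"
  using harnack_disc[OF h pos ab] unfolding Re[OF ab(1)] Re[OF ab(2)] .
qed

text \<open>For the disc the gap is \<open>1 - s\<close>. For the punctured disc it is
  \<open>- ln s\<close>, with the upper bound \<open>M\<close> keeping away from the puncture. An
  annulus gets one logarithmic gap for each boundary circle.\<close>

lemma rotation_domain_gaps:
 assumes "rotation_domain D"
 obtains a1 a2 where "harnack_gap D a1" "harnack_gap D a2"
  "\<And>b M. b > 0 ==> \<exists>C. compact C \<and> C \<subseteq> D \<and>
   (\<forall>c\<in>D. b <= a1 (cmod c) --> b <= a2 (cmod c) --> a1 (cmod c) <= M --> c \<in> C)"
proof -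
 have cpt: "compact {c::complex. x <= cmod c \<and> cmod c <= y}" for x y
 proof -
  have "closed {c::complex. x <= cmod c \<and> cmod c <= y}"
   by (intro closed_Collect_conj closed_Collect_le continuous_intros)
  moreover have "{c::complex. x <= cmod c \<and> cmod c <= y} \<subseteq> cball 0 y" by auto
  then have "bounded {c::complex. x <= cmod c \<and> cmod c <= y}" by (rule bounded_subset[OF bounded_cball])
  ultimately show ?thesis by (simp add: compact_eq_bounded_closed)
 qed
 consider "D = ball 0 1" | "D = ball 0 1 - {0}" | r R where "0 < r" "r < R" "D = {c. r < cmod c \<and> cmod c < R}"
  using assms unfolding rotation_domain_def by blast
 then show ?thesis
 proof cases
  case 1
  show ?thesis
  proof (rule that[of "\<lambda>s. 1 - s" "\<lambda>s. 1 - s"])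
   show "harnack_gap D (\<lambda>s. 1 - s)" "harnack_gap D (\<lambda>s. 1 - s)" by (rule harnack_gap_disc, simp add: 1)+
   fix b M :: real assume "b > 0"
   then show "\<exists>C. compact C \<and> C \<subseteq> D \<and> (\<forall>c\<in>D. b <= 1 - cmod c --> b <= 1 - cmod c --> 1 - cmod c <= M --> c \<in> C)"
    unfolding 1 by (intro exI[of _ "cball 0 (1 - b)"]) auto
  qed
 next
  case 2
  have g: "harnack_gap D (\<lambda>x. 0 - 1 * ln x)"
   by (rule harnack_gap_log) (auto simp: 2 ln_less_zero_iff)
  show ?thesis
  proof (rule that[OF g g])
   fix b M :: real assume b: "b > 0"
   show "\<exists>C. compact C \<and> C \<subseteq> D \<and> (\<forall>c\<in>D. b <= 0 - 1 * ln (cmod c) --> b <= 0 - 1 * ln (cmod c) --> 0 - 1 * ln (cmod c) <= M --> c \<in> C)"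
   proof (intro exI[of _ "{c. exp (- M) <= cmod c \<and> cmod c <= exp (- b)}"] conjI ballI impI cpt)
    have y: "exp (- b) < 1" "0 < exp (- M)" using b by simp_all
    show "{c. exp (- M) <= cmod c \<and> cmod c <= exp (- b)} \<subseteq> D"
    proof
     fix c :: complex assume "c \<in> {c. exp (- M) <= cmod c \<and> cmod c <= exp (- b)}"
     then have "exp (- M) <= cmod c" "cmod c <= exp (- b)" by simp_all
     then have "0 < cmod c" "cmod c < 1" using y by linarith+
     then show "c \<in> D" unfolding 2 by simp
    qed
    fix c assume z: "c \<in> D" "b <= 0 - 1 * ln (cmod c)" "0 - 1 * ln (cmod c) <= M"
    then have "cmod c > 0" unfolding 2 by simp
    then have e: "cmod c = exp (ln (cmod c))" by simp
    have "exp (- M) <= exp (ln (cmod c))" "exp (ln (cmod c)) <= exp (- b)" using z(2,3) by simp_all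
    then show "c \<in> {c. exp (- M) <= cmod c \<and> cmod c <= exp (- b)}" using e by simp
   qed
  qed
 next
  case 3
  have R0: "R > 0" using 3 by simp
  have lz: "ln r < ln (cmod c)" "ln (cmod c) < ln R" if "c \<in> D" for c
   using that 3 R0 unfolding 3(3) by (auto intro!: ln_less_cancel_iff[THEN iffD2])
  have g1: "harnack_gap D (\<lambda>x. ln R - 1 * ln x)"
   by (rule harnack_gap_log) (use 3(1) lz in \<open>auto simp: 3(3)\<close>)
  have g2: "harnack_gap D (\<lambda>x. - ln r - (-1) * ln x)"
   by (rule harnack_gap_log) (use 3(1) lz in \<open>auto simp: 3(3)\<close>)
  show ?thesis
  proof (rule that[OF g1 g2])
   fix b M :: real assume b: "b > 0"
   show "\<exists>C. compact C \<and> C \<subseteq> D \<and> (\<forall>c\<in>D. b <= ln R - 1 * ln (cmod c) --> b <= - ln r - (-1) * ln (cmod c) --> ln R - 1 * ln (cmod c) <= M --> c \<in> C)"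
   proof (intro exI[of _ "{c. exp (ln r + b) <= cmod c \<and> cmod c <= exp (ln R - b)}"] conjI ballI impI cpt)
    have "exp (ln R - b) < exp (ln R)" "exp (ln r) < exp (ln r + b)" using b by simp_all
    then have "exp (ln R - b) < R" "r < exp (ln r + b)" using 3(1) R0 by simp_all
    then show "{c. exp (ln r + b) <= cmod c \<and> cmod c <= exp (ln R - b)} \<subseteq> D" unfolding 3(3) by auto
    fix c assume z: "c \<in> D" "b <= ln R - 1 * ln (cmod c)" "b <= - ln r - (-1) * ln (cmod c)"
    then have "cmod c > 0" using 3(1) unfolding 3(3) by auto
    then have e: "cmod c = exp (ln (cmod c))" by simp
    have "exp (ln r + b) <= exp (ln (cmod c))" "exp (ln (cmod c)) <= exp (ln R - b)" using z(2,3) by simp_all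
    then show "c \<in> {c. exp (ln r + b) <= cmod c \<and> cmod c <= exp (ln R - b)}" using e by simp
   qed
  qed
 qed
qed

section \<open>Levels of limit points\<close>

context rotation_curve
begin

definition limit_point :: "cp2 => cp2 => bool" where
 "limit_point z c \<longleftrightarrow> (\<exists>m. filterlim m at_top sequentially \<and> (\<lambda>k. (f ^^ m k) z) \<longlonglongrightarrow> c)"

lemma limit_point_exists: "\<exists>c. limit_point z c"
proof -
 obtain r c where r: "strict_mono (r :: nat => nat)" "(\<lambda>k. (f ^^ r k) z) \<longlonglongrightarrow> c" by (rule cp2_convergent_subseq)
 then show ?thesis unfolding limit_point_def using filterlim_subseq[OF r(1)] by blast
qed

lemma limit_point_\<Sigma>:
 assumes z: "z \<in> \<Omega>" and c: "limit_point z c"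
 shows "c \<in> \<Sigma>"
proof -
 obtain m where m: "filterlim m at_top sequentially" "(\<lambda>k. (f ^^ m k) z) \<longlonglongrightarrow> c" using c unfolding limit_point_def by blast
 have "c \<in> closure (range (\<lambda>n. (f ^^ n) z))"
  unfolding closure_sequential using m(2) by (intro exI[of _ "\<lambda>k. (f ^^ m k) z"]) auto
 then have "c \<in> \<Omega>" using trapped_\<Omega>[OF z] unfolding trapped_def by blast
 then show ?thesis by (intro attract_limit[of "{z}" "\<lambda>k. z", OF _ _ _ m]) (use z in auto)
qed

text \<open>Once the orbit of \<open>z\<close> is near \<open>c\<close>, the orbit of
  \<open>c\<close> follows it by equicontinuity, so \<open>c'\<close> is a limit of iterates of
  \<open>c\<close>. Along these the modulus of \<open>\<psi>\<close> is constant.\<close>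

lemma limit_point_level:
 assumes z: "z \<in> \<Omega>" and c: "limit_point z c" "limit_point z c'"
 shows "cmod (\<psi> c) = cmod (\<psi> c')"
proof -
 obtain m where m: "filterlim m at_top sequentially" "(\<lambda>k. (f ^^ m k) z) \<longlonglongrightarrow> c" using c unfolding limit_point_def by blast
 obtain m' where m': "filterlim m' at_top sequentially" "(\<lambda>k. (f ^^ m' k) z) \<longlonglongrightarrow> c'" using c unfolding limit_point_def by blast
 have cS: "c \<in> \<Sigma>" "c' \<in> \<Sigma>" using limit_point_\<Sigma>[OF z] c by auto
 then have cF: "{c} \<subseteq> fatou_set f" using \<Sigma>_sub comp_facts(1) by blast
 obtain e C where C: "e > 0" "\<forall>p\<in>{c}. \<forall>q. dist p q < e --> (\<forall>n. dist ((f ^^ n) p) ((f ^^ n) q) <= C * dist p q)"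
  using compact_equi_lipschitz[OF _ cF] by auto
 have "\<forall>k. \<exists>l\<ge>k. m' l >= m k"
 proof
  fix k
  have "\<forall>\<^sub>F l in sequentially. m' l >= m k" using m'(1) by (simp add: filterlim_at_top)
  then obtain l0 where "\<forall>l\<ge>l0. m' l >= m k" unfolding eventually_sequentially by blast
  then show "\<exists>l\<ge>k. m' l >= m k" by (intro exI[of _ "max l0 k"]) auto
 qed
 from choice[OF this] obtain l where l: "\<forall>k. l k >= k \<and> m' (l k) >= m k" by (rule exE)
 define n where "n = (\<lambda>k. m' (l k) - m k)"
 have it: "(f ^^ n k) ((f ^^ m k) z) = (f ^^ m' (l k)) z" for k
  using l by (simp add: n_def flip: funpow_add[THEN fun_cong, unfolded o_apply])
 have "filterlim l at_top sequentially" by (rule filterlim_at_top_mono[OF filterlim_ident]) (use l in simp)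
 then have 1: "(\<lambda>k. (f ^^ m' (l k)) z) \<longlonglongrightarrow> c'" by (rule filterlim_compose[OF m'(2)])
 have d0: "(\<lambda>k. dist c ((f ^^ m k) z)) \<longlonglongrightarrow> 0" using tendsto_dist[OF tendsto_const[of c] m(2)] by simp
 then have "\<forall>\<^sub>F k in sequentially. dist (dist c ((f ^^ m k) z)) 0 < e" using C(1) by (rule tendstoD)
 then have "\<forall>\<^sub>F k in sequentially. norm (dist ((f ^^ n k) c) ((f ^^ m' (l k)) z)) <= C * dist c ((f ^^ m k) z)"
 proof eventually_elim
  case (elim k)
  then show ?case using C(2)[rule_format, of c "(f ^^ m k) z" "n k"] it[of k] by simp
 qed
 moreover have "(\<lambda>k. C * dist c ((f ^^ m k) z)) \<longlonglongrightarrow> 0" using tendsto_mult_left[OF d0, of C] by simp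
 ultimately have "(\<lambda>k. dist ((f ^^ n k) c) ((f ^^ m' (l k)) z)) \<longlonglongrightarrow> 0" by (rule Lim_null_comparison)
 then have "(\<lambda>k. dist ((f ^^ n k) c) ((f ^^ m' (l k)) z) + dist ((f ^^ m' (l k)) z) c') \<longlonglongrightarrow> 0 + 0"
  by (intro tendsto_add) (use tendsto_dist[OF 1 tendsto_const[of c']] in simp_all)
 then have s: "(\<lambda>k. dist ((f ^^ n k) c) ((f ^^ m' (l k)) z) + dist ((f ^^ m' (l k)) z) c') \<longlonglongrightarrow> 0" by simp
 have "(\<lambda>k. dist ((f ^^ n k) c) c') \<longlonglongrightarrow> 0"
  by (rule Lim_null_comparison[OF _ s]) (simp add: dist_triangle)
 then have 2: "(\<lambda>k. (f ^^ n k) c) \<longlonglongrightarrow> c'" by (subst tendsto_dist_iff)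
 have "(\<lambda>k. \<psi> ((f ^^ n k) c)) \<longlonglongrightarrow> \<psi> c'"
  by (rule continuous_on_tendsto_compose[OF \<psi>_cont 2 cS(2)]) (use \<psi>_iter[OF cS(1)] in simp)
 then have "(\<lambda>k. cmod (\<psi> ((f ^^ n k) c))) \<longlonglongrightarrow> cmod (\<psi> c')" by (rule tendsto_norm)
 then show ?thesis using \<psi>_iter[OF cS(1)] by (simp add: LIMSEQ_const_iff)
qed

definition level :: "cp2 => real" where
 "level z = cmod (\<psi> (SOME c. limit_point z c))"

lemma level_eq: "z \<in> \<Omega> ==> limit_point z c ==> level z = cmod (\<psi> c)"
 unfolding level_def using limit_point_level someI_ex[OF limit_point_exists] by blast

lemma level_D:
 assumes "z \<in> \<Omega>"
 obtains a where "a \<in> D" "cmod a = level z"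
 using limit_point_exists[of z] level_eq[OF assms] \<psi>_D[OF limit_point_\<Sigma>[OF assms]] by metis

text \<open>Holomorphy of \<open>\<psi>\<close> is given through \<open>curve_atlas\<close>, whose
  charts are first coordinates of adapted charts. The parametrization inverts such a chart, so the
  composite is \<open>\<psi>\<close> read in it.\<close>

lemma \<psi>_param_holomorphic:
 assumes m: "\<And>g. g \<in> ball b r ==> proj (m g) \<in> \<Sigma> \<and> proj (m g) \<in> U \<and> e (proj (m g)) $ 1 = g"
  and U: "adapted_chart (cp2_domain \<Omega>) \<Sigma> U e"
 shows "(\<lambda>g. \<psi> (proj (m g))) holomorphic_on ball b r"
proof -
 define a where "a = (\<lambda>p. vec (e p $ 1) :: complex^1)"
 have im: "e ` (U \<inter> \<Sigma>) = {w \<in> e ` U. w $ 2 = 0}" and hc: "holomorphic_chart (cp2_domain \<Omega>) U e"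
  using U by (auto simp: adapted_chart_def)
 have inj: "\<And>p. p \<in> U ==> inv_into U e (e p) = p"
  using hc unfolding holomorphic_chart_def homeomorphism_def by blast
 have ainj: "inj_on a (U \<inter> \<Sigma>)"
 proof (rule inj_onI)
  fix p q assume pq: "p \<in> U \<inter> \<Sigma>" "q \<in> U \<inter> \<Sigma>" "a p = a q"
  have "e p $ 2 = 0" "e q $ 2 = 0" using im pq(1,2) by blast+
  moreover have "e p $ 1 = e q $ 1" using pq(3) inj_vec_1[of UNIV] by (simp add: a_def inj_on_def)
  ultimately have "e p = e q" by (simp add: vec_eq_iff forall_2)
  then show "p = q" using inj pq(1,2) by (metis IntD1)
 qed
 have "(U \<inter> \<Sigma>, a) \<in> curve_atlas (cp2_domain \<Omega>) \<Sigma>" unfolding curve_atlas_def a_def using U by blast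
 note in1 = this
 have in2: "(D, vec :: complex => complex^1) \<in> planar_atlas D" by (simp add: planar_atlas_def)
 have hm: "\<forall>(U, e)\<in>curve_atlas (cp2_domain \<Omega>) \<Sigma>. \<forall>(V, t)\<in>planar_atlas D.
   holomorphic_vec (t \<circ> \<psi> \<circ> inv_into U e) (e ` (U \<inter> \<psi> -` V))"
  using \<psi> unfolding biholomorphic_map_def holomorphic_map_def by (elim conjE)
 have hm2: "\<forall>(V, t)\<in>planar_atlas D. holomorphic_vec (t \<circ> \<psi> \<circ> inv_into (U \<inter> \<Sigma>) a) (a ` (U \<inter> \<Sigma> \<inter> \<psi> -` V))"
  using bspec[OF hm in1] by (simp only: prod.case)
 have hv: "holomorphic_vec ((vec :: complex => complex^1) \<circ> \<psi> \<circ> inv_into (U \<inter> \<Sigma>) a) (a ` (U \<inter> \<Sigma> \<inter> \<psi> -` D))"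
  using bspec[OF hm2 in2] by (simp only: prod.case)
 define G where "G = (vec \<circ> \<psi> \<circ> inv_into (U \<inter> \<Sigma>) a :: complex^1 => complex^1)"
 have eq: "\<psi> (proj (m g)) = G (vec g) $ 1" if z: "g \<in> ball b r" for g
 proof -
  have p: "proj (m g) \<in> U \<inter> \<Sigma>" "a (proj (m g)) = vec g" using m[OF z] by (auto simp: a_def)
  then have "inv_into (U \<inter> \<Sigma>) a (vec g) = proj (m g)" using inv_into_f_f[OF ainj p(1)] by simp
  then show ?thesis by (simp add: G_def)
 qed
 have "\<exists>w. ((\<lambda>g. G (vec g)) has_derivative (\<lambda>h. h *s w)) (at g)" if z: "g \<in> ball b r" for g
 proof -
  have p: "proj (m g) \<in> U \<inter> \<Sigma> \<inter> \<psi> -` D" "a (proj (m g)) = vec g" using m[OF z] \<psi>_D by (auto simp: a_def)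
  then have "vec g \<in> a ` (U \<inter> \<Sigma> \<inter> \<psi> -` D)" by (metis imageI)
  then obtain E where E: "(G has_derivative E) (at (vec g))" "\<And>c v. E (c *s v) = c *s E v"
   using hv unfolding holomorphic_vec_def G_def by blast
  have "((\<lambda>g. G (vec g)) has_derivative (\<lambda>h. E (vec h))) (at g)"
   by (rule has_derivative_compose[OF bounded_linear_imp_has_derivative[OF bounded_linear_vec_1] E(1)])
  moreover have "E (vec h) = h *s E (vec 1)" for h by (subst vec_1_smult) (rule E(2))
  ultimately show ?thesis by auto
 qed
 then have "hol_vec (\<lambda>g. G (vec g)) (ball b r)" by (rule hol_vecI)
 from hol_vecD[OF this, of 1] show ?thesis by (rule holomorphic_transform) (simp add: eq)
qed

lemma \<psi>_disc_holomorphic: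
 assumes A: "open A" and S: "hol_vec S A" "\<And>t. t \<in> A ==> S t ~= 0 \<and> proj (S t) \<in> \<Sigma>"
 shows "(\<lambda>t. \<psi> (proj (S t))) holomorphic_on A"
proof -
 have "\<exists>r>0. ball t r \<subseteq> A \<and> (\<lambda>t. \<psi> (proj (S t))) holomorphic_on ball t r" if t: "t \<in> A" for t
 proof -
  define c where "c = proj (S t)"
  have c: "c \<in> \<Sigma>" using S(2)[OF t] by (simp add: c_def)
  obtain e b m k where e: "e > 0" "b > 0" "hol_vec m (ball (k c) b)"
   "\<And>g. g \<in> ball (k c) b ==> m g ~= 0 \<and> proj (m g) \<in> \<Sigma> \<and> k (proj (m g)) = g"
   "\<And>p. p \<in> \<Sigma> ==> p \<in> ball c e ==> k p \<in> ball (k c) b \<and> proj (m (k p)) = p"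
   "continuous_on (ball c e) (k :: cp2 => complex)"
   "\<forall>L A. open A --> hol_vec L A --> (\<forall>z\<in>A. L z ~= 0 \<and> proj (L z) \<in> ball c e) -->
    (\<lambda>z. k (proj (L z))) holomorphic_on A"
   "\<exists>U a. adapted_chart (cp2_domain \<Omega>) \<Sigma> U a \<and> ball c e \<subseteq> U \<and> k = (\<lambda>p. a p $ 1) \<and>
    (\<forall>g\<in>ball (k c) b. proj (m g) \<in> U)"
   by (rule curve_param[OF c]) (rule that)
  from e(8) obtain U a where U: "adapted_chart (cp2_domain \<Omega>) \<Sigma> U a" "ball c e \<subseteq> U" "k = (\<lambda>p. a p $ 1)"
   "\<forall>g\<in>ball (k c) b. proj (m g) \<in> U" by (elim exE conjE)
  have G: "(\<lambda>g. \<psi> (proj (m g))) holomorphic_on ball (k c) b"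
   by (rule \<psi>_param_holomorphic[OF _ U(1)]) (use e(4) U(4) fun_cong[OF U(3)] in \<open>metis\<close>)
  have "continuous_on A (\<lambda>t. proj (S t))"
   by (rule continuous_on_compose2[OF continuous_on_proj hol_vec_continuous[OF S(1)]]) (use S(2) in auto)
  then have "open (A \<inter> (\<lambda>t. proj (S t)) -` ball c e)" using A by (intro continuous_open_preimage) auto
  moreover have "t \<in> A \<inter> (\<lambda>t. proj (S t)) -` ball c e" using t e(1) by (simp add: c_def)
  ultimately obtain r where r: "r > 0" "ball t r \<subseteq> A \<inter> (\<lambda>t. proj (S t)) -` ball c e" by (rule openE)
  have rA: "ball t r \<subseteq> A" using r(2) by blast
  have K: "(\<lambda>t. k (proj (S t))) holomorphic_on ball t r"
   by (rule e(7)[rule_format, OF open_ball hol_vec_subset[OF S(1) rA]]) (use r(2) S(2) in auto)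
  have pt: "k (proj (S s)) \<in> ball (k c) b \<and> proj (m (k (proj (S s)))) = proj (S s)" if "s \<in> ball t r" for s
   by (rule e(5)) (use that r(2) S(2) in auto)
  have "((\<lambda>g. \<psi> (proj (m g))) \<circ> (\<lambda>t. k (proj (S t)))) holomorphic_on ball t r"
   by (rule holomorphic_on_compose_gen[OF K G]) (use pt in blast)
  then have "(\<lambda>t. \<psi> (proj (S t))) holomorphic_on ball t r"
   by (rule holomorphic_transform) (simp add: pt)
  then show ?thesis using r(1) rA by blast
 qed
 note loc = this
 show ?thesis
  unfolding holomorphic_on_open[OF A]
 proof
  fix t assume "t \<in> A"
  from loc[OF this] obtain r where "r > 0" "(\<lambda>t. \<psi> (proj (S t))) holomorphic_on ball t r" by blast
  then have "(\<lambda>t. \<psi> (proj (S t))) field_differentiable (at t)"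
   by (intro holomorphic_on_imp_differentiable_at[OF _ open_ball]) auto
  then show "\<exists>f'. ((\<lambda>t. \<psi> (proj (S t))) has_field_derivative f') (at t)" unfolding field_differentiable_def .
 qed
qed

text \<open>One subsequence of the iterated normalized lifts converges at all parameters at once,
  and its limit \<open>S\<close> sends each parameter to a limit point of the orbit of
  \<open>g t\<close>. The level is thus the modulus of the holomorphic function
  \<open>\<psi> (proj (S t))\<close>.\<close>

lemma level_disc:
 assumes g: "hol_disc (ball 0 1) g" "g ` ball 0 1 \<subseteq> \<Omega>" and a: "0 < a" "a < 1"
 shows "\<exists>v. v holomorphic_on ball 0 a \<and> (\<forall>t\<in>ball 0 a. v t \<in> D \<and> cmod (v t) = level (g t))"
proof -
 have gF: "g ` ball 0 1 \<subseteq> fatou_set f" using g(2) comp_facts(1) by blast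
 obtain N where N: "nlift N (ball 0 a)" "\<forall>z\<in>ball 0 a. proj (N z) = g z" using nlift_ball[OF g(1) gF a] by blast
 obtain S r where S: "strict_mono (r :: nat => nat)" "nlift S (ball 0 a)"
  "\<And>C. compact C ==> C \<subseteq> ball 0 a ==> uniform_limit C (\<lambda>k z. (F ^^ r k) (N z)) S sequentially"
  by (rule nlift_Montel[where Y = "\<lambda>k z. (F ^^ k) (N z)", OF open_ball nlift_iter[OF N(1)]]) (rule that)
 have Sh: "hol_vec S (ball 0 a)" "\<And>t. t \<in> ball 0 a ==> S t ~= 0" using S(2) by (auto simp: nlift_def)
 have pt: "g t \<in> \<Omega>" "limit_point (g t) (proj (S t))" if t: "t \<in> ball 0 a" for t
 proof -
  have "t \<in> ball 0 1" using t a by simp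
  then show "g t \<in> \<Omega>" using g(2) by blast
  have N0: "N t ~= 0" using N(1) t by (simp add: nlift_def)
  have "(\<lambda>k. (F ^^ r k) (N t)) \<longlonglongrightarrow> S t"
   by (rule tendsto_uniform_limitI[OF S(3)[of "{t}"]]) (use t in auto)
  then have "(\<lambda>k. proj ((F ^^ r k) (N t))) \<longlonglongrightarrow> proj (S t)"
   by (rule tendsto_proj) (use Sh(2)[OF t] N0 in \<open>auto simp: iter_zero\<close>)
  then have "(\<lambda>k. (f ^^ r k) (g t)) \<longlonglongrightarrow> proj (S t)" using N(2) t f_iter_proj[OF N0] by simp
  then show "limit_point (g t) (proj (S t))" unfolding limit_point_def using filterlim_subseq[OF S(1)] by blast
 qed
 show ?thesis
 proof (intro exI[of _ "\<lambda>t. \<psi> (proj (S t))"] conjI ballI)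
  show "(\<lambda>t. \<psi> (proj (S t))) holomorphic_on ball 0 a"
   by (rule \<psi>_disc_holomorphic[OF open_ball Sh(1)]) (use Sh(2) limit_point_\<Sigma> pt in blast)
  fix t assume t: "t \<in> ball (0::complex) a"
  show "\<psi> (proj (S t)) \<in> D" by (rule \<psi>_D[OF limit_point_\<Sigma>[OF pt[OF t]]])
  show "cmod (\<psi> (proj (S t))) = level (g t)" using level_eq[OF pt[OF t]] by simp
 qed
qed

text \<open>\<open>level_disc\<close> is available only on smaller concentric discs. Harnack's
  inequality is rescaled to radius \<open>r n\<close>, and \<open>r n\<close> tends to 1.\<close>

lemma gap_level_harnack:
 assumes c: "harnack_gap D c" and g: "hol_disc (ball 0 1) g" "g ` ball 0 1 \<subseteq> \<Omega>"
  and ab: "a \<in> ball 0 1" "b \<in> ball 0 1"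
 shows "c (level (g b)) >= c (level (g a)) * ((1 - pseudo_hyp a b) / (1 + pseudo_hyp a b))"
proof -
 define m where "m = max (cmod a) (cmod b)"
 have m: "0 <= m" "m < 1" "cmod a <= m" "cmod b <= m" using ab by (auto simp: m_def le_max_iff_disj)
 define r where "r = (\<lambda>n. 1 - (1 - m) / real (n + 2))"
 have r: "0 < r n" "r n < 1" "m < r n" for n
 proof -
  have "(1 - m) / real (n + 2) < 1 - m" using m by (simp add: divide_less_eq)
  then show "m < r n" by (simp add: r_def)
  then show "0 < r n" using m by linarith
  show "r n < 1" using m by (simp add: r_def)
 qed
 have ineq: "c (level (g a)) * ((1 - pseudo_hyp (a / of_real (r n)) (b / of_real (r n))) / (1 + pseudo_hyp (a / of_real (r n)) (b / of_real (r n)))) <= c (level (g b))" for n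
 proof -
  obtain v where v: "v holomorphic_on ball 0 (r n)" "\<forall>t\<in>ball 0 (r n). v t \<in> D \<and> cmod (v t) = level (g t)"
   using level_disc[OF g r(1,2)] by blast
  define w where "w = (\<lambda>z. v (of_real (r n) * z))"
  have im: "of_real (r n) * z \<in> ball 0 (r n)" if "z \<in> ball 0 1" for z :: complex
  proof -
   have "r n * cmod z < r n * 1" using that r(1)[of n] by (intro mult_strict_left_mono) auto
   then show ?thesis using r(1)[of n] by (simp add: norm_mult)
  qed
  have "(\<lambda>z. complex_of_real (r n) * z) ` ball 0 1 \<subseteq> ball 0 (r n)" using im by blast
  from holomorphic_on_compose_gen[OF _ v(1) this] have wh: "w holomorphic_on ball 0 1"
   unfolding w_def o_def by (simp add: holomorphic_intros)
  have wD: "w ` ball 0 1 \<subseteq> D" unfolding w_def using im v(2) by blast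
  have "cmod a / r n < 1" "cmod b / r n < 1" using m r[of n] by auto
  then have ab': "a / of_real (r n) \<in> ball 0 1" "b / of_real (r n) \<in> ball 0 1"
   using r(1)[of n] by (simp_all add: norm_divide)
  have "r n ~= 0" using r(1)[of n] by simp
  then have "w (a / of_real (r n)) = v a" "w (b / of_real (r n)) = v b" by (simp_all add: w_def)
  moreover have "a \<in> ball 0 (r n)" "b \<in> ball 0 (r n)" using m r(3)[of n] by auto
  ultimately have "cmod (w (a / of_real (r n))) = level (g a)" "cmod (w (b / of_real (r n))) = level (g b)" using v(2) by auto
  then show ?thesis using c wh wD ab' unfolding harnack_gap_def by metis
 qed
 have "(\<lambda>n. (1 - m) / real (n + 2)) \<longlonglongrightarrow> 0"
  using LIMSEQ_ignore_initial_segment[OF lim_const_over_n[of "1 - m"], of 2] by simp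
 then have "r \<longlonglongrightarrow> 1 - 0" unfolding r_def by (intro tendsto_diff tendsto_const)
 then have lim: "r \<longlonglongrightarrow> 1" by simp
 have l: "(\<lambda>n. complex_of_real (r n)) \<longlonglongrightarrow> 1" using tendsto_of_real[OF lim] by simp
 have ne: "1 - cnj a * b ~= 0"
 proof
  assume "1 - cnj a * b = 0"
  then have "cmod a * cmod b = 1" by (metis complex_mod_cnj eq_iff_diff_eq_0 norm_mult norm_one)
  moreover have "cmod a * cmod b < 1 * 1" using ab by (intro mult_strict_mono') auto
  ultimately show False by simp
 qed
 have p: "(\<lambda>n. pseudo_hyp (a / of_real (r n)) (b / of_real (r n))) \<longlonglongrightarrow> pseudo_hyp a b"
 proof -
  have "(\<lambda>n. cmod ((a / of_real (r n) - b / of_real (r n)) / (1 - cnj (a / of_real (r n)) * (b / of_real (r n)))))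
   \<longlonglongrightarrow> cmod ((a / 1 - b / 1) / (1 - cnj (a / 1) * (b / 1)))"
   by (intro tendsto_intros l) (use ne in auto)
  then show ?thesis by (simp add: pseudo_hyp_def)
 qed
 have "1 + pseudo_hyp a b ~= 0" using pseudo_hyp_nonneg[of a b] by linarith
 then have "(\<lambda>n. c (level (g a)) * ((1 - pseudo_hyp (a / of_real (r n)) (b / of_real (r n))) / (1 + pseudo_hyp (a / of_real (r n)) (b / of_real (r n)))))
  \<longlonglongrightarrow> c (level (g a)) * ((1 - pseudo_hyp a b) / (1 + pseudo_hyp a b))"
  by (intro tendsto_intros p)
 then show ?thesis by (rule LIMSEQ_le_const2) (use ineq in blast)
qed

lemma gap_level_pos: "harnack_gap D g ==> z \<in> \<Omega> ==> g (level z) > 0"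
 using level_D[of z] unfolding harnack_gap_def by metis

text \<open>The logarithm of the Harnack factor is exactly minus the Poincare distance, which makes
  the logarithm of the gap 1-Lipschitz along discs and hence for \<open>kob\<close>.\<close>

lemma gap_level_disc:
 assumes c: "harnack_gap D c" and g: "holomorphic_map (planar_atlas (ball 0 1)) (cp2_domain \<Omega>) g"
  and ab: "a \<in> ball 0 1" "b \<in> ball 0 1"
 shows "\<bar>ln (c (level (g a))) - ln (c (level (g b)))\<bar> <= poincare_dist a b"
proof -
 note hd = holomorphic_map_imp_hol_disc[OF open_ball g]
 have half: "ln (c (level (g x))) - ln (c (level (g y))) <= poincare_dist x y"
  if xy: "x \<in> ball 0 1" "y \<in> ball 0 1" for x y
 proof -
  define m where "m = pseudo_hyp x y"
  have m: "0 <= m" "m < 1" using pseudo_hyp_nonneg pseudo_hyp_lt_1[OF xy] by (auto simp: m_def)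
  have p: "c (level (g x)) > 0" "c (level (g y)) > 0" using gap_level_pos[OF c] hd(2) xy by blast+
  have k: "(1 - m) / (1 + m) > 0" using m by simp
  have "c (level (g x)) * ((1 - m) / (1 + m)) <= c (level (g y))"
   unfolding m_def by (rule gap_level_harnack[OF c hd xy])
  then have "ln (c (level (g x)) * ((1 - m) / (1 + m))) <= ln (c (level (g y)))"
   by (subst ln_le_cancel_iff[OF mult_pos_pos[OF p(1) k] p(2)])
  moreover have "ln (c (level (g x)) * ((1 - m) / (1 + m))) = ln (c (level (g x))) + (ln (1 - m) - ln (1 + m))"
   using p k m by (simp add: ln_mult ln_div)
  moreover have "poincare_dist x y = ln (1 + m) - ln (1 - m)"
   using m by (simp add: poincare_dist_eq m_def[symmetric] artanh_def ln_div)
  ultimately show ?thesis by linarith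
 qed
 show ?thesis using half[OF ab] half[OF ab(2,1)] poincare_dist_sym[of a b] by linarith
qed

lemma gap_level_kob:
 assumes g: "harnack_gap D g" and pq: "p \<in> \<Omega>" "q \<in> \<Omega>"
 shows "\<bar>ln (g (level p)) - ln (g (level q))\<bar> <= kob p q"
 unfolding kob_eq[OF pq]
proof (rule cInf_greatest[OF chain_exists[OF pq]])
 fix x assume "x \<in> disc_chain_lengths (cp2_domain \<Omega>) p q"
 then show "\<bar>ln (g (level p)) - ln (g (level q))\<bar> <= x"
  by (rule disc_chain_bound[where D = "\<lambda>p q. \<bar>ln (g (level p)) - ln (g (level q))\<bar>"])
   (rule gap_level_disc[OF g], assumption+, linarith)
qed

text \<open>Limit points of the orbits of late members of a Cauchy sequence lie in one compact part
  \<open>\<Gamma>\<close> of \<open>\<Sigma>\<close>. A limit \<open>p\<close> of the sequence in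
  the plane might lie outside \<open>\<Omega>\<close>, but \<open>kob_dist\<close> holds at all
  times, so some iterate of \<open>p\<close> is close to \<open>\<Gamma>\<close> and in
  \<open>\<Omega>\<close>; backward invariance of the Fatou set returns to \<open>p\<close>.\<close>

theorem kobayashi_complete_\<Omega>: "kobayashi_complete (cp2_domain \<Omega>)"
proof (rule kobayashi_complete_compI)
 fix \<sigma> :: "nat => cp2"
 assume \<sigma>: "range \<sigma> \<subseteq> \<Omega>" and cauchy: "\<And>\<epsilon>. \<epsilon> > 0 ==> \<exists>N. \<forall>m n. m >= N --> n >= N --> kob (\<sigma> m) (\<sigma> n) < \<epsilon>"
 have \<sigma>\<Omega>: "\<sigma> n \<in> \<Omega>" for n using \<sigma> by blast
 obtain \<gamma>1 \<gamma>2 where \<gamma>: "harnack_gap D \<gamma>1" "harnack_gap D \<gamma>2"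
  "\<And>\<epsilon> M. \<epsilon> > 0 ==> \<exists>C. compact C \<and> C \<subseteq> D \<and>
   (\<forall>\<zeta>\<in>D. \<epsilon> <= \<gamma>1 (cmod \<zeta>) --> \<epsilon> <= \<gamma>2 (cmod \<zeta>) --> \<gamma>1 (cmod \<zeta>) <= M --> \<zeta> \<in> C)"
  by (rule rotation_domain_gaps[OF D]) (rule that)
 obtain N0 where N0: "\<And>m n. m >= N0 ==> n >= N0 ==> kob (\<sigma> m) (\<sigma> n) < 1" using cauchy[of 1] by auto
 have bd: "exp (ln (\<gamma> (level (\<sigma> N0))) - 1) <= \<gamma> (level (\<sigma> n))" "\<gamma> (level (\<sigma> n)) <= exp (ln (\<gamma> (level (\<sigma> N0))) + 1)"
  if g: "harnack_gap D \<gamma>" and n: "n >= N0" for \<gamma> n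
 proof -
  have "\<bar>ln (\<gamma> (level (\<sigma> N0))) - ln (\<gamma> (level (\<sigma> n)))\<bar> <= 1"
   using gap_level_kob[OF g \<sigma>\<Omega> \<sigma>\<Omega>, of N0 n] N0[OF order_refl n] by linarith
  then have "exp (ln (\<gamma> (level (\<sigma> N0))) - 1) <= exp (ln (\<gamma> (level (\<sigma> n))))"
   "exp (ln (\<gamma> (level (\<sigma> n)))) <= exp (ln (\<gamma> (level (\<sigma> N0))) + 1)" by simp_all
  then show "exp (ln (\<gamma> (level (\<sigma> N0))) - 1) <= \<gamma> (level (\<sigma> n))" "\<gamma> (level (\<sigma> n)) <= exp (ln (\<gamma> (level (\<sigma> N0))) + 1)"
   using gap_level_pos[OF g \<sigma>\<Omega>, of n] by simp_all
 qed
 define \<epsilon> where "\<epsilon> = min (exp (ln (\<gamma>1 (level (\<sigma> N0))) - 1)) (exp (ln (\<gamma>2 (level (\<sigma> N0))) - 1))"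
 have "\<epsilon> > 0" by (simp add: \<epsilon>_def)
 from \<gamma>(3)[OF this, of "exp (ln (\<gamma>1 (level (\<sigma> N0))) + 1)"]
 obtain C where C: "compact C" "C \<subseteq> D" "\<And>\<zeta>. \<zeta> \<in> D ==> \<epsilon> <= \<gamma>1 (cmod \<zeta>) ==> \<epsilon> <= \<gamma>2 (cmod \<zeta>) ==>
   \<gamma>1 (cmod \<zeta>) <= exp (ln (\<gamma>1 (level (\<sigma> N0))) + 1) ==> \<zeta> \<in> C" by blast
 define \<Gamma> where "\<Gamma> = \<xi> ` C"
 have \<Gamma>: "compact \<Gamma>" "\<Gamma> \<subseteq> \<Omega>"
  unfolding \<Gamma>_def using compact_continuous_image[OF continuous_on_subset[OF \<xi>_cont C(2)] C(1)] \<xi>_\<Sigma>(1) C(2) \<Sigma>_sub by blast+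
 have lp: "c \<in> \<Gamma>" if n: "n >= N0" and c: "limit_point (\<sigma> n) c" for n c
 proof -
  have cS: "c \<in> \<Sigma>" by (rule limit_point_\<Sigma>[OF \<sigma>\<Omega> c])
  have l: "cmod (\<psi> c) = level (\<sigma> n)" using level_eq[OF \<sigma>\<Omega> c] by simp
  have "\<psi> c \<in> C"
  proof (rule C(3)[OF \<psi>_D[OF cS]])
   show "\<epsilon> <= \<gamma>1 (cmod (\<psi> c))" using bd(1)[OF \<gamma>(1) n] unfolding l \<epsilon>_def by linarith
   show "\<epsilon> <= \<gamma>2 (cmod (\<psi> c))" using bd(1)[OF \<gamma>(2) n] unfolding l \<epsilon>_def by linarith
   show "\<gamma>1 (cmod (\<psi> c)) <= exp (ln (\<gamma>1 (level (\<sigma> N0))) + 1)" using bd(2)[OF \<gamma>(1) n] unfolding l .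
  qed
  then show ?thesis unfolding \<Gamma>_def using \<xi>_\<psi>[OF cS] by (metis imageI)
 qed
 obtain e where e: "e > 0" "(\<Union>x\<in>\<Gamma>. cball x e) \<subseteq> \<Omega>"
  by (rule compact_subset_open_imp_cball_epsilon_subset[OF \<Gamma>(1) comp_open \<Gamma>(2)]) (rule that)
 have kc: "kob_const > 0" using kob_const_ge by linarith
 \<comment> \<open>By \<open>kob_dist\<close> all iterates of two such members are within
   \<open>e / 2\<close>. The other half of \<open>e\<close> is spent on the distance of an iterate
   of \<open>\<sigma> N\<close> from its limit point \<open>c\<close>.\<close>
 obtain N1 where N1: "\<And>m n. m >= N1 ==> n >= N1 ==> kob (\<sigma> m) (\<sigma> n) < e / 2 / kob_const"
  using cauchy[of "e / 2 / kob_const"] e(1) kc by auto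
 define N where "N = max N0 N1"
 obtain c where c: "limit_point (\<sigma> N) c" using limit_point_exists by blast
 have c\<Gamma>: "c \<in> \<Gamma>" by (rule lp[OF _ c]) (simp add: N_def)
 obtain m where m: "filterlim m at_top sequentially" "(\<lambda>k. (f ^^ m k) (\<sigma> N)) \<longlonglongrightarrow> c" using c unfolding limit_point_def by blast
 obtain r p where r: "strict_mono (r :: nat => nat)" "(\<lambda>k. \<sigma> (r k)) \<longlonglongrightarrow> p" by (rule cp2_convergent_subseq)
 have "\<forall>\<^sub>F k in sequentially. dist ((f ^^ m k) (\<sigma> N)) c < e / 2" using m(2) by (rule tendstoD) (use e(1) in simp)
 then obtain k where k: "dist ((f ^^ m k) (\<sigma> N)) c < e / 2" using eventually_happens'[OF sequentially_bot] by blast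
 have "dist ((f ^^ m k) p) ((f ^^ m k) (\<sigma> N)) <= e / 2"
 proof (rule tendsto_upperbound)
  have "isCont (f ^^ m k) p" using continuous_on_f_iter[of UNIV "m k"] by (simp add: continuous_on_eq_continuous_at)
  then have "(\<lambda>j. (f ^^ m k) (\<sigma> (r j))) \<longlonglongrightarrow> (f ^^ m k) p" using r(2) by (rule isCont_tendsto_compose)
  then show "(\<lambda>j. dist ((f ^^ m k) (\<sigma> (r j))) ((f ^^ m k) (\<sigma> N))) \<longlonglongrightarrow> dist ((f ^^ m k) p) ((f ^^ m k) (\<sigma> N))"
   by (intro tendsto_dist tendsto_const)
  have "\<forall>\<^sub>F j in sequentially. j >= N" by (rule eventually_ge_at_top)
  then show "\<forall>\<^sub>F j in sequentially. dist ((f ^^ m k) (\<sigma> (r j))) ((f ^^ m k) (\<sigma> N)) <= e / 2"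
  proof eventually_elim
   case (elim j)
   have "kob (\<sigma> (r j)) (\<sigma> N) < e / 2 / kob_const"
    using N1[of "r j" N] elim seq_suble[OF r(1), of j] by (simp add: N_def)
   then have "kob_const * kob (\<sigma> (r j)) (\<sigma> N) <= e / 2" using kc by (simp add: field_simps)
   then show ?case using kob_dist[OF \<sigma>\<Omega> \<sigma>\<Omega>, of "m k" "r j" N] by linarith
  qed
 qed simp
 then have "(f ^^ m k) p \<in> cball c e" using k dist_triangle[of "(f ^^ m k) p" c "(f ^^ m k) (\<sigma> N)"] by (simp add: dist_commute)
 then have "(f ^^ m k) p \<in> \<Omega>" using e(2) c\<Gamma> by blast
 then have "(f ^^ m k) p \<in> fatou_set f" using comp_facts(1) by blast
 then have pF: "p \<in> fatou_set f" by (rule fatou_iter_preimage)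
 have "p \<in> closure \<Omega>" unfolding closure_sequential using r(2) \<sigma>\<Omega> by (intro exI[of _ "\<lambda>k. \<sigma> (r k)"]) auto
 then have "p \<in> \<Omega>" using pF by (rule comp_closure)
 then show "\<exists>p\<in>\<Omega>. \<exists>r. strict_mono (r :: nat => nat) \<and> (\<lambda>n. \<sigma> (r n)) \<longlonglongrightarrow> p" using r by blast
qed

end

theorem theorem8:
  fixes f :: "cp2 \<Rightarrow> cp2" and d :: nat and \<Omega> \<Sigma> :: "cp2 set"
  assumes "d \<ge> 2" and "holomorphic_self_map d f"
    and "invariant_fatou_component f \<Omega>"
    and "attracting_riemann_surface f \<Omega> \<Sigma>"
  shows "kobayashi_complete (cp2_domain \<Omega>)"
proof -
 obtain F where F: "\<And>i. homogeneous_polynomial d (\<lambda>z. F z $ i)" "\<And>z. F z = 0 \<longleftrightarrow> z = 0"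
  "\<And>z. z \<noteq> 0 \<Longrightarrow> f (proj z) = proj (F z)"
  using assms(2) unfolding holomorphic_self_map_def by blast
 have \<Omega>: "\<Omega> \<in> components (fatou_set f)" "f ` \<Omega> = \<Omega>"
  using assms(3) unfolding invariant_fatou_component_def by blast+
 from assms(4) obtain D \<psi> \<theta> where \<Sigma>: "\<Sigma> \<subseteq> \<Omega>" "closed_complex_curve (cp2_domain \<Omega>) \<Sigma>" "f ` \<Sigma> = \<Sigma>"
  "\<forall>K. compact K \<and> K \<noteq> {} \<and> K \<subseteq> \<Omega> \<longrightarrow> (\<lambda>n. SUP z\<in>K. infdist ((f ^^ n) z) \<Sigma>) \<longlonglongrightarrow> 0"
  "rotation_domain D" "biholomorphic_map (curve_atlas (cp2_domain \<Omega>) \<Sigma>) (planar_atlas D) \<psi>"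
  "\<theta> \<notin> \<rat>" "\<forall>p\<in>\<Sigma>. \<psi> (f p) = cis (2 * pi * \<theta>) * \<psi> p"
  unfolding attracting_riemann_surface_def by (elim conjE exE)
 have "bij_betw \<psi> \<Sigma> D"
  using \<Sigma>(6) unfolding biholomorphic_map_def carrier_curve_atlas[OF \<Sigma>(2)] carrier_planar_atlas by blast
 then have ne: "\<Sigma> \<noteq> {}" using rotation_domain_facts(1)[OF \<Sigma>(5)] by (auto simp: bij_betw_def)
 have att: "(\<lambda>n. SUP z\<in>K. infdist ((f ^^ n) z) \<Sigma>) \<longlonglongrightarrow> 0" if "compact K" "K \<noteq> {}" "K \<subseteq> \<Omega>" for K
  using \<Sigma>(4) that by simp
 interpret rotation_curve f d F \<Omega> \<Sigma> D \<psi> \<theta>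
  by unfold_locales (fact assms(1) F \<Omega> \<Sigma> ne att bspec[OF \<Sigma>(8)])+
 show ?thesis by (rule kobayashi_complete_\<Omega>)
qed

end
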